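(* Assume the standing assumptions and that the loads are equilibrated and compatible. Then $\mathcal F$ and $\mathcal E$ attain their minima on $H^1(\Omega;\mathbb R^N)$, $$\min_{H^1(\Omega;\mathbb R^N)}\mathcal F=\min_{H^1(\Omega;\mathbb R^N)}\mathcal E,\qquad \operatorname{argmin}_{H^1(\Omega;\mathbb R^N)}\mathcal F=\operatorname{argmin}_{H^1(\Omega;\mathbb R^N)}\mathcal E.$$
   Context: Standing assumptions: $\Omega\subset\mathbb R^N$, $N\in\{2,3\}$, is a bounded connected open set with Lipschitz boundary. $M^{N\times N}$ denotes real $N\times N$ matrices, $M^{N\times N}_{skew}$ the skew-symmetric ones, $SO(N)$ the rotations. $\mathcal W:\Omega\times M^{N\times N}\to[0,+\infty]$ is measurable and, for a.e. $\mathbf x$: $\mathcal W(\mathbf x,\mathbf F)=+\infty$ if $\det\mathbf F\le0$; frame indifferent; $C^2$ near $SO(N)$; $\mathcal W(\mathbf x,\mathbf F)\ge C|\mathbf F^T\mathbf F-\mathbf I|^2$ with $C>0$ independent of $\mathbf x$; $\mathcal W(\mathbf x,\mathbf I)=0$, $D\mathcal W(\mathbf x,\mathbf I)=0$. Writing $\mathcal W(\mathbf x,\mathbf F)=\mathcal V(\mathbf x,\frac12(\mathbf F^T\mathbf F-\mathbf I))$, $\mathcal V(\mathbf x,\cdot)$ is $C^2$ on a neighborhood $\mathcal O$ of $\mathbf 0$ with $|D^2\mathcal V(\mathbf x,\mathbf D)[\mathbf B,\mathbf B]|\le2\gamma|\mathbf B|^2$ for $\mathbf D\in\mathcal O$,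 $\gamma$ independent of $\mathbf x$. $\mathcal V_0(\mathbf x,\mathbf B)=\frac12D^2\mathcal V(\mathbf x,\mathbf 0)[\mathbf B,\mathbf B]$. $\mathbb E(\mathbf v)=\frac12(\nabla\mathbf v+\nabla\mathbf v^T)$. Loads $\mathbf f\in L^2(\partial\Omega;\mathbb R^N)$, $\mathbf g\in L^2(\Omega;\mathbb R^N)$; $\mathcal L(\mathbf v)=\int_{\partial\Omega}\mathbf f\cdot\mathbf v\,d\mathcal H^{N-1}+\int_\Omega\mathbf g\cdot\mathbf v\,d\mathbf x$. Limit functional: $\mathcal F(\mathbf v)=\min_{\mathbf W\in M^{N\times N}_{skew}}\int_\Omega\mathcal V_0(\mathbf x,\mathbb E(\mathbf v)-\frac12\mathbf W^2)\,d\mathbf x-\mathcal L(\mathbf v)$. Linear elasticity functional: $\mathcal E(\mathbf v)=\int_\Omega\mathcal V_0(\mathbf x,\mathbb E(\mathbf v))\,d\mathbf x-\mathcal L(\mathbf v)$. Loads are equilibrated if $\mathcal L(\mathbf z)=0$ whenever $\mathbb E(\mathbf z)=\mathbf 0$, and compatible if $\mathcal L(\mathbf x\mapsto\mathbf W^2\mathbf x)<0$ for every $\mathbf W\in M^{N\times N}_{skew}\setminus\{\mathbf 0\}$. *)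

theory Defs
  imports "HOL-Analysis.Analysis"
begin

definition SOmat :: "(real^'n^'n) set" where
  "SOmat = {R. orthogonal_matrix R \<and> det R = 1}"

definition skew :: "real^'n^'n \<Rightarrow> bool" where
  "skew W \<longleftrightarrow> transpose W = - W"

definition C2_on :: "'a::euclidean_space set \<Rightarrow> ('a \<Rightarrow> real) \<Rightarrow> bool" where
  "C2_on U f \<longleftrightarrow> (\<exists>Df D2f.
      (\<forall>y\<in>U. (f has_derivative blinfun_apply (Df y)) (at y)
             \<and> (Df has_derivative blinfun_apply (D2f y)) (at y))
      \<and> continuous_on U D2f)"

text \<open>Near every boundary point, after a rotation, the domain is the subgraph of a
  Lipschitz function of the remaining N-1 variables: direction e (unit vector),
  phi Lipschitz and constant along e, and a ball B around p with
  Omega inter B = the points of B lying below the graph.\<close>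
definition lipschitz_boundary :: "(real^'n) set \<Rightarrow> bool" where
  "lipschitz_boundary \<Omega> \<longleftrightarrow> (\<forall>p\<in>frontier \<Omega>. \<exists>e r \<phi> L.
      norm e = 1 \<and> r > 0 \<and> L-lipschitz_on UNIV \<phi> \<and>
      (\<forall>y t. \<phi> (y + t *\<^sub>R e) = \<phi> y) \<and>
      \<Omega> \<inter> ball p r = {y \<in> ball p r. y \<bullet> e < \<phi> y})"

definition omega_s :: "real \<Rightarrow> real" where
  "omega_s s = pi powr (s/2) / Gamma (s/2 + 1)"

definition hausdorff_pre :: "real \<Rightarrow> real \<Rightarrow> 'a::euclidean_space set \<Rightarrow> ennreal" where
  "hausdorff_pre s \<delta> A = (INF C \<in> {C :: nat \<Rightarrow> 'a set. A \<subseteq> (\<Union>i. C i) \<and>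
        (\<forall>i. bounded (C i) \<and> diameter (C i) \<le> \<delta>)}.
        (\<Sum>i. ennreal (omega_s s * (diameter (C i) / 2) powr s)))"

definition hausdorff_outer :: "real \<Rightarrow> 'a::euclidean_space set \<Rightarrow> ennreal" where
  "hausdorff_outer s A = (SUP \<delta>\<in>{0<..}. hausdorff_pre s \<delta> A)"

definition hausdorff_measure :: "real \<Rightarrow> 'a::euclidean_space set \<Rightarrow> 'a measure" where
  "hausdorff_measure s S = measure_of S (sets (restrict_space borel S)) (hausdorff_outer s)"

definition surf :: "(real^'n) set \<Rightarrow> (real^'n) measure" where
  "surf \<Omega> = hausdorff_measure (real CARD('n) - 1) (frontier \<Omega>)"

definition L2_on :: "'a measure \<Rightarrow> ('a \<Rightarrow> 'b::euclidean_space) \<Rightarrow> bool" where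
  "L2_on M u \<longleftrightarrow> u \<in> borel_measurable M \<and> integrable M (\<lambda>x. (norm (u x))\<^sup>2)"

definition smooth_fun :: "(real^'n \<Rightarrow> real) \<Rightarrow> bool" where
  "smooth_fun \<phi> \<longleftrightarrow> (\<exists>S. \<phi> \<in> S \<and> (\<forall>\<psi>\<in>S. \<exists>D\<psi>.
      (\<forall>x. (\<psi> has_derivative D\<psi> x) (at x)) \<and> (\<forall>j. (\<lambda>x. D\<psi> x (axis j 1)) \<in> S)))"

definition test_fun :: "(real^'n) set \<Rightarrow> (real^'n \<Rightarrow> real) \<Rightarrow> bool" where
  "test_fun \<Omega> \<phi> \<longleftrightarrow> smooth_fun \<phi> \<and> (\<exists>K. compact K \<and> K \<subseteq> \<Omega> \<and> (\<forall>x. x \<notin> K \<longrightarrow> \<phi> x = 0))"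

definition partial_deriv :: "(real^'n \<Rightarrow> real) \<Rightarrow> 'n \<Rightarrow> real^'n \<Rightarrow> real" where
  "partial_deriv \<phi> j x = frechet_derivative \<phi> (at x) (axis j 1)"

definition weak_grad :: "(real^'n) set \<Rightarrow> (real^'n \<Rightarrow> real^'n) \<Rightarrow> (real^'n \<Rightarrow> real^'n^'n) \<Rightarrow> bool" where
  "weak_grad \<Omega> v G \<longleftrightarrow> (\<forall>\<phi>. test_fun \<Omega> \<phi> \<longrightarrow> (\<forall>i j.
      integral\<^sup>L (lebesgue_on \<Omega>) (\<lambda>x. v x $ i * partial_deriv \<phi> j x)
      = - integral\<^sup>L (lebesgue_on \<Omega>) (\<lambda>x. G x $ i $ j * \<phi> x)))"

definition H1 :: "(real^'n) set \<Rightarrow> (real^'n \<Rightarrow> real^'n) \<Rightarrow> bool" where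
  "H1 \<Omega> v \<longleftrightarrow> L2_on (lebesgue_on \<Omega>) v \<and>
     (\<exists>G. L2_on (lebesgue_on \<Omega>) G \<and> weak_grad \<Omega> v G)"

text \<open>A representative of the weak gradient (unique up to null sets).\<close>
definition grad :: "(real^'n) set \<Rightarrow> (real^'n \<Rightarrow> real^'n) \<Rightarrow> real^'n \<Rightarrow> real^'n^'n" where
  "grad \<Omega> v = (SOME G. L2_on (lebesgue_on \<Omega>) G \<and> weak_grad \<Omega> v G)"

definition symgrad :: "(real^'n) set \<Rightarrow> (real^'n \<Rightarrow> real^'n) \<Rightarrow> real^'n \<Rightarrow> real^'n^'n" where
  "symgrad \<Omega> v x = (1/2) *\<^sub>R (grad \<Omega> v x + transpose (grad \<Omega> v x))"

definition H1_dist :: "(real^'n) set \<Rightarrow> (real^'n \<Rightarrow> real^'n) \<Rightarrow> (real^'n \<Rightarrow> real^'n) \<Rightarrow> real" where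
  "H1_dist \<Omega> u v = sqrt (integral\<^sup>L (lebesgue_on \<Omega>) (\<lambda>x. (norm (u x - v x))\<^sup>2)
      + integral\<^sup>L (lebesgue_on \<Omega>) (\<lambda>x. (norm (grad \<Omega> u x - grad \<Omega> v x))\<^sup>2))"

text \<open>Boundary work of the surface load f on v, through the trace of v:
  the limit of the boundary integrals along any sequence of functions smooth on R^N
  converging to v in H^1(Omega).\<close>
definition bdry_work :: "(real^'n) set \<Rightarrow> (real^'n \<Rightarrow> real^'n) \<Rightarrow> (real^'n \<Rightarrow> real^'n) \<Rightarrow> real" where
  "bdry_work \<Omega> f v = (THE l. \<forall>u :: nat \<Rightarrow> real^'n \<Rightarrow> real^'n.
      ((\<forall>k i. smooth_fun (\<lambda>x. u k x $ i)) \<and> (\<lambda>k. H1_dist \<Omega> (u k) v) \<longlonglongrightarrow> 0)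
      \<longrightarrow> (\<lambda>k. integral\<^sup>L (surf \<Omega>) (\<lambda>x. f x \<bullet> u k x)) \<longlonglongrightarrow> l)"

definition load :: "(real^'n) set \<Rightarrow> (real^'n \<Rightarrow> real^'n) \<Rightarrow> (real^'n \<Rightarrow> real^'n) \<Rightarrow> (real^'n \<Rightarrow> real^'n) \<Rightarrow> real" where
  "load \<Omega> f g v = bdry_work \<Omega> f v + integral\<^sup>L (lebesgue_on \<Omega>) (\<lambda>x. g x \<bullet> v x)"

definition equilibrated :: "(real^'n) set \<Rightarrow> (real^'n \<Rightarrow> real^'n) \<Rightarrow> (real^'n \<Rightarrow> real^'n) \<Rightarrow> bool" where
  "equilibrated \<Omega> f g \<longleftrightarrow> (\<forall>z. H1 \<Omega> z \<and> (AE x in lebesgue_on \<Omega>. symgrad \<Omega> z x = 0)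
      \<longrightarrow> load \<Omega> f g z = 0)"

definition compatible :: "(real^'n) set \<Rightarrow> (real^'n \<Rightarrow> real^'n) \<Rightarrow> (real^'n \<Rightarrow> real^'n) \<Rightarrow> bool" where
  "compatible \<Omega> f g \<longleftrightarrow> (\<forall>W::real^'n^'n. skew W \<and> W \<noteq> 0
      \<longrightarrow> load \<Omega> f g (\<lambda>x. (W ** W) *v x) < 0)"

text \<open>V0 x B = 1/2 D^2 V(x,0)[B,B], with D2V the second derivative of V(x,.).\<close>
definition V0 :: "(real^'n \<Rightarrow> real^'n^'n \<Rightarrow> ((real^'n^'n) \<Rightarrow>\<^sub>L ((real^'n^'n) \<Rightarrow>\<^sub>L real)))
                 \<Rightarrow> real^'n \<Rightarrow> real^'n^'n \<Rightarrow> real" where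
  "V0 D2V x B = (1/2) * blinfun_apply (blinfun_apply (D2V x 0) B) B"

definition Flim :: "(real^'n) set \<Rightarrow> (real^'n \<Rightarrow> real^'n^'n \<Rightarrow> ((real^'n^'n) \<Rightarrow>\<^sub>L ((real^'n^'n) \<Rightarrow>\<^sub>L real)))
   \<Rightarrow> (real^'n \<Rightarrow> real^'n) \<Rightarrow> (real^'n \<Rightarrow> real^'n) \<Rightarrow> (real^'n \<Rightarrow> real^'n) \<Rightarrow> real" where
  "Flim \<Omega> D2V f g v = (INF W \<in> {W. skew W}.
      integral\<^sup>L (lebesgue_on \<Omega>) (\<lambda>x. V0 D2V x (symgrad \<Omega> v x - (1/2) *\<^sub>R (W ** W))))
      - load \<Omega> f g v"

definition Elin :: "(real^'n) set \<Rightarrow> (real^'n \<Rightarrow> real^'n^'n \<Rightarrow> ((real^'n^'n) \<Rightarrow>\<^sub>L ((real^'n^'n) \<Rightarrow>\<^sub>L real)))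
   \<Rightarrow> (real^'n \<Rightarrow> real^'n) \<Rightarrow> (real^'n \<Rightarrow> real^'n) \<Rightarrow> (real^'n \<Rightarrow> real^'n) \<Rightarrow> real" where
  "Elin \<Omega> D2V f g v = integral\<^sup>L (lebesgue_on \<Omega>) (\<lambda>x. V0 D2V x (symgrad \<Omega> v x)) - load \<Omega> f g v"

end

theory Submission
  imports Defs
begin

text \<open>
The quadratic form \<open>V0\<close> inherits coercivity on symmetric matrices from that of \<open>W\<close>. Korn's inequality and the
trace inequality on the Lipschitz domain, together with the balance of loads, make the linear energy
bounded below and coercive modulo rigid motions, so it has a minimizer. The correction \<open>W ** W\<close> is itself the
symmetric gradient of the linear field \<open>x \<mapsto> W ** W *v x\<close>; absorbing it into \<open>v\<close> turns the inner functional of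
\<open>Flim\<close> into \<open>Elin (v - 1/2 W\<^sup>2 x) - 1/2 L (W\<^sup>2 x)\<close>, and compatibility makes the last term at least a positive multiple of
\<open>|W|\<^sup>2\<close>. Hence both infima agree, and along an infimizing sequence of \<open>W\<close> for a minimizer of \<open>Flim\<close>
the matrices tend to zero, so that it also minimizes \<open>Elin\<close>.
\<close>

section \<open>Smooth functions\<close>

text \<open>The boundary work is a definite description of a limit along smooth approximations. That
  this limit exists, and is linear and bounded, already rests on density of smooth fields and on the
  trace inequality. Hence every inequality is first proved for smooth fields and then transferred.
  The Lipschitz graph is exploited in three ways: the cone of directions below it leaves room for
  one-sided mollification and for star-shaped pieces; stretching along its axis moves averages away
  from the boundary, with a Jacobian large enough for Korn's inequality to be closed by absorption;
  integration along its axis bounds boundary values. The Poincare-Korn inequality comes from a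
  representation of a field by its values on pairs of points, which gives explicit constants. Strong
  convergence of a minimizing sequence comes from the parallelogram identity for the quadratic
  energy. Measurability of \<open>V0\<close> in the space variable is recovered from that of
  \<open>W\<close> through a limit of rescaled energies.\<close>

abbreviation (input) tends_to (infixr "---->" 60) where
  "X ----> l \<equiv> X \<longlonglongrightarrow> l"

text \<open>The witness set of \<open>smooth_fun\<close> is closed under partial derivatives, so the
  same set witnesses the smoothness of each partial. The full differential is rebuilt from the axis
  directions by linearity.\<close>

lemma smooth_fun_has_derivative:
  fixes \<phi> :: "real^'n => real"
  assumes "smooth_fun \<phi>"
  shows "(\<phi> has_derivative (%h. \<Sum>j\<in>UNIV. h $ j * partial_deriv \<phi> j x)) (at x)"
    and "smooth_fun (partial_deriv \<phi> j)"
proof -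
  obtain S where S: "\<phi> \<in> S" "!!\<psi>. \<psi> \<in> S ==> \<exists>D\<psi>. (\<forall>x. (\<psi> has_derivative D\<psi> x) (at x)) & (\<forall>j. (%x. D\<psi> x (axis j 1)) \<in> S)"
    using assms unfolding smooth_fun_def by auto
  obtain D where D: "!!x. (\<phi> has_derivative D x) (at x)" "!!j. (%x. D x (axis j 1)) \<in> S" using S by blast
  have fr: "frechet_derivative \<phi> (at x) = D x" for x using D(1) frechet_derivative_at by metis
  have pd: "partial_deriv \<phi> j = (%x. D x (axis j 1))" for j by (auto simp: partial_deriv_def fr)
  have lin: "linear (D x)" using D(1) has_derivative_linear by blast
  have "D x = (%h. \<Sum>j\<in>UNIV. h $ j * partial_deriv \<phi> j x)"
  proof
    fix h
    have "D x h = D x (\<Sum>j\<in>UNIV. h $ j *s axis j 1)" by (simp add: basis_expansion)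
    also have "... = (\<Sum>j\<in>UNIV. h $ j * D x (axis j 1))"
      using lin by (simp add: linear_sum linear_scale scalar_mult_eq_scaleR)
    finally show "D x h = (\<Sum>j\<in>UNIV. h $ j * partial_deriv \<phi> j x)" by (simp add: pd)
  qed
  with D(1)[of x] show "(\<phi> has_derivative (%h. \<Sum>j\<in>UNIV. h $ j * partial_deriv \<phi> j x)) (at x)" by simp
  show "smooth_fun (partial_deriv \<phi> j)" unfolding smooth_fun_def pd by (rule exI[of _ S]) (use S(2) D(2) in auto)
qed

lemma partial_derivI:
  "(\<phi> has_derivative D) (at x) ==> partial_deriv \<phi> j x = D (axis j 1)"
  by (simp add: partial_deriv_def flip: frechet_derivative_at)

text \<open>Derivatives given by the product and chain rules are usually not members of the
  candidate set itself, but sums of products of its members with known smooth functions. This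
  closure absorbs them.\<close>

inductive_set smooth_alg :: "(real^'n => real) set => (real^'n => real) set" for S where
  base: "\<phi> \<in> S ==> \<phi> \<in> smooth_alg S"
| smooth: "smooth_fun \<phi> ==> \<phi> \<in> smooth_alg S"
| add: "\<phi> \<in> smooth_alg S ==> \<psi> \<in> smooth_alg S ==> (%x. \<phi> x + \<psi> x) \<in> smooth_alg S"
| mult: "\<phi> \<in> smooth_alg S ==> \<psi> \<in> smooth_alg S ==> (%x. \<phi> x * \<psi> x) \<in> smooth_alg S"

text \<open>Coinduction up to the algebra generated by the candidate set and the smooth functions.\<close>
lemma smooth_alg_smooth:
  fixes S :: "(real^'n => real) set"
  assumes S: "!!\<psi>. \<psi> \<in> S ==> \<exists>D. (\<forall>x. (\<psi> has_derivative D x) (at x)) & (\<forall>j. (%x. D x (axis j 1)) \<in> smooth_alg S)"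
    and "\<phi> \<in> smooth_alg S"
  shows "smooth_fun \<phi>"
proof -
  have "\<exists>D. (\<forall>x. (\<psi> has_derivative D x) (at x)) & (\<forall>j. (%x. D x (axis j 1)) \<in> smooth_alg S)"
    if "\<psi> \<in> smooth_alg S" for \<psi> using that
  proof induction
    case (base \<phi>)
    then show ?case by (rule S)
  next
    case (smooth \<phi>)
    note d = smooth_fun_has_derivative[OF smooth]
    have "(%x. \<Sum>k\<in>UNIV. axis j 1 $ k * partial_deriv \<phi> k x) = partial_deriv \<phi> j" for j
      proof
      fix x
      have "(\<Sum>k\<in>UNIV. axis j 1 $ k * partial_deriv \<phi> k x) = (\<Sum>k\<in>UNIV. if k = j then partial_deriv \<phi> j x else 0)"
        by (rule sum.cong) (auto simp: axis_def)
      then show "(\<Sum>k\<in>UNIV. axis j 1 $ k * partial_deriv \<phi> k x) = partial_deriv \<phi> j x" by simp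
    qed
    then show ?case using d smooth_alg.smooth
      by (intro exI[of _ "%x h. \<Sum>k\<in>UNIV. h $ k * partial_deriv \<phi> k x"] conjI allI) (auto intro: smooth_alg.smooth)
  next
    case (add \<phi> \<psi>)
    then obtain D E where "\<forall>x. (\<phi> has_derivative D x) (at x)" "\<forall>j. (%x. D x (axis j 1)) \<in> smooth_alg S"
      "\<forall>x. (\<psi> has_derivative E x) (at x)" "\<forall>j. (%x. E x (axis j 1)) \<in> smooth_alg S" by auto
    then show ?case by (intro exI[of _ "%x h. D x h + E x h"]) (auto intro!: derivative_intros smooth_alg.add)
  next
    case (mult \<phi> \<psi>)
    then obtain D E where "\<forall>x. (\<phi> has_derivative D x) (at x)" "\<forall>j. (%x. D x (axis j 1)) \<in> smooth_alg S"
      "\<forall>x. (\<psi> has_derivative E x) (at x)" "\<forall>j. (%x. E x (axis j 1)) \<in> smooth_alg S" by auto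
    then show ?case using mult.hyps by (intro exI[of _ "%x h. \<phi> x * E x h + D x h * \<psi> x"])
        (auto intro!: has_derivative_mult smooth_alg.add smooth_alg.mult)
  qed
  then show ?thesis using assms(2) unfolding smooth_fun_def by (intro exI[of _ "smooth_alg S"]) blast
qed

lemma smooth_fun_add [intro]:
  fixes \<phi> :: "real^'n => real"
  shows "smooth_fun \<phi> ==> smooth_fun \<psi> ==> smooth_fun (%x. \<phi> x + \<psi> x)"
  by (rule smooth_alg_smooth[of "{}"]) (auto intro: smooth_alg.intros)

lemma smooth_fun_mult [intro]:
  fixes \<phi> :: "real^'n => real"
  shows "smooth_fun \<phi> ==> smooth_fun \<psi> ==> smooth_fun (%x. \<phi> x * \<psi> x)"
  by (rule smooth_alg_smooth[of "{}"]) (auto intro: smooth_alg.intros)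

lemma smooth_fun_const [intro]: "smooth_fun (%x::real^'n. c)"
proof -
  have "\<exists>D. (\<forall>x. (\<psi> has_derivative D x) (at x)) & (\<forall>j. (%x. D x (axis j 1)) \<in> range (%c x. c))"
    if "\<psi> \<in> range (%c x. c)" for \<psi> :: "real^'n => real" using that by (auto intro!: exI[of _ "%x h. 0"] derivative_eq_intros)
  then show ?thesis unfolding smooth_fun_def by (intro exI[of _ "range (%c x. c)"]) auto
qed

lemma smooth_fun_component [intro]: "smooth_fun (%x::real^'n. x $ i)"
proof (rule smooth_alg_smooth[of "{%x::real^'n. x $ i}"])
  show "\<exists>D. (\<forall>x. (\<psi> has_derivative D x) (at x)) & (\<forall>j. (%x. D x (axis j 1)) \<in> smooth_alg {%x::real^'n. x $ i})"
    if "\<psi> \<in> {%x::real^'n. x $ i}" for \<psi>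
  proof -
    have "((%x::real^'n. x $ i) has_derivative (%h. h $ i)) (at x)" for x
      by (intro bounded_linear.has_derivative[OF bounded_linear_vec_nth] has_derivative_ident)
    then show ?thesis using that by (auto intro!: exI[of _ "%x h. h $ i"] smooth_alg.smooth)
  qed
qed (simp add: smooth_alg.base)

lemma smooth_fun_sum [intro]:
  fixes \<phi> :: "'a => real^'n => real"
  shows "(!!i. i \<in> I ==> smooth_fun (\<phi> i)) ==> smooth_fun (%x. \<Sum>i\<in>I. \<phi> i x)"
  by (induction I rule: infinite_finite_induct) (simp_all add: smooth_fun_const smooth_fun_add)

lemma smooth_fun_minus [intro]:
  fixes \<phi> :: "real^'n => real"
  shows "smooth_fun \<phi> ==> smooth_fun (%x. - \<phi> x)" using smooth_fun_mult[OF smooth_fun_const[of "-1"]] by simp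

lemma smooth_fun_diff [intro]:
  fixes \<phi> :: "real^'n => real"
  shows "smooth_fun \<phi> ==> smooth_fun \<psi> ==> smooth_fun (%x. \<phi> x - \<psi> x)"
  using smooth_fun_add[OF _ smooth_fun_minus] by fastforce

lemma smooth_fun_continuous: "smooth_fun \<phi> ==> continuous_on A \<phi>" using smooth_fun_has_derivative(1)
  by (meson continuous_at_imp_continuous_on has_derivative_continuous)

lemma smooth_fun_borel: "smooth_fun \<phi> ==> \<phi> \<in> borel_measurable borel"
  using smooth_fun_continuous borel_measurable_continuous_onI by blast

text \<open>Each differentiation of a composition with the affine map produces a factor
  \<open>c\<close>, so the set of all such compositions is closed under derivatives only up to
  constants, which the generated algebra supplies.\<close>

lemma smooth_fun_affine:
  fixes \<phi> :: "real^'n => real"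
  assumes "smooth_fun \<phi>"
  shows "smooth_fun (%x. \<phi> (a + c *\<^sub>R x))"
    and "partial_deriv (%x. \<phi> (a + c *\<^sub>R x)) j x = c * partial_deriv \<phi> j (a + c *\<^sub>R x)"
proof -
  let ?S = "{%x. \<psi> (a + c *\<^sub>R x) |\<psi>. smooth_fun \<psi>}"
  have d: "((%x. \<psi> (a + c *\<^sub>R x)) has_derivative (%h. \<Sum>j\<in>UNIV. (c *\<^sub>R h) $ j * partial_deriv \<psi> j (a + c *\<^sub>R x))) (at x)"
    if "smooth_fun \<psi>" for \<psi> :: "real^'n => real" and x
  proof -
    have 1: "((%x. a + c *\<^sub>R x) has_derivative (%h. c *\<^sub>R h)) (at x)" by (auto intro!: derivative_eq_intros)
    have "(\<psi> \<circ> (%x. a + c *\<^sub>R x) has_derivative (%h. \<Sum>j\<in>UNIV. h $ j * partial_deriv \<psi> j (a + c *\<^sub>R x)) \<circ> (%h. c *\<^sub>R h)) (at x)"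
      by (rule diff_chain_at[OF 1 smooth_fun_has_derivative(1)[OF that]])
    then show ?thesis by (simp add: o_def)
  qed
  have e: "(\<Sum>k\<in>UNIV. (c *\<^sub>R axis j 1) $ k * partial_deriv \<psi> k y) = c * partial_deriv \<psi> j y"
    for \<psi> :: "real^'n => real" and j y
  proof -
    have "(\<Sum>k\<in>UNIV. (c *\<^sub>R axis j 1) $ k * partial_deriv \<psi> k y) = (\<Sum>k\<in>UNIV. if k = j then c * partial_deriv \<psi> j y else 0)"
      by (rule sum.cong) (auto simp: axis_def)
    then show ?thesis by simp
  qed
  show "smooth_fun (%x. \<phi> (a + c *\<^sub>R x))"
  proof (rule smooth_alg_smooth[of ?S])
    fix \<psi> assume "\<psi> \<in> ?S"
    then obtain \<theta> where t: "\<psi> = (%x. \<theta> (a + c *\<^sub>R x))" "smooth_fun \<theta>" by blast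
    show "\<exists>D. (\<forall>x. (\<psi> has_derivative D x) (at x)) & (\<forall>j. (%x. D x (axis j 1)) \<in> smooth_alg ?S)"
    proof (intro exI conjI allI)
      show "(\<psi> has_derivative (%h. \<Sum>j\<in>UNIV. (c *\<^sub>R h) $ j * partial_deriv \<theta> j (a + c *\<^sub>R x))) (at x)" for x
        unfolding t(1) by (rule d[OF t(2)])
      show "(%x. \<Sum>k\<in>UNIV. (c *\<^sub>R axis j 1) $ k * partial_deriv \<theta> k (a + c *\<^sub>R x)) \<in> smooth_alg ?S" for j
        unfolding e by (intro smooth_alg.mult smooth_alg.smooth[OF smooth_fun_const] smooth_alg.base)
          (use smooth_fun_has_derivative(2)[OF t(2)] in auto)
    qed
  qed (use assms in \<open>auto intro: smooth_alg.base\<close>)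
  show "partial_deriv (%x. \<phi> (a + c *\<^sub>R x)) j x = c * partial_deriv \<phi> j (a + c *\<^sub>R x)"
    using partial_derivI[OF d[OF assms]] e by simp
qed

lemma partial_deriv_rules:
  fixes \<phi> :: "real^'n => real"
  assumes "smooth_fun \<phi>" "smooth_fun \<psi>"
  shows "partial_deriv (%x. \<phi> x + \<psi> x) j x = partial_deriv \<phi> j x + partial_deriv \<psi> j x"
    and "partial_deriv (%x. \<phi> x - \<psi> x) j x = partial_deriv \<phi> j x - partial_deriv \<psi> j x"
    and "partial_deriv (%x. \<phi> x * \<psi> x) j x = \<phi> x * partial_deriv \<psi> j x + partial_deriv \<phi> j x * \<psi> x"
    and "partial_deriv (%x. c * \<phi> x) j x = c * partial_deriv \<phi> j x"
proof -
  let ?D = "frechet_derivative \<phi> (at x)" and ?E = "frechet_derivative \<psi> (at x)"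
  have d: "(\<phi> has_derivative ?D) (at x)" "(\<psi> has_derivative ?E) (at x)"
    using assms smooth_fun_has_derivative(1) frechet_derivative_works differentiable_def by blast+
  show "partial_deriv (%x. \<phi> x + \<psi> x) j x = partial_deriv \<phi> j x + partial_deriv \<psi> j x"
    by (subst partial_derivI[OF has_derivative_add[OF d]]) (simp add: partial_deriv_def)
  show "partial_deriv (%x. \<phi> x - \<psi> x) j x = partial_deriv \<phi> j x - partial_deriv \<psi> j x"
    by (subst partial_derivI[OF has_derivative_diff[OF d]]) (simp add: partial_deriv_def)
  show "partial_deriv (%x. \<phi> x * \<psi> x) j x = \<phi> x * partial_deriv \<psi> j x + partial_deriv \<phi> j x * \<psi> x"
    by (subst partial_derivI[OF has_derivative_mult[OF d]]) (simp add: partial_deriv_def)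
  show "partial_deriv (%x. c * \<phi> x) j x = c * partial_deriv \<phi> j x"
    by (subst partial_derivI[OF has_derivative_mult_right[OF d(1)]]) (simp add: partial_deriv_def)
qed

lemma partial_deriv_const [simp]: "partial_deriv (%x::real^'n. c) j x = 0"
  by (subst partial_derivI[OF has_derivative_const]) simp

lemma partial_deriv_component [simp]: "partial_deriv (%x::real^'n. x $ i) j x = (if i = j then 1 else 0)"
  by (subst partial_derivI[OF bounded_linear.has_derivative[OF bounded_linear_vec_nth has_derivative_ident]])
    (simp add: axis_def)

lemma partial_deriv_eq_0:
  fixes \<phi> :: "real^'n => real"
  assumes "open U" "x \<in> U" "!!y. y \<in> U ==> \<phi> y = c"
  shows "partial_deriv \<phi> j x = 0"
proof -
  have "(\<phi> has_derivative (%_. 0)) (at x)"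
    by (rule has_derivative_transform_within_open[OF has_derivative_const[of c]]) (use assms in auto)
  then show ?thesis by (rule partial_derivI)
qed

subsection \<open>Bump functions\<close>

text \<open>Up to the factor given by \<open>p\<close> these are the derivatives of \<open>exp (- 1 / t)\<close>.\<close>
definition flat :: "real poly => real => real" where
  "flat p t = (if t > 0 then poly p (1/t) * exp (- (1/t)) else 0)"

lemma poly_exp_tendsto_0:
  fixes p :: "real poly"
  shows "((%x. poly p x * exp (- x)) \<longlongrightarrow> 0) at_top"
proof -
  have "((%x. \<Sum>i\<le>degree p. coeff p i * (x ^ i / exp x)) \<longlongrightarrow> (\<Sum>i\<le>degree p. coeff p i * 0)) at_top"
    by (intro tendsto_sum tendsto_mult tendsto_const tendsto_power_div_exp_0)
  then show ?thesis by (simp add: poly_altdef sum_distrib_right exp_minus field_simps sum_divide_distrib)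
qed

text \<open>For \<open>t > 0\<close> the derivative of \<open>poly p (1/t) * exp (- (1/t))\<close>
  is the same expression with the polynomial \<open>X^2 (p - p')\<close>, so the family
  \<open>flat\<close> is closed under differentiation. At 0 the exponential beats every power of
  \<open>1/t\<close>.\<close>

lemma flat_has_derivative:
  "(flat p has_field_derivative flat ([:0,0,1:] * (p - pderiv p)) t) (at t)"
proof -
  consider "t > 0" | "t < 0" | "t = 0" by linarith
  then show ?thesis
  proof cases
    case 1
    have "((%t. poly p (1/t) * exp (- (1/t))) has_field_derivative flat ([:0,0,1:] * (p - pderiv p)) t) (at t)"
      using 1 by (auto intro!: derivative_eq_intros simp: flat_def power2_eq_square field_simps)
    then show ?thesis
      by (rule has_field_derivative_transform_within_open[of _ _ _ "{0<..}"]) (use 1 in \<open>auto simp: flat_def\<close>)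
  next
    case 2
    have "((%t. 0) has_field_derivative flat ([:0,0,1:] * (p - pderiv p)) t) (at t)" using 2 by (auto simp: flat_def)
    then show ?thesis
      by (rule has_field_derivative_transform_within_open[of _ _ _ "{..<0}"]) (use 2 in \<open>auto simp: flat_def\<close>)
  next
    case 3
    \<comment> \<open>The quotient vanishes identically on the left; on the right the substitution
      of \<open>inverse h\<close> turns it into a polynomial times a decaying exponential at
      infinity.\<close>
    have "((%h. flat p h / h) \<longlongrightarrow> 0) (at 0)" unfolding at_eq_sup_left_right
    proof (rule filterlim_sup)
      show "((%h. flat p h / h) \<longlongrightarrow> 0) (at_left 0)"
        by (rule tendsto_eventually) (auto simp: eventually_at_left_field flat_def intro!: exI[of _ "-1"])
      have "((%h. poly ([:0,1:] * p) (inverse h) * exp (- inverse h)) \<longlongrightarrow> 0) (at_right 0)"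
        by (rule filterlim_compose[OF poly_exp_tendsto_0 filterlim_inverse_at_top_right])
      then show "((%h. flat p h / h) \<longlongrightarrow> 0) (at_right 0)" by (rule Lim_transform_eventually)
          (auto simp: eventually_at_right_field flat_def field_simps intro!: exI[of _ 1])
    qed
    then show ?thesis using 3 by (auto simp: has_field_derivative_iff flat_def)
  qed
qed

lemma smooth_fun_flat: "smooth_fun (%x::real^'n. flat p (1 - x \<bullet> x))"
proof (rule smooth_alg_smooth[of "range (%p (x::real^'n). flat p (1 - x \<bullet> x))"])
  let ?S = "range (%p (x::real^'n). flat p (1 - x \<bullet> x))"
  fix \<psi> assume "\<psi> \<in> ?S"
  then obtain p where p: "\<psi> = (%x. flat p (1 - x \<bullet> x))" by auto
  let ?q = "[:0,0,1:] * (p - pderiv p)"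
  have d: "(\<psi> has_derivative (%h. flat ?q (1 - x \<bullet> x) * (- (x \<bullet> h + h \<bullet> x)))) (at x)" for x
  proof -
    have 1: "((%x. 1 - x \<bullet> x) has_derivative (%h. - (x \<bullet> h + h \<bullet> x))) (at x)" by (auto intro!: derivative_eq_intros)
    show ?thesis unfolding p using diff_chain_at[OF 1, of "flat p"] flat_has_derivative[of p "1 - x \<bullet> x"]
      by (auto simp: has_field_derivative_def o_def)
  qed
  have "(%x. flat ?q (1 - x \<bullet> x) * (- (x \<bullet> axis j 1 + axis j 1 \<bullet> x))) \<in> smooth_alg ?S" for j
  proof (rule smooth_alg.mult)
    show "(%x. flat ?q (1 - x \<bullet> x)) \<in> smooth_alg ?S" by (rule smooth_alg.base) blast
    have "(%x::real^'n. - (x \<bullet> axis j 1 + axis j 1 \<bullet> x)) = (%x. (- 2) * x $ j)" by (auto simp: inner_axis inner_commute)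
    then show "(%x::real^'n. - (x \<bullet> axis j 1 + axis j 1 \<bullet> x)) \<in> smooth_alg ?S"
      by (simp only: smooth_alg.smooth smooth_fun_mult smooth_fun_const smooth_fun_component)
  qed
  then show "\<exists>D. (\<forall>x. (\<psi> has_derivative D x) (at x)) & (\<forall>j. (%x. D x (axis j 1)) \<in> smooth_alg ?S)"
    using d by (intro exI[of _ "%x h. flat ?q (1 - x \<bullet> x) * (- (x \<bullet> h + h \<bullet> x))"]) simp
qed (auto intro: smooth_alg.base)

lemma test_fun_integrable:
  fixes \<phi> :: "real^'n => real"
  assumes "continuous_on UNIV \<phi>" "compact K" "!!x. x \<notin> K ==> \<phi> x = 0"
  shows "integrable lborel \<phi>"
proof -
  have "integrable lborel (%x. indicator K x *\<^sub>R \<phi> x)"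
    by (rule borel_integrable_compact) (use assms in \<open>auto intro: continuous_on_subset\<close>)
  moreover have "(%x. indicator K x *\<^sub>R \<phi> x) = \<phi>" using assms(3) by (auto simp: indicator_def fun_eq_iff)
  ultimately show ?thesis by simp
qed

lemma bump_exists:
  fixes a :: "real^'n"
  assumes "r > 0"
  obtains \<rho> :: "real^'n => real" where "smooth_fun \<rho>" "!!x. \<rho> x >= 0" "!!x. x \<notin> ball a r ==> \<rho> x = 0"
    "integral\<^sup>L lborel \<rho> = 1"
proof -
  define f where "f x = flat 1 (1 - (- (1/r) *\<^sub>R a + (1/r) *\<^sub>R x) \<bullet> (- (1/r) *\<^sub>R a + (1/r) *\<^sub>R x))" for x :: "real^'n"
  have sm: "smooth_fun f" unfolding f_def by (rule smooth_fun_affine(1)[OF smooth_fun_flat])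
  have nn: "f x >= 0" for x by (auto simp: f_def flat_def)
  have pos: "f x > 0 \<longleftrightarrow> x \<in> ball a r" for x
  proof -
    have "- (1/r) *\<^sub>R a + (1/r) *\<^sub>R x = (1/r) *\<^sub>R (x - a)" by (simp add: algebra_simps)
    then have "(- (1/r) *\<^sub>R a + (1/r) *\<^sub>R x) \<bullet> (- (1/r) *\<^sub>R a + (1/r) *\<^sub>R x) = (norm (x - a))\<^sup>2 / r\<^sup>2"
      by (simp add: dot_square_norm power2_eq_square)
    moreover have "(norm (x - a))\<^sup>2 / r\<^sup>2 < 1 \<longleftrightarrow> norm (x - a) < r"
      using assms abs_square_less_1[of "norm (x - a) / r"] by (simp add: power_divide)
    ultimately show ?thesis by (auto simp: f_def flat_def dist_norm norm_minus_commute)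
  qed
  then have z: "f x = 0" if "x \<notin> ball a r" for x using nn[of x] that by force
  have int: "integrable lborel f"
    by (rule test_fun_integrable[of _ "cball a r"]) (use z smooth_fun_continuous[OF sm] in auto)
  \<comment> \<open>The function is positive exactly on the ball, an open set that is not
    negligible.\<close>
  have "integral\<^sup>L lborel f ~= 0"
  proof
    assume "integral\<^sup>L lborel f = 0"
    then have "AE x in lborel. f x = 0" using integral_nonneg_eq_0_iff_AE[OF int] nn by auto
    then have "emeasure lborel {x. f x ~= 0} = 0"
      by (subst (asm) AE_iff_measurable[OF _ refl]) (use smooth_fun_borel[OF sm] in auto)
    moreover have "{x. f x ~= 0} = ball a r" using pos z nn by (auto simp: less_le)
    ultimately have "ball a r \<in> null_sets lborel" by auto
    then have "negligible (ball a r)" by (simp add: negligible_iff_null_sets null_sets_completionI)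
    then show False using assms open_not_negligible[OF open_ball, of a r] by simp
  qed
  moreover have "integral\<^sup>L lborel f >= 0" by (simp add: nn)
  ultimately have ip: "integral\<^sup>L lborel f > 0" by simp
  show ?thesis
  proof
    show "smooth_fun (%x. inverse (integral\<^sup>L lborel f) * f x)" using sm by (intro smooth_fun_mult) auto
    show "inverse (integral\<^sup>L lborel f) * f x >= 0" for x using nn ip by simp
    show "x \<notin> ball a r ==> inverse (integral\<^sup>L lborel f) * f x = 0" for x using z by simp
    show "(LINT x|lborel. inverse (integral\<^sup>L lborel f) * f x) = 1" using ip by simp
  qed
qed

subsection \<open>Affine changes of variables\<close>

lemma nn_integral_lborel_affine:
  fixes f :: "real^'n => ennreal"
  assumes [measurable]: "f \<in> borel_measurable borel" and c: "c ~= 0"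
  shows "(\<integral>\<^sup>+x. f x \<partial>lborel) = ennreal (\<bar>c\<bar> ^ CARD('n)) * (\<integral>\<^sup>+x. f (a + c *\<^sub>R x) \<partial>lborel)"
proof -
  have "(\<integral>\<^sup>+x. f x \<partial>lborel) = (\<integral>\<^sup>+x. f x \<partial>density (distr lborel borel (%x. a + c *\<^sub>R x)) (%_. \<bar>c\<bar> ^ DIM(real^'n)))"
    using lborel_affine[OF c, of a] by simp
  also have "... = ennreal (\<bar>c\<bar> ^ CARD('n)) * (\<integral>\<^sup>+x. f (a + c *\<^sub>R x) \<partial>lborel)"
    by (simp add: nn_integral_density nn_integral_distr nn_integral_cmult)
  finally show ?thesis .
qed

lemma lborel_affine_integral:
  fixes f :: "real^'n => real"
  assumes "f \<in> borel_measurable borel" and c: "c ~= 0"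
  shows "integral\<^sup>L lborel f = \<bar>c\<bar> ^ CARD('n) * (LINT x|lborel. f (a + c *\<^sub>R x))"
    and "integrable lborel f ==> integrable lborel (%x. f (a + c *\<^sub>R x))"
proof -
  have [measurable]: "f \<in> borel_measurable borel" by fact
  have e: "(lborel :: (real^'n) measure) = density (distr lborel borel (%x. a + c *\<^sub>R x)) (%_. ennreal (\<bar>c\<bar> ^ CARD('n)))"
    using lborel_affine[OF c, of a] by simp
  have "integral\<^sup>L lborel f = (\<integral>x. f x \<partial>density (distr lborel borel (%x. a + c *\<^sub>R x)) (%_. ennreal (\<bar>c\<bar> ^ CARD('n))))"
    using e by simp
  also have "... = (\<integral>x. \<bar>c\<bar> ^ CARD('n) *\<^sub>R f x \<partial>distr lborel borel (%x. a + c *\<^sub>R x))" by (rule integral_density) auto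
  also have "... = \<bar>c\<bar> ^ CARD('n) * (LINT x|lborel. f (a + c *\<^sub>R x))" by (subst integral_distr) auto
  finally show "integral\<^sup>L lborel f = \<bar>c\<bar> ^ CARD('n) * (LINT x|lborel. f (a + c *\<^sub>R x))" .
  assume "integrable lborel f"
  then have "integrable (density (distr lborel borel (%x. a + c *\<^sub>R x)) (%_. ennreal (\<bar>c\<bar> ^ CARD('n)))) f" using e by simp
  then have "integrable (distr lborel borel (%x. a + c *\<^sub>R x)) (%x. \<bar>c\<bar> ^ CARD('n) *\<^sub>R f x)"
    by (subst (asm) integrable_density) auto
  then show "integrable lborel (%x. f (a + c *\<^sub>R x))" by (subst (asm) integrable_distr_eq) (use c in auto)
qed

subsection \<open>Convolution\<close>

lemma integrable_convolution:
  fixes w \<psi> :: "real^'n => real"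
  assumes w: "integrable lborel w" "\<forall>y. norm y > R --> w y = 0" and c: "continuous_on UNIV \<psi>"
  shows "integrable lborel (%y. w y * \<psi> (x - y))"
proof -
  have "compact (\<psi> ` cball x R)" by (intro compact_continuous_image continuous_on_subset[OF c]) auto
  then obtain M where M: "!!z. z \<in> cball x R ==> norm (\<psi> z) <= M" using bounded_iff compact_imp_bounded by (metis image_eqI)
  have [measurable]: "w \<in> borel_measurable borel" "\<psi> \<in> borel_measurable borel"
    using w(1) borel_measurable_continuous_onI[OF c] by auto
  show ?thesis
  proof (rule Bochner_Integration.integrable_bound[of _ "%y. w y * M"])
    show "AE y in lborel. norm (w y * \<psi> (x - y)) <= norm (w y * M)"
    proof (rule AE_I2)
      fix y show "norm (w y * \<psi> (x - y)) <= norm (w y * M)"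
      proof (cases "norm y > R")
        case False
        then have "norm (\<psi> (x - y)) <= M" by (intro M) (auto simp: dist_norm)
        then show ?thesis by (auto simp: norm_mult abs_mult intro!: mult_left_mono)
      qed (use w(2) in auto)
    qed
  qed (use w in auto)
qed

text \<open>Since \<open>w\<close> has bounded support, the points where \<open>\<psi>\<close> is
  evaluated stay in a compact ball, on which its gradient is uniformly continuous. The linearization
  error is therefore uniform in \<open>y\<close> and can be integrated against
  \<open>\<bar>w y\<bar>\<close>.\<close>

lemma convolution_has_derivative:
  fixes w \<psi> :: "real^'n => real"
  assumes w: "integrable lborel w" "\<forall>y. norm y > R --> w y = 0" and sm: "smooth_fun \<psi>"
  shows "((%x. \<integral>y. w y * \<psi> (x - y) \<partial>lborel) has_derivative
     (%h. \<Sum>j\<in>UNIV. h $ j * (LINT y|lborel. w y * partial_deriv \<psi> j (x - y)))) (at x)" unfolding has_derivative_at_alt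
proof (intro conjI allI impI)
  let ?D = "%h. \<Sum>j\<in>UNIV. h $ j * (LINT y|lborel. w y * partial_deriv \<psi> j (x - y))"
  show "bounded_linear ?D"
    by (intro bounded_linear_sum bounded_linear_mult_left[THEN bounded_linear_compose] bounded_linear_vec_nth)
  fix e :: real assume "e > 0"
  define g where "g z = (\<chi> j. partial_deriv \<psi> j z)" for z
  have gc: "continuous_on UNIV g" unfolding g_def
    by (intro continuous_on_vec_lambda smooth_fun_continuous smooth_fun_has_derivative(2) sm)
  have dpsi: "(\<psi> has_derivative (%h. g z \<bullet> h)) (at z within S)" for z S
    using smooth_fun_has_derivative(1)[OF sm, of z] unfolding g_def inner_vec_def
    by (auto intro: has_derivative_at_withinI simp: mult.commute)
  define I where "I = (LINT y|lborel. \<bar>w y\<bar>)"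
  have I: "I >= 0" by (simp add: I_def)
  define e' where "e' = e / (I + 1)"
  have e': "e' > 0" "I * e' <= e" using \<open>e > 0\<close> I by (auto simp: e'_def field_simps)
  \<comment> \<open>This ball contains every \<open>x' - y\<close> with \<open>norm y <= R\<close>
    and \<open>norm (x' - x) < 1\<close>, which is why the admissible radius is later taken as
    \<open>min d 1\<close>.\<close>
  define C where "C = cball x (\<bar>R\<bar> + 1)"
  have "uniformly_continuous_on C g" unfolding C_def by (intro compact_uniformly_continuous continuous_on_subset[OF gc]) auto
  then obtain d where d: "d > 0" "!!a b. a \<in> C ==> b \<in> C ==> dist b a < d ==> dist (g b) (g a) < e'"
    using e' unfolding uniformly_continuous_on_def by blast
  have lin: "\<bar>\<psi> (x' - y) - \<psi> (x - y) - g (x - y) \<bullet> (x' - x)\<bar> <= norm (x' - x) * e'"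
    if "norm (x' - x) < min d 1" "norm y <= R" for x' y
  proof -
    let ?S = "closed_segment (x - y) (x' - y)"
    have seg: "z \<in> C & dist z (x - y) < d" if "z \<in> ?S" for z
    proof -
      have "dist z (x - y) <= norm (x' - x)" using segment_bound1[OF that] by (simp add: dist_norm)
      moreover have "dist x z <= dist z (x - y) + norm y"
        using norm_triangle_ineq[of "x - z - y" y] by (simp add: dist_norm norm_minus_commute algebra_simps)
      ultimately show ?thesis using \<open>norm (x' - x) < min d 1\<close> \<open>norm y <= R\<close> by (auto simp: C_def)
    qed
    have "norm (\<psi> (x' - y) - \<psi> (x - y) - g (x - y) \<bullet> ((x' - y) - (x - y))) <= norm ((x' - y) - (x - y)) * e'"
    proof (rule differentiable_bound_linearization[of "x - y" "x' - y" ?S \<psi> "%z h. g z \<bullet> h" "x - y" e'])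
      show "(x - y) + t *\<^sub>R ((x' - y) - (x - y)) \<in> ?S" if "t \<in> {0..1}" for t
        using that unfolding in_segment by (intro exI[of _ t]) (auto simp: algebra_simps)
      show "(\<psi> has_derivative (%h. g z \<bullet> h)) (at z within ?S)" for z by (rule dpsi)
      show "x - y \<in> ?S" by simp
      show "onorm ((%h. g z \<bullet> h) - (%h. g (x - y) \<bullet> h)) <= e'" if "z \<in> ?S" for z
      proof (rule onorm_le)
        fix h
        have "norm (g z - g (x - y)) <= e'" using d(2)[of "x - y" z] seg[OF that] seg[of "x - y"] by (simp add: dist_norm)
        then show "norm (((%h. g z \<bullet> h) - (%h. g (x - y) \<bullet> h)) h) <= e' * norm h"
          using Cauchy_Schwarz_ineq2[of "g z - g (x - y)" h]
          by (auto simp: inner_diff_left intro: order_trans[OF _ mult_right_mono])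
      qed
    qed
    then show ?thesis by simp
  qed
  show "\<exists>d>0. \<forall>x'. norm (x' - x) < d -->
      norm ((LINT y|lborel. w y * \<psi> (x' - y)) - (LINT y|lborel. w y * \<psi> (x - y)) - ?D (x' - x)) <= e * norm (x' - x)"
  proof (intro exI[of _ "min d 1"] conjI allI impI)
    fix x' assume x': "norm (x' - x) < min d 1"
    let ?h = "x' - x"
    note i = integrable_convolution[OF w smooth_fun_continuous]
    have i1: "integrable lborel (%y. w y * \<psi> (z - y))" for z by (rule i[OF sm])
    have i2: "integrable lborel (%y. w y * partial_deriv \<psi> j (x - y))" for j
      by (rule i[OF smooth_fun_has_derivative(2)[OF sm]])
    have ig: "w y * (g (x - y) \<bullet> ?h) = (\<Sum>j\<in>UNIV. ?h $ j * (w y * partial_deriv \<psi> j (x - y)))" for y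
      by (simp add: g_def inner_vec_def sum_distrib_left algebra_simps)
    have D: "?D ?h = (LINT y|lborel. w y * (g (x - y) \<bullet> ?h))"
      unfolding ig by (subst Bochner_Integration.integral_sum) (use i2 in auto)
    have i3: "integrable lborel (%y. w y * (g (x - y) \<bullet> ?h))" unfolding ig
      by (intro Bochner_Integration.integrable_sum integrable_mult_right i2)
    have "(LINT y|lborel. w y * \<psi> (x' - y)) - (LINT y|lborel. w y * \<psi> (x - y)) - ?D ?h
       = (LINT y|lborel. w y * (\<psi> (x' - y) - \<psi> (x - y) - g (x - y) \<bullet> ?h))"
      unfolding D using i1 i3 by (simp add: right_diff_distrib Bochner_Integration.integral_diff)
    also have "norm ... <= (LINT y|lborel. \<bar>w y\<bar> * (norm ?h * e'))"
    proof (rule Bochner_Integration.integral_norm_bound_integral)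
      show "integrable lborel (%y. w y * (\<psi> (x' - y) - \<psi> (x - y) - g (x - y) \<bullet> ?h))"
        using i1 i3 by (simp add: right_diff_distrib)
      show "integrable lborel (%y. \<bar>w y\<bar> * (norm ?h * e'))" using w(1) by auto
      fix y
      show "norm (w y * (\<psi> (x' - y) - \<psi> (x - y) - g (x - y) \<bullet> ?h)) <= \<bar>w y\<bar> * (norm ?h * e')"
      proof (cases "norm y > R")
        case False
        then show ?thesis using lin[OF x', of y] by (auto simp: abs_mult intro!: mult_left_mono)
      qed (use w(2) in auto)
    qed
    also have "... = I * e' * norm ?h" using w(1) by (simp add: I_def algebra_simps)
    also have "... <= e * norm ?h" using e' by (intro mult_right_mono) auto
    finally show "norm ((LINT y|lborel. w y * \<psi> (x' - y)) - (LINT y|lborel. w y * \<psi> (x - y)) - ?D ?h) <= e * norm ?h" .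
  qed (use d in auto)
qed

lemma sum_axis [simp]: "(\<Sum>k\<in>UNIV. axis j (1::real) $ k * f k) = f j"
proof -
  have "(\<Sum>k\<in>UNIV. axis j (1::real) $ k * f k) = (\<Sum>k\<in>UNIV. if k = j then f j else 0)" by (rule sum.cong) (auto simp: axis_def)
  then show ?thesis by simp
qed

text \<open>Differentiation falls on \<open>\<psi>\<close> alone, so for fixed \<open>w\<close> the
  convolutions with all smooth functions form a set closed under partial derivatives, and
  \<open>w\<close> may be merely integrable.\<close>

lemma smooth_fun_convolution:
  fixes w \<psi> :: "real^'n => real"
  assumes w: "integrable lborel w" "\<forall>y. norm y > R --> w y = 0" and sm: "smooth_fun \<psi>"
  shows "smooth_fun (%x. \<integral>y. w y * \<psi> (x - y) \<partial>lborel)"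
    and "partial_deriv (%x. \<integral>y. w y * \<psi> (x - y) \<partial>lborel) j x = (LINT y|lborel. w y * partial_deriv \<psi> j (x - y))"
proof -
  note d = convolution_has_derivative[OF w]
  show "partial_deriv (%x. \<integral>y. w y * \<psi> (x - y) \<partial>lborel) j x = (LINT y|lborel. w y * partial_deriv \<psi> j (x - y))"
    by (subst partial_derivI[OF d[OF sm]]) simp_all
  let ?S = "{%x. \<integral>y. w y * \<psi> (x - y) \<partial>lborel |\<psi>. smooth_fun \<psi>}"
  show "smooth_fun (%x. \<integral>y. w y * \<psi> (x - y) \<partial>lborel)" unfolding smooth_fun_def
  proof (intro exI[of _ ?S] conjI ballI)
    show "(%x. \<integral>y. w y * \<psi> (x - y) \<partial>lborel) \<in> ?S" using sm by blast
    fix \<theta> assume "\<theta> \<in> ?S"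
    then obtain \<psi> where p: "\<theta> = (%x. \<integral>y. w y * \<psi> (x - y) \<partial>lborel)" "smooth_fun \<psi>" by blast
    show "\<exists>D. (\<forall>x. (\<theta> has_derivative D x) (at x)) & (\<forall>j. (%x. D x (axis j 1)) \<in> ?S)"
      by (rule exI, rule conjI, rule allI, unfold p(1), rule d[OF p(2)])
        (use smooth_fun_has_derivative(2)[OF p(2)] in auto)
  qed
qed

text \<open>The indicator of the ball of intermediate radius \<open>m\<close> is convolved with a
  bump supported within distance \<open>d\<close>, half the gap between the two radii. Near the
  inner ball the whole mass of the bump is seen, outside the outer ball none of it.\<close>

lemma plateau_exists:
  fixes p :: "real^'n"
  assumes "0 < r'" "r' < r"
  obtains \<eta> :: "real^'n => real" where "smooth_fun \<eta>" "!!x. 0 <= \<eta> x & \<eta> x <= 1"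
    "!!x. x \<in> ball p r' ==> \<eta> x = 1" "!!x. x \<notin> ball p r ==> \<eta> x = 0"
proof -
  define m d where "m = (r + r') / 2" and "d = (r - r') / 2"
  have md: "m = r' + d" "r = m + d" "d > 0" using assms by (auto simp: m_def d_def field_simps)
  obtain \<rho> :: "real^'n => real" where rho: "smooth_fun \<rho>" "!!x. \<rho> x >= 0" "!!x. x \<notin> ball 0 d ==> \<rho> x = 0"
    "integral\<^sup>L lborel \<rho> = 1" using bump_exists[OF md(3), of 0] by metis
  have irho: "integrable lborel \<rho>" by (rule test_fun_integrable[of _ "cball 0 d"]) (use rho smooth_fun_continuous in auto)
  define w where "w = (indicator (ball p m) :: real^'n => real)"
  have iw: "integrable lborel w" unfolding w_def using emeasure_lborel_ball_finite by (auto simp: integrable_indicator_iff)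
  have w0: "\<forall>y. norm y > norm p + m --> w y = 0"
  proof (intro allI impI)
    fix y :: "real^'n" assume "norm y > norm p + m"
    then show "w y = 0" using norm_triangle_ineq2[of y p] by (auto simp: w_def indicator_def dist_norm norm_minus_commute)
  qed
  define \<eta> where "\<eta> x = (LINT y|lborel. w y * \<rho> (x - y))" for x
  have sm: "smooth_fun \<eta>" unfolding \<eta>_def by (rule smooth_fun_convolution(1)[OF iw w0 rho(1)])
  have ic: "integrable lborel (%y. w y * \<rho> (x - y))" for x
    by (rule integrable_convolution[OF iw w0 smooth_fun_continuous[OF rho(1)]])
  have tr: "(LINT y|lborel. \<rho> (x - y)) = 1" "integrable lborel (%y. \<rho> (x - y))" for x
  proof -
    note a = lborel_affine_integral[OF smooth_fun_borel[OF rho(1)], of "-1" x]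
    show "(LINT y|lborel. \<rho> (x - y)) = 1" "integrable lborel (%y. \<rho> (x - y))" using a rho(4) irho by auto
  qed
  show ?thesis
  proof
    show "smooth_fun \<eta>" by (rule sm)
    show "0 <= \<eta> x & \<eta> x <= 1" for x
    proof
      show "0 <= \<eta> x" unfolding \<eta>_def by (intro integral_nonneg_AE AE_I2) (auto simp: w_def rho)
      have "\<eta> x <= (LINT y|lborel. \<rho> (x - y))" unfolding \<eta>_def
        by (intro integral_mono ic tr) (auto simp: w_def rho indicator_def)
      then show "\<eta> x <= 1" by (simp add: tr)
    qed
    show "\<eta> x = 1" if "x \<in> ball p r'" for x
    proof -
      have "w y * \<rho> (x - y) = \<rho> (x - y)" for y
      proof (cases "x - y \<in> ball 0 d")
        case True
        then have "dist p y < m" using that md dist_triangle[of p y x] by (simp add: dist_norm norm_minus_commute)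
        then show ?thesis by (simp add: w_def)
      qed (use rho in auto)
      then have "\<eta> x = (LINT y|lborel. \<rho> (x - y))" unfolding \<eta>_def by (intro Bochner_Integration.integral_cong) auto
      then show ?thesis by (simp add: tr)
    qed
    show "\<eta> x = 0" if "x \<notin> ball p r" for x
    proof -
      have "w y * \<rho> (x - y) = 0" for y
      proof (cases "x - y \<in> ball 0 d")
        case True
        then have "\<not> dist p y < m" using that md dist_triangle[of p x y] by (simp add: dist_norm norm_minus_commute)
        then show ?thesis by (simp add: w_def)
      qed (use rho in auto)
      then show ?thesis unfolding \<eta>_def by (simp only: integral_zero)
    qed
  qed
qed

subsection \<open>Mollification in the mean\<close>

lemma translation_integral:
  fixes f :: "real^'n => real"
  assumes "integrable lborel f"
  shows "integrable lborel (%x. f (x + t))" "(LINT x|lborel. f (x + t)) = integral\<^sup>L lborel f"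
  using lborel_affine_integral[of f 1 t] assms by (auto simp: add.commute)

text \<open>The property \<open>approx\<close> says that the claim passes to limits in the mean. It
  holds for open sets of finite measure by dominated convergence, then for Borel sets by outer
  regularity, and then for all integrable functions by induction.\<close>

lemma translation_continuous_L1:
  fixes f :: "real^'n => real"
  assumes "integrable lborel f" and t: "t ----> 0"
  shows "(%k. \<integral>x. \<bar>f (x + t k) - f x\<bar> \<partial>lborel) ----> 0"
proof -
  have approx: "(%k. \<integral>x. \<bar>f (x + t k) - f x\<bar> \<partial>lborel) ----> 0"
    if f: "integrable lborel f"
      and g: "!!e. e > 0 ==> \<exists>g. integrable lborel g & (LINT x|lborel. \<bar>f x - g x\<bar>) <= e &
          (%k. \<integral>x. \<bar>g (x + t k) - g x\<bar> \<partial>lborel) ----> 0" for f :: "real^'n => real"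
  proof (rule LIMSEQ_I)
    fix e :: real assume e: "e > 0"
    then have "e / 4 > 0" by simp
    then obtain g where g: "integrable lborel g" "(LINT x|lborel. \<bar>f x - g x\<bar>) <= e / 4"
      "(%k. \<integral>x. \<bar>g (x + t k) - g x\<bar> \<partial>lborel) ----> 0" using g by blast
    obtain N where N: "!!k. k >= N ==> norm ((LINT x|lborel. \<bar>g (x + t k) - g x\<bar>) - 0) < e / 4"
      using LIMSEQ_D[OF g(3) \<open>e / 4 > 0\<close>] by blast
    have "norm ((LINT x|lborel. \<bar>f (x + t k) - f x\<bar>) - 0) < e" if "k >= N" for k
    proof -
      note ti = translation_integral(1)
      have i: "integrable lborel (%x. \<bar>f x - g x\<bar>)" using f g by auto
      have "(LINT x|lborel. \<bar>f (x + t k) - f x\<bar>) <= (LINT x|lborel. \<bar>f (x + t k) - g (x + t k)\<bar> + (\<bar>g (x + t k) - g x\<bar> + \<bar>f x - g x\<bar>))"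
        by (rule integral_mono) (use f g ti[OF f] ti[OF g(1)] in \<open>auto intro!: Bochner_Integration.integrable_add integrable_abs Bochner_Integration.integrable_diff\<close>)
      also have "... = (LINT x|lborel. \<bar>f (x + t k) - g (x + t k)\<bar>) + ((LINT x|lborel. \<bar>g (x + t k) - g x\<bar>) + (LINT x|lborel. \<bar>f x - g x\<bar>))"
        using f g ti[OF f] ti[OF g(1)] by (simp add: Bochner_Integration.integral_add)
      also have "(LINT x|lborel. \<bar>f (x + t k) - g (x + t k)\<bar>) = (LINT x|lborel. \<bar>f x - g x\<bar>)"
        by (rule translation_integral(2)[OF i])
      finally have "(LINT x|lborel. \<bar>f (x + t k) - f x\<bar>) < e" using g(2) N[OF that] e by simp
      then show ?thesis by simp
    qed
    then show "\<exists>N. \<forall>k\<ge>N. norm ((LINT x|lborel. \<bar>f (x + t k) - f x\<bar>) - 0) < e" by blast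
  qed
  have opn: "(%k. \<integral>x. \<bar>indicator U (x + t k) - indicator U x\<bar> \<partial>lborel) ----> (0::real)"
    if U: "open U" "emeasure lborel U < \<infinity>" for U :: "(real^'n) set"
  proof -
    have iU: "integrable lborel (indicator U :: real^'n => real)" using U by (auto simp: integrable_indicator_iff)
    have [measurable]: "U \<in> sets borel" using U by auto
    have "(%k. \<integral>x. indicator U x * indicator U (x + t k) \<partial>lborel) ----> (LINT x|lborel. (indicator U x :: real))"
    proof (rule integral_dominated_convergence[where w = "indicator U"])
      show "AE x in lborel. (%k. indicator U x * indicator U (x + t k)) ----> (indicator U x :: real)"
      proof (rule AE_I2)
        fix x
        show "(%k. indicator U x * indicator U (x + t k)) ----> (indicator U x :: real)"
        proof (cases "x \<in> U")
          case True
          have "(%k. x + t k) ----> x + 0" by (intro tendsto_intros t)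
          then have "eventually (%k. x + t k \<in> U) sequentially" using topological_tendstoD[OF _ U(1)] True by fastforce
          then show ?thesis by (rule tendsto_eventually[OF eventually_mono]) (use True in auto)
        qed auto
      qed
    qed (use iU in \<open>auto simp: indicator_def\<close>)
    \<comment> \<open>\<open>U\<close> and its translate have the same measure, so their symmetric
      difference has twice the measure of \<open>U\<close> minus that of the overlap.\<close>
    then have "(%k. 2 * ((LINT x|lborel. indicator U x) - (LINT x|lborel. indicator U x * indicator U (x + t k)))) ----> 2 * ((LINT x|lborel. (indicator U x :: real)) - (LINT x|lborel. (indicator U x :: real)))"
      by (intro tendsto_intros)
    moreover have "2 * ((LINT x|lborel. indicator U x) - (LINT x|lborel. indicator U x * indicator U (x + t k))) = (\<integral>x. \<bar>indicator U (x + t k) - indicator U x\<bar> \<partial>lborel :: real)" for k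
    proof -
      have a: "\<bar>indicator U (x + t k) - indicator U x :: real\<bar> = (indicator U (x + t k) + indicator U x) - 2 * (indicator U x * indicator U (x + t k))" for x
        by (auto simp: indicator_def)
      have m: "integrable lborel (%x. indicator U x * indicator U (x + t k) :: real)"
        by (rule Bochner_Integration.integrable_bound[OF iU]) (auto simp: indicator_def)
      note ti = translation_integral[OF iU, of "t k"]
      show ?thesis unfolding a using ti m iU
        by (simp add: Bochner_Integration.integral_diff Bochner_Integration.integral_add del: integral_indicator)
    qed
    ultimately show ?thesis by simp
  qed
  show ?thesis using assms(1)
  proof (induction rule: integrable_induct)
    case (base A c)
    have A: "A \<in> sets borel" "emeasure lborel A < \<infinity>" using base by auto
    have ind: "(%k. \<integral>x. \<bar>indicator A (x + t k) - indicator A x\<bar> \<partial>lborel) ----> (0::real)"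
    proof (rule approx)
      show "integrable lborel (indicator A :: real^'n => real)" using A by (auto simp: integrable_indicator_iff)
      fix e :: real assume "e > 0"
      then obtain U where U: "open U" "A \<subseteq> U" "emeasure lborel (U - A) < ennreal e"
        using outer_regular_lborel[OF A(1)] by blast
      have mU: "U \<in> sets borel" using U by auto
      have "emeasure lborel U = emeasure lborel A + emeasure lborel (U - A)"
        using U A mU by (subst plus_emeasure) (auto intro!: arg_cong[of _ _ "emeasure lborel"])
      then have fU: "emeasure lborel U < \<infinity>" using A(2) order.strict_trans[OF U(3) ennreal_less_top] by simp
      have "\<bar>indicator A x - indicator U x :: real\<bar> = indicator (U - A) x" for x using U by (auto simp: indicator_def)
      then have "(LINT x|lborel. \<bar>indicator A x - indicator U x\<bar>) = measure lborel (U - A)" by simp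
      also have "... <= e" using U(3) \<open>e > 0\<close> by (simp add: measure_def enn2real_leI)
      finally show "\<exists>g. integrable lborel g & (LINT x|lborel. \<bar>indicator A x - g x\<bar>) <= e &
          (%k. \<integral>x. \<bar>g (x + t k) - g x\<bar> \<partial>lborel) ----> 0"
        using opn[OF U(1) fU] fU mU by (intro exI[of _ "indicator U"]) (auto simp: integrable_indicator_iff)
    qed
    have "(LINT x|lborel. \<bar>indicator A (x + t k) *\<^sub>R c - indicator A x *\<^sub>R c\<bar>) = (LINT x|lborel. \<bar>indicator A (x + t k) - indicator A x\<bar>) * \<bar>c\<bar>" for k
    proof -
      have "\<bar>indicator A (x + t k) *\<^sub>R c - indicator A x *\<^sub>R c\<bar> = \<bar>indicator A (x + t k) - indicator A x\<bar> * \<bar>c\<bar>" for x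
        by (simp add: abs_mult left_diff_distrib[symmetric])
      then show ?thesis by simp
    qed
    then show ?case using tendsto_mult_left_zero[OF ind, of "\<bar>c\<bar>"] by simp
  next
    case (add f g)
    have ti: "integrable lborel (%x. f (x + t k))" "integrable lborel (%x. g (x + t k))" for k
      using add translation_integral(1) by auto
    show ?case
    proof (rule tendsto_sandwich[OF _ _ tendsto_const tendsto_add_zero[OF add.IH]])
      show "\<forall>\<^sub>F k in sequentially. (LINT x|lborel. \<bar>f (x + t k) + g (x + t k) - (f x + g x)\<bar>)
         <= (LINT x|lborel. \<bar>f (x + t k) - f x\<bar>) + (LINT x|lborel. \<bar>g (x + t k) - g x\<bar>)"
      proof (intro always_eventually allI)
        fix k
        have "(LINT x|lborel. \<bar>f (x + t k) + g (x + t k) - (f x + g x)\<bar>) <= (LINT x|lborel. \<bar>f (x + t k) - f x\<bar> + \<bar>g (x + t k) - g x\<bar>)"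
          by (rule integral_mono) (use add ti in \<open>auto intro!: Bochner_Integration.integrable_add integrable_abs Bochner_Integration.integrable_diff\<close>)
        also have "... = (LINT x|lborel. \<bar>f (x + t k) - f x\<bar>) + (LINT x|lborel. \<bar>g (x + t k) - g x\<bar>)"
          using add ti by (intro Bochner_Integration.integral_add) auto
        finally show "(LINT x|lborel. \<bar>f (x + t k) + g (x + t k) - (f x + g x)\<bar>)
         <= (LINT x|lborel. \<bar>f (x + t k) - f x\<bar>) + (LINT x|lborel. \<bar>g (x + t k) - g x\<bar>)" .
      qed
    qed auto
  next
    case (lim f s)
    show ?case
    proof (rule approx)
      show "integrable lborel f" by fact
      fix e :: real assume "e > 0"
      have "(%i. \<integral>x. \<bar>f x - s i x\<bar> \<partial>lborel) ----> (\<integral>x. 0 \<partial>(lborel :: (real^'n) measure))"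
      \<comment> \<open>The approximants satisfy
        \<open>\<bar>s i x\<bar> <= 2 * \<bar>f x\<bar>\<close>, whence the factor 3.\<close>
      proof (rule integral_dominated_convergence[where w = "%x. 3 * \<bar>f x\<bar>"])
        show "AE x in lborel. (%i. \<bar>f x - s i x\<bar>) ----> 0"
        proof (rule AE_I2)
          fix x :: "real^'n"
          have "(%i. \<bar>f x - s i x\<bar>) ----> \<bar>f x - f x\<bar>" by (intro tendsto_intros lim) auto
          then show "(%i. \<bar>f x - s i x\<bar>) ----> 0" by simp
        qed
        show "AE x in lborel. norm \<bar>f x - s i x\<bar> <= 3 * \<bar>f x\<bar>" for i
        proof (rule AE_I2)
          fix x :: "real^'n"
          show "norm \<bar>f x - s i x\<bar> <= 3 * \<bar>f x\<bar>" using lim.hyps(3)[of x i] by simp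
        qed
      qed (use lim in auto)
      then have "(%i. \<integral>x. \<bar>f x - s i x\<bar> \<partial>lborel) ----> 0" by simp
      from LIMSEQ_D[OF this \<open>e > 0\<close>] obtain i where "norm ((LINT x|lborel. \<bar>f x - s i x\<bar>) - 0) < e" by blast
      then show "\<exists>g. integrable lborel g & (LINT x|lborel. \<bar>f x - g x\<bar>) <= e &
          (%k. \<integral>x. \<bar>g (x + t k) - g x\<bar> \<partial>lborel) ----> 0" using lim by (intro exI[of _ "s i"]) auto
    qed
  qed
qed

lemma sq_diff_le: "((a::real) - b)\<^sup>2 <= 2 * a\<^sup>2 + 2 * b\<^sup>2"
  using zero_le_power2[of "a + b"] by (simp add: power2_eq_square algebra_simps)

lemma sq_add_le: "((a::real) + b)\<^sup>2 <= 2 * a\<^sup>2 + 2 * b\<^sup>2"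
  using zero_le_power2[of "a - b"] by (simp add: power2_eq_square algebra_simps)

text \<open>For the truncation \<open>g M\<close> at height \<open>M\<close> the square of an
  increment is at most \<open>2 * M\<close> times its absolute value, so continuity in the mean
  suffices; the truncation error is small in the square mean.\<close>

lemma translation_continuous_L2:
  fixes f :: "real^'n => real"
  assumes f: "integrable lborel f" "integrable lborel (%x. (f x)\<^sup>2)" and t: "t ----> 0"
  shows "(%k. \<integral>x. (f (x + t k) - f x)\<^sup>2 \<partial>lborel) ----> 0"
proof (rule LIMSEQ_I)
  fix e :: real assume e: "e > 0"
  define g where "g M x = max (- real M) (min (real M) (f x))" for M x
  have [measurable]: "f \<in> borel_measurable borel" using f by auto
  have gm[measurable]: "g M \<in> borel_measurable borel" for M unfolding g_def by auto
  have gb: "\<bar>g M x\<bar> <= \<bar>f x\<bar>" "\<bar>f x - g M x\<bar> <= \<bar>f x\<bar>" "\<bar>g M x\<bar> <= real M" for M x unfolding g_def by auto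
  have gi: "integrable lborel (g M)" for M by (rule Bochner_Integration.integrable_bound[OF f(1)]) (auto simp: gb)
  have "(%M. \<integral>x. (f x - g M x)\<^sup>2 \<partial>lborel) ----> (\<integral>x. 0 \<partial>(lborel :: (real^'n) measure))"
  proof (rule integral_dominated_convergence[where w = "%x. (f x)\<^sup>2"])
    show "AE x in lborel. (%M. (f x - g M x)\<^sup>2) ----> 0"
    proof (rule AE_I2)
      fix x
      obtain M0 where "real M0 >= \<bar>f x\<bar>" using real_arch_simple by blast
      then have "!!M. M >= M0 ==> (f x - g M x)\<^sup>2 = 0" by (auto simp: g_def)
      then show "(%M. (f x - g M x)\<^sup>2) ----> 0" by (intro tendsto_eventually) (auto simp: eventually_sequentially)
    qed
    show "AE x in lborel. norm ((f x - g M x)\<^sup>2) <= (f x)\<^sup>2" for M using gb(2) by (auto simp: abs_le_square_iff[symmetric])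
  qed (use f in auto)
  then have "(%M. \<integral>x. (f x - g M x)\<^sup>2 \<partial>lborel) ----> 0" by simp
  \<comment> \<open>The truncation error enters twice with factor 3 and so uses up
    \<open>e/2\<close>; the truncated increment receives the other half.\<close>
  from LIMSEQ_D[OF this, of "e/12"] e obtain M where "norm ((LINT x|lborel. (f x - g M x)\<^sup>2) - 0) < e/12" by auto
  then have M: "(LINT x|lborel. (f x - g M x)\<^sup>2) < e/12" by simp
  have "(%k. 6 * real M * (LINT x|lborel. \<bar>g M (x + t k) - g M x\<bar>)) ----> 0"
    by (rule tendsto_mult_right_zero[OF translation_continuous_L1[OF gi t]])
  from LIMSEQ_D[OF this, of "e/2"] e obtain N where
    N: "!!k. k >= N ==> norm (6 * real M * (LINT x|lborel. \<bar>g M (x + t k) - g M x\<bar>) - 0) < e/2" by auto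
  have i0: "integrable lborel (%x. (f x - g M x)\<^sup>2)" by (rule Bochner_Integration.integrable_bound[OF f(2)])
      (use gb(2) in \<open>auto simp: abs_le_square_iff[symmetric]\<close>)
  have "norm ((LINT x|lborel. (f (x + t k) - f x)\<^sup>2) - 0) < e" if "k >= N" for k
  proof -
    have pt: "(f (x + t k) - f x)\<^sup>2 <= 3 * (f (x + t k) - g M (x + t k))\<^sup>2 + (6 * real M * \<bar>g M (x + t k) - g M x\<bar> + 3 * (f x - g M x)\<^sup>2)" for x
    proof -
      let ?a = "f (x + t k) - g M (x + t k)" and ?b = "g M (x + t k) - g M x" and ?c = "g M x - f x"
      have "(?a + ?b + ?c)\<^sup>2 <= 3 * (?a\<^sup>2 + ?b\<^sup>2 + ?c\<^sup>2)"
        using zero_le_power2[of "?a - ?b"] zero_le_power2[of "?a - ?c"] zero_le_power2[of "?b - ?c"]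
        by (simp add: power2_eq_square algebra_simps)
      moreover have "?b\<^sup>2 <= 2 * real M * \<bar>?b\<bar>"
      proof -
        have "\<bar>?b\<bar> <= 2 * real M" using gb(3)[of M x] gb(3)[of M "x + t k"] by simp
        then have "\<bar>?b\<bar> * \<bar>?b\<bar> <= 2 * real M * \<bar>?b\<bar>" by (intro mult_right_mono) auto
        then show ?thesis by (simp add: power2_eq_square)
      qed
      moreover have "?c\<^sup>2 = (f x - g M x)\<^sup>2" by (simp add: power2_commute)
      ultimately show ?thesis by simp
    qed
    note i = translation_integral[OF i0, of "t k"]
    have i2: "integrable lborel (%x. 6 * real M * \<bar>g M (x + t k) - g M x\<bar>)"
      using translation_integral(1)[OF gi] gi by (intro integrable_mult_right integrable_abs Bochner_Integration.integrable_diff) auto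
    have "(LINT x|lborel. (f (x + t k) - f x)\<^sup>2) <= (LINT x|lborel. 3 * (f (x + t k) - g M (x + t k))\<^sup>2 + (6 * real M * \<bar>g M (x + t k) - g M x\<bar> + 3 * (f x - g M x)\<^sup>2))"
    proof (rule integral_mono)
      show "integrable lborel (%x. (f (x + t k) - f x)\<^sup>2)"
      proof (rule Bochner_Integration.integrable_bound)
        show "integrable lborel (%x. 2 * (f (x + t k))\<^sup>2 + 2 * (f x)\<^sup>2)"
          using f(2) translation_integral(1)[OF f(2), of "t k"] by auto
        show "AE x in lborel. norm ((f (x + t k) - f x)\<^sup>2) <= norm (2 * (f (x + t k))\<^sup>2 + 2 * (f x)\<^sup>2)"
          using sq_diff_le by auto
      qed auto
      show "integrable lborel (%x. 3 * (f (x + t k) - g M (x + t k))\<^sup>2 + (6 * real M * \<bar>g M (x + t k) - g M x\<bar> + 3 * (f x - g M x)\<^sup>2))"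
        using i(1) i2 i0 by (intro Bochner_Integration.integrable_add integrable_mult_right) auto
    qed (rule pt)
    also have "... = 3 * (LINT x|lborel. (f x - g M x)\<^sup>2) + (6 * real M * (LINT x|lborel. \<bar>g M (x + t k) - g M x\<bar>) + 3 * (LINT x|lborel. (f x - g M x)\<^sup>2))"
      using i i2 i0 by (simp add: Bochner_Integration.integral_add)
    also have "... < e" using M N[OF that] by simp
    finally have "(LINT x|lborel. (f (x + t k) - f x)\<^sup>2) < e" .
    moreover have "(LINT x|lborel. (f (x + t k) - f x)\<^sup>2) >= 0" by simp
    ultimately show ?thesis by simp
  qed
  then show "\<exists>N. \<forall>k\<ge>N. norm ((LINT x|lborel. (f (x + t k) - f x)\<^sup>2) - 0) < e" by blast
qed

definition mollifier :: "(real^'n => real) => real => real^'n => real" where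
  "mollifier \<rho> e z = inverse (e ^ CARD('n)) * \<rho> ((1/e) *\<^sub>R z)"

lemma smooth_mollifier: "smooth_fun \<rho> ==> smooth_fun (mollifier \<rho> e)" unfolding mollifier_def
  by (intro smooth_fun_mult smooth_fun_const) (use smooth_fun_affine(1)[of \<rho> 0 "1/e"] in simp)

lemma mollify_eq:
  fixes w \<rho> :: "real^'n => real"
  assumes [measurable]: "w \<in> borel_measurable borel" "\<rho> \<in> borel_measurable borel" and "e > 0"
  shows "(LINT y|lborel. w y * mollifier \<rho> e (x - y)) = (LINT z|lborel. \<rho> z * w (x - e *\<^sub>R z))"
proof -
  have "(%y. w y * mollifier \<rho> e (x - y)) \<in> borel_measurable borel" unfolding mollifier_def by measurable
  from lborel_affine_integral(1)[OF this, of "-e" x]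
  have "(LINT y|lborel. w y * mollifier \<rho> e (x - y)) = e ^ CARD('n) * (LINT z|lborel. w (x - e *\<^sub>R z) * mollifier \<rho> e (e *\<^sub>R z))"
    using \<open>e > 0\<close> by simp
  also have "... = (LINT z|lborel. e ^ CARD('n) * (w (x - e *\<^sub>R z) * mollifier \<rho> e (e *\<^sub>R z)))" by simp
  also have "... = (LINT z|lborel. \<rho> z * w (x - e *\<^sub>R z))"
    using \<open>e > 0\<close> by (intro Bochner_Integration.integral_cong) (auto simp: mollifier_def)
  finally show ?thesis .
qed

text \<open>By Jensen's inequality for the probability density \<open>\<rho>\<close> the squared
  error is at most the \<open>\<rho>\<close>-average of squared translation errors, which tend to 0
  and are dominated by \<open>B\<close>. The support of \<open>\<rho>\<close> may lie away from the
  origin; this is what permits one-sided mollification near a boundary.\<close>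

lemma mollify_tendsto:
  fixes w \<rho> :: "real^'n => real"
  assumes w: "integrable lborel w" "integrable lborel (%x. (w x)\<^sup>2)" "\<forall>y. norm y > R --> w y = 0"
    and rho: "smooth_fun \<rho>" "!!x. \<rho> x >= 0" "integrable lborel \<rho>" "integral\<^sup>L lborel \<rho> = 1"
    and e: "!!k. e k > 0" "e ----> 0"
  shows "(%k. \<integral>\<^sup>+x. ennreal (((LINT y|lborel. w y * mollifier \<rho> (e k) (x - y)) - w x)\<^sup>2) \<partial>lborel) ----> 0"
proof -
  have [measurable]: "w \<in> borel_measurable borel" "\<rho> \<in> borel_measurable borel" using w smooth_fun_borel[OF rho(1)] by auto
  define a where "a k z = (\<integral>\<^sup>+x. ennreal ((w (x - e k *\<^sub>R z) - w x)\<^sup>2) \<partial>lborel)" for k z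
  have am[measurable]: "a k \<in> borel_measurable borel" for k unfolding a_def by measurable
  have i: "integrable lborel (%x. (w (x + s) - w x)\<^sup>2)" for s
  proof (rule Bochner_Integration.integrable_bound)
    show "integrable lborel (%x. 2 * (w (x + s))\<^sup>2 + 2 * (w x)\<^sup>2)" using w(2) translation_integral(1)[OF w(2), of s] by auto
  qed (use sq_diff_le in auto)
  have a_eq: "a k z = ennreal (LINT x|lborel. (w (x + (- e k *\<^sub>R z)) - w x)\<^sup>2)" for k z
    unfolding a_def by (subst nn_integral_eq_integral[symmetric, OF i]) auto
  have a0: "(%k. a k z) ----> 0" for z
  proof -
    have "(%k. - e k *\<^sub>R z) ----> - 0 *\<^sub>R z" by (intro tendsto_intros e)
    then have "(%k. - e k *\<^sub>R z) ----> 0" by simp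
    from translation_continuous_L2[OF w(1,2) this] show ?thesis unfolding a_eq using tendsto_ennrealI by fastforce
  qed
  define B where "B = 4 * (LINT x|lborel. (w x)\<^sup>2)"
  have aB: "a k z <= ennreal B" for k z
  proof -
    have "(LINT x|lborel. (w (x + s) - w x)\<^sup>2) <= (LINT x|lborel. 2 * (w (x + s))\<^sup>2 + 2 * (w x)\<^sup>2)" for s
      by (intro integral_mono i) (use w(2) translation_integral(1)[OF w(2), of s] sq_diff_le in auto)
    also have "... s = B" for s using w(2) translation_integral[OF w(2), of s] by (simp add: B_def)
    finally show ?thesis unfolding a_eq by (intro ennreal_leI)
  qed
  have "(%k. \<integral>\<^sup>+z. ennreal (\<rho> z) * a k z \<partial>lborel) ----> (\<integral>\<^sup>+z. 0 \<partial>(lborel :: (real^'n) measure))"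
  proof (rule nn_integral_dominated_convergence[where w = "%z. ennreal (\<rho> z) * ennreal B"])
    show "(\<integral>\<^sup>+z. ennreal (\<rho> z) * ennreal B \<partial>lborel) < \<infinity>"
      using rho by (simp add: nn_integral_multc nn_integral_eq_integral ennreal_mult_less_top)
    show "AE z in lborel. (%k. ennreal (\<rho> z) * a k z) ----> 0"
      using ennreal_tendsto_cmult[OF _ a0] by (intro AE_I2) fastforce
  qed (auto intro!: mult_left_mono aB)
  then have lim: "(%k. \<integral>\<^sup>+z. ennreal (\<rho> z) * a k z \<partial>lborel) ----> 0" by simp
  have le: "(\<integral>\<^sup>+x. ennreal (((LINT y|lborel. w y * mollifier \<rho> (e k) (x - y)) - w x)\<^sup>2) \<partial>lborel) <= (\<integral>\<^sup>+z. ennreal (\<rho> z) * a k z \<partial>lborel)" for k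
  proof -
    have pt: "ennreal (((LINT z|lborel. \<rho> z * w (x - e k *\<^sub>R z)) - w x)\<^sup>2) <= (\<integral>\<^sup>+z. ennreal (\<rho> z * (w (x - e k *\<^sub>R z) - w x)\<^sup>2) \<partial>lborel)" (is "_ <= ?R") for x
    proof (cases "?R = \<infinity>")
      case False
      define g where "g z = w (x - e k *\<^sub>R z) - w x" for z
      have [measurable]: "g \<in> borel_measurable borel" unfolding g_def by measurable
      have i2: "integrable lborel (%z. \<rho> z * (g z)\<^sup>2)"
        using False by (intro integrableI_nonneg) (auto simp: g_def rho less_top)
      have i1: "integrable lborel (%z. \<rho> z * g z)"
      proof (rule Bochner_Integration.integrable_bound)
        show "integrable lborel (%z. \<rho> z + \<rho> z * (g z)\<^sup>2)" using rho i2 by auto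
        have "\<bar>s\<bar> <= 1 + s\<^sup>2" for s :: real using zero_le_power2[of "\<bar>s\<bar> - 1"] by (simp add: power2_eq_square algebra_simps) 
        then have "\<bar>\<rho> z\<bar> * \<bar>g z\<bar> <= \<bar>\<rho> z\<bar> * (1 + (g z)\<^sup>2)" for z by (intro mult_left_mono) auto
        then show "AE z in lborel. norm (\<rho> z * g z) <= norm (\<rho> z + \<rho> z * (g z)\<^sup>2)"
          using rho(2) by (auto simp: abs_mult algebra_simps intro!: AE_I2)
      qed auto
      define m where "m = (LINT z|lborel. \<rho> z * g z)"
      \<comment> \<open>Jensen's inequality for the square: the variance of \<open>g\<close> under
        the density \<open>\<rho>\<close> is nonnegative.\<close>
      have "0 <= (LINT z|lborel. \<rho> z * (g z - m)\<^sup>2)" by (intro integral_nonneg_AE) (auto simp: rho)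
      also have "(LINT z|lborel. \<rho> z * (g z - m)\<^sup>2) = (LINT z|lborel. \<rho> z * (g z)\<^sup>2 - 2 * m * (\<rho> z * g z) + m\<^sup>2 * \<rho> z)"
        by (intro Bochner_Integration.integral_cong) (auto simp: power2_eq_square algebra_simps)
      also have "... = (LINT z|lborel. \<rho> z * (g z)\<^sup>2) - 2 * m * m + m\<^sup>2"
        using i1 i2 rho by (simp add: Bochner_Integration.integral_add Bochner_Integration.integral_diff flip: m_def)
      finally have "m\<^sup>2 <= (LINT z|lborel. \<rho> z * (g z)\<^sup>2)" by (simp add: power2_eq_square)
      moreover have "(LINT z|lborel. \<rho> z * w (x - e k *\<^sub>R z)) - w x = m"
      proof -
        have "(LINT z|lborel. \<rho> z * w (x - e k *\<^sub>R z)) = (LINT z|lborel. \<rho> z * g z + w x * \<rho> z)"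
          by (intro Bochner_Integration.integral_cong) (auto simp: g_def algebra_simps)
        also have "... = m + w x" using i1 rho by (simp add: m_def)
        finally show ?thesis by simp
      qed
      moreover have "?R = ennreal (LINT z|lborel. \<rho> z * (g z)\<^sup>2)"
        using nn_integral_eq_integral[OF i2] rho by (simp add: g_def)
      ultimately show ?thesis by (simp add: ennreal_leI)
    qed simp
    have "(\<integral>\<^sup>+x. ennreal (((LINT y|lborel. w y * mollifier \<rho> (e k) (x - y)) - w x)\<^sup>2) \<partial>lborel)
       <= (\<integral>\<^sup>+x. \<integral>\<^sup>+z. ennreal (\<rho> z * (w (x - e k *\<^sub>R z) - w x)\<^sup>2) \<partial>lborel \<partial>lborel)"
      by (subst mollify_eq) (auto intro!: nn_integral_mono pt e)
    also have "... = (\<integral>\<^sup>+z. \<integral>\<^sup>+x. ennreal (\<rho> z * (w (x - e k *\<^sub>R z) - w x)\<^sup>2) \<partial>lborel \<partial>lborel)"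
      by (rule lborel_pair.Fubini') measurable
    also have "... = (\<integral>\<^sup>+z. ennreal (\<rho> z) * a k z \<partial>lborel)"
      unfolding a_def by (intro nn_integral_cong) (simp add: ennreal_mult rho nn_integral_cmult)
    finally show ?thesis .
  qed
  show ?thesis by (rule tendsto_sandwich[OF _ _ tendsto_const lim]) (auto intro: always_eventually le)
qed

section \<open>Square integrable functions\<close>

lemma L2_onI:
  assumes "u \<in> borel_measurable M" "integrable M h" "!!x. x \<in> space M ==> (norm (u x))\<^sup>2 <= h x"
  shows "L2_on M u" unfolding L2_on_def
proof
  show "integrable M (%x. (norm (u x))\<^sup>2)"
    by (rule Bochner_Integration.integrable_bound[OF assms(2)]) (use assms order_trans in \<open>fastforce intro!: AE_I2\<close>)+
qed (rule assms)

lemma norm_sq_add_le: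
  fixes a b :: "'a::real_normed_vector"
  shows "(norm (a + b))\<^sup>2 <= 2 * (norm a)\<^sup>2 + 2 * (norm b)\<^sup>2"
proof -
  have "(norm (a + b))\<^sup>2 <= (norm a + norm b)\<^sup>2" by (intro power_mono norm_triangle_ineq) auto
  then show ?thesis using sq_add_le[of "norm a" "norm b"] by linarith
qed

lemma norm_sq_diff_le:
  fixes a b :: "'a::real_normed_vector"
  shows "(norm (a - b))\<^sup>2 <= 2 * (norm a)\<^sup>2 + 2 * (norm b)\<^sup>2" using norm_sq_add_le[of a "- b"] by simp

lemma L2_on_add: "L2_on M u ==> L2_on M v ==> L2_on M (%x. u x + v x)"
  by (rule L2_onI[where h = "%x. 2 * (norm (u x))\<^sup>2 + 2 * (norm (v x))\<^sup>2"])
    (auto simp: L2_on_def norm_sq_add_le)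

lemma L2_on_diff: "L2_on M u ==> L2_on M v ==> L2_on M (%x. u x - v x)"
  by (rule L2_onI[where h = "%x. 2 * (norm (u x))\<^sup>2 + 2 * (norm (v x))\<^sup>2"])
    (auto simp: L2_on_def norm_sq_diff_le)

lemma L2_on_scaleR: "L2_on M u ==> L2_on M (%x. c *\<^sub>R u x)"
  by (rule L2_onI[where h = "%x. c\<^sup>2 * (norm (u x))\<^sup>2"]) (auto simp: L2_on_def power_mult_distrib)

lemma L2_on_bounded_mult:
  fixes \<eta> :: "'a => real"
  assumes "L2_on M u" "\<eta> \<in> borel_measurable M" "!!x. x \<in> space M ==> \<bar>\<eta> x\<bar> <= B"
  shows "L2_on M (%x. \<eta> x *\<^sub>R u x)"
proof (rule L2_onI[where h = "%x. B\<^sup>2 * (norm (u x))\<^sup>2"])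
  fix x assume "x \<in> space M"
  then have "(\<eta> x)\<^sup>2 <= B\<^sup>2" using assms(3) by (metis abs_ge_zero power2_abs power_mono)
  then show "(norm (\<eta> x *\<^sub>R u x))\<^sup>2 <= B\<^sup>2 * (norm (u x))\<^sup>2" by (simp add: power_mult_distrib mult_right_mono)
qed (use assms in \<open>auto simp: L2_on_def\<close>)

lemma L2_on_linear:
  fixes T :: "'b::euclidean_space => 'c::euclidean_space"
  assumes "bounded_linear T" "L2_on M u"
  shows "L2_on M (%x. T (u x))"
proof -
  obtain K where K: "!!x. norm (T x) <= norm x * K" using bounded_linear.bounded[OF assms(1)] by blast
  have [measurable]: "T \<in> borel_measurable borel"
    using bounded_linear.continuous_on[OF assms(1) continuous_on_id] by (intro borel_measurable_continuous_onI) simp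
  show ?thesis
  proof (rule L2_onI[where h = "%x. K\<^sup>2 * (norm (u x))\<^sup>2"])
    fix x
    have "(norm (T (u x)))\<^sup>2 <= (norm (u x) * K)\<^sup>2" using K by (intro power_mono) auto
    then show "(norm (T (u x)))\<^sup>2 <= K\<^sup>2 * (norm (u x))\<^sup>2" by (simp add: power_mult_distrib mult.commute)
  qed (use assms(2) in \<open>auto simp: L2_on_def\<close>)
qed

lemma L2_on_component: "L2_on M u ==> L2_on M (%x. u x $ i)"
  for u :: "'a => 'b::euclidean_space^'n" by (rule L2_on_linear[OF bounded_linear_vec_nth])

lemma norm_vec_sq: "(norm (x :: 'b::real_inner^'n))\<^sup>2 = (\<Sum>i\<in>UNIV. (norm (x $ i))\<^sup>2)"
  by (simp add: power2_norm_eq_inner inner_vec_def)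

lemma L2_on_vec:
  fixes u :: "'a => 'b::euclidean_space^'n"
  assumes "!!i. L2_on M (%x. u x $ i)"
  shows "L2_on M u"
proof (rule L2_onI[where h = "%x. \<Sum>i\<in>UNIV. (norm (u x $ i))\<^sup>2"])
  have m: "(%x. u x $ i) \<in> borel_measurable M" for i using assms by (auto simp: L2_on_def)
  show "u \<in> borel_measurable M"
  proof (rule borel_measurable_euclidean_space[THEN iffD2], intro ballI)
    fix b :: "'b^'n" assume "b \<in> Basis"
    then obtain i c where "b = axis i c" by (auto simp: Basis_vec_def)
    then show "(%x. u x \<bullet> b) \<in> borel_measurable M" using m[of i] by (simp add: inner_axis)
  qed
qed (use assms in \<open>auto simp: L2_on_def norm_vec_sq\<close>)

lemma L2_on_inner:
  assumes "L2_on M u" "L2_on M v"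
  shows "integrable M (%x. u x \<bullet> v x)"
proof (rule Bochner_Integration.integrable_bound)
  show "integrable M (%x. (norm (u x))\<^sup>2 + (norm (v x))\<^sup>2)" using assms by (auto simp: L2_on_def)
  show "AE x in M. norm (u x \<bullet> v x) <= norm ((norm (u x))\<^sup>2 + (norm (v x))\<^sup>2)"
  proof (rule AE_I2)
    fix x
    have "\<bar>u x \<bullet> v x\<bar> <= norm (u x) * norm (v x)" by (rule Cauchy_Schwarz_ineq2)
    also have "... <= (norm (u x))\<^sup>2 + (norm (v x))\<^sup>2"
      using sum_squares_bound[of "norm (u x)" "norm (v x)"] mult_nonneg_nonneg[OF norm_ge_zero norm_ge_zero, of "u x" "v x"]
      by linarith
    finally show "norm (u x \<bullet> v x) <= norm ((norm (u x))\<^sup>2 + (norm (v x))\<^sup>2)" by simp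
  qed
qed (use assms in \<open>auto simp: L2_on_def\<close>)

lemma L2_on_mult:
  fixes u v :: "'a => real"
  shows "L2_on M u ==> L2_on M v ==> integrable M (%x. u x * v x)" using L2_on_inner[of M u v] by simp

lemma L2_on_integrable: "finite_measure M ==> L2_on M u ==> integrable M u"
proof -
  assume M: "finite_measure M" and u: "L2_on M u"
  interpret finite_measure M by fact
  show "integrable M u"
  proof (rule Bochner_Integration.integrable_bound[of M "%x. 1 + (norm (u x))\<^sup>2"])
    show "AE x in M. norm (u x) <= norm (1 + (norm (u x))\<^sup>2)"
    proof (rule AE_I2)
      fix x
      have "2 * norm (u x) <= 1 + (norm (u x))\<^sup>2"
        using zero_le_power2[of "norm (u x) - 1"] by (simp add: power2_eq_square algebra_simps)
      then show "norm (u x) <= norm (1 + (norm (u x))\<^sup>2)" using norm_ge_zero[of "u x"] by (simp add: add_nonneg_nonneg del: norm_ge_zero)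
    qed
  qed (use u in \<open>auto simp: L2_on_def\<close>)
qed

text \<open>The squared norm of \<open>u - t v\<close> is a nonnegative quadratic polynomial in
  \<open>t\<close>; its minimum at \<open>t = b / c\<close> gives the claim when \<open>c\<close> is
  positive.\<close>

lemma L2_Cauchy_Schwarz:
  assumes u: "L2_on M u" and v: "L2_on M v"
  shows "(LINT x|M. u x \<bullet> v x)\<^sup>2 <= (LINT x|M. (norm (u x))\<^sup>2) * (LINT x|M. (norm (v x))\<^sup>2)"
proof -
  define a b c where "a = (LINT x|M. (norm (u x))\<^sup>2)" and "b = (LINT x|M. u x \<bullet> v x)" and "c = (LINT x|M. (norm (v x))\<^sup>2)"
  have q: "0 <= a - 2 * t * b + t\<^sup>2 * c" for t
  proof -
    have "0 <= (LINT x|M. (norm (u x - t *\<^sub>R v x))\<^sup>2)" by simp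
    also have "... = (LINT x|M. (norm (u x))\<^sup>2 - 2 * t * (u x \<bullet> v x) + t\<^sup>2 * (norm (v x))\<^sup>2)"
      by (intro Bochner_Integration.integral_cong)
        (auto simp: power2_norm_eq_inner inner_diff_left inner_diff_right inner_commute algebra_simps power2_eq_square[of t])
    also have "... = a - 2 * t * b + t\<^sup>2 * c" using u v L2_on_inner[OF u v] by (simp add: a_def b_def c_def L2_on_def)
    finally show ?thesis .
  qed
  have ac: "a >= 0" "c >= 0" by (auto simp: a_def c_def)
  have "b\<^sup>2 <= a * c"
  proof (cases "c = 0")
    case True
    have "b = 0"
    proof (rule ccontr)
      assume "b ~= 0"
      \<comment> \<open>For \<open>c = 0\<close> the nonnegative expression is affine in
        \<open>t\<close>, and this \<open>t\<close> would make it equal to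
        \<open>-1\<close>.\<close>
      then show False using q[of "(a + 1) / (2 * b)"] True by simp
    qed
    then show ?thesis using ac by simp
  next
    case False
    then have c: "c > 0" using ac by simp
    have "0 <= (a - 2 * (b / c) * b + (b / c)\<^sup>2 * c) * c" using q[of "b / c"] c by simp
    also have "... = a * c - b\<^sup>2" using c by (simp add: field_simps power2_eq_square)
    finally show ?thesis by simp
  qed
  then show ?thesis by (simp add: a_def b_def c_def)
qed

subsection \<open>Lebesgue measure on an open set\<close>

lemma lebesgue_on_borel_integral:
  fixes f :: "real^'n => real"
  assumes "open \<Omega>" and [measurable]: "f \<in> borel_measurable borel" and "!!x. x \<notin> \<Omega> ==> f x = 0"
  shows "integral\<^sup>L (lebesgue_on \<Omega>) f = integral\<^sup>L lborel f"
    and "integrable (lebesgue_on \<Omega>) f \<longleftrightarrow> integrable lborel f"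
proof -
  have O: "\<Omega> \<inter> space lebesgue \<in> sets lebesgue" using assms(1) by auto
  have f: "(%x. indicator \<Omega> x *\<^sub>R f x) = f" using assms(3) by (auto simp: indicator_def fun_eq_iff)
  show "integral\<^sup>L (lebesgue_on \<Omega>) f = integral\<^sup>L lborel f"
    using integral_restrict_space[OF O, of f] unfolding f by (simp add: integral_completion)
  show "integrable (lebesgue_on \<Omega>) f \<longleftrightarrow> integrable lborel f"
    using integrable_restrict_space[OF O, of f] unfolding f by (simp add: integrable_completion)
qed

lemma nn_integral_lebesgue_on:
  fixes f :: "real^'n => ennreal"
  assumes "open \<Omega>"
  shows "(\<integral>\<^sup>+x. f x \<partial>lebesgue_on \<Omega>) = (\<integral>\<^sup>+x. f x * indicator \<Omega> x \<partial>lborel)"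
  using assms by (subst nn_integral_restrict_space) (auto simp: nn_integral_completion)

lemma finite_measure_lebesgue_on_bounded:
  fixes \<Omega> :: "(real^'n) set"
  assumes "bounded \<Omega>" "open \<Omega>"
  shows "finite_measure (lebesgue_on \<Omega>)" by (rule finite_measure_lebesgue_on) (use assms in \<open>simp add: lmeasurable_open\<close>)

lemma continuous_borel_lebesgue_on:
  fixes u :: "real^'n => 'b::euclidean_space"
  shows "continuous_on UNIV u ==> u \<in> borel_measurable (lebesgue_on \<Omega>)"
  by (rule measurable_restrict_space1, rule measurable_completion, simp add: borel_measurable_continuous_onI)

lemma continuous_bounded_on:
  fixes u :: "real^'n => 'b::euclidean_space"
  assumes "bounded \<Omega>" "continuous_on UNIV u"
  obtains B where "B >= 0" "!!x. x \<in> \<Omega> ==> norm (u x) <= B"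
proof -
  have "compact (u ` closure \<Omega>)" by (intro compact_continuous_image continuous_on_subset[OF assms(2)]) (use assms in auto)
  then obtain B where "!!x. x \<in> closure \<Omega> ==> norm (u x) <= B" using compact_imp_bounded bounded_iff by (metis image_eqI)
  then show ?thesis using that[of "max 0 B"] closure_subset by fastforce
qed

lemma L2_on_continuous:
  fixes u :: "real^'n => 'b::euclidean_space"
  assumes "bounded \<Omega>" "open \<Omega>" "continuous_on UNIV u"
  shows "L2_on (lebesgue_on \<Omega>) u"
proof -
  interpret finite_measure "lebesgue_on \<Omega>" using assms finite_measure_lebesgue_on_bounded by blast
  obtain B where B: "B >= 0" "!!x. x \<in> \<Omega> ==> norm (u x) <= B" using continuous_bounded_on assms by blast
  show ?thesis by (rule L2_onI[where h = "%x. B\<^sup>2"])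
      (use B continuous_borel_lebesgue_on assms in \<open>auto intro!: power_mono\<close>)
qed

text \<open>Convolution and Fubini take place in \<open>lborel\<close> on the whole space, while
  fields on the domain are only Lebesgue measurable there. The representative is Borel, extended by
  0, and vanishes everywhere, not just almost everywhere, outside the localizing set
  \<open>B\<close>.\<close>

lemma borel_representative:
  fixes h :: "real^'n => real"
  assumes O: "bounded \<Omega>" "open \<Omega>" and h: "L2_on (lebesgue_on \<Omega>) h" and B: "open B" "!!x. x \<in> \<Omega> ==> x \<notin> B ==> h x = 0"
  obtains h' where "integrable lborel h'" "integrable lborel (%x. (h' x)\<^sup>2)" "!!x. x \<notin> \<Omega> \<inter> B ==> h' x = 0"
    "AE x in lebesgue_on \<Omega>. h x = h' x"
    "!!\<phi>. \<phi> \<in> borel_measurable borel ==> (LINT x|lebesgue_on \<Omega>. h x * \<phi> x) = (LINT x|lborel. h' x * \<phi> x)"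
proof -
  interpret finite_measure "lebesgue_on \<Omega>" using O finite_measure_lebesgue_on_bounded by blast
  have hm: "h \<in> borel_measurable (lebesgue_on \<Omega>)" using h by (simp add: L2_on_def)
  then have "(%x. if x \<in> \<Omega> then h x else 0) \<in> borel_measurable lebesgue" using O by (subst borel_measurable_if) auto
  then obtain g where g: "g \<in> borel_measurable lborel" "AE x in lborel. (if x \<in> \<Omega> then h x else 0) = g x"
    using completion_ex_borel_measurable_real by blast
  define h' where "h' x = g x * indicator (\<Omega> \<inter> B) x" for x
  have [measurable]: "\<Omega> \<in> sets borel" "B \<in> sets borel" using O B by auto
  have h'm[measurable]: "h' \<in> borel_measurable borel" unfolding h'_def using g(1) by measurable
  have z: "h' x = 0" if "x \<notin> \<Omega> \<inter> B" for x using that by (simp add: h'_def)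
  have ae: "AE x in lebesgue_on \<Omega>. h x = h' x"
  proof -
    have "AE x in lebesgue. (if x \<in> \<Omega> then h x else 0) = g x" by (rule AE_completion[OF g(2)])
    then have "AE x in lebesgue. x \<in> \<Omega> --> h x = h' x" by eventually_elim (use B(2) in \<open>auto simp: h'_def indicator_def\<close>)
    then show ?thesis using O by (subst AE_restrict_space_iff) auto
  qed
  have h'm2: "h' \<in> borel_measurable (lebesgue_on \<Omega>)" by (rule measurable_restrict_space1, rule measurable_completion) simp
  have "integrable (lebesgue_on \<Omega>) (%x. (h' x)\<^sup>2)" by (rule integrable_cong_AE_imp[of _ "%x. (norm (h x))\<^sup>2"])
      (use h h'm2 ae in \<open>auto simp: L2_on_def elim: eventually_mono\<close>)
  then have i2: "integrable lborel (%x. (h' x)\<^sup>2)" using lebesgue_on_borel_integral(2)[OF O(2), of "%x. (h' x)\<^sup>2"] z by auto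
  have "integrable (lebesgue_on \<Omega>) h'" by (rule integrable_cong_AE_imp[of _ h])
      (use L2_on_integrable[OF finite_measure_axioms h] h'm2 ae in \<open>auto elim: eventually_mono\<close>)
  then have i1: "integrable lborel h'" using lebesgue_on_borel_integral(2)[OF O(2), of h'] z by auto
  show ?thesis
  proof (rule that[OF i1 i2 z ae])
    fix \<phi> :: "real^'n => real" assume p[measurable]: "\<phi> \<in> borel_measurable borel"
    have "\<phi> \<in> borel_measurable (lebesgue_on \<Omega>)" by (rule measurable_restrict_space1, rule measurable_completion) simp
    then have "(LINT x|lebesgue_on \<Omega>. h x * \<phi> x) = (LINT x|lebesgue_on \<Omega>. h' x * \<phi> x)"
      by (intro integral_cong_AE) (use hm h'm2 ae in \<open>auto elim: eventually_mono\<close>)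
    also have "... = (LINT x|lborel. h' x * \<phi> x)" by (rule lebesgue_on_borel_integral(1)[OF O(2)]) (auto simp: z)
    finally show "(LINT x|lebesgue_on \<Omega>. h x * \<phi> x) = (LINT x|lborel. h' x * \<phi> x)" .
  qed
qed

section \<open>Weak gradients\<close>

definition weak_grad1 :: "(real^'n) set => (real^'n => real) => (real^'n => real^'n) => bool" where
  "weak_grad1 \<Omega> w g \<longleftrightarrow> (\<forall>\<phi>. test_fun \<Omega> \<phi> --> (\<forall>j.
      (LINT x|lebesgue_on \<Omega>. w x * partial_deriv \<phi> j x) = - (LINT x|lebesgue_on \<Omega>. g x $ j * \<phi> x)))"

lemma weak_grad_iff: "weak_grad \<Omega> v G \<longleftrightarrow> (\<forall>i. weak_grad1 \<Omega> (%x. v x $ i) (%x. G x $ i))"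
  unfolding weak_grad_def weak_grad1_def by blast

text \<open>For fixed \<open>x\<close> the mollifier is a test function of \<open>y\<close> once the
  scaled support, reflected through \<open>x\<close>, lies in the domain. The definition of weak
  derivative then moves a derivative of the mollification onto the gradient; the reflection accounts
  for the sign.\<close>

lemma test_fun_mollifier:
  fixes \<Omega> :: "(real^'n) set"
  assumes rho: "smooth_fun \<rho>" "\<forall>z. z \<notin> ball c k --> \<rho> z = 0" and e: "e > 0"
    and x: "\<forall>z\<in>cball c k. x - e *\<^sub>R z \<in> \<Omega>"
  shows "test_fun \<Omega> (%y. mollifier \<rho> e (x - y))"
    and "partial_deriv (%y. mollifier \<rho> e (x - y)) j y = - partial_deriv (mollifier \<rho> e) j (x - y)"
proof -
  note sm = smooth_mollifier[OF rho(1), of e]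
  show "partial_deriv (%y. mollifier \<rho> e (x - y)) j y = - partial_deriv (mollifier \<rho> e) j (x - y)"
    using smooth_fun_affine(2)[OF sm, of x "-1" j y] by simp
  show "test_fun \<Omega> (%y. mollifier \<rho> e (x - y))" unfolding test_fun_def
  proof (intro conjI exI[of _ "(%z. x - e *\<^sub>R z) ` cball c k"] allI impI)
    show "smooth_fun (%y. mollifier \<rho> e (x - y))" using smooth_fun_affine(1)[OF sm, of x "-1"] by simp
    show "compact ((%z. x - e *\<^sub>R z) ` cball c k)" by (intro compact_continuous_image continuous_intros) auto
    show "(%z. x - e *\<^sub>R z) ` cball c k \<subseteq> \<Omega>" using x by blast
    fix y assume y: "y \<notin> (%z. x - e *\<^sub>R z) ` cball c k"
    have "y = x - e *\<^sub>R ((1/e) *\<^sub>R (x - y))" using e by simp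
    then have "(1/e) *\<^sub>R (x - y) \<notin> cball c k" using y by blast
    then show "mollifier \<rho> e (x - y) = 0" unfolding mollifier_def using rho(2) by auto
  qed
qed

text \<open>At points deeper than \<open>e n\<close> inside the domain, all mollifiers of scale
  \<open>e k\<close> with \<open>k >= n\<close> are test functions, so the mollifications of
  \<open>h'\<close> vanish there. They converge to \<open>h'\<close> in the square mean, and the
  sets \<open>K n\<close> exhaust the domain.\<close>

lemma fundamental_lemma:
  fixes h :: "real^'n => real"
  assumes O: "bounded \<Omega>" "open \<Omega>" and h: "L2_on (lebesgue_on \<Omega>) h"
    and t: "!!\<phi>. test_fun \<Omega> \<phi> ==> (LINT x|lebesgue_on \<Omega>. h x * \<phi> x) = 0"
  shows "AE x in lebesgue_on \<Omega>. h x = 0"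
proof -
  obtain h' where h': "integrable lborel h'" "integrable lborel (%x. (h' x)\<^sup>2)" "!!x. x \<notin> \<Omega> \<inter> UNIV ==> h' x = 0"
    "AE x in lebesgue_on \<Omega>. h x = h' x"
    "!!\<phi>. \<phi> \<in> borel_measurable borel ==> (LINT x|lebesgue_on \<Omega>. h x * \<phi> x) = (LINT x|lborel. h' x * \<phi> x)"
    by (rule borel_representative[OF O h open_UNIV]) auto
  obtain R where R: "!!x. x \<in> \<Omega> ==> norm x <= R" using O(1) bounded_iff by blast
  have h'R: "\<forall>y. norm y > R --> h' y = 0" using h'(3) R by (auto simp: not_le[symmetric])
  have [measurable]: "h' \<in> borel_measurable borel" using h'(1) by auto
  obtain \<rho> :: "real^'n => real" where rho: "smooth_fun \<rho>" "!!x. \<rho> x >= 0" "!!x. x \<notin> ball 0 1 ==> \<rho> x = 0"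
    "integral\<^sup>L lborel \<rho> = 1" using bump_exists[of 1 0] by (metis zero_less_one)
  have irho: "integrable lborel \<rho>" by (rule test_fun_integrable[of _ "cball 0 1"]) (use rho smooth_fun_continuous in auto)
  define e where "e k = 1 / (real k + 1)" for k :: nat
  have e: "!!k. e k > 0" "e ----> 0"
    using LIMSEQ_inverse_real_of_nat by (auto simp: e_def[abs_def] inverse_eq_divide add.commute)
  note moll = mollify_tendsto[OF h'(1,2) h'R rho(1,2) irho rho(4) e]
  define K where "K n = {x \<in> \<Omega>. infdist x (- \<Omega>) > e n}" for n
  have Km[measurable]: "K n \<in> sets borel" for n
  proof -
    have "open (\<Omega> \<inter> {x. infdist x (- \<Omega>) > e n})" by (intro open_Int O open_Collect_less continuous_intros)
    moreover have "K n = \<Omega> \<inter> {x. infdist x (- \<Omega>) > e n}" unfolding K_def by blast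
    ultimately show ?thesis by simp
  qed
  have K0: "AE x in lborel. x \<in> K n --> h' x = 0" for n
  proof -
    have "(\<integral>\<^sup>+x. ennreal ((h' x)\<^sup>2) * indicator (K n) x \<partial>lborel) <= (\<integral>\<^sup>+x. ennreal (((LINT y|lborel. h' y * mollifier \<rho> (e k) (x - y)) - h' x)\<^sup>2) \<partial>lborel)"
      if "k >= n" for k
    proof (rule nn_integral_mono)
      fix x
      show "ennreal ((h' x)\<^sup>2) * indicator (K n) x <= ennreal (((LINT y|lborel. h' y * mollifier \<rho> (e k) (x - y)) - h' x)\<^sup>2)"
      proof (cases "x \<in> K n")
        case True
        have "\<forall>z\<in>cball 0 1. x - e k *\<^sub>R z \<in> \<Omega>"
        proof (rule ballI, rule ccontr)
          fix z :: "real^'n" assume z: "z \<in> cball 0 1"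
          assume "x - e k *\<^sub>R z \<notin> \<Omega>"
          then have "infdist x (- \<Omega>) <= dist x (x - e k *\<^sub>R z)" by (intro infdist_le) auto
          also have "... <= e k" using z e(1)[of k] by (simp add: dist_norm mult_left_le)
          also have "... <= e n" using \<open>k >= n\<close> by (simp add: e_def frac_le)
          finally show False using True by (simp add: K_def)
        qed
        moreover have "\<forall>z. z \<notin> ball 0 1 --> \<rho> z = 0" using rho(3) by blast
        ultimately have tf: "test_fun \<Omega> (%y. mollifier \<rho> (e k) (x - y))"
          using test_fun_mollifier(1)[OF rho(1) _ e(1)] by blast
        have "(LINT y|lborel. h' y * mollifier \<rho> (e k) (x - y)) = 0"
          using t[OF tf] h'(5)[of "%y. mollifier \<rho> (e k) (x - y)"] tf smooth_fun_borel by (auto simp: test_fun_def)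
        then show ?thesis by (simp add: indicator_def)
      qed auto
    qed
    then have "(\<integral>\<^sup>+x. ennreal ((h' x)\<^sup>2) * indicator (K n) x \<partial>lborel) <= 0"
      by (intro LIMSEQ_le_const[OF moll] exI[of _ n]) auto
    then have "AE x in lborel. ennreal ((h' x)\<^sup>2) * indicator (K n) x = 0" by (subst nn_integral_0_iff_AE[symmetric]) auto
    then show ?thesis by eventually_elim (auto simp: indicator_def ennreal_eq_0_iff)
  qed
  have "AE x in lborel. \<forall>n. x \<in> K n --> h' x = 0" unfolding AE_all_countable using K0 by blast
  then have "AE x in lborel. x \<in> \<Omega> --> h' x = 0"
  proof eventually_elim
    case (elim x)
    show ?case
    proof
      assume x: "x \<in> \<Omega>"
      \<comment> \<open>\<open>infdist\<close> to the empty set is 0 by convention, so positivity of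
        the distance requires a nonempty complement.\<close>
      have "- \<Omega> ~= {}" using O(1) not_bounded_UNIV Compl_empty_eq by (metis Compl_eq_Diff_UNIV Diff_eq_empty_iff top.extremum_uniqueI)
      then have "infdist x (- \<Omega>) > 0"
        using x O(2) in_closed_iff_infdist_zero[of "- \<Omega>" x] infdist_nonneg[of x "- \<Omega>"] by (auto simp: closed_Compl less_le)
      then obtain n where "e n < infdist x (- \<Omega>)" using order_tendstoD(2)[OF e(2)] unfolding eventually_sequentially by blast
      then show "h' x = 0" using elim x by (auto simp: K_def)
    qed
  qed
  then have "AE x in lebesgue. x \<in> \<Omega> --> h' x = 0" by (rule AE_completion)
  then have "AE x in lebesgue_on \<Omega>. h' x = 0" using O by (subst AE_restrict_space_iff) auto
  with h'(4) show ?thesis by eventually_elim simp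
qed

lemma test_fun_L2:
  assumes "test_fun \<Omega> \<phi>" "bounded \<Omega>" "open \<Omega>"
  shows "L2_on (lebesgue_on \<Omega>) \<phi>" "L2_on (lebesgue_on \<Omega>) (partial_deriv \<phi> j)"
proof -
  have "smooth_fun \<phi>" using assms(1) by (simp add: test_fun_def)
  then show "L2_on (lebesgue_on \<Omega>) \<phi>" "L2_on (lebesgue_on \<Omega>) (partial_deriv \<phi> j)"
    using assms(2,3) L2_on_continuous smooth_fun_continuous smooth_fun_has_derivative(2) by blast+
qed

lemma weak_grad1_unique:
  assumes O: "bounded \<Omega>" "open \<Omega>" and g: "L2_on (lebesgue_on \<Omega>) g" "L2_on (lebesgue_on \<Omega>) g'"
    "weak_grad1 \<Omega> w g" "weak_grad1 \<Omega> w g'"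
  shows "AE x in lebesgue_on \<Omega>. g x = g' x"
proof -
  have "AE x in lebesgue_on \<Omega>. g x $ j - g' x $ j = 0" for j
  proof (rule fundamental_lemma[OF O])
    note c = L2_on_component[OF g(1), of j] L2_on_component[OF g(2), of j]
    show "L2_on (lebesgue_on \<Omega>) (%x. g x $ j - g' x $ j)" by (rule L2_on_diff[OF c])
    fix \<phi> assume t: "test_fun \<Omega> \<phi>"
    have "(LINT x|lebesgue_on \<Omega>. g x $ j * \<phi> x) = (LINT x|lebesgue_on \<Omega>. g' x $ j * \<phi> x)"
      using g(3,4) t unfolding weak_grad1_def by simp
    then show "(LINT x|lebesgue_on \<Omega>. (g x $ j - g' x $ j) * \<phi> x) = 0"
      using L2_on_mult[OF c(1) test_fun_L2(1)[OF t O]] L2_on_mult[OF c(2) test_fun_L2(1)[OF t O]]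
      by (simp add: left_diff_distrib)
  qed
  then have "AE x in lebesgue_on \<Omega>. \<forall>j. g x $ j - g' x $ j = 0" by (simp add: AE_all_countable)
  then show ?thesis by eventually_elim (simp add: vec_eq_iff)
qed

lemma integral_partial_deriv_eq_0:
  fixes F :: "real^'n => real"
  assumes F: "smooth_fun F" "compact K" "!!x. x \<notin> K ==> F x = 0"
  shows "(LINT x|lborel. partial_deriv F j x) = 0" "integrable lborel (partial_deriv F j)"
proof -
  obtain R where R: "R > 0" "!!x. x \<in> K ==> norm x <= R" using compact_imp_bounded[OF F(2)] bounded_pos by blast
  have pdz: "partial_deriv F j x = 0" if "x \<notin> K" for x
    by (rule partial_deriv_eq_0[of "- K"]) (use that F compact_imp_closed in auto)
  note pc = smooth_fun_continuous[OF smooth_fun_has_derivative(2)[OF F(1)]]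
  show ip: "integrable lborel (partial_deriv F j)" by (rule test_fun_integrable[OF pc F(2) pdz])
  \<comment> \<open>Convolving with the indicator of a large ball gives a function that is constant near the origin.\<close>
  define w where "w = (indicator (ball 0 (R + 2)) :: real^'n => real)"
  have iw: "integrable lborel w" unfolding w_def using emeasure_lborel_ball_finite by (auto simp: integrable_indicator_iff)
  have w0: "\<forall>y. norm y > R + 2 --> w y = 0" by (auto simp: w_def)
  have wy: "w y * G (x - y) = G (x - y)" if "norm x < 1" "!!x. x \<notin> K ==> G x = 0" for x y and G :: "real^'n => real"
  proof (cases "x - y \<in> K")
    case True
    then have "norm y < R + 2" using R(2)[OF True] that(1) norm_triangle_ineq4[of x "x - y"] by simp
    then show ?thesis by (simp add: w_def)
  qed (use that in auto)
  have c: "(LINT y|lborel. w y * F (x - y)) = integral\<^sup>L lborel F" if "norm x < 1" for x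
  proof -
    have "(LINT y|lborel. w y * F (x - y)) = (LINT y|lborel. F (x - y))"
      using wy[OF that, of F] F(3) by (intro Bochner_Integration.integral_cong) auto
    then show ?thesis using lborel_affine_integral(1)[OF smooth_fun_borel[OF F(1)], of "-1" x] by simp
  qed
  have "partial_deriv (%x. \<integral>y. w y * F (x - y) \<partial>lborel) j 0 = 0" by (rule partial_deriv_eq_0[of "ball 0 1"]) (use c in auto)
  moreover have "partial_deriv (%x. \<integral>y. w y * F (x - y) \<partial>lborel) j 0 = (LINT y|lborel. partial_deriv F j (0 - y))"
    by (subst smooth_fun_convolution(2)[OF iw w0 F(1)]) (use wy[of 0 "partial_deriv F j"] pdz in \<open>auto intro!: Bochner_Integration.integral_cong\<close>)
  ultimately show "(LINT x|lborel. partial_deriv F j x) = 0"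
    using lborel_affine_integral(1)[of "partial_deriv F j" "-1" 0] ip by simp
qed

lemma weak_grad1_smooth:
  fixes u :: "real^'n => real"
  assumes O: "bounded \<Omega>" "open \<Omega>" and u: "smooth_fun u"
  shows "weak_grad1 \<Omega> u (%x. \<chi> j. partial_deriv u j x)" unfolding weak_grad1_def
proof (intro allI impI)
  fix \<phi> j assume t: "test_fun \<Omega> \<phi>"
  then obtain K where K: "smooth_fun \<phi>" "compact K" "K \<subseteq> \<Omega>" "!!x. x \<notin> K ==> \<phi> x = 0" unfolding test_fun_def by blast
  have pz: "partial_deriv \<phi> j x = 0" if "x \<notin> K" for x
    by (rule partial_deriv_eq_0[of "- K"]) (use that K compact_imp_closed in auto)
  note sm = u K(1) smooth_fun_has_derivative(2)[OF u, of j] smooth_fun_has_derivative(2)[OF K(1), of j]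
  note c = sm[THEN smooth_fun_continuous] and b = sm[THEN smooth_fun_borel]
  have i: "integrable lborel (%x. u x * partial_deriv \<phi> j x)" "integrable lborel (%x. partial_deriv u j x * \<phi> x)"
    by (rule test_fun_integrable[OF _ K(2)]; auto intro!: continuous_intros c simp: pz K)+
  have "0 = (LINT x|lborel. partial_deriv (%x. u x * \<phi> x) j x)"
    by (rule integral_partial_deriv_eq_0(1)[OF _ K(2), symmetric]) (use K u in auto)
  also have "... = (LINT x|lborel. u x * partial_deriv \<phi> j x) + (LINT x|lborel. partial_deriv u j x * \<phi> x)"
    using i by (simp add: partial_deriv_rules(3)[OF u K(1)])
  finally have "(LINT x|lborel. u x * partial_deriv \<phi> j x) = - (LINT x|lborel. partial_deriv u j x * \<phi> x)" by simp
  moreover have "(LINT x|lebesgue_on \<Omega>. u x * partial_deriv \<phi> j x) = (LINT x|lborel. u x * partial_deriv \<phi> j x)"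
    by (rule lebesgue_on_borel_integral(1)[OF O(2)]) (use b pz K in auto)
  moreover have "(LINT x|lebesgue_on \<Omega>. partial_deriv u j x * \<phi> x) = (LINT x|lborel. partial_deriv u j x * \<phi> x)"
    by (rule lebesgue_on_borel_integral(1)[OF O(2)]) (use b K in auto)
  ultimately show "(LINT x|lebesgue_on \<Omega>. u x * partial_deriv \<phi> j x) = - (LINT x|lebesgue_on \<Omega>. (\<chi> j. partial_deriv u j x) $ j * \<phi> x)"
    by simp
qed

text \<open>The Leibniz rule follows by testing the weak gradient of \<open>w\<close> with
  \<open>\<eta> * \<phi>\<close>, which is again a test function with support in the same compact
  set.\<close>

lemma weak_grad1_mult:
  fixes w \<eta> :: "real^'n => real"
  assumes O: "bounded \<Omega>" "open \<Omega>" and w: "L2_on (lebesgue_on \<Omega>) w" "L2_on (lebesgue_on \<Omega>) g" "weak_grad1 \<Omega> w g"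
    and e: "smooth_fun \<eta>"
  shows "weak_grad1 \<Omega> (%x. \<eta> x * w x) (%x. \<eta> x *\<^sub>R g x + w x *\<^sub>R (\<chi> j. partial_deriv \<eta> j x))"
    and "L2_on (lebesgue_on \<Omega>) (%x. \<eta> x * w x)"
    and "L2_on (lebesgue_on \<Omega>) (%x. \<eta> x *\<^sub>R g x + w x *\<^sub>R (\<chi> j. partial_deriv \<eta> j x))"
proof -
  note sp = smooth_fun_has_derivative(2)[OF e]
  have m: "L2_on (lebesgue_on \<Omega>) (%x. \<psi> x *\<^sub>R u x)" if "smooth_fun \<psi>" "L2_on (lebesgue_on \<Omega>) u"
    for \<psi> :: "real^'n => real" and u :: "real^'n => 'b::euclidean_space"
  proof -
    obtain B where "B >= 0" "!!x. x \<in> \<Omega> ==> norm (\<psi> x) <= B"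
      by (rule continuous_bounded_on[OF O(1) smooth_fun_continuous[OF \<open>smooth_fun \<psi>\<close>]]) blast
    then show ?thesis
      by (intro L2_on_bounded_mult[where B = B] that continuous_borel_lebesgue_on[OF smooth_fun_continuous]) auto
  qed
  show "L2_on (lebesgue_on \<Omega>) (%x. \<eta> x * w x)" using m[OF e w(1)] by simp
  have "L2_on (lebesgue_on \<Omega>) (%x. w x *\<^sub>R (\<chi> j. partial_deriv \<eta> j x))"
    by (rule L2_on_vec) (use m[OF sp w(1)] in \<open>simp add: mult.commute\<close>)
  then show "L2_on (lebesgue_on \<Omega>) (%x. \<eta> x *\<^sub>R g x + w x *\<^sub>R (\<chi> j. partial_deriv \<eta> j x))" by (intro L2_on_add m[OF e w(2)])
  show "weak_grad1 \<Omega> (%x. \<eta> x * w x) (%x. \<eta> x *\<^sub>R g x + w x *\<^sub>R (\<chi> j. partial_deriv \<eta> j x))" unfolding weak_grad1_def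
  proof (intro allI impI)
    fix \<phi> j assume t: "test_fun \<Omega> \<phi>"
    then have t2: "test_fun \<Omega> (%x. \<eta> x * \<phi> x)" using smooth_fun_mult[OF e] unfolding test_fun_def by (metis mult_zero_right)
    have sm: "smooth_fun \<phi>" using t by (simp add: test_fun_def)
    have "(LINT x|lebesgue_on \<Omega>. w x * (\<eta> x * partial_deriv \<phi> j x + partial_deriv \<eta> j x * \<phi> x)) = - (LINT x|lebesgue_on \<Omega>. g x $ j * (\<eta> x * \<phi> x))"
      using w(3)[unfolded weak_grad1_def, rule_format, OF t2, of j] by (simp add: partial_deriv_rules(3)[OF e sm])
    moreover have i: "integrable (lebesgue_on \<Omega>) (%x. \<eta> x * w x * partial_deriv \<phi> j x)"
      "integrable (lebesgue_on \<Omega>) (%x. w x * partial_deriv \<eta> j x * \<phi> x)"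
      "integrable (lebesgue_on \<Omega>) (%x. \<eta> x * g x $ j * \<phi> x)" using L2_on_mult[OF m[OF e w(1)] test_fun_L2(2)[OF t O]]
        L2_on_mult[OF m[OF sp w(1)] test_fun_L2(1)[OF t O]]
        L2_on_mult[OF m[OF e L2_on_component[OF w(2)]] test_fun_L2(1)[OF t O]]
      by (simp_all add: mult.commute mult.left_commute)
    moreover have "(LINT x|lebesgue_on \<Omega>. w x * (\<eta> x * partial_deriv \<phi> j x + partial_deriv \<eta> j x * \<phi> x))
       = (LINT x|lebesgue_on \<Omega>. \<eta> x * w x * partial_deriv \<phi> j x + w x * partial_deriv \<eta> j x * \<phi> x)"
      by (intro Bochner_Integration.integral_cong) (auto simp: algebra_simps)
    moreover have "(LINT x|lebesgue_on \<Omega>. (\<eta> x *\<^sub>R g x + w x *\<^sub>R (\<chi> j. partial_deriv \<eta> j x)) $ j * \<phi> x)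
       = (LINT x|lebesgue_on \<Omega>. \<eta> x * g x $ j * \<phi> x + w x * partial_deriv \<eta> j x * \<phi> x)"
      by (intro Bochner_Integration.integral_cong) (auto simp: algebra_simps)
    moreover have "(LINT x|lebesgue_on \<Omega>. g x $ j * (\<eta> x * \<phi> x)) = (LINT x|lebesgue_on \<Omega>. \<eta> x * g x $ j * \<phi> x)"
      by (intro Bochner_Integration.integral_cong) (auto simp: algebra_simps)
    ultimately show "(LINT x|lebesgue_on \<Omega>. \<eta> x * w x * partial_deriv \<phi> j x)
        = - (LINT x|lebesgue_on \<Omega>. (\<eta> x *\<^sub>R g x + w x *\<^sub>R (\<chi> j. partial_deriv \<eta> j x)) $ j * \<phi> x)" by simp
  qed
qed

lemma weak_grad1_add:
  assumes O: "bounded \<Omega>" "open \<Omega>" and w: "L2_on (lebesgue_on \<Omega>) w" "L2_on (lebesgue_on \<Omega>) g" "weak_grad1 \<Omega> w g"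
    and w': "L2_on (lebesgue_on \<Omega>) w'" "L2_on (lebesgue_on \<Omega>) g'" "weak_grad1 \<Omega> w' g'"
  shows "weak_grad1 \<Omega> (%x. w x + c * w' x) (%x. g x + c *\<^sub>R g' x)" unfolding weak_grad1_def
proof (intro allI impI)
  fix \<phi> j assume t: "test_fun \<Omega> \<phi>"
  note t2 = test_fun_L2[OF t O]
  note i = L2_on_mult[OF w(1) t2(2), of j] L2_on_mult[OF w'(1) t2(2), of j]
    L2_on_mult[OF L2_on_component[OF w(2)] t2(1), of j] L2_on_mult[OF L2_on_component[OF w'(2)] t2(1), of j]
  have "(LINT x|lebesgue_on \<Omega>. w x * partial_deriv \<phi> j x) = - (LINT x|lebesgue_on \<Omega>. g x $ j * \<phi> x)"
    "(LINT x|lebesgue_on \<Omega>. w' x * partial_deriv \<phi> j x) = - (LINT x|lebesgue_on \<Omega>. g' x $ j * \<phi> x)"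
    using w(3) w'(3) t unfolding weak_grad1_def by auto
  then show "(LINT x|lebesgue_on \<Omega>. (w x + c * w' x) * partial_deriv \<phi> j x) = - (LINT x|lebesgue_on \<Omega>. (g x + c *\<^sub>R g' x) $ j * \<phi> x)"
    using i by (simp add: distrib_right mult.assoc)
qed

section \<open>Density of smooth functions\<close>

text \<open>The uniform interior cone property near \<open>p\<close>; the cone is generated by the
  ball \<open>cball c k\<close> of directions and truncated at scale \<open>e0\<close>.\<close>

definition cone_at :: "(real^'n) set => real^'n => real => real => real^'n => real => bool" where
  "cone_at \<Omega> p r e0 c k \<longleftrightarrow> r > 0 & e0 > 0 & k > 0 &
    (\<forall>x\<in>\<Omega> \<inter> ball p r. \<forall>z\<in>cball c k. \<forall>e. 0 < e & e <= e0 --> x + e *\<^sub>R z \<in> \<Omega>)"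

lemma cone_at_exists:
  fixes \<Omega> :: "(real^'n) set"
  assumes O: "open \<Omega>" "lipschitz_boundary \<Omega>" and p: "p \<in> closure \<Omega>"
  shows "\<exists>r e0 c k. cone_at \<Omega> p r e0 c k"
proof (cases "p \<in> \<Omega>")
  case True
  then obtain s where s: "s > 0" "ball p s \<subseteq> \<Omega>" using O(1) open_contains_ball by blast
  have "x + e *\<^sub>R z \<in> \<Omega>" if "x \<in> ball p (s/2)" "norm z <= 1" "0 < e" "e <= s/2" for x z e
  proof -
    have "norm (e *\<^sub>R z) <= s/2" using that mult_mono[of e "s/2" "norm z" 1] by simp
    moreover have "norm (p - x) < s/2" using that(1) by (simp add: dist_norm)
    ultimately have "norm (p - (x + e *\<^sub>R z)) < s"
      using norm_triangle_ineq4[of "p - x" "e *\<^sub>R z"] by (simp add: diff_diff_add)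
    then show ?thesis using s(2) by (auto simp: dist_norm)
  qed
  then have "cone_at \<Omega> p (s/2) (s/2) 0 1" unfolding cone_at_def using s(1) by auto
  then show ?thesis by blast
next
  case False
  then have "p \<in> frontier \<Omega>" using p O(1) by (simp add: frontier_def interior_open)
  then obtain e r \<phi> L where c: "norm e = 1" "r > 0" "L-lipschitz_on UNIV \<phi>"
    "!!y t. \<phi> (y + t *\<^sub>R e) = \<phi> y" "\<Omega> \<inter> ball p r = {y \<in> ball p r. y \<bullet> e < \<phi> y}"
    using bspec[OF O(2)[unfolded lipschitz_boundary_def]] by blast
  have L: "L >= 0" using c(3) by (simp add: lipschitz_on_def)
  \<comment> \<open>Chosen so that \<open>(L + 1) * k < 1\<close>, that is, the descent beats the
    drop of the graph.\<close>
  define k where "k = 1 / (L + 2)"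
  have k: "k > 0" "k <= 1" "L * k < 1 - k" using L by (auto simp: k_def field_simps)
  have "x + s *\<^sub>R z \<in> \<Omega>" if x: "x \<in> \<Omega> \<inter> ball p (r/2)" and z: "z \<in> cball (- e) k" and s: "0 < s" "s <= r/4" for x z s
  proof -
    define w where "w = z + e"
    have w: "norm w <= k" using z by (simp add: w_def dist_norm norm_minus_commute)
    have zw: "z = w - e" by (simp add: w_def)
    have "norm z <= 2" using norm_triangle_ineq4[of w e] w k c(1) zw by simp
    then have "norm (s *\<^sub>R z) <= r/2" using s mult_mono[of s "r/4" "norm z" 2] by simp
    moreover have "norm (p - x) < r/2" using x by (simp add: dist_norm)
    ultimately have b: "x + s *\<^sub>R z \<in> ball p r"
      using norm_triangle_ineq4[of "p - x" "s *\<^sub>R z"] by (simp add: diff_diff_add dist_norm)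
    have "x \<in> ball p r" using x c(2) by auto
    then have "x \<bullet> e < \<phi> x" using x c(5) by blast
    have "\<phi> (x + s *\<^sub>R z) = \<phi> (x + s *\<^sub>R w + (- s) *\<^sub>R e)" by (simp add: zw algebra_simps)
    also have "... = \<phi> (x + s *\<^sub>R w)" by (rule c(4))
    finally have "\<bar>\<phi> (x + s *\<^sub>R z) - \<phi> x\<bar> <= L * norm (s *\<^sub>R w)"
      using lipschitz_onD[OF c(3), of "x + s *\<^sub>R w" x] by (simp add: dist_norm)
    also have "... <= L * (s * k)" using L w s by (intro mult_left_mono) auto
    finally have 1: "\<phi> (x + s *\<^sub>R z) >= \<phi> x - s * (L * k)" by (simp add: algebra_simps abs_le_iff)
    have "w \<bullet> e <= k" using norm_cauchy_schwarz[of w e] w c(1) by simp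
    then have "s * (w \<bullet> e) <= s * k" using s by simp
    then have "(x + s *\<^sub>R z) \<bullet> e <= x \<bullet> e - s * (1 - k)"
      using c(1) by (simp add: zw inner_add_left inner_diff_left algebra_simps norm_eq_1)
    moreover have "s * (L * k) < s * (1 - k)" using k(3) s by simp
    ultimately have "(x + s *\<^sub>R z) \<bullet> e < \<phi> (x + s *\<^sub>R z)" using 1 \<open>x \<bullet> e < \<phi> x\<close> by linarith
    then show ?thesis using b c(5) by blast
  qed
  then have "cone_at \<Omega> p (r/2) (r/4) (- e) k" unfolding cone_at_def using c(2) k(1) by auto
  then show ?thesis by blast
qed

text \<open>Nonnegative integrals make the notion meaningful with no integrability assumption and
  let convergence statements be added and restricted freely.\<close>

definition h1_approx :: "(real^'n) set => (real^'n => real) => (real^'n => real^'n) => bool" where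
  "h1_approx \<Omega> w g \<longleftrightarrow> (\<exists>u :: nat => real^'n => real. (\<forall>k. smooth_fun (u k)) &
     (%k. \<integral>\<^sup>+x. ennreal ((u k x - w x)\<^sup>2) \<partial>lebesgue_on \<Omega>) ----> 0 &
     (\<forall>j. (%k. \<integral>\<^sup>+x. ennreal ((partial_deriv (u k) j x - g x $ j)\<^sup>2) \<partial>lebesgue_on \<Omega>) ----> 0))"

lemma h1_approx_cong:
  assumes "h1_approx \<Omega> w g" "!!x. x \<in> \<Omega> ==> w x = w' x" "!!x. x \<in> \<Omega> ==> g x = g' x"
  shows "h1_approx \<Omega> w' g'"
proof -
  have "(\<integral>\<^sup>+x. ennreal ((u x - w x)\<^sup>2) \<partial>lebesgue_on \<Omega>) = (\<integral>\<^sup>+x. ennreal ((u x - w' x)\<^sup>2) \<partial>lebesgue_on \<Omega>)" for u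
    by (rule nn_integral_cong) (use assms in auto)
  moreover have "(\<integral>\<^sup>+x. ennreal ((u x - g x $ j)\<^sup>2) \<partial>lebesgue_on \<Omega>) = (\<integral>\<^sup>+x. ennreal ((u x - g' x $ j)\<^sup>2) \<partial>lebesgue_on \<Omega>)" for u j
    by (rule nn_integral_cong) (use assms in auto)
  ultimately show ?thesis using assms(1) unfolding h1_approx_def by simp
qed

lemma nn_sq_tendsto_add:
  fixes a b :: "nat => 'a => real"
  assumes "(%k. \<integral>\<^sup>+x. ennreal ((a k x)\<^sup>2) \<partial>M) ----> 0" "(%k. \<integral>\<^sup>+x. ennreal ((b k x)\<^sup>2) \<partial>M) ----> 0"
    and m: "!!k. a k \<in> borel_measurable M" "!!k. b k \<in> borel_measurable M"
  shows "(%k. \<integral>\<^sup>+x. ennreal ((a k x + b k x)\<^sup>2) \<partial>M) ----> 0"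
proof (rule tendsto_sandwich[OF _ _ tendsto_const])
  let ?A = "%k. \<integral>\<^sup>+x. ennreal ((a k x)\<^sup>2) \<partial>M" and ?B = "%k. \<integral>\<^sup>+x. ennreal ((b k x)\<^sup>2) \<partial>M"
  have "(%k. 2 * ?A k + 2 * ?B k) ----> 2 * 0 + 2 * 0" by (intro tendsto_add ennreal_tendsto_cmult assms) auto
  then show "(%k. 2 * ?A k + 2 * ?B k) ----> 0" by simp
  have "(\<integral>\<^sup>+x. ennreal ((a k x + b k x)\<^sup>2) \<partial>M) <= 2 * ?A k + 2 * ?B k" for k
  proof -
    have "ennreal ((a k x + b k x)\<^sup>2) <= 2 * ennreal ((a k x)\<^sup>2) + 2 * ennreal ((b k x)\<^sup>2)" for x
    proof -
      have "ennreal ((a k x + b k x)\<^sup>2) <= ennreal (2 * (a k x)\<^sup>2 + 2 * (b k x)\<^sup>2)" by (intro ennreal_leI sq_add_le)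
      then show ?thesis by (simp add: ennreal_plus ennreal_mult)
    qed
    then have "(\<integral>\<^sup>+x. ennreal ((a k x + b k x)\<^sup>2) \<partial>M) <= (\<integral>\<^sup>+x. 2 * ennreal ((a k x)\<^sup>2) + 2 * ennreal ((b k x)\<^sup>2) \<partial>M)"
      by (rule nn_integral_mono)
    also have "... = 2 * ?A k + 2 * ?B k" using m by (subst nn_integral_add) (auto simp: nn_integral_cmult)
    finally show ?thesis .
  qed
  then show "\<forall>\<^sub>F k in sequentially. (\<integral>\<^sup>+x. ennreal ((a k x + b k x)\<^sup>2) \<partial>M) <= 2 * ?A k + 2 * ?B k" by simp
qed simp

lemma h1_approx_add:
  assumes w: "h1_approx \<Omega> w g" "h1_approx \<Omega> w' g'"
    and m: "w \<in> borel_measurable (lebesgue_on \<Omega>)" "w' \<in> borel_measurable (lebesgue_on \<Omega>)"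
      "g \<in> borel_measurable (lebesgue_on \<Omega>)" "g' \<in> borel_measurable (lebesgue_on \<Omega>)"
  shows "h1_approx \<Omega> (%x. w x + w' x) (%x. g x + g' x)"
proof -
  let ?M = "lebesgue_on \<Omega>"
  obtain u where u: "!!k. smooth_fun (u k)" "(%k. \<integral>\<^sup>+x. ennreal ((u k x - w x)\<^sup>2) \<partial>?M) ----> 0"
    "!!j. (%k. \<integral>\<^sup>+x. ennreal ((partial_deriv (u k) j x - g x $ j)\<^sup>2) \<partial>?M) ----> 0"
    using w(1) unfolding h1_approx_def by blast
  obtain u' where u': "!!k. smooth_fun (u' k)" "(%k. \<integral>\<^sup>+x. ennreal ((u' k x - w' x)\<^sup>2) \<partial>?M) ----> 0"
    "!!j. (%k. \<integral>\<^sup>+x. ennreal ((partial_deriv (u' k) j x - g' x $ j)\<^sup>2) \<partial>?M) ----> 0"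
    using w(2) unfolding h1_approx_def by blast
  note cm = continuous_borel_lebesgue_on[OF smooth_fun_continuous]
  have gm: "(%x. g x $ j) \<in> borel_measurable ?M" "(%x. g' x $ j) \<in> borel_measurable ?M" for j
    using m(3,4)[THEN measurable_compose, OF borel_measurable_continuous_onI[OF linear_continuous_on[OF bounded_linear_vec_nth]]] by auto
  have um: "(%x. u k x - w x) \<in> borel_measurable ?M" "(%x. u' k x - w' x) \<in> borel_measurable ?M"
    "(%x. partial_deriv (u k) j x - g x $ j) \<in> borel_measurable ?M"
    "(%x. partial_deriv (u' k) j x - g' x $ j) \<in> borel_measurable ?M" for k j
    using m gm cm[OF u(1)] cm[OF u'(1)] cm[OF smooth_fun_has_derivative(2)[OF u(1)]] cm[OF smooth_fun_has_derivative(2)[OF u'(1)]]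
    by (auto intro!: borel_measurable_diff)
  show ?thesis unfolding h1_approx_def
  proof (intro exI[of _ "%k x. u k x + u' k x"] conjI allI)
    show "smooth_fun (%x. u k x + u' k x)" for k by (rule smooth_fun_add[OF u(1) u'(1)])
    show "(%k. \<integral>\<^sup>+x. ennreal ((u k x + u' k x - (w x + w' x))\<^sup>2) \<partial>?M) ----> 0"
      using nn_sq_tendsto_add[OF u(2) u'(2) um(1,2)] by (simp add: algebra_simps)
    show "(%k. \<integral>\<^sup>+x. ennreal ((partial_deriv (%x. u k x + u' k x) j x - (g x + g' x) $ j)\<^sup>2) \<partial>?M) ----> 0" for j
      unfolding partial_deriv_rules(1)[OF u(1) u'(1)]
      using nn_sq_tendsto_add[OF u(3)[of j] u'(3)[of j] um(3,4)] by (simp add: algebra_simps)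
  qed
qed

text \<open>The mollifier is supported in the directions of the cone, so that the mollified function only
  samples points of the domain.\<close>
lemma cone_approx:
  fixes \<Omega> :: "(real^'n) set"
  assumes O: "bounded \<Omega>" "open \<Omega>" and w: "L2_on (lebesgue_on \<Omega>) w" "L2_on (lebesgue_on \<Omega>) g" "weak_grad1 \<Omega> w g"
    and cone: "cone_at \<Omega> p r e0 c \<kappa>"
    and z: "r' < r" "!!x. x \<in> \<Omega> ==> x \<notin> ball p r' ==> w x = 0" "!!x. x \<in> \<Omega> ==> x \<notin> ball p r' ==> g x = 0"
  shows "h1_approx \<Omega> w g"
proof -
  let ?M = "lebesgue_on \<Omega>"
  have k: "\<kappa> > 0" "e0 > 0" using cone by (auto simp: cone_at_def)
  obtain w' where w': "integrable lborel w'" "integrable lborel (%x. (w' x)\<^sup>2)" "!!x. x \<notin> \<Omega> \<inter> ball p r' ==> w' x = 0"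
    "AE x in ?M. w x = w' x"
    "!!\<phi>. \<phi> \<in> borel_measurable borel ==> (LINT x|?M. w x * \<phi> x) = (LINT x|lborel. w' x * \<phi> x)"
    by (rule borel_representative[OF O w(1) open_ball, of p r']) (use z in auto)
  have "\<exists>h. integrable lborel h & integrable lborel (%x. (h x)\<^sup>2) & (\<forall>x. x \<notin> \<Omega> \<inter> ball p r' --> h x = 0) &
    (AE x in ?M. g x $ j = h x) &
    (\<forall>\<phi>. \<phi> \<in> borel_measurable borel --> (LINT x|?M. g x $ j * \<phi> x) = (LINT x|lborel. h x * \<phi> x))" for j
    by (rule borel_representative[OF O L2_on_component[OF w(2)] open_ball, of p r' j]) (use z in \<open>simp, blast\<close>)
  then have "\<forall>j. \<exists>h. integrable lborel h & integrable lborel (%x. (h x)\<^sup>2) & (\<forall>x. x \<notin> \<Omega> \<inter> ball p r' --> h x = 0) &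
    (AE x in ?M. g x $ j = h x) &
    (\<forall>\<phi>. \<phi> \<in> borel_measurable borel --> (LINT x|?M. g x $ j * \<phi> x) = (LINT x|lborel. h x * \<phi> x))" by blast
  from choice[OF this] obtain g' where g': "!!j. integrable lborel (g' j)" "!!j. integrable lborel (%x. (g' j x)\<^sup>2)" "!!j x. x \<notin> \<Omega> \<inter> ball p r' ==> g' j x = 0"
    "!!j. AE x in ?M. g x $ j = g' j x"
    "!!j \<phi>. \<phi> \<in> borel_measurable borel ==> (LINT x|?M. g x $ j * \<phi> x) = (LINT x|lborel. g' j x * \<phi> x)" by blast
  obtain R where R: "!!x. x \<in> \<Omega> ==> norm x <= R" using O(1) bounded_iff by blast
  have w'R: "\<forall>y. norm y > R --> w' y = 0" using w'(3) R by (auto simp: not_le[symmetric])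
  have g'R: "\<forall>y. norm y > R --> g' j y = 0" for j using g'(3) R by (auto simp: not_le[symmetric])
  \<comment> \<open>Centred at \<open>- c\<close>: mollification evaluates at
    \<open>x - e *\<^sub>R z\<close>, so \<open>- z\<close> has to range over the directions of the
    cone.\<close>
  obtain \<rho> :: "real^'n => real" where rho: "smooth_fun \<rho>" "!!x. \<rho> x >= 0" "!!x. x \<notin> ball (- c) \<kappa> ==> \<rho> x = 0"
    "integral\<^sup>L lborel \<rho> = 1" using bump_exists[OF k(1), of "- c"] by blast
  have rho3: "\<forall>z. z \<notin> ball (- c) \<kappa> --> \<rho> z = 0" using rho(3) by blast
  have irho: "integrable lborel \<rho>"
    by (rule test_fun_integrable[of _ "cball (- c) \<kappa>"]) (use rho smooth_fun_continuous in auto)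
  define B where "B = norm c + \<kappa> + 1"
  have B: "B > 0" "!!z. z \<in> cball (- c) \<kappa> ==> norm z < B"
  proof -
    show "B > 0" using k by (simp add: B_def add_pos_nonneg add_nonneg_pos)
    show "norm z < B" if "z \<in> cball (- c) \<kappa>" for z
      using that norm_triangle_ineq4[of "- c" "- c - z"] by (simp add: B_def dist_norm)
  qed
  define e1 where "e1 = min e0 ((r - r') / B)"
  have e1: "e1 > 0" "e1 <= e0" "e1 * B <= r - r'" using k B z(1) by (auto simp: e1_def min_def field_simps)
  define e where "e i = e1 / (real i + 1)" for i :: nat
  have e: "!!i. e i > 0" "e ----> 0" "!!i. e i <= e1"
  proof -
    show "e i > 0" "e i <= e1" for i using e1 by (auto simp: e_def field_simps)
    have "(%i. e1 * inverse (real (Suc i))) ----> e1 * 0" by (intro tendsto_intros LIMSEQ_inverse_real_of_nat)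
    then show "e ----> 0" by (simp add: e_def[abs_def] inverse_eq_divide add.commute)
  qed
  have far: "x - y \<notin> (%z. e i *\<^sub>R z) ` cball (- c) \<kappa>" if "x \<notin> ball p r" "y \<in> ball p r'" for x y i
  proof
    assume "x - y \<in> (%z. e i *\<^sub>R z) ` cball (- c) \<kappa>"
    then obtain z where z: "z \<in> cball (- c) \<kappa>" "x - y = e i *\<^sub>R z" by blast
    have "norm (x - y) = e i * norm z" using z e(1)[of i] by simp
    also have "... <= e1 * B" using B(2)[OF z(1)] e(1,3)[of i] e1 by (intro mult_mono) auto
    finally have "norm (x - y) <= r - r'" using e1 by simp
    then show False using that dist_triangle[of p x y] by (simp add: dist_norm norm_minus_commute)
  qed
  have mz: "mollifier \<rho> (e i) z = 0" "partial_deriv (mollifier \<rho> (e i)) j z = 0"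
    if "z \<notin> (%z. e i *\<^sub>R z) ` cball (- c) \<kappa>" for i j z
  proof -
    have *: "mollifier \<rho> (e i) z = 0" if "z \<notin> (%z. e i *\<^sub>R z) ` cball (- c) \<kappa>" for z
    proof -
      have "z = e i *\<^sub>R ((1 / e i) *\<^sub>R z)" using e(1)[of i] by simp
      then have "(1 / e i) *\<^sub>R z \<notin> cball (- c) \<kappa>" using that by blast
      then show ?thesis unfolding mollifier_def using rho3 by auto
    qed
    then show "mollifier \<rho> (e i) z = 0" using that by blast
    have "closed ((%z. e i *\<^sub>R z) ` cball (- c) \<kappa>)" by (intro closed_scaling) auto
    then show "partial_deriv (mollifier \<rho> (e i)) j z = 0"
      by (intro partial_deriv_eq_0[of "- (%z. e i *\<^sub>R z) ` cball (- c) \<kappa>"]) (use that * in auto)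
  qed
  define u where "u i x = (LINT y|lborel. w' y * mollifier \<rho> (e i) (x - y))" for i x
  note sm = smooth_mollifier[OF rho(1)]
  have us: "smooth_fun (u i)" for i unfolding u_def by (rule smooth_fun_convolution(1)[OF w'(1) w'R sm])
  have ud: "partial_deriv (u i) j x = (LINT y|lborel. g' j y * mollifier \<rho> (e i) (x - y))" if x: "x \<in> \<Omega>" for i j x
  proof -
    have "partial_deriv (u i) j x = (LINT y|lborel. w' y * partial_deriv (mollifier \<rho> (e i)) j (x - y))"
      unfolding u_def by (rule smooth_fun_convolution(2)[OF w'(1) w'R sm])
    also have "... = (LINT y|lborel. g' j y * mollifier \<rho> (e i) (x - y))"
    proof (cases "x \<in> ball p r")
      case True
      have "\<forall>z\<in>cball (- c) \<kappa>. x - e i *\<^sub>R z \<in> \<Omega>"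
      proof
        fix z assume "z \<in> cball (- c) \<kappa>"
        then have "- z \<in> cball c \<kappa>" by (simp add: dist_norm norm_minus_commute add.commute)
        then have "x + e i *\<^sub>R (- z) \<in> \<Omega>"
          using cone x True e(1,3)[of i] e1(2) unfolding cone_at_def by (metis IntI order_trans)
        then show "x - e i *\<^sub>R z \<in> \<Omega>" by simp
      qed
      note tf = test_fun_mollifier[OF rho(1) rho3 e(1) this]
      have "(LINT y|?M. w y * partial_deriv (%y. mollifier \<rho> (e i) (x - y)) j y) = - (LINT y|?M. g y $ j * mollifier \<rho> (e i) (x - y))"
        using w(3) tf(1) unfolding weak_grad1_def by blast
      then have "(LINT y|?M. w y * partial_deriv (mollifier \<rho> (e i)) j (x - y)) = (LINT y|?M. g y $ j * mollifier \<rho> (e i) (x - y))"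
        by (simp add: tf(2))
      moreover have "(%y. partial_deriv (mollifier \<rho> (e i)) j (x - y)) \<in> borel_measurable borel"
        using smooth_fun_borel[OF smooth_fun_has_derivative(2)[OF sm]] by measurable
      moreover have "(%y. mollifier \<rho> (e i) (x - y)) \<in> borel_measurable borel" using smooth_fun_borel[OF sm] by measurable
      ultimately show ?thesis using w'(5) g'(5) by simp
    next
      case False
      \<comment> \<open>Off \<open>ball p r\<close> both integrands vanish, since the scaled support
        of the mollifier does not reach back to \<open>ball p r'\<close>.\<close>
      have "w' y * partial_deriv (mollifier \<rho> (e i)) j (x - y) = g' j y * mollifier \<rho> (e i) (x - y)" for y
      proof (cases "y \<in> \<Omega> \<inter> ball p r'")
        case True
        then show ?thesis using mz[OF far[OF False]] by simp
      qed (use w'(3) g'(3) in simp)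
      then show ?thesis by simp
    qed
    finally show ?thesis .
  qed
  have lift: "(%i. \<integral>\<^sup>+x. ennreal ((a i x - h x)\<^sup>2) \<partial>?M) ----> 0"
    if h': "integrable lborel h'" "integrable lborel (%x. (h' x)\<^sup>2)" "\<forall>y. norm y > R --> h' y = 0" "AE x in ?M. h x = h' x"
      and a: "!!i x. x \<in> \<Omega> ==> a i x = (LINT y|lborel. h' y * mollifier \<rho> (e i) (x - y))" for a h h'
  proof (rule tendsto_sandwich[OF _ _ tendsto_const mollify_tendsto[OF h'(1-3) rho(1,2) irho rho(4) e(1,2)]])
    have "(\<integral>\<^sup>+x. ennreal ((a i x - h x)\<^sup>2) \<partial>?M) <= (\<integral>\<^sup>+x. ennreal (((LINT y|lborel. h' y * mollifier \<rho> (e i) (x - y)) - h' x)\<^sup>2) \<partial>lborel)" for i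
    proof -
      have "(\<integral>\<^sup>+x. ennreal ((a i x - h x)\<^sup>2) \<partial>?M) = (\<integral>\<^sup>+x. ennreal (((LINT y|lborel. h' y * mollifier \<rho> (e i) (x - y)) - h' x)\<^sup>2) \<partial>?M)"
        by (rule nn_integral_cong_AE) (use h'(4) AE_space in \<open>eventually_elim, use a in auto\<close>)
      also have "... <= (\<integral>\<^sup>+x. ennreal (((LINT y|lborel. h' y * mollifier \<rho> (e i) (x - y)) - h' x)\<^sup>2) \<partial>lborel)"
        unfolding nn_integral_lebesgue_on[OF O(2)] by (rule nn_integral_mono) (auto simp: indicator_def)
      finally show ?thesis .
    qed
    then show "\<forall>\<^sub>F i in sequentially. (\<integral>\<^sup>+x. ennreal ((a i x - h x)\<^sup>2) \<partial>?M) <= (\<integral>\<^sup>+x. ennreal (((LINT y|lborel. h' y * mollifier \<rho> (e i) (x - y)) - h' x)\<^sup>2) \<partial>lborel)"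
      by simp
  qed simp
  show ?thesis unfolding h1_approx_def
  proof (intro exI[of _ u] conjI allI us)
    show "(%i. \<integral>\<^sup>+x. ennreal ((u i x - w x)\<^sup>2) \<partial>?M) ----> 0" by (rule lift[OF w'(1,2) w'R w'(4)]) (simp add: u_def)
    show "(%i. \<integral>\<^sup>+x. ennreal ((partial_deriv (u i) j x - g x $ j)\<^sup>2) \<partial>?M) ----> 0" for j
      by (rule lift[OF g'(1,2) g'R g'(4)]) (rule ud)
  qed
qed

text \<open>Instead of a partition of unity, one ball of a finite cover is peeled off at a time:
  \<open>\<eta> * w\<close> is handled by the cone at the centre, and
  \<open>(1 - \<eta>) * w\<close> vanishes on the plateau of \<open>\<eta>\<close>, hence off the
  union of the remaining balls, so that the induction hypothesis applies.\<close>

lemma h1_approx_all: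
  fixes \<Omega> :: "(real^'n) set"
  assumes O: "bounded \<Omega>" "open \<Omega>" "lipschitz_boundary \<Omega>"
    and w: "L2_on (lebesgue_on \<Omega>) w" "L2_on (lebesgue_on \<Omega>) g" "weak_grad1 \<Omega> w g"
  shows "h1_approx \<Omega> w g"
proof -
  have "\<forall>p\<in>closure \<Omega>. \<exists>r. r > 0 & (\<exists>e0 c k. cone_at \<Omega> p r e0 c k)"
    using cone_at_exists[OF O(2,3)] unfolding cone_at_def by blast
  then obtain r where r: "!!p. p \<in> closure \<Omega> ==> r p > 0 & (\<exists>e0 c k. cone_at \<Omega> p (r p) e0 c k)" by metis
  have cpt: "compact (closure \<Omega>)" using O(1) by simp
  have "closure \<Omega> \<subseteq> (\<Union>p\<in>closure \<Omega>. ball p (r p / 3))" using r by fastforce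
  then obtain P where P: "P \<subseteq> closure \<Omega>" "finite P" "closure \<Omega> \<subseteq> (\<Union>p\<in>P. ball p (r p / 3))"
    using compactE_image[OF cpt, of "closure \<Omega>" "%p. ball p (r p / 3)"] by (metis open_ball)
  have "h1_approx \<Omega> w g" if "finite Q" "Q \<subseteq> closure \<Omega>" 
     "L2_on (lebesgue_on \<Omega>) w" "L2_on (lebesgue_on \<Omega>) g" "weak_grad1 \<Omega> w g"
     "!!x. x \<in> \<Omega> ==> x \<notin> (\<Union>p\<in>Q. ball p (r p / 3)) ==> w x = 0 & g x = 0" for Q w g using that
  proof (induction Q arbitrary: w g rule: finite_induct)
    case empty
    have "h1_approx \<Omega> (%x. 0) (%x. 0)" unfolding h1_approx_def by (rule exI[of _ "%k x. 0"]) (simp add: smooth_fun_const)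
    then show ?case by (rule h1_approx_cong) (use empty in auto)
  next
    case (insert q Q)
    note wg = insert.prems(2-4)
    have rq: "r q > 0" using insert.prems r by auto
    obtain \<eta> where e: "smooth_fun \<eta>" "!!x. 0 <= \<eta> x & \<eta> x <= 1"
      "!!x. x \<in> ball q (r q / 3) ==> \<eta> x = 1" "!!x. x \<notin> ball q (r q / 2) ==> \<eta> x = 0"
      using plateau_exists[of "r q / 3" "r q / 2" q] rq by auto
    let ?e = "%x. 1 - \<eta> x"
    have e': "smooth_fun ?e" by (rule smooth_fun_diff[OF smooth_fun_const e(1)])
    have pd': "partial_deriv ?e j x = - partial_deriv \<eta> j x" for j x
      using partial_deriv_rules(2)[OF smooth_fun_const e(1), of 1 j x] by simp
    \<comment> \<open>The radius \<open>2 * r q / 3\<close> exceeds \<open>r q / 2\<close> so that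
      these points have a neighbourhood on which the cutoff is identically 0.\<close>
    have out: "partial_deriv \<eta> j x = 0" if "x \<notin> ball q (2 * r q / 3)" for j x
    proof (rule partial_deriv_eq_0[of "- cball q (r q / 2)"])
      show "x \<in> - cball q (r q / 2)" using that rq by auto
      show "\<eta> y = 0" if "y \<in> - cball q (r q / 2)" for y by (rule e(4)) (use that in auto)
    qed (simp add: open_Compl)
    have inn: "partial_deriv \<eta> j x = 0" if "x \<in> ball q (r q / 3)" for j x
      by (rule partial_deriv_eq_0[OF open_ball that e(3)])
    note m1 = weak_grad1_mult[OF O(1,2) wg e(1)] and m2 = weak_grad1_mult[OF O(1,2) wg e']
    obtain e0 c k where cone: "cone_at \<Omega> q (r q) e0 c k" using r insert.prems(1) by blast
    have "h1_approx \<Omega> (%x. \<eta> x * w x) (%x. \<eta> x *\<^sub>R g x + w x *\<^sub>R (\<chi> j. partial_deriv \<eta> j x))"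
    proof (rule cone_approx[OF O(1,2) m1(2,3,1) cone, of "2 * r q / 3"])
      show "\<eta> x * w x = 0" if "x \<notin> ball q (2 * r q / 3)" for x using e(4)[of x] that rq by auto
      show "\<eta> x *\<^sub>R g x + w x *\<^sub>R (\<chi> j. partial_deriv \<eta> j x) = 0" if "x \<notin> ball q (2 * r q / 3)" for x
        using e(4)[of x] that rq out[OF that] by (auto simp: vec_eq_iff)
    qed (use rq in auto)
    moreover have "h1_approx \<Omega> (%x. ?e x * w x) (%x. ?e x *\<^sub>R g x + w x *\<^sub>R (\<chi> j. partial_deriv ?e j x))"
    proof (rule insert.IH[OF _ m2(2,3,1)])
      show "Q \<subseteq> closure \<Omega>" using insert.prems by auto
      fix x assume x: "x \<in> \<Omega>" "x \<notin> (\<Union>p\<in>Q. ball p (r p / 3))"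
      show "?e x * w x = 0 & ?e x *\<^sub>R g x + w x *\<^sub>R (\<chi> j. partial_deriv ?e j x) = 0"
      proof (cases "x \<in> ball q (r q / 3)")
        case True
        then show ?thesis using e(3) inn[OF True] by (simp add: pd' vec_eq_iff)
      next
        case False
        then have "w x = 0 & g x = 0" using x by (intro insert.prems(5)) auto
        then show ?thesis by simp
      qed
    qed
    ultimately have "h1_approx \<Omega> (%x. \<eta> x * w x + ?e x * w x) (%x. (\<eta> x *\<^sub>R g x + w x *\<^sub>R (\<chi> j. partial_deriv \<eta> j x)) + (?e x *\<^sub>R g x + w x *\<^sub>R (\<chi> j. partial_deriv ?e j x)))"
      by (rule h1_approx_add) (use m1 m2 in \<open>auto simp: L2_on_def\<close>)
    then show ?case by (rule h1_approx_cong) (auto simp: algebra_simps pd' vec_eq_iff)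
  qed
  from this[OF P(2,1) w] show ?thesis using P(3) closure_subset by blast
qed

section \<open>Smooth vector fields, their Jacobians, and representatives of the weak
  gradient\<close>

definition smooth_vec :: "(real^'n => real^'n) => bool" where
  "smooth_vec u \<longleftrightarrow> (\<forall>i. smooth_fun (%x. u x $ i))"

definition jac :: "(real^'n => real^'n) => real^'n => real^'n^'n" where
  "jac u x = (\<chi> i j. partial_deriv (%y. u y $ i) j x)"

lemma smooth_vec_continuous: "smooth_vec u ==> continuous_on A u"
  using continuous_on_vec_lambda[of A "%i x. u x $ i", OF smooth_fun_continuous] by (simp add: smooth_vec_def)

lemma jac_continuous: "smooth_vec u ==> continuous_on A (jac u)" unfolding smooth_vec_def jac_def[abs_def]
  by (intro continuous_on_vec_lambda smooth_fun_continuous smooth_fun_has_derivative(2)) auto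

lemma smooth_vec_has_derivative:
  assumes "smooth_vec u"
  shows "(u has_derivative (%h. jac u x *v h)) (at x)"
proof -
  have "((%x. u x $ i) has_derivative (%h. (jac u x *v h) $ i)) (at x)" for i
    using smooth_fun_has_derivative(1)[of "%x. u x $ i" x] assms
    by (simp add: smooth_vec_def jac_def matrix_vector_mult_def mult.commute)
  then show ?thesis by (subst has_derivative_componentwise_within)
      (auto simp: Basis_vec_def inner_axis)
qed

lemma smooth_vec_add: "smooth_vec u ==> smooth_vec v ==> smooth_vec (%x. u x + v x)"
  unfolding smooth_vec_def by (simp add: smooth_fun_add)

lemma smooth_vec_diff: "smooth_vec u ==> smooth_vec v ==> smooth_vec (%x. u x - v x)"
  unfolding smooth_vec_def by (simp add: smooth_fun_diff)

lemma smooth_vec_scaleR: "smooth_vec u ==> smooth_vec (%x. c *\<^sub>R u x)"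
  unfolding smooth_vec_def by (simp add: smooth_fun_mult smooth_fun_const)

lemma smooth_vec_affine: "smooth_vec (%x::real^'n. b + A *v x)" unfolding smooth_vec_def matrix_vector_mult_def
  by (simp add: smooth_fun_add smooth_fun_const smooth_fun_sum smooth_fun_mult smooth_fun_component)

lemma jac_rules:
  assumes "smooth_vec u" "smooth_vec v"
  shows "jac (%x. u x + v x) x = jac u x + jac v x" "jac (%x. u x - v x) x = jac u x - jac v x"
    "jac (%x. c *\<^sub>R u x) x = c *\<^sub>R jac u x"
  using assms by (auto simp: jac_def vec_eq_iff smooth_vec_def partial_deriv_rules(1,2) partial_deriv_rules(4)[OF _ smooth_fun_const])

lemma jac_affine: "jac (%x::real^'n. b + A *v x) x = A"
proof -
  have "((%y. (b + A *v y) $ i) has_derivative (%h. (A *v h) $ i)) (at x)" for i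
    by (intro bounded_linear.has_derivative[OF bounded_linear_vec_nth])
      (auto intro!: derivative_eq_intros bounded_linear_imp_has_derivative simp: matrix_vector_mul_bounded_linear)
  then have "partial_deriv (%y. (b + A *v y) $ i) j x = (A *v axis j 1) $ i" for i j by (rule partial_derivI)
  then show ?thesis by (simp add: jac_def vec_eq_iff matrix_vector_mult_def mult.commute)
qed

lemma grad_props:
  assumes "H1 \<Omega> v"
  shows "L2_on (lebesgue_on \<Omega>) v" "L2_on (lebesgue_on \<Omega>) (grad \<Omega> v)" "weak_grad \<Omega> v (grad \<Omega> v)"
  using assms someI_ex[of "%G. L2_on (lebesgue_on \<Omega>) G & weak_grad \<Omega> v G"] unfolding H1_def grad_def by auto

text \<open>\<open>grad\<close> picks an unspecified representative. Every computation of it, for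
  sums, smooth fields or limits, goes through this identification almost everywhere.\<close>

lemma grad_unique:
  assumes O: "bounded \<Omega>" "open \<Omega>" and v: "L2_on (lebesgue_on \<Omega>) v" "L2_on (lebesgue_on \<Omega>) G" "weak_grad \<Omega> v G"
  shows "H1 \<Omega> v" "AE x in lebesgue_on \<Omega>. grad \<Omega> v x = G x"
proof -
  show h: "H1 \<Omega> v" using v unfolding H1_def by blast
  have "AE x in lebesgue_on \<Omega>. grad \<Omega> v x $ i = G x $ i" for i
    by (rule weak_grad1_unique[OF O]) (use grad_props[OF h] v L2_on_component in \<open>auto simp: weak_grad_iff\<close>)
  then have "AE x in lebesgue_on \<Omega>. \<forall>i. grad \<Omega> v x $ i = G x $ i" by (simp add: AE_all_countable)
  then show "AE x in lebesgue_on \<Omega>. grad \<Omega> v x = G x" by eventually_elim (simp add: vec_eq_iff)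
qed

lemma grad_smooth:
  fixes \<Omega> :: "(real^'n) set"
  assumes O: "bounded \<Omega>" "open \<Omega>" and u: "smooth_vec u"
  shows "H1 \<Omega> u" "AE x in lebesgue_on \<Omega>. grad \<Omega> u x = jac u x" "L2_on (lebesgue_on \<Omega>) u" "L2_on (lebesgue_on \<Omega>) (jac u)"
proof -
  show l: "L2_on (lebesgue_on \<Omega>) u" "L2_on (lebesgue_on \<Omega>) (jac u)"
    using L2_on_continuous[OF O] smooth_vec_continuous[OF u] jac_continuous[OF u] by auto
  have "weak_grad \<Omega> u (jac u)" unfolding weak_grad_iff using weak_grad1_smooth[OF O] u by (simp add: jac_def smooth_vec_def)
  from grad_unique[OF O l this] show "H1 \<Omega> u" "AE x in lebesgue_on \<Omega>. grad \<Omega> u x = jac u x" .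
qed

lemma grad_add:
  fixes c :: real
  assumes O: "bounded \<Omega>" "open \<Omega>" and "H1 \<Omega> v" "H1 \<Omega> w"
  shows "H1 \<Omega> (%x. v x + c *\<^sub>R w x)"
    "AE x in lebesgue_on \<Omega>. grad \<Omega> (%x. v x + c *\<^sub>R w x) x = grad \<Omega> v x + c *\<^sub>R grad \<Omega> w x"
proof -
  note v = grad_props[OF assms(3)] and w = grad_props[OF assms(4)]
  have l: "L2_on (lebesgue_on \<Omega>) (%x. v x + c *\<^sub>R w x)" "L2_on (lebesgue_on \<Omega>) (%x. grad \<Omega> v x + c *\<^sub>R grad \<Omega> w x)"
    by (intro L2_on_add L2_on_scaleR v w)+
  have "weak_grad \<Omega> (%x. v x + c *\<^sub>R w x) (%x. grad \<Omega> v x + c *\<^sub>R grad \<Omega> w x)" unfolding weak_grad_iff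
  proof
    fix i
    show "weak_grad1 \<Omega> (%x. (v x + c *\<^sub>R w x) $ i) (%x. (grad \<Omega> v x + c *\<^sub>R grad \<Omega> w x) $ i)"
      using weak_grad1_add[OF O L2_on_component[OF v(1), of i] L2_on_component[OF v(2), of i] _ L2_on_component[OF w(1), of i] L2_on_component[OF w(2), of i], where c = c]
        v(3) w(3) by (simp add: weak_grad_iff)
  qed
  from grad_unique[OF O l this] show "H1 \<Omega> (%x. v x + c *\<^sub>R w x)"
    "AE x in lebesgue_on \<Omega>. grad \<Omega> (%x. v x + c *\<^sub>R w x) x = grad \<Omega> v x + c *\<^sub>R grad \<Omega> w x" .
qed

section \<open>Squared norms in L2 and convergence in H1\<close>

definition sq_int :: "'a measure => ('a => 'b::euclidean_space) => real" where
  "sq_int M u = (LINT x|M. (norm (u x))\<^sup>2)"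

lemma sq_int_nonneg: "sq_int M u >= 0" by (simp add: sq_int_def)

lemma sq_int_cong_AE:
  assumes "AE x in M. u x = v x" "L2_on M u" "L2_on M v"
  shows "sq_int M u = sq_int M v"
  unfolding sq_int_def by (rule integral_cong_AE) (use assms in \<open>auto simp: L2_on_def elim: eventually_mono\<close>)

lemma sq_int_eq_nn: "L2_on M u ==> ennreal (sq_int M u) = (\<integral>\<^sup>+x. ennreal ((norm (u x))\<^sup>2) \<partial>M)"
  unfolding sq_int_def L2_on_def by (subst nn_integral_eq_integral) auto

lemma sq_int_add_le:
  assumes "L2_on M u" "L2_on M v"
  shows "sq_int M (%x. u x + v x) <= 2 * sq_int M u + 2 * sq_int M v"
proof -
  have "sq_int M (%x. u x + v x) <= (LINT x|M. 2 * (norm (u x))\<^sup>2 + 2 * (norm (v x))\<^sup>2)" unfolding sq_int_def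
    by (intro integral_mono norm_sq_add_le) (use L2_on_add[OF assms] assms in \<open>auto simp: L2_on_def\<close>)
  also have "... = 2 * sq_int M u + 2 * sq_int M v" using assms by (simp add: sq_int_def L2_on_def)
  finally show ?thesis .
qed

lemma sq_int_scaleR: "sq_int M (%x. c *\<^sub>R u x) = c\<^sup>2 * sq_int M u" by (simp add: sq_int_def power_mult_distrib)

lemma H1_dist_eq:
  "H1_dist \<Omega> u v = sqrt (sq_int (lebesgue_on \<Omega>) (%x. u x - v x) + sq_int (lebesgue_on \<Omega>) (%x. grad \<Omega> u x - grad \<Omega> v x))"
  by (simp add: H1_dist_def sq_int_def)

lemma H1_dist_tendsto_iff:
  "(%k. H1_dist \<Omega> (u k) v) ----> 0 \<longleftrightarrow>
    (%k. sq_int (lebesgue_on \<Omega>) (%x. u k x - v x)) ----> 0 &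
    (%k. sq_int (lebesgue_on \<Omega>) (%x. grad \<Omega> (u k) x - grad \<Omega> v x)) ----> 0" (is "?L \<longleftrightarrow> ?a ----> 0 & ?b ----> 0")
proof
  assume ?L
  then have "(%k. (H1_dist \<Omega> (u k) v)\<^sup>2) ----> 0\<^sup>2" by (intro tendsto_intros)
  then have s: "(%k. ?a k + ?b k) ----> 0" by (simp add: H1_dist_eq sq_int_nonneg add_nonneg_nonneg)
  show "?a ----> 0 & ?b ----> 0" by (intro conjI; rule tendsto_sandwich[OF _ _ tendsto_const s]) (auto simp: sq_int_nonneg)
next
  assume "?a ----> 0 & ?b ----> 0"
  then have "(%k. sqrt (?a k + ?b k)) ----> sqrt (0 + 0)" by (intro tendsto_intros) auto
  then show ?L by (simp add: H1_dist_eq)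
qed

lemma smooth_dense:
  fixes \<Omega> :: "(real^'n) set"
  assumes O: "bounded \<Omega>" "open \<Omega>" "lipschitz_boundary \<Omega>" and v: "H1 \<Omega> v"
  obtains u where "!!k. smooth_vec (u k)" "(%k. H1_dist \<Omega> (u k) v) ----> 0"
proof -
  let ?M = "lebesgue_on \<Omega>"
  note vg = grad_props[OF v]
  have "h1_approx \<Omega> (%x. v x $ i) (%x. grad \<Omega> v x $ i)" for i
    by (rule h1_approx_all[OF O]) (use vg L2_on_component in \<open>auto simp: weak_grad_iff\<close>)
  then have "\<forall>i. \<exists>u. (\<forall>k. smooth_fun (u k)) & (%k. \<integral>\<^sup>+x. ennreal ((u k x - v x $ i)\<^sup>2) \<partial>?M) ----> 0 &
    (\<forall>j. (%k. \<integral>\<^sup>+x. ennreal ((partial_deriv (u k) j x - grad \<Omega> v x $ i $ j)\<^sup>2) \<partial>?M) ----> 0)"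
    unfolding h1_approx_def by blast
  from choice[OF this] obtain U where U: "!!i k. smooth_fun (U i k)"
    "!!i. (%k. \<integral>\<^sup>+x. ennreal ((U i k x - v x $ i)\<^sup>2) \<partial>?M) ----> 0"
    "!!i j. (%k. \<integral>\<^sup>+x. ennreal ((partial_deriv (U i k) j x - grad \<Omega> v x $ i $ j)\<^sup>2) \<partial>?M) ----> 0" by blast
  define u where "u k x = (\<chi> i. U i k x)" for k x
  have us: "smooth_vec (u k)" for k by (simp add: smooth_vec_def u_def U)
  note gs = grad_smooth[OF O(1,2) us]
  have "(%k. ennreal (sq_int ?M (%x. u k x - v x))) ----> 0"
  proof -
    have "ennreal (sq_int ?M (%x. u k x - v x)) = (\<Sum>i\<in>UNIV. \<integral>\<^sup>+x. ennreal ((U i k x - v x $ i)\<^sup>2) \<partial>?M)" for k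
    proof -
      have m: "(%x. U i k x - v x $ i) \<in> borel_measurable ?M" for i
        using L2_on_component[OF L2_on_diff[OF gs(3) vg(1)], of k i] by (simp add: u_def L2_on_def)
      show ?thesis by (subst sq_int_eq_nn[OF L2_on_diff[OF gs(3) vg(1)]])
          (use m in \<open>simp add: norm_vec_sq u_def sum_nonneg flip: sum_ennreal nn_integral_sum\<close>)
    qed
    then show ?thesis using tendsto_sum[of UNIV, OF U(2)] by simp
  qed
  then have 1: "(%k. sq_int ?M (%x. u k x - v x)) ----> 0"
    using tendsto_ennreal_iff[of "%k. sq_int ?M (%x. u k x - v x)" sequentially 0] by (simp add: sq_int_nonneg)
  have "(%k. ennreal (sq_int ?M (%x. jac (u k) x - grad \<Omega> v x))) ----> 0"
  proof -
    have "ennreal (sq_int ?M (%x. jac (u k) x - grad \<Omega> v x)) = (\<Sum>i\<in>UNIV. \<Sum>j\<in>UNIV. \<integral>\<^sup>+x. ennreal ((partial_deriv (U i k) j x - grad \<Omega> v x $ i $ j)\<^sup>2) \<partial>?M)" for k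
    proof -
      have m: "(%x. partial_deriv (U i k) j x - grad \<Omega> v x $ i $ j) \<in> borel_measurable ?M" for i j
        using L2_on_component[OF L2_on_component[OF L2_on_diff[OF gs(4) vg(2)], of k i], of j] by (simp add: u_def jac_def L2_on_def)
      show ?thesis by (subst sq_int_eq_nn[OF L2_on_diff[OF gs(4) vg(2)]])
          (use m in \<open>simp add: norm_vec_sq u_def jac_def sum_nonneg flip: sum_ennreal nn_integral_sum\<close>)
    qed
    moreover have "(%k. \<Sum>i\<in>UNIV. \<Sum>j\<in>UNIV. \<integral>\<^sup>+x. ennreal ((partial_deriv (U i k) j x - grad \<Omega> v x $ i $ j)\<^sup>2) \<partial>?M) ----> (\<Sum>i\<in>(UNIV::'n set). \<Sum>j\<in>(UNIV::'n set). 0)"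
      by (intro tendsto_sum U)
    ultimately show ?thesis by simp
  qed
  then have 2: "(%k. sq_int ?M (%x. jac (u k) x - grad \<Omega> v x)) ----> 0"
    using tendsto_ennreal_iff[of "%k. sq_int ?M (%x. jac (u k) x - grad \<Omega> v x)" sequentially 0] by (simp add: sq_int_nonneg)
  have "sq_int ?M (%x. grad \<Omega> (u k) x - grad \<Omega> v x) = sq_int ?M (%x. jac (u k) x - grad \<Omega> v x)" for k
  proof (rule sq_int_cong_AE)
    show "AE x in ?M. grad \<Omega> (u k) x - grad \<Omega> v x = jac (u k) x - grad \<Omega> v x" using gs(2)[of k] by eventually_elim simp
  qed (intro L2_on_diff vg gs grad_props(2)[OF gs(1)])+
  with 1 2 have "(%k. H1_dist \<Omega> (u k) v) ----> 0" by (simp add: H1_dist_tendsto_iff)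
  then show ?thesis using that us by blast
qed

section \<open>Korn inequalities for smooth fields\<close>

definition sympart :: "real^'n^'n => real^'n^'n" where
  "sympart A = (1/2) *\<^sub>R (A + transpose A)"

lemma sympart_nth: "sympart A $ i $ j = (A $ i $ j + A $ j $ i) / 2" by (simp add: sympart_def transpose_def)

lemma sympart_simps:
  "sympart (A + B) = sympart A + sympart B" "sympart (A - B) = sympart A - sympart B" "sympart (c *\<^sub>R A) = c *\<^sub>R sympart A" "sympart 0 = 0"
  by (auto simp: vec_eq_iff sympart_nth field_simps)

lemma bounded_linear_sympart: "bounded_linear sympart"
  by (rule linear_conv_bounded_linear[THEN iffD1], rule linearI) (simp_all add: sympart_simps)

lemma sympart_skew: "skew R ==> sympart R = 0" by (simp add: sympart_def skew_def)

lemma skew_diff_sympart: "skew (A - sympart A)" by (auto simp: skew_def vec_eq_iff transpose_def sympart_nth field_simps)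

lemma norm_mat_sq: "(norm (A :: real^'n^'m))\<^sup>2 = (\<Sum>i\<in>UNIV. \<Sum>j\<in>UNIV. (A $ i $ j)\<^sup>2)" by (simp add: norm_vec_sq)

text \<open>The second sum is isolated because, for a gradient with compact support, its integral
  has a sign.\<close>

lemma norm_sympart_sq: "(norm (sympart A))\<^sup>2 = (norm A)\<^sup>2 / 2 + (\<Sum>i\<in>UNIV. \<Sum>j\<in>UNIV. A $ i $ j * A $ j $ i) / 2"
proof -
  have "(sympart A $ i $ j)\<^sup>2 = (A $ i $ j)\<^sup>2 / 4 + (A $ j $ i)\<^sup>2 / 4 + A $ i $ j * A $ j $ i / 2" for i j
    by (simp add: sympart_nth power2_eq_square field_simps)
  then have "(norm (sympart A))\<^sup>2 = (\<Sum>i\<in>UNIV. \<Sum>j\<in>UNIV. (A $ i $ j)\<^sup>2) / 4 + (\<Sum>i\<in>UNIV. \<Sum>j\<in>UNIV. (A $ j $ i)\<^sup>2) / 4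
     + (\<Sum>i\<in>UNIV. \<Sum>j\<in>UNIV. A $ i $ j * A $ j $ i) / 2" by (simp add: norm_mat_sq sum.distrib sum_divide_distrib)
  also have "(\<Sum>i\<in>UNIV. \<Sum>j\<in>UNIV. (A $ j $ i)\<^sup>2) = (\<Sum>i\<in>UNIV. \<Sum>j\<in>UNIV. (A $ i $ j)\<^sup>2)" by (rule sum.swap)
  finally show ?thesis by (simp add: norm_mat_sq)
qed

lemma norm_sympart_le: "norm (sympart A) <= norm A"
proof -
  have "norm (transpose A) = norm A"
  proof -
    have "(norm (transpose A))\<^sup>2 = (norm A)\<^sup>2" unfolding norm_mat_sq transpose_def by (simp, rule sum.swap)
    then show ?thesis by simp
  qed
  then show ?thesis using norm_triangle_ineq[of A "transpose A"] by (simp add: sympart_def)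
qed

lemma norm_matrix_vector_le: "norm ((A::real^'n^'m) *v x) <= norm A * norm x"
proof (rule power2_le_imp_le)
  have "(norm (A *v x))\<^sup>2 = (\<Sum>i\<in>UNIV. ((A $ i) \<bullet> x)\<^sup>2)" by (simp add: norm_vec_sq matrix_vector_mult_def inner_vec_def)
  also have "... <= (\<Sum>i\<in>UNIV. (norm (A $ i))\<^sup>2 * (norm x)\<^sup>2)"
  proof (rule sum_mono)
    fix i
    have "\<bar>(A $ i) \<bullet> x\<bar>\<^sup>2 <= (norm (A $ i) * norm x)\<^sup>2" by (intro power_mono Cauchy_Schwarz_ineq2) auto
    then show "((A $ i) \<bullet> x)\<^sup>2 <= (norm (A $ i))\<^sup>2 * (norm x)\<^sup>2" by (simp add: power_mult_distrib)
  qed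
  also have "... = (norm A * norm x)\<^sup>2" by (simp add: norm_vec_sq[of A] power_mult_distrib flip: sum_distrib_right)
  finally show "(norm (A *v x))\<^sup>2 <= (norm A * norm x)\<^sup>2" .
qed simp

text \<open>This is why the increment of a field between two points, projected on their difference,
  is governed by the strain alone.\<close>

lemma inner_sympart: "z \<bullet> (sympart A *v z) = z \<bullet> (A *v z)"
proof -
  have t: "z \<bullet> (transpose A *v z) = z \<bullet> (A *v z)"
    by (simp add: transpose_matrix_vector dot_lmul_matrix inner_commute[of z "z v* A"])
  have "z \<bullet> (sympart A *v z) = (1/2) * (z \<bullet> (A *v z) + z \<bullet> (transpose A *v z))"
    by (simp add: sympart_def scaleR_matrix_vector_assoc[symmetric] matrix_vector_mult_add_rdistrib inner_add_right)
  then show ?thesis using t by simp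
qed

definition strain :: "(real^'n => real^'n) => real^'n => real^'n^'n" where
  "strain u x = sympart (jac u x)"

lemma strain_continuous: "smooth_vec u ==> continuous_on A (strain u)" unfolding strain_def[abs_def]
  by (rule bounded_linear.continuous_on[OF bounded_linear_sympart jac_continuous])

text \<open>A squared L2 norm with values in \<open>ennreal\<close>: the inequalities for smooth
  fields on unbounded sets hold without integrability, and finiteness is demanded only where
  something is subtracted.\<close>

definition nsq :: "(real^'n) set => (real^'n => 'b::euclidean_space) => ennreal" where
  "nsq U F = (\<integral>\<^sup>+x. ennreal ((norm (F x))\<^sup>2) * indicator U x \<partial>lborel)"

lemma nsq_mono: "(!!x. x \<in> U ==> x \<in> V & norm (F x) <= norm (G x)) ==> nsq U F <= nsq V G"
  unfolding nsq_def by (rule nn_integral_mono) (auto simp: indicator_def intro!: ennreal_leI power_mono)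

lemma nsq_cong: "(!!x. x \<in> U ==> norm (F x) = norm (G x)) ==> nsq U F = nsq U G" by (intro antisym nsq_mono) auto

lemma nsq_add_le:
  assumes [measurable]: "U \<in> sets borel" "G \<in> borel_measurable borel" "H \<in> borel_measurable borel"
    and le: "!!x. x \<in> U ==> norm (F x) <= norm (G x) + norm (H x)"
  shows "nsq U F <= 2 * nsq U G + 2 * nsq U H"
proof -
  have "nsq U F <= (\<integral>\<^sup>+x. 2 * (ennreal ((norm (G x))\<^sup>2) * indicator U x) + 2 * (ennreal ((norm (H x))\<^sup>2) * indicator U x) \<partial>lborel)"
    unfolding nsq_def
  proof (rule nn_integral_mono)
    fix x
    show "ennreal ((norm (F x))\<^sup>2) * indicator U x <= 2 * (ennreal ((norm (G x))\<^sup>2) * indicator U x) + 2 * (ennreal ((norm (H x))\<^sup>2) * indicator U x)"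
    proof (cases "x \<in> U")
      case True
      have "(norm (F x))\<^sup>2 <= (norm (G x) + norm (H x))\<^sup>2" using le[OF True] by (intro power_mono) auto
      then have "(norm (F x))\<^sup>2 <= 2 * (norm (G x))\<^sup>2 + 2 * (norm (H x))\<^sup>2"
        using sq_add_le[of "norm (G x)" "norm (H x)"] by linarith
      from ennreal_leI[OF this] show ?thesis using True by (simp add: ennreal_plus ennreal_mult)
    qed simp
  qed
  also have "... = 2 * nsq U G + 2 * nsq U H" unfolding nsq_def by (subst nn_integral_add) (auto simp: nn_integral_cmult)
  finally show ?thesis .
qed

lemma nsq_scale: "F \<in> borel_measurable borel ==> U \<in> sets borel ==> nsq U (%x. c *\<^sub>R F x) = ennreal (c\<^sup>2) * nsq U F"
  unfolding nsq_def by (subst nn_integral_cmult[symmetric]) (auto simp: power_mult_distrib ennreal_mult mult.assoc)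

lemma smooth_vec_measurable:
  assumes "smooth_vec u"
  shows "u \<in> borel_measurable borel" "jac u \<in> borel_measurable borel" "strain u \<in> borel_measurable borel"
  by (intro borel_measurable_continuous_onI smooth_vec_continuous jac_continuous strain_continuous assms)+

subsection \<open>Compactly supported fields\<close>

text \<open>Both sides are the derivative along \<open>i\<close> and \<open>j\<close> of the same correlation of \<open>a\<close> and \<open>b\<close>.\<close>
lemma integral_partials_swap:
  fixes a b :: "real^'n => real"
  assumes a: "smooth_fun a" "compact K" "!!x. x \<notin> K ==> a x = 0"
    and b: "smooth_fun b" "!!x. x \<notin> K ==> b x = 0"
  shows "(LINT x|lborel. partial_deriv a i x * partial_deriv b j x) = (LINT x|lborel. partial_deriv a j x * partial_deriv b i x)"
proof -
  define b' where "b' x = b (- x)" for x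
  have b's: "smooth_fun b'" "partial_deriv b' k x = - partial_deriv b k (- x)" for k x
    using smooth_fun_affine[OF b(1), of 0 "-1"] by (auto simp: b'_def[abs_def])
  obtain R where R: "!!x. x \<in> K ==> norm x <= R" using compact_imp_bounded[OF a(2)] bounded_iff by blast
  have pz: "partial_deriv f k x = 0" if "x \<notin> K" "!!x. x \<notin> K ==> f x = 0" for f :: "real^'n => real" and k x
    by (rule partial_deriv_eq_0[of "- K"]) (use that a compact_imp_closed in auto)
  note as = smooth_fun_has_derivative(2)[OF a(1)] and bs = smooth_fun_has_derivative(2)[OF b's(1)]
  have Ra: "\<forall>y. norm y > R --> a y = 0" "\<forall>y. norm y > R --> partial_deriv a k y = 0"
    "\<forall>y. norm y > R --> b' y = 0" "\<forall>y. norm y > R --> partial_deriv b' k y = 0" for k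
  proof -
    have *: "x \<notin> K" if "norm x > R" for x using R that by force
    show "\<forall>y. norm y > R --> a y = 0" "\<forall>y. norm y > R --> partial_deriv a k y = 0"
      "\<forall>y. norm y > R --> b' y = 0" "\<forall>y. norm y > R --> partial_deriv b' k y = 0"
      using * pz[of _ a] pz[of _ b] a(3) b(2) by (auto simp: b's(2) b'_def)
  qed
  have int: "integrable lborel f" if "smooth_fun f" "\<forall>y. norm y > R --> f y = 0" for f :: "real^'n => real"
    by (rule test_fun_integrable[of _ "cball 0 R"]) (use that smooth_fun_continuous in auto)
  define cv where "cv f g x = (LINT y|lborel. f y * g (x - y))" for f g :: "real^'n => real" and x
  have comm: "cv f g = cv g f" if "smooth_fun f" "smooth_fun g" for f g
  proof
    fix x
    have "(%y. f y * g (x - y)) \<in> borel_measurable borel"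
      using smooth_fun_borel[OF that(1)] smooth_fun_borel[OF that(2)] by measurable
    from lborel_affine_integral(1)[OF this, of "-1" x] show "cv f g x = cv g f x" by (simp add: cv_def mult.commute)
  qed
  have d2: "partial_deriv (cv f g) k = cv f (partial_deriv g k)" if "smooth_fun f" "smooth_fun g" "\<forall>y. norm y > R --> f y = 0" for f g k
    unfolding cv_def[abs_def] by (rule ext) (rule smooth_fun_convolution(2)[OF int[OF that(1,3)] that(3,2)])
  have "cv (partial_deriv a i) (partial_deriv b' j) = partial_deriv (cv (partial_deriv a i) b') j"
    by (rule d2[symmetric]) (use as b's Ra in auto)
  also have "cv (partial_deriv a i) b' = cv b' (partial_deriv a i)" by (rule comm) (use as b's in auto)
  also have "... = partial_deriv (cv b' a) i" by (rule d2[symmetric]) (use a b's Ra in auto)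
  also have "cv b' a = cv a b'" by (rule comm) (use a b's in auto)
  also have "partial_deriv (cv a b') i = cv a (partial_deriv b' i)" by (rule d2) (use a b's Ra in auto)
  also have "... = cv (partial_deriv b' i) a" by (rule comm) (use a bs in auto)
  also have "partial_deriv ... j = cv (partial_deriv b' i) (partial_deriv a j)" by (rule d2) (use a bs Ra in auto)
  also have "... = cv (partial_deriv a j) (partial_deriv b' i)" by (rule comm) (use as bs in auto)
  finally have "cv (partial_deriv a i) (partial_deriv b' j) 0 = cv (partial_deriv a j) (partial_deriv b' i) 0" by simp
  then show ?thesis by (simp add: cv_def b's(2))
qed

text \<open>Exchanging the two derivatives turns the integral of
  \<open>\<Sum>i. \<Sum>j. (\<partial>_j u_i) (\<partial>_i u_j)\<close> into that of the squared
  divergence. The mixed term of \<open>norm_sympart_sq\<close> is thus nonnegative in the mean, and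
  the factor 2 remains.\<close>

lemma korn_compact_support:
  fixes u :: "real^'n => real^'n"
  assumes u: "smooth_vec u" "compact K" "!!x. x \<notin> K ==> u x = 0"
  shows "nsq UNIV (jac u) <= 2 * nsq UNIV (strain u)"
proof -
  have ui: "smooth_fun (%x. u x $ i)" "!!x. x \<notin> K ==> u x $ i = 0" for i using u by (auto simp: smooth_vec_def)
  have pz: "jac u x = 0" if "x \<notin> K" for x unfolding jac_def vec_eq_iff
    using partial_deriv_eq_0[of "- K" x "%y. u y $ _" 0] that ui(2) compact_imp_closed[OF u(2)] by (simp add: open_Compl)
  have int: "integrable lborel f" if "continuous_on UNIV f" "!!x. x \<notin> K ==> f x = 0" for f :: "real^'n => real"
    by (rule test_fun_integrable[OF that(1) u(2) that(2)])
  note jc = jac_continuous[OF u(1), of UNIV] and sc = strain_continuous[OF u(1), of UNIV]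
  have jcc: "continuous_on UNIV (%x. jac u x $ i $ j)" for i j by (intro continuous_intros jc)
  have i1: "integrable lborel (%x. (norm (jac u x))\<^sup>2)" by (intro int continuous_intros jc) (simp add: pz)
  have i2: "integrable lborel (%x. (norm (strain u x))\<^sup>2)"
    by (intro int continuous_intros sc) (simp add: pz strain_def sympart_simps)
  have i3: "integrable lborel (%x. jac u x $ i $ j * jac u x $ k $ l)" for i j k l
    by (intro int continuous_intros jcc) (simp add: pz)
  have "(LINT x|lborel. (\<Sum>i\<in>UNIV. \<Sum>j\<in>UNIV. jac u x $ i $ j * jac u x $ j $ i)) = (\<Sum>i\<in>UNIV. \<Sum>j\<in>UNIV. \<integral>x. jac u x $ i $ j * jac u x $ j $ i \<partial>lborel)"
    using i3 by (simp add: Bochner_Integration.integral_sum Bochner_Integration.integrable_sum)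
  also have "... = (\<Sum>i\<in>UNIV. \<Sum>j\<in>UNIV. \<integral>x. jac u x $ i $ i * jac u x $ j $ j \<partial>lborel)"
  proof (intro sum.cong refl)
    fix i j
    show "(LINT x|lborel. jac u x $ i $ j * jac u x $ j $ i) = (LINT x|lborel. jac u x $ i $ i * jac u x $ j $ j)"
      using integral_partials_swap[OF ui(1) u(2) ui(2) ui(1) ui(2), of i i j j] by (simp add: jac_def)
  qed
  also have "... = (LINT x|lborel. (\<Sum>i\<in>UNIV. \<Sum>j\<in>UNIV. jac u x $ i $ i * jac u x $ j $ j))"
    using i3 by (simp add: Bochner_Integration.integral_sum Bochner_Integration.integrable_sum)
  also have "... = (LINT x|lborel. (\<Sum>i\<in>UNIV. jac u x $ i $ i)\<^sup>2)" by (simp add: power2_eq_square sum_product)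
  also have "... >= 0" by simp
  finally have nn: "(LINT x|lborel. (\<Sum>i\<in>UNIV. \<Sum>j\<in>UNIV. jac u x $ i $ j * jac u x $ j $ i)) >= 0" .
  have "(LINT x|lborel. (norm (strain u x))\<^sup>2) = (LINT x|lborel. (norm (jac u x))\<^sup>2 / 2 + (\<Sum>i\<in>UNIV. \<Sum>j\<in>UNIV. jac u x $ i $ j * jac u x $ j $ i) / 2)"
    by (simp add: strain_def norm_sympart_sq)
  also have "... = (LINT x|lborel. (norm (jac u x))\<^sup>2) / 2 + (LINT x|lborel. (\<Sum>i\<in>UNIV. \<Sum>j\<in>UNIV. jac u x $ i $ j * jac u x $ j $ i)) / 2"
    using i1 i3 by (subst Bochner_Integration.integral_add) (auto intro!: Bochner_Integration.integrable_sum)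
  finally have "(LINT x|lborel. (norm (jac u x))\<^sup>2) <= 2 * (LINT x|lborel. (norm (strain u x))\<^sup>2)" using nn by simp
  from ennreal_leI[OF this] show ?thesis unfolding nsq_def
    by (simp add: nn_integral_eq_integral[OF i1] nn_integral_eq_integral[OF i2] ennreal_mult)
qed

subsection \<open>Poincare--Korn inequality on star-shaped pieces\<close>

lemma FTC_square_le:
  fixes F f :: "real => real"
  assumes F: "!!t. (F has_field_derivative f t) (at t)" and f: "continuous_on UNIV f"
  shows "ennreal ((F 1 - F 0)\<^sup>2) <= (\<integral>\<^sup>+t. ennreal ((f t)\<^sup>2) * indicator {0..1} t \<partial>lborel)"
proof -
  have cm: "f \<in> borel_measurable borel" by (rule borel_measurable_continuous_onI[OF f])
  have fc: "isCont f t" for t using f by (simp add: continuous_on_eq_continuous_at)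
  have ftc: "(LINT t|lborel. f t * indicator {0..1} t) = F 1 - F 0" by (rule integral_FTC_Icc_real) (use F fc in auto)
  have i: "integrable lborel (%t. indicator {0..1} t *\<^sub>R (f t)\<^sup>2)"
    by (rule borel_integrable_compact) (auto intro!: continuous_intros continuous_on_subset[OF f])
  have e: "(%t. (norm (f t * indicator {0..1} t))\<^sup>2) = (%t. indicator {0..1} t *\<^sub>R (f t)\<^sup>2)"
    by (auto simp: indicator_def fun_eq_iff)
  have e1: "(%t::real. (norm (indicator {0..1} t :: real))\<^sup>2) = indicator {0..1}" by (auto simp: indicator_def fun_eq_iff)
  have 1: "L2_on lborel (%t. f t * indicator {0..1} t)" unfolding L2_on_def e using cm i by simp
  have 2: "L2_on lborel (indicator {0..1} :: real => real)" unfolding L2_on_def e1 by (auto simp: integrable_indicator_iff)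
  have e3: "(f t * indicator {0..1} t) \<bullet> indicator {0..1} t = f t * indicator {0..1} t" for t by (auto simp: indicator_def)
  have "(F 1 - F 0)\<^sup>2 <= (LINT t|lborel. indicator {0..1} t *\<^sub>R (f t)\<^sup>2) * 1"
    using L2_Cauchy_Schwarz[OF 1 2] unfolding e e1 e3 ftc by simp
  then have "ennreal ((F 1 - F 0)\<^sup>2) <= ennreal (LINT t|lborel. indicator {0..1} t *\<^sub>R (f t)\<^sup>2)" by (intro ennreal_leI) simp
  also have "... = (\<integral>\<^sup>+t. ennreal (indicator {0..1} t *\<^sub>R (f t)\<^sup>2) \<partial>lborel)"
    by (rule nn_integral_eq_integral[symmetric, OF i]) auto
  also have "... = (\<integral>\<^sup>+t. ennreal ((f t)\<^sup>2) * indicator {0..1} t \<partial>lborel)"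
    by (intro nn_integral_cong) (auto simp: indicator_def)
  finally show ?thesis .
qed

text \<open>The derivative of \<open>u (y + t *\<^sub>R z) \<bullet> z\<close> in \<open>t\<close>
  is \<open>z \<bullet> (jac u *v z)\<close>, which only sees the strain and is at most
  \<open>(norm z)\<^sup>2\<close> times its norm. Squaring yields the fourth power.\<close>

lemma pair_strain_bound:
  fixes u :: "real^'n => real^'n"
  assumes u: "smooth_vec u"
  shows "ennreal (((u x - u y) \<bullet> (x - y))\<^sup>2)
    <= ennreal ((norm (x - y))^4) * (\<integral>\<^sup>+t. ennreal ((norm (strain u (y + t *\<^sub>R (x - y))))\<^sup>2) * indicator {0..1} t \<partial>lborel)"
proof -
  let ?z = "x - y"
  define f where "f t = ?z \<bullet> (strain u (y + t *\<^sub>R ?z) *v ?z)" for t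
  have d: "((%t. u (y + t *\<^sub>R ?z) \<bullet> ?z) has_field_derivative f t) (at t)" for t
  proof -
    have 1: "((%t. y + t *\<^sub>R ?z) has_derivative (%h. h *\<^sub>R ?z)) (at t)" by (auto intro!: derivative_eq_intros)
    have "((%t. u (y + t *\<^sub>R ?z)) has_derivative (%h. jac u (y + t *\<^sub>R ?z) *v (h *\<^sub>R ?z))) (at t)"
      using diff_chain_at[OF 1 smooth_vec_has_derivative[OF u]] by (simp add: o_def)
    then have "((%t. u (y + t *\<^sub>R ?z) \<bullet> ?z) has_derivative (%h. (jac u (y + t *\<^sub>R ?z) *v (h *\<^sub>R ?z)) \<bullet> ?z)) (at t)"
      by (rule bounded_linear.has_derivative[OF bounded_linear_inner_left])
    moreover have "(jac u (y + t *\<^sub>R ?z) *v (h *\<^sub>R ?z)) \<bullet> ?z = f t * h" for h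
      by (simp add: f_def strain_def inner_sympart matrix_vector_mult_scaleR inner_commute)
    ultimately show ?thesis by (simp add: has_field_derivative_def)
  qed
  have fc: "continuous_on UNIV f"
  proof -
    have "bounded_linear (%A :: real^'n^'n. A *v ?z)" by (rule linear_conv_bounded_linear[THEN iffD1], rule linearI)
        (simp_all add: matrix_vector_mult_add_rdistrib scaleR_matrix_vector_assoc)
    note bl = bounded_linear.continuous_on[OF this]
    have "continuous_on UNIV (%t. strain u (y + t *\<^sub>R ?z))"
      by (rule continuous_on_compose2[OF strain_continuous[OF u, of UNIV]]) (auto intro!: continuous_intros)
    from bl[OF this] show ?thesis unfolding f_def by (intro continuous_intros)
  qed
  have fb: "(f t)\<^sup>2 <= (norm ?z)^4 * (norm (strain u (y + t *\<^sub>R ?z)))\<^sup>2" for t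
  proof -
    have "\<bar>f t\<bar> <= norm ?z * norm (strain u (y + t *\<^sub>R ?z) *v ?z)" unfolding f_def by (rule Cauchy_Schwarz_ineq2)
    also have "... <= norm ?z * (norm (strain u (y + t *\<^sub>R ?z)) * norm ?z)" by (intro mult_left_mono norm_matrix_vector_le) auto
    finally have "\<bar>f t\<bar>\<^sup>2 <= (norm ?z * (norm (strain u (y + t *\<^sub>R ?z)) * norm ?z))\<^sup>2" by (intro power_mono) auto
    then show ?thesis by (simp add: power_mult_distrib power2_eq_square power4_eq_xxxx algebra_simps)
  qed
  have [measurable]: "strain u \<in> borel_measurable borel" by (rule smooth_vec_measurable(3)[OF u])
  have "ennreal (((u x - u y) \<bullet> ?z)\<^sup>2) <= (\<integral>\<^sup>+t. ennreal ((f t)\<^sup>2) * indicator {0..1} t \<partial>lborel)"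
    using FTC_square_le[OF d fc] by (simp add: inner_diff_left)
  also have "... <= (\<integral>\<^sup>+t. ennreal ((norm ?z)^4) * (ennreal ((norm (strain u (y + t *\<^sub>R ?z)))\<^sup>2) * indicator {0..1} t) \<partial>lborel)"
    by (rule nn_integral_mono) (auto simp: indicator_def ennreal_mult[symmetric] intro!: ennreal_leI fb)
  also have "... = ennreal ((norm ?z)^4) * (\<integral>\<^sup>+t. ennreal ((norm (strain u (y + t *\<^sub>R ?z)))\<^sup>2) * indicator {0..1} t \<partial>lborel)"
    by (rule nn_integral_cmult) measurable
  finally show ?thesis .
qed

text \<open>The point \<open>y + t *\<^sub>R (x - y)\<close> depends on \<open>y\<close> with factor
  \<open>1 - t\<close> and on \<open>x\<close> with factor \<open>t\<close>. Integrating first over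
  the variable whose factor is at least \<open>1/2\<close> keeps the Jacobian of the substitution
  under control, whence \<open>2 ^ CARD('n)\<close>; the other variable contributes the measure of
  its set.\<close>

lemma segment_average_bound:
  fixes g :: "real^'n => ennreal"
  assumes [measurable]: "g \<in> borel_measurable borel" "S \<in> sets borel" "Y \<in> sets borel"
  shows "(\<integral>\<^sup>+x. \<integral>\<^sup>+y. (\<integral>\<^sup>+t. g (y + t *\<^sub>R (x - y)) * indicator {0..1} t \<partial>lborel) * indicator Y y * indicator S x \<partial>lborel \<partial>lborel)
    <= ennreal (2 ^ CARD('n)) * (emeasure lborel S + emeasure lborel Y) * (\<integral>\<^sup>+x. g x \<partial>lborel)"
proof -
  let ?I = "\<integral>\<^sup>+x. g x \<partial>lborel" and ?N = "CARD('n)"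
  have sc: "(\<integral>\<^sup>+y. g (a + c *\<^sub>R y) \<partial>lborel) <= ennreal (2 ^ ?N) * ?I" if "c >= 1/2" for a c
  proof -
    have "?I = ennreal (\<bar>c\<bar> ^ ?N) * (\<integral>\<^sup>+y. g (a + c *\<^sub>R y) \<partial>lborel)" by (rule nn_integral_lborel_affine) (use that in auto)
    then have "ennreal (2 ^ ?N) * ?I = ennreal (2 ^ ?N * \<bar>c\<bar> ^ ?N) * (\<integral>\<^sup>+y. g (a + c *\<^sub>R y) \<partial>lborel)"
      by (simp add: ennreal_mult mult.assoc)
    moreover have "1 <= 2 ^ ?N * \<bar>c\<bar> ^ ?N" using one_le_power[of "2 * \<bar>c\<bar>" ?N] that by (simp add: power_mult_distrib)
    then have "1 * (\<integral>\<^sup>+y. g (a + c *\<^sub>R y) \<partial>lborel) <= ennreal (2 ^ ?N * \<bar>c\<bar> ^ ?N) * (\<integral>\<^sup>+y. g (a + c *\<^sub>R y) \<partial>lborel)"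
      by (intro mult_right_mono) (simp_all add: ennreal_ge_1)
    ultimately show ?thesis by (simp only: mult_1)
  qed
  define G where "G t x y = g (y + t *\<^sub>R (x - y)) * indicator {0..1} t * indicator Y y * indicator S x" for t :: real and x y
  have Gm[measurable]: "(%(t, x, y). G t x y) \<in> borel_measurable (borel \<Otimes>\<^sub>M borel \<Otimes>\<^sub>M borel)" unfolding G_def by measurable
  have bd: "(\<integral>\<^sup>+x. \<integral>\<^sup>+y. G t x y \<partial>lborel \<partial>lborel) <= ennreal (2 ^ ?N) * (emeasure lborel S + emeasure lborel Y) * ?I * indicator {0..1} t" for t
  proof -
    consider "t \<notin> {0..1}" | "0 <= t" "t <= 1/2" | "1/2 <= t" "t <= 1" by fastforce
    then show ?thesis
    proof cases
      case 1
      then show ?thesis by (simp add: G_def)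
    next
      case 2
      have "(\<integral>\<^sup>+x. \<integral>\<^sup>+y. G t x y \<partial>lborel \<partial>lborel) <= (\<integral>\<^sup>+x. (ennreal (2 ^ ?N) * ?I) * indicator S x \<partial>lborel)"
      proof (rule nn_integral_mono)
        fix x
        have "(\<integral>\<^sup>+y. G t x y \<partial>lborel) <= (\<integral>\<^sup>+y. g (t *\<^sub>R x + (1 - t) *\<^sub>R y) * indicator S x \<partial>lborel)"
          by (rule nn_integral_mono) (auto simp: G_def indicator_def algebra_simps)
        also have "... = (\<integral>\<^sup>+y. g (t *\<^sub>R x + (1 - t) *\<^sub>R y) \<partial>lborel) * indicator S x" by (rule nn_integral_multc) measurable
        also have "... <= (ennreal (2 ^ ?N) * ?I) * indicator S x" by (intro mult_right_mono sc) (use 2 in auto)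
        finally show "(\<integral>\<^sup>+y. G t x y \<partial>lborel) <= (ennreal (2 ^ ?N) * ?I) * indicator S x" .
      qed
      also have "... = ennreal (2 ^ ?N) * emeasure lborel S * ?I" by (subst nn_integral_cmult) (auto simp: mult_ac)
      also have "... <= ennreal (2 ^ ?N) * (emeasure lborel S + emeasure lborel Y) * ?I"
        by (intro mult_right_mono mult_left_mono) auto
      finally show ?thesis using 2 by simp
    next
      case 3
      have "(\<integral>\<^sup>+x. \<integral>\<^sup>+y. G t x y \<partial>lborel \<partial>lborel) = (\<integral>\<^sup>+y. \<integral>\<^sup>+x. G t x y \<partial>lborel \<partial>lborel)"
        by (rule lborel_pair.Fubini'[symmetric]) (unfold G_def, measurable)
      also have "... <= (\<integral>\<^sup>+y. (ennreal (2 ^ ?N) * ?I) * indicator Y y \<partial>lborel)"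
      proof (rule nn_integral_mono)
        fix y
        have "(\<integral>\<^sup>+x. G t x y \<partial>lborel) <= (\<integral>\<^sup>+x. g ((1 - t) *\<^sub>R y + t *\<^sub>R x) * indicator Y y \<partial>lborel)"
          by (rule nn_integral_mono) (auto simp: G_def indicator_def algebra_simps)
        also have "... = (\<integral>\<^sup>+x. g ((1 - t) *\<^sub>R y + t *\<^sub>R x) \<partial>lborel) * indicator Y y" by (rule nn_integral_multc) measurable
        also have "... <= (ennreal (2 ^ ?N) * ?I) * indicator Y y" by (intro mult_right_mono sc) (use 3 in auto)
        finally show "(\<integral>\<^sup>+x. G t x y \<partial>lborel) <= (ennreal (2 ^ ?N) * ?I) * indicator Y y" .
      qed
      also have "... = ennreal (2 ^ ?N) * emeasure lborel Y * ?I" by (subst nn_integral_cmult) (auto simp: mult_ac)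
      also have "... <= ennreal (2 ^ ?N) * (emeasure lborel S + emeasure lborel Y) * ?I"
        by (intro mult_right_mono mult_left_mono) auto
      finally show ?thesis using 3 by simp
    qed
  qed
  have "(\<integral>\<^sup>+x. \<integral>\<^sup>+y. (\<integral>\<^sup>+t. g (y + t *\<^sub>R (x - y)) * indicator {0..1} t \<partial>lborel) * indicator Y y * indicator S x \<partial>lborel \<partial>lborel)
      = (\<integral>\<^sup>+x. \<integral>\<^sup>+y. \<integral>\<^sup>+t. G t x y \<partial>lborel \<partial>lborel \<partial>lborel)" unfolding G_def by (simp add: nn_integral_multc)
  also have "... = (\<integral>\<^sup>+x. \<integral>\<^sup>+t. \<integral>\<^sup>+y. G t x y \<partial>lborel \<partial>lborel \<partial>lborel)"
    by (intro nn_integral_cong lborel_pair.Fubini'[symmetric]) (unfold G_def, measurable)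
  also have "... = (\<integral>\<^sup>+t. \<integral>\<^sup>+x. \<integral>\<^sup>+y. G t x y \<partial>lborel \<partial>lborel \<partial>lborel)"
    by (rule lborel_pair.Fubini') (unfold G_def, measurable)
  also have "... <= (\<integral>\<^sup>+t. ennreal (2 ^ ?N) * (emeasure lborel S + emeasure lborel Y) * ?I * indicator {0..1} (t::real) \<partial>lborel)"
    by (rule nn_integral_mono) (rule bd)
  also have "... = ennreal (2 ^ ?N) * (emeasure lborel S + emeasure lborel Y) * ?I" by (subst nn_integral_cmult) auto
  finally show ?thesis .
qed

text \<open>Only \<open>g\<close> has compact support; cutting \<open>f\<close> to that support
  makes both factors square integrable and leaves the product unchanged.\<close>

lemma nn_Cauchy_Schwarz:
  fixes f g :: "real^'n => real"
  assumes c: "continuous_on UNIV f" "continuous_on UNIV g" and K: "compact K" "K \<subseteq> Y" "!!x. x \<notin> K ==> g x = 0"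
  shows "ennreal ((LINT x|lborel. f x * g x)\<^sup>2) <= ennreal (LINT x|lborel. (g x)\<^sup>2) * (\<integral>\<^sup>+x. ennreal ((f x)\<^sup>2) * indicator Y x \<partial>lborel)"
proof -
  have [measurable]: "f \<in> borel_measurable borel" "g \<in> borel_measurable borel" "K \<in> sets borel"
    using c borel_closed[OF compact_imp_closed[OF K(1)]] by (auto intro: borel_measurable_continuous_onI)
  have i: "integrable lborel (%x. indicator K x *\<^sub>R (f x)\<^sup>2)"
    by (rule borel_integrable_compact[OF K(1)]) (auto intro!: continuous_intros continuous_on_subset[OF c(1)])
  have e: "(%x. (norm (f x * indicator K x))\<^sup>2) = (%x. indicator K x *\<^sub>R (f x)\<^sup>2)" by (auto simp: indicator_def fun_eq_iff)
  have 1: "L2_on lborel (%x. f x * indicator K x)" unfolding L2_on_def e using i by simp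
  have "integrable lborel (%x. (g x)\<^sup>2)" by (rule test_fun_integrable[OF _ K(1)]) (use c K in \<open>auto intro!: continuous_intros\<close>)
  then have 2: "L2_on lborel g" by (simp add: L2_on_def)
  have e3: "(f x * indicator K x) \<bullet> g x = f x * g x" for x using K(3) by (auto simp: indicator_def)
  have "(LINT x|lborel. f x * g x)\<^sup>2 <= (LINT x|lborel. (g x)\<^sup>2) * (LINT x|lborel. indicator K x *\<^sub>R (f x)\<^sup>2)"
    using L2_Cauchy_Schwarz[OF 1 2] unfolding e e3 by (simp add: mult.commute)
  from ennreal_leI[OF this] have "ennreal ((LINT x|lborel. f x * g x)\<^sup>2) <= ennreal (LINT x|lborel. (g x)\<^sup>2) * ennreal (LINT x|lborel. indicator K x *\<^sub>R (f x)\<^sup>2)"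
    by (simp add: ennreal_mult)
  also have "ennreal (LINT x|lborel. indicator K x *\<^sub>R (f x)\<^sup>2) = (\<integral>\<^sup>+x. ennreal (indicator K x *\<^sub>R (f x)\<^sup>2) \<partial>lborel)"
    by (rule nn_integral_eq_integral[symmetric, OF i]) auto
  also have "... <= (\<integral>\<^sup>+x. ennreal ((f x)\<^sup>2) * indicator Y x \<partial>lborel)"
    by (rule nn_integral_mono) (use K(2) in \<open>auto simp: indicator_def\<close>)
  finally show ?thesis by (simp add: mult_left_mono)
qed

text \<open>Testing \<open>(u x - u y) \<bullet> (x - y)\<close> with the derivatives of a bump function \<open>\<eta>\<close> in the variable \<open>y\<close>
  reproduces \<open>u x\<close> up to an affine map whose symmetric part is an average of the strain.\<close>
lemma poincare_korn_star:
  fixes S U :: "(real^'n) set"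
  assumes mS: "S \<in> sets borel" and mU: "U \<in> sets borel" and Sd: "S \<subseteq> ball a d" and r: "0 < \<rho>" "\<rho> <= d" and YU: "ball a \<rho> \<subseteq> U"
    and star: "!!x y. x \<in> S ==> y \<in> ball a \<rho> ==> closed_segment y x \<subseteq> U"
  shows "\<exists>C\<ge>0. \<forall>u. smooth_vec u --> (\<exists>b R. skew R & nsq S (%x. u x - (b + R *v x)) <= ennreal C * nsq U (strain u))"
proof -
  let ?N = "CARD('n)" and ?Y = "ball a \<rho>" and ?K = "cball a (\<rho>/2)"
  obtain \<eta> :: "real^'n => real" where eta: "smooth_fun \<eta>" "!!x. \<eta> x >= 0" "!!x. x \<notin> ball a (\<rho>/2) ==> \<eta> x = 0" "integral\<^sup>L lborel \<eta> = 1"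
    using bump_exists[of "\<rho>/2" a] r by auto
  have eK: "\<eta> x = 0" if "x \<notin> ?K" for x using eta(3)[of x] that by auto
  define D where "D i = partial_deriv \<eta> i" for i
  note Ds = smooth_fun_has_derivative(2)[OF eta(1), folded D_def]
  have DK: "D i x = 0" if "x \<notin> ?K" for i x
    unfolding D_def by (rule partial_deriv_eq_0[of "- ?K"]) (use that eK in \<open>auto simp: open_Compl\<close>)
  have KY: "?K \<subseteq> ?Y" using r by auto
  have int: "integrable lborel (%y. f y * g y)" if "continuous_on UNIV f" "continuous_on UNIV g" "!!x. x \<notin> ?K ==> g x = 0" for f g :: "real^'n => real"
    by (rule test_fun_integrable[of _ ?K]) (use that in \<open>auto intro!: continuous_intros\<close>)
  note ec = smooth_fun_continuous[OF eta(1), of UNIV] and Dc = smooth_fun_continuous[OF Ds, of UNIV]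
  have parts: "(LINT y|lborel. f y * D i y) = - (LINT y|lborel. partial_deriv f i y * \<eta> y)" if f: "smooth_fun f" for f :: "real^'n => real" and i
  proof -
    note fc = smooth_fun_continuous[OF f, of UNIV] smooth_fun_continuous[OF smooth_fun_has_derivative(2)[OF f], of UNIV]
    have "0 = (LINT y|lborel. partial_deriv (%y. f y * \<eta> y) i y)"
      by (rule integral_partial_deriv_eq_0(1)[symmetric, of _ ?K]) (use eK smooth_fun_mult[OF f eta(1)] in auto)
    also have "... = (LINT y|lborel. f y * D i y) + (LINT y|lborel. partial_deriv f i y * \<eta> y)"
      using int[OF fc(1) Dc DK] int[OF fc(2) ec eK] by (simp add: partial_deriv_rules(3)[OF f eta(1)] D_def)
    finally show ?thesis by simp
  qed
  \<comment> \<open>Integration by parts against the linear factor leaves the unit mass of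
    \<open>\<eta>\<close>. These moments are what reproduces \<open>u x\<close>.\<close>
  have mom: "(LINT y|lborel. (x $ j - y $ j) * D i y) = (if i = j then 1 else 0)" for x i j
  proof -
    have s: "smooth_fun (%y. x $ j - y $ j)" by (intro smooth_fun_diff smooth_fun_const smooth_fun_component)
    have "partial_deriv (%y. x $ j - y $ j) i y = - (if j = i then 1 else 0)" for y
      by (simp add: partial_deriv_rules(2)[OF smooth_fun_const smooth_fun_component])
    then show ?thesis using parts[OF s, of i] eta(4) by auto
  qed
  define \<kappa> where "\<kappa> = (\<Sum>i\<in>UNIV. \<integral>y. (D i y)\<^sup>2 \<partial>lborel)"
  define \<mu> where "\<mu> = (LINT y|lborel. (\<eta> y)\<^sup>2)"
  define mS where "mS = measure lborel S"
  have bS: "emeasure lborel S < \<infinity>"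
    using emeasure_mono[OF Sd, of lborel] emeasure_lborel_ball_finite[of a d] mS by (auto simp: less_top top_unique)
  then have eS: "emeasure lborel S = ennreal mS" unfolding mS_def by (simp add: emeasure_eq_ennreal_measure less_top[symmetric])
  define mY where "mY = measure lborel ?Y"
  have eY: "emeasure lborel ?Y = ennreal mY" unfolding mY_def using emeasure_lborel_ball_finite[of a \<rho>]
    by (simp add: emeasure_eq_ennreal_measure less_top[symmetric])
  have nn: "\<kappa> >= 0" "\<mu> >= 0" "mS >= 0" "mY >= 0" "d > 0" using r by (auto simp: \<kappa>_def \<mu>_def mS_def mY_def intro!: sum_nonneg)
  \<comment> \<open>The first summand bounds the remainder \<open>Q\<close> through pairs of points,
    the second bounds the symmetric part of the affine map; both are doubled by
    \<open>nsq_add_le\<close>.\<close>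
  define C where "C = 2 * (\<kappa> * (2 * d)^4 * 2 ^ ?N * (mS + mY)) + 2 * (d\<^sup>2 * mS * (real ?N * real ?N * \<mu>))"
  have C0: "C >= 0" unfolding C_def using nn by (intro add_nonneg_nonneg mult_nonneg_nonneg) auto
  have comb: "2 * (ennreal P * E) + 2 * (ennreal Q * E) = ennreal (2 * P + 2 * Q) * E" if "P >= 0" "Q >= 0" for P Q E
    using that by (simp add: ennreal_plus ennreal_mult distrib_right mult.assoc)
  have "\<exists>b R. skew R & nsq S (%x. u x - (b + R *v x)) <= ennreal C * nsq U (strain u)" if u: "smooth_vec u" for u
  proof -
    note uc = smooth_vec_continuous[OF u, of UNIV] and um = smooth_vec_measurable[OF u]
    have ui: "smooth_fun (%x. u x $ i)" for i using u by (simp add: smooth_vec_def)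
    have uic: "continuous_on UNIV (%x. u x $ i)" for i by (rule smooth_fun_continuous[OF ui])
    define q where "q x y = (u x - u y) \<bullet> (x - y)" for x y
    have qc: "continuous_on UNIV (q x)" for x unfolding q_def[abs_def] by (intro continuous_intros uc)
    define M :: "real^'n^'n" where "M = (\<chi> i j. \<integral>y. u y $ j * D i y \<partial>lborel)"
    define c where "c = (\<chi> i. \<integral>y. (u y \<bullet> (a - y)) * D i y \<partial>lborel)"
    define Q where "Q x = u x - (c + M *v (x - a))" for x
    \<comment> \<open>Expanding \<open>q x y\<close> separates the moments of \<open>x - y\<close>,
      which give back \<open>u x\<close>, from an affine function of \<open>x\<close> with
      coefficients \<open>c\<close> and \<open>M\<close>. What is left of \<open>u\<close> is an
      integral of \<open>q\<close>, hence controlled by the strain.\<close>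
    have Qi: "Q x $ i = (LINT y|lborel. q x y * D i y)" for x i
    proof -
      have c1: "continuous_on UNIV (%y. u y \<bullet> (a - y))" by (intro continuous_intros uc)
      have i1: "integrable lborel (%y. u y $ j * D i y)" for j by (rule int[OF uic Dc DK])
      have i2: "integrable lborel (%y. (u y \<bullet> (a - y)) * D i y)" by (rule int[OF c1 Dc DK])
      have i3: "integrable lborel (%y. (x $ j - y $ j) * D i y)" for j by (rule int[OF _ Dc DK]) (intro continuous_intros)
      have "q x y * D i y = (\<Sum>j\<in>UNIV. u x $ j * ((x $ j - y $ j) * D i y)) - ((u y \<bullet> (a - y)) * D i y + (\<Sum>j\<in>UNIV. (x $ j - a $ j) * (u y $ j * D i y)))" for y
      proof -
        have "q x y = u x \<bullet> (x - y) - (u y \<bullet> (a - y) + u y \<bullet> (x - a))" by (simp add: q_def inner_diff_left inner_diff_right)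
        moreover have "u x \<bullet> (x - y) = (\<Sum>j\<in>UNIV. u x $ j * (x $ j - y $ j))" by (simp add: inner_vec_def)
        moreover have "u y \<bullet> (x - a) = (\<Sum>j\<in>UNIV. (x $ j - a $ j) * u y $ j)" by (simp add: inner_vec_def mult.commute)
        ultimately show ?thesis by (simp only: left_diff_distrib distrib_right sum_distrib_right mult.assoc)
      qed
      then have "(LINT y|lborel. q x y * D i y) = (\<Sum>j\<in>UNIV. u x $ j * (LINT y|lborel. (x $ j - y $ j) * D i y)) - (c $ i + (\<Sum>j\<in>UNIV. (x $ j - a $ j) * M $ i $ j))"
        using i1 i2 i3 by (simp add: c_def M_def Bochner_Integration.integral_sum Bochner_Integration.integrable_sum)
      also have "(\<Sum>j\<in>UNIV. u x $ j * (LINT y|lborel. (x $ j - y $ j) * D i y)) = u x $ i"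
        by (simp add: mom if_distrib sum.delta' cong: if_cong)
      finally show ?thesis by (simp add: Q_def matrix_vector_mult_def mult.commute)
    qed
    \<comment> \<open>Integration by parts moves the derivatives from \<open>\<eta>\<close> to
      \<open>u\<close>; symmetrizing \<open>M\<close> then produces the mean of the strain.\<close>
    have sM: "sympart M $ i $ j = - (LINT y|lborel. strain u y $ i $ j * \<eta> y)" for i j
    proof -
      have jc: "continuous_on UNIV (%y. jac u y $ i $ j)" for i j by (intro continuous_intros jac_continuous[OF u])
      have ij: "integrable lborel (%y. jac u y $ i $ j * \<eta> y)" for i j by (rule int[OF jc ec eK])
      have "M $ i $ j = - (LINT y|lborel. jac u y $ j $ i * \<eta> y)" for i j
        using parts[OF ui, of j i] by (simp add: M_def jac_def)
      then have "sympart M $ i $ j = - ((LINT y|lborel. jac u y $ i $ j * \<eta> y) + (LINT y|lborel. jac u y $ j $ i * \<eta> y)) / 2"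
        by (simp add: sympart_nth)
      also have "... = - (LINT y|lborel. strain u y $ i $ j * \<eta> y)"
        using ij by (simp add: strain_def sympart_nth distrib_right add_divide_distrib)
      finally show ?thesis .
    qed
    let ?E = "nsq U (strain u)"
    have sMb: "ennreal ((norm (sympart M))\<^sup>2) <= ennreal (real ?N * real ?N * \<mu>) * ?E"
    proof -
      have 1: "ennreal ((sympart M $ i $ j)\<^sup>2) <= ennreal \<mu> * ?E" for i j
      proof -
        have sc: "continuous_on UNIV (%y. strain u y $ i $ j)" by (intro continuous_intros strain_continuous[OF u])
        have "ennreal ((sympart M $ i $ j)\<^sup>2) = ennreal ((LINT y|lborel. strain u y $ i $ j * \<eta> y)\<^sup>2)" by (simp add: sM)
        also have "... <= ennreal \<mu> * (\<integral>\<^sup>+y. ennreal ((strain u y $ i $ j)\<^sup>2) * indicator U y \<partial>lborel)"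
          unfolding \<mu>_def by (rule nn_Cauchy_Schwarz[OF sc ec compact_cball _ eK]) (use KY YU in auto)
        also have "... <= ennreal \<mu> * ?E" unfolding nsq_def
        proof (intro mult_left_mono nn_integral_mono mult_right_mono ennreal_leI)
          fix y
          have "\<bar>strain u y $ i $ j\<bar> <= norm (strain u y)"
            using component_le_norm_cart[of "strain u y $ i" j] Finite_Cartesian_Product.norm_nth_le[where x = "strain u y" and i = i] by linarith
          then show "(strain u y $ i $ j)\<^sup>2 <= (norm (strain u y))\<^sup>2" by (simp add: abs_le_square_iff[symmetric])
        qed auto
        finally show ?thesis .
      qed
      have "ennreal ((norm (sympart M))\<^sup>2) = (\<Sum>i\<in>UNIV. \<Sum>j\<in>UNIV. ennreal ((sympart M $ i $ j)\<^sup>2))"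
        unfolding norm_mat_sq by (simp add: sum_nonneg flip: sum_ennreal)
      also have "... <= (\<Sum>i\<in>(UNIV::'n set). \<Sum>j\<in>(UNIV::'n set). ennreal \<mu> * ?E)" by (intro sum_mono 1)
      also have "... = ennreal (real ?N * real ?N * \<mu>) * ?E"
        using nn by (simp add: ennreal_mult ennreal_of_nat_eq_real_of_nat mult.assoc)
      finally show ?thesis .
    qed
    have Qb: "nsq S Q <= ennreal (\<kappa> * (2 * d)^4 * 2 ^ ?N * (mS + mY)) * ?E"
    proof -
      define g where "g x = ennreal ((norm (strain u x))\<^sup>2) * indicator U x" for x
      have gm[measurable]: "g \<in> borel_measurable borel" unfolding g_def using um(3) mU by measurable
      note [measurable] = \<open>S \<in> sets borel\<close>
      have [measurable]: "?Y \<in> sets borel" by simp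
      define A where "A x y = (\<integral>\<^sup>+t. g (y + t *\<^sub>R (x - y)) * indicator {0..1} t \<partial>lborel)" for x y
      have Am[measurable]: "(%(x, y). A x y) \<in> borel_measurable (borel \<Otimes>\<^sub>M borel)" unfolding A_def by measurable
      have Am'[measurable]: "A x \<in> borel_measurable borel" for x unfolding A_def by measurable
      have "ennreal ((norm (Q x))\<^sup>2) * indicator S x <= (\<integral>\<^sup>+y. ennreal (\<kappa> * (2 * d)^4) * (A x y * indicator ?Y y * indicator S x) \<partial>lborel)" for x
      proof (cases "x \<in> S")
        case True
        have "ennreal ((norm (Q x))\<^sup>2) = (\<Sum>i\<in>UNIV. ennreal ((LINT y|lborel. q x y * D i y)\<^sup>2))"
          unfolding norm_vec_sq by (simp add: Qi)
        also have "... <= (\<Sum>i\<in>UNIV. ennreal (LINT y|lborel. (D i y)\<^sup>2) * (\<integral>\<^sup>+y. ennreal ((q x y)\<^sup>2) * indicator ?Y y \<partial>lborel))"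
          by (intro sum_mono nn_Cauchy_Schwarz[OF qc Dc compact_cball KY DK])
        also have "... = ennreal \<kappa> * (\<integral>\<^sup>+y. ennreal ((q x y)\<^sup>2) * indicator ?Y y \<partial>lborel)"
          by (simp add: \<kappa>_def sum_distrib_right flip: sum_ennreal)
        also have "... <= ennreal \<kappa> * (\<integral>\<^sup>+y. ennreal ((2 * d)^4) * (A x y * indicator ?Y y) \<partial>lborel)"
        proof (intro mult_left_mono nn_integral_mono)
          fix y
          show "ennreal ((q x y)\<^sup>2) * indicator ?Y y <= ennreal ((2 * d)^4) * (A x y * indicator ?Y y)"
          proof (cases "y \<in> ?Y")
            case y: True
            have "norm (x - y) <= 2 * d" using True y Sd r dist_triangle[of x y a] by (auto simp: dist_norm norm_minus_commute subset_eq)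
            then have n4: "ennreal ((norm (x - y))^4) <= ennreal ((2 * d)^4)" by (intro ennreal_leI power_mono) auto
            have "(\<integral>\<^sup>+t. ennreal ((norm (strain u (y + t *\<^sub>R (x - y))))\<^sup>2) * indicator {0..1} t \<partial>lborel) <= A x y"
              unfolding A_def
            proof (rule nn_integral_mono)
              fix t :: real
              have "y + t *\<^sub>R (x - y) \<in> U" if "t \<in> {0..1}"
                by (rule subsetD[OF star[OF True y]]) (use that in \<open>auto simp: in_segment algebra_simps intro!: exI[of _ t]\<close>)
              then show "ennreal ((norm (strain u (y + t *\<^sub>R (x - y))))\<^sup>2) * indicator {0..1} t <= g (y + t *\<^sub>R (x - y)) * indicator {0..1} t"
                by (auto simp: g_def indicator_def)
            qed
            from order_trans[OF pair_strain_bound[OF u, of x y] mult_mono[OF n4 this]]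
            have "ennreal ((q x y)\<^sup>2) <= ennreal ((2 * d)^4) * A x y" unfolding q_def by simp
            then show ?thesis using y by simp
          qed simp
        qed auto
        also have "... = (\<integral>\<^sup>+y. ennreal (\<kappa> * (2 * d)^4) * (A x y * indicator ?Y y * indicator S x) \<partial>lborel)"
          proof -
          have k: "ennreal (\<kappa> * (2 * d)^4) = ennreal \<kappa> * ennreal ((2 * d)^4)" using nn by (intro ennreal_mult) auto
          show ?thesis unfolding k using True
            by (subst nn_integral_cmult[symmetric], measurable) (simp only: mult.assoc indicator_simps(1) mult_1_right simp_thms)
        qed
        finally show ?thesis using True by simp
      qed simp
      then have "nsq S Q <= (\<integral>\<^sup>+x. \<integral>\<^sup>+y. ennreal (\<kappa> * (2 * d)^4) * (A x y * indicator ?Y y * indicator S x) \<partial>lborel \<partial>lborel)"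
        unfolding nsq_def by (rule nn_integral_mono)
      also have "... = ennreal (\<kappa> * (2 * d)^4) * (\<integral>\<^sup>+x. \<integral>\<^sup>+y. A x y * indicator ?Y y * indicator S x \<partial>lborel \<partial>lborel)"
        by (simp add: nn_integral_cmult del: power_mult_distrib)
      also have "... <= ennreal (\<kappa> * (2 * d)^4) * (ennreal (2 ^ ?N) * (emeasure lborel S + emeasure lborel ?Y) * (\<integral>\<^sup>+x. g x \<partial>lborel))"
        unfolding A_def by (intro mult_left_mono segment_average_bound) auto
      also have "(\<integral>\<^sup>+x. g x \<partial>lborel) = ?E" by (simp add: g_def nsq_def)
      also have "ennreal (\<kappa> * (2 * d)^4) * (ennreal (2 ^ ?N) * (emeasure lborel S + emeasure lborel ?Y) * ?E) = ennreal (\<kappa> * (2 * d)^4 * 2 ^ ?N * (mS + mY)) * ?E"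
        unfolding eS eY using nn by (simp add: ennreal_mult ennreal_plus[symmetric] mult.assoc del: ennreal_plus)
      finally show ?thesis .
    qed
    \<comment> \<open>Only the skew part of \<open>M\<close> is kept in the rigid motion; the
      symmetric part is small with the strain and joins the error.\<close>
    define R where "R = M - sympart M"
    define b where "b = c - R *v a"
    have "nsq S (%x. u x - (b + R *v x)) <= 2 * nsq S Q + 2 * nsq S (%x::real^'n. d *\<^sub>R sympart M)"
    proof (rule nsq_add_le)
      show "Q \<in> borel_measurable borel" unfolding Q_def
        by (intro borel_measurable_continuous_onI continuous_intros uc linear_continuous_on[OF matrix_vector_mul_bounded_linear, THEN continuous_on_compose2]) auto
      fix x assume "x \<in> S"
      then have n: "norm (x - a) <= d" using Sd by (auto simp: dist_norm norm_minus_commute)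
      have "u x - (b + R *v x) = Q x + sympart M *v (x - a)"
        by (simp add: Q_def b_def R_def matrix_vector_mult_diff_distrib matrix_vector_mult_diff_rdistrib)
      then have "norm (u x - (b + R *v x)) <= norm (Q x) + norm (sympart M *v (x - a))" by (simp add: norm_triangle_ineq)
      also have "norm (sympart M *v (x - a)) <= norm (sympart M) * norm (x - a)" by (rule norm_matrix_vector_le)
      also have "... <= norm (d *\<^sub>R sympart M)" using n nn mult_left_mono[OF n, of "norm (sympart M)"] by (simp add: mult.commute)
      finally show "norm (u x - (b + R *v x)) <= norm (Q x) + norm (d *\<^sub>R sympart M)" by simp
    qed (use \<open>S \<in> sets borel\<close> in auto)
    also have "nsq S (%x::real^'n. d *\<^sub>R sympart M) = ennreal (d\<^sup>2) * (ennreal ((norm (sympart M))\<^sup>2) * ennreal mS)"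
      using \<open>S \<in> sets borel\<close> eS by (simp add: nsq_def power_mult_distrib ennreal_mult nn_integral_cmult mult.assoc)
    also have "... <= ennreal (d\<^sup>2) * (ennreal (real ?N * real ?N * \<mu>) * ?E * ennreal mS)"
      by (intro mult_left_mono mult_right_mono sMb) auto
    also have "... = ennreal (d\<^sup>2 * mS * (real ?N * real ?N * \<mu>)) * ?E" using nn by (simp add: ennreal_mult mult_ac)
    also have "2 * nsq S Q + 2 * ... <= 2 * (ennreal (\<kappa> * (2 * d)^4 * 2 ^ ?N * (mS + mY)) * ?E) + 2 * (ennreal (d\<^sup>2 * mS * (real ?N * real ?N * \<mu>)) * ?E)"
      by (intro add_right_mono mult_left_mono Qb) auto
    also have "... = ennreal C * ?E"
      unfolding C_def by (rule comb) (use nn in \<open>intro mult_nonneg_nonneg add_nonneg_nonneg; simp\<close>)+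
    finally have "nsq S (%x. u x - (b + R *v x)) <= ennreal C * ?E" by (auto simp: mult_left_mono add_left_mono)
    moreover have "skew R" unfolding R_def by (rule skew_diff_sympart)
    ultimately show ?thesis by blast
  qed
  then show ?thesis using C0 by blast
qed

subsection \<open>Interior Korn inequality\<close>

lemma smooth_vec_cutoff: "smooth_fun \<eta> ==> smooth_vec u ==> smooth_vec (%x. \<eta> x *\<^sub>R u x)"
  unfolding smooth_vec_def by (simp add: smooth_fun_mult)

lemma cutoff_jac:
  assumes e: "smooth_fun \<eta>" and u: "smooth_vec u"
  shows "jac (%x. \<eta> x *\<^sub>R u x) x = \<eta> x *\<^sub>R jac u x + (\<chi> i j. u x $ i * partial_deriv \<eta> j x)"
  using partial_deriv_rules(3)[OF e, of "%y. u y $ _"] u by (simp add: jac_def vec_eq_iff smooth_vec_def mult.commute[of _ "u x $ _"])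

lemma norm_outer: "norm ((\<chi> i j. u $ i * g $ j) :: real^'n^'n) = norm u * norm g"
proof -
  have "(norm ((\<chi> i j. u $ i * g $ j) :: real^'n^'n))\<^sup>2 = (norm u * norm g)\<^sup>2"
    by (simp add: norm_mat_sq power_mult_distrib norm_vec_sq[of u] norm_vec_sq[of g] sum_product)
  then show ?thesis by (simp add: power2_eq_iff_nonneg)
qed

text \<open>The product rule adds the outer product of \<open>u\<close> with the gradient of
  \<open>\<eta>\<close>, bounded and supported in the larger ball. The set \<open>D\<close> is left
  free, with one constant for all of them, so that the estimate serves both the whole space and the
  region below a graph.\<close>

lemma cutoff_strain_bound:
  fixes \<eta> :: "real^'n => real"
  assumes e: "smooth_fun \<eta>" "!!x. 0 <= \<eta> x & \<eta> x <= 1" "!!x. x \<notin> ball p s ==> \<eta> x = 0" and s: "s < r"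
  shows "\<exists>B\<ge>0. \<forall>u D. smooth_vec u --> D \<in> sets borel -->
    nsq D (strain (%x. \<eta> x *\<^sub>R u x)) <= 2 * nsq (D \<inter> ball p r) (strain u) + ennreal B * nsq (D \<inter> ball p r) u &
    nsq D (jac (%x. \<eta> x *\<^sub>R u x)) <= 2 * nsq (D \<inter> ball p r) (jac u) + ennreal B * nsq (D \<inter> ball p r) u"
proof -
  define g where "g x = (\<chi> j. partial_deriv \<eta> j x)" for x
  have gc: "continuous_on UNIV g" unfolding g_def
    by (intro continuous_on_vec_lambda smooth_fun_continuous smooth_fun_has_derivative(2) e)
  obtain B0 where B0: "B0 >= 0" "!!x. x \<in> ball p r ==> norm (g x) <= B0"
    using continuous_bounded_on[OF bounded_ball gc] by blast
  have out: "g x = 0" "\<eta> x = 0" if "x \<notin> ball p r" for x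
  proof -
    show "\<eta> x = 0" by (rule e(3)) (use that s in auto)
    have "partial_deriv \<eta> j x = 0" for j
      by (rule partial_deriv_eq_0[of "- cball p s" _ _ 0]) (use that s e(3) in \<open>auto simp: open_Compl\<close>)
    then show "g x = 0" by (simp add: g_def vec_eq_iff)
  qed
  have key: "nsq D F <= 2 * nsq (D \<inter> ball p r) G + ennreal (2 * B0\<^sup>2) * nsq (D \<inter> ball p r) u"
    if u: "smooth_vec u" and D: "D \<in> sets borel" and G: "G \<in> borel_measurable borel"
      and F: "!!x. norm (F x) <= \<eta> x * norm (G x) + norm (u x) * norm (g x)" for u D and F G :: "real^'n => real^'n^'n"
  proof -
    have "nsq D F <= nsq (D \<inter> ball p r) F" unfolding nsq_def
    proof (rule nn_integral_mono)
      fix x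
      show "ennreal ((norm (F x))\<^sup>2) * indicator D x <= ennreal ((norm (F x))\<^sup>2) * indicator (D \<inter> ball p r) x"
      proof (cases "x \<in> ball p r")
        case False
        then show ?thesis using F[of x] out[OF False] by simp
      qed (auto simp: indicator_def)
    qed
    also have "... <= 2 * nsq (D \<inter> ball p r) G + 2 * nsq (D \<inter> ball p r) (%x. B0 *\<^sub>R u x)"
    proof (rule nsq_add_le)
      fix x assume x: "x \<in> D \<inter> ball p r"
      have "\<eta> x * norm (G x) <= norm (G x)" using e(2)[of x] by (intro mult_left_le_one_le) auto
      moreover have "norm (u x) * norm (g x) <= norm (B0 *\<^sub>R u x)" using B0 x mult_left_mono[OF B0(2)[of x], of "norm (u x)"] by (simp add: mult.commute)
      ultimately show "norm (F x) <= norm (G x) + norm (B0 *\<^sub>R u x)" using F[of x] by linarith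
    qed (use D G smooth_vec_measurable[OF u] in auto)
    also have "nsq (D \<inter> ball p r) (%x. B0 *\<^sub>R u x) = ennreal (B0\<^sup>2) * nsq (D \<inter> ball p r) u"
      by (rule nsq_scale) (use D smooth_vec_measurable[OF u] in auto)
    finally show ?thesis by (simp add: ennreal_mult mult.assoc)
  qed
  have "nsq D (strain (%x. \<eta> x *\<^sub>R u x)) <= 2 * nsq (D \<inter> ball p r) (strain u) + ennreal (2 * B0\<^sup>2) * nsq (D \<inter> ball p r) u &
    nsq D (jac (%x. \<eta> x *\<^sub>R u x)) <= 2 * nsq (D \<inter> ball p r) (jac u) + ennreal (2 * B0\<^sup>2) * nsq (D \<inter> ball p r) u"
    if u: "smooth_vec u" and D: "D \<in> sets borel" for u D
  proof (intro conjI key[OF u D] smooth_vec_measurable[OF u])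
    fix x
    let ?o = "(\<chi> i j. u x $ i * g x $ j) :: real^'n^'n"
    have j: "jac (%x. \<eta> x *\<^sub>R u x) x = \<eta> x *\<^sub>R jac u x + ?o" using cutoff_jac[OF e(1) u] by (simp add: g_def)
    then show "norm (jac (%x. \<eta> x *\<^sub>R u x) x) <= \<eta> x * norm (jac u x) + norm (u x) * norm (g x)"
      using norm_triangle_ineq[of "\<eta> x *\<^sub>R jac u x" ?o] e(2)[of x] by (simp add: norm_outer)
    have "strain (%x. \<eta> x *\<^sub>R u x) x = \<eta> x *\<^sub>R strain u x + sympart ?o" by (simp add: strain_def j sympart_simps)
    then show "norm (strain (%x. \<eta> x *\<^sub>R u x) x) <= \<eta> x * norm (strain u x) + norm (u x) * norm (g x)"
      using norm_triangle_ineq[of "\<eta> x *\<^sub>R strain u x" "sympart ?o"] e(2)[of x] norm_sympart_le[of ?o] by (simp add: norm_outer)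
  qed
  then show ?thesis by (intro exI[of _ "2 * B0\<^sup>2"]) auto
qed

lemma strain_minus_rigid:
  assumes "smooth_vec u" "skew R"
  shows "smooth_vec (%x. u x - (b + R *v x))" "jac (%x. u x - (b + R *v x)) x = jac u x - R"
    "strain (%x. u x - (b + R *v x)) x = strain u x"
  using assms smooth_vec_diff[OF assms(1) smooth_vec_affine] jac_rules(2)[OF assms(1) smooth_vec_affine]
  by (auto simp: jac_affine strain_def sympart_simps sympart_skew)

lemma cutoff_jac_on_plateau:
  assumes "smooth_fun \<eta>" "smooth_vec u" "open U" "x \<in> U" "!!y. y \<in> U ==> \<eta> y = 1"
  shows "jac (%x. \<eta> x *\<^sub>R u x) x = jac u x"
  using cutoff_jac[OF assms(1,2), of x] partial_deriv_eq_0[OF assms(3,4), of \<eta> 1] assms(4,5) by (simp add: vec_eq_iff)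

text \<open>On the fixed ball of radius 2, a rigid motion is removed by the Poincare-Korn
  inequality, the remainder is cut off, and the inequality for compact support is applied. Scaling
  makes \<open>C\<close> independent of centre and radius, as is needed when the radius shrinks
  towards a boundary.\<close>

lemma korn_ball:
  "\<exists>C\<ge>0. \<forall>(u :: real^'n => real^'n) a \<rho>. smooth_vec u --> \<rho> > 0 -->
     (\<exists>R. nsq (ball a \<rho>) (%x. jac u x - R) <= ennreal C * nsq (ball a (2 * \<rho>)) (strain u))"
proof -
  have seg: "closed_segment y x \<subseteq> ball 0 2" if "x \<in> ball 0 2" "y \<in> ball 0 1" for x y :: "real^'n"
    using that by (intro closed_segment_subset) auto
  obtain C1 where C1: "C1 >= 0" "!!u :: real^'n => real^'n. smooth_vec u ==> \<exists>b R. skew R & nsq (ball 0 2) (%x. u x - (b + R *v x)) <= ennreal C1 * nsq (ball 0 2) (strain u)"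
    using poincare_korn_star[of "ball 0 2 :: (real^'n) set" "ball 0 2" 0 2 1] seg by (auto simp: subset_iff)
  obtain \<eta> :: "real^'n => real" where e: "smooth_fun \<eta>" "!!x. 0 <= \<eta> x & \<eta> x <= 1" "!!x. x \<in> ball 0 1 ==> \<eta> x = 1" "!!x. x \<notin> ball 0 (3/2) ==> \<eta> x = 0"
    using plateau_exists[of 1 "3/2" 0] by auto
  obtain B where B: "B >= 0" "!!u. smooth_vec u ==> nsq UNIV (strain (%x. \<eta> x *\<^sub>R u x)) <= 2 * nsq (ball 0 2) (strain u) + ennreal B * nsq (ball 0 2) u"
  proof -
    have "\<exists>B\<ge>0. \<forall>u D. smooth_vec u --> D \<in> sets borel -->
      nsq D (strain (%x. \<eta> x *\<^sub>R u x)) <= 2 * nsq (D \<inter> ball 0 2) (strain u) + ennreal B * nsq (D \<inter> ball 0 2) u &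
      nsq D (jac (%x. \<eta> x *\<^sub>R u x)) <= 2 * nsq (D \<inter> ball 0 2) (jac u) + ennreal B * nsq (D \<inter> ball 0 2) u"
      by (rule cutoff_strain_bound[of _ _ "3/2"]) (use e in auto)
    then obtain B where B: "B >= 0" "\<forall>u D. smooth_vec u --> D \<in> sets borel -->
      nsq D (strain (%x. \<eta> x *\<^sub>R u x)) <= 2 * nsq (D \<inter> ball 0 2) (strain u) + ennreal B * nsq (D \<inter> ball 0 2) u" by blast
    show thesis by (rule that[OF B(1)]) (use B(2)[rule_format, of _ UNIV] in simp)
  qed
  define C where "C = 2 * (2 + B * C1)"
  have C0: "C >= 0" using B C1 by (simp add: C_def)
  have unit: "\<exists>R. nsq (ball 0 1) (%x. jac u x - R) <= ennreal C * nsq (ball 0 2) (strain u)" if u: "smooth_vec u" for u :: "real^'n => real^'n"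
  proof -
    obtain b R where R: "skew R" "nsq (ball 0 2) (%x. u x - (b + R *v x)) <= ennreal C1 * nsq (ball 0 2) (strain u)"
      using C1(2)[OF u] by blast
    let ?v = "%x. u x - (b + R *v x)"
    note sr = strain_minus_rigid[OF u R(1), of b]
    have "nsq (ball 0 1) (%x. jac u x - R) = nsq (ball 0 1) (jac (%x. \<eta> x *\<^sub>R ?v x))"
      by (rule nsq_cong) (use cutoff_jac_on_plateau[OF e(1) sr(1) open_ball[of 0 1]] e(3) sr(2) in simp)
    also have "... <= nsq UNIV (jac (%x. \<eta> x *\<^sub>R ?v x))" by (rule nsq_mono) auto
    also have "... <= 2 * nsq UNIV (strain (%x. \<eta> x *\<^sub>R ?v x))"
      by (rule korn_compact_support[of _ "cball 0 (3/2)"]) (use smooth_vec_cutoff[OF e(1) sr(1)] e(4) in auto)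
    also have "... <= 2 * (2 * nsq (ball 0 2) (strain u) + ennreal B * (ennreal C1 * nsq (ball 0 2) (strain u)))"
    proof (intro mult_left_mono)
      have "nsq (ball 0 2) (strain ?v) = nsq (ball 0 2) (strain u)" by (rule nsq_cong) (simp add: sr(3))
      then have "nsq UNIV (strain (%x. \<eta> x *\<^sub>R ?v x)) <= 2 * nsq (ball 0 2) (strain u) + ennreal B * nsq (ball 0 2) ?v"
        using B(2)[OF sr(1)] by simp
      also have "... <= 2 * nsq (ball 0 2) (strain u) + ennreal B * (ennreal C1 * nsq (ball 0 2) (strain u))"
        by (intro add_left_mono mult_left_mono R(2)) auto
      finally show "nsq UNIV (strain (%x. \<eta> x *\<^sub>R ?v x)) <= ..." .
    qed auto
    also have "... = ennreal C * nsq (ball 0 2) (strain u)"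
      unfolding C_def using B C1 by (simp add: ennreal_mult ennreal_plus distrib_right mult.assoc)
    finally show ?thesis by blast
  qed
  have "\<exists>R. nsq (ball a \<rho>) (%x. jac u x - R) <= ennreal C * nsq (ball a (2 * \<rho>)) (strain u)"
    if u: "smooth_vec u" and r: "\<rho> > 0" for u :: "real^'n => real^'n" and a \<rho>
  proof -
    \<comment> \<open>The factor \<open>1/\<rho>\<close> makes the Jacobian of \<open>v\<close>
      equal to that of \<open>u\<close> at the transported point.\<close>
    define v where "v x = (1/\<rho>) *\<^sub>R u (a + \<rho> *\<^sub>R x)" for x
    have ui: "smooth_fun (%x. u x $ i)" for i using u by (simp add: smooth_vec_def)
    note ai = smooth_fun_affine[OF ui, of a \<rho>]
    have vs: "smooth_vec v" unfolding smooth_vec_def v_def using smooth_fun_mult[OF smooth_fun_const[of "1/\<rho>"] ai(1)] by simp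
    have vj: "jac v x = jac u (a + \<rho> *\<^sub>R x)" for x
      using r ai(2) partial_deriv_rules(4)[OF ai(1) smooth_fun_const, of "1/\<rho>"] by (simp add: jac_def v_def vec_eq_iff)
    obtain R where R: "nsq (ball 0 1) (%x. jac v x - R) <= ennreal C * nsq (ball 0 2) (strain v)" using unit[OF vs] by blast
    have resc: "nsq (ball a (s * \<rho>)) F = ennreal (\<rho> ^ CARD('n)) * nsq (ball 0 s) (%x. F (a + \<rho> *\<^sub>R x))"
      if F: "F \<in> borel_measurable borel" for F :: "real^'n => real^'n^'n" and s
    proof -
      have "a + \<rho> *\<^sub>R x \<in> ball a (s * \<rho>) \<longleftrightarrow> x \<in> ball 0 s" for x using r by (simp add: dist_norm mult.commute)
      then show ?thesis
        using nn_integral_lborel_affine[of "%x. ennreal ((norm (F x))\<^sup>2) * indicator (ball a (s * \<rho>)) x" \<rho> a] r F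
        by (simp add: nsq_def indicator_def)
    qed
    have "nsq (ball a \<rho>) (%x. jac u x - R) = ennreal (\<rho> ^ CARD('n)) * nsq (ball 0 1) (%x. jac v x - R)"
      using resc[of "%x. jac u x - R" 1] smooth_vec_measurable(2)[OF u] by (simp add: vj)
    also have "... <= ennreal (\<rho> ^ CARD('n)) * (ennreal C * nsq (ball 0 2) (strain v))" by (intro mult_left_mono R) auto
    also have "... = ennreal C * nsq (ball a (2 * \<rho>)) (strain u)"
      using resc[of "strain u" 2] smooth_vec_measurable(3)[OF u] by (simp add: vj strain_def[abs_def] mult_ac)
    finally show ?thesis by blast
  qed
  then show ?thesis using C0 by blast
qed

subsection \<open>Integration along lines\<close>

text \<open>Fubini in the direction \<open>e\<close> without rotating coordinates: the unit mass of
  \<open>indicator {0<..<1} (x \<bullet> e - t)\<close> in \<open>t\<close> is inserted, the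
  integrals are exchanged and \<open>x\<close> is translated. Each line parallel to \<open>e\<close>
  is represented by its points in a slab of thickness 1.\<close>

lemma nn_integral_along_lines:
  fixes F :: "real^'n => ennreal"
  assumes [measurable]: "F \<in> borel_measurable borel" and e: "norm e = 1"
  shows "(\<integral>\<^sup>+x. F x \<partial>lborel) = (\<integral>\<^sup>+x. indicator {0<..<1} (x \<bullet> e) * (\<integral>\<^sup>+t. F (x + t *\<^sub>R e) \<partial>lborel) \<partial>lborel)"
proof -
  let ?i = "indicator {0<..<1::real} :: real => ennreal"
  have 1: "(\<integral>\<^sup>+t. ?i (x \<bullet> e - t) \<partial>lborel) = 1" for x
  proof -
    have "(\<integral>\<^sup>+t. ?i (x \<bullet> e - t) \<partial>lborel) = (\<integral>\<^sup>+t. indicator {x \<bullet> e - 1<..<x \<bullet> e} t \<partial>lborel)"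
      by (rule nn_integral_cong) (auto simp: indicator_def)
    then show ?thesis by simp
  qed
  have "(\<integral>\<^sup>+x. F x \<partial>lborel) = (\<integral>\<^sup>+x. \<integral>\<^sup>+t. F x * ?i (x \<bullet> e - t) \<partial>lborel \<partial>lborel)" by (simp add: nn_integral_cmult 1)
  also have "... = (\<integral>\<^sup>+t. \<integral>\<^sup>+x. F x * ?i (x \<bullet> e - t) \<partial>lborel \<partial>lborel)" by (rule lborel_pair.Fubini') measurable
  also have "... = (\<integral>\<^sup>+t. \<integral>\<^sup>+x. F (x + t *\<^sub>R e) * ?i (x \<bullet> e) \<partial>lborel \<partial>lborel)"
  proof (rule nn_integral_cong)
    fix t :: real
    have "e \<bullet> e = 1" using e by (simp add: norm_eq_1)
    then show "(\<integral>\<^sup>+x. F x * ?i (x \<bullet> e - t) \<partial>lborel) = (\<integral>\<^sup>+x. F (x + t *\<^sub>R e) * ?i (x \<bullet> e) \<partial>lborel)"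
      using nn_integral_lborel_affine[of "%x. F x * ?i (x \<bullet> e - t)" 1 "t *\<^sub>R e"] by (simp add: inner_add_left add.commute)
  qed
  also have "... = (\<integral>\<^sup>+x. \<integral>\<^sup>+t. F (x + t *\<^sub>R e) * ?i (x \<bullet> e) \<partial>lborel \<partial>lborel)" by (rule lborel_pair.Fubini') measurable
  also have "... = (\<integral>\<^sup>+x. ?i (x \<bullet> e) * (\<integral>\<^sup>+t. F (x + t *\<^sub>R e) \<partial>lborel) \<partial>lborel)"
    by (simp add: nn_integral_multc mult.commute)
  finally show ?thesis .
qed

subsection \<open>Special Lipschitz domains\<close>

locale special_lipschitz =
  fixes e :: "real^'n" and \<phi> :: "real^'n => real" and L :: real
  assumes e: "norm e = 1" and lip: "L-lipschitz_on UNIV \<phi>" and inv: "!!y t. \<phi> (y + t *\<^sub>R e) = \<phi> y"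
begin

text \<open>The depth below the graph along \<open>e\<close>. It is Lipschitz and affine on lines
  parallel to \<open>e\<close>, and it substitutes for the distance to the boundary.\<close>

definition h where "h x = \<phi> x - x \<bullet> e"

definition D where "D = {x. h x > 0}"

lemma L_nonneg: "L >= 0" using lip by (simp add: lipschitz_on_def)

lemma ee: "e \<bullet> e = 1" using e by (simp add: norm_eq_1)

lemma h_line: "h (x + t *\<^sub>R e) = h x - t" by (simp add: h_def inv inner_add_left ee)

lemma h_lip: "\<bar>h x - h y\<bar> <= (L + 1) * norm (x - y)"
proof -
  have "\<bar>\<phi> x - \<phi> y\<bar> <= L * norm (x - y)" using lipschitz_onD[OF lip, of x y] by (simp add: dist_norm)
  moreover have "\<bar>x \<bullet> e - y \<bullet> e\<bar> <= norm (x - y)" using Cauchy_Schwarz_ineq2[of "x - y" e] e by (simp add: inner_diff_left)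
  ultimately show ?thesis by (simp add: h_def algebra_simps abs_le_iff)
qed

lemma h_continuous: "continuous_on UNIV h"
  unfolding h_def using lipschitz_on_continuous_on[OF lip] by (intro continuous_intros)

lemma h_measurable [measurable]: "h \<in> borel_measurable borel" by (rule borel_measurable_continuous_onI[OF h_continuous])

lemma D_measurable [measurable]: "D \<in> sets borel" unfolding D_def by measurable

text \<open>The map \<open>x \<mapsto> x - s h(x) e\<close> multiplies \<open>h\<close> by \<open>1 + s\<close> along each line in direction \<open>e\<close>.\<close>
lemma stretch_integral:
  assumes [measurable]: "F \<in> borel_measurable borel" and s: "s > 0"
  shows "(\<integral>\<^sup>+x. F x * indicator D x \<partial>lborel) = ennreal (1 + s) * (\<integral>\<^sup>+x. F (x - (s * h x) *\<^sub>R e) * indicator D x \<partial>lborel)"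
proof -
  have "(\<integral>\<^sup>+t. F (x + t *\<^sub>R e) * indicator D (x + t *\<^sub>R e) \<partial>lborel) = ennreal (1 + s) *
      (\<integral>\<^sup>+t. F (x + t *\<^sub>R e - (s * h (x + t *\<^sub>R e)) *\<^sub>R e) * indicator D (x + t *\<^sub>R e) \<partial>lborel)" for x
  proof -
    have "(\<integral>\<^sup>+t. F (x + t *\<^sub>R e) * indicator D (x + t *\<^sub>R e) \<partial>lborel) =
       ennreal \<bar>1 + s\<bar> * (\<integral>\<^sup>+t. F (x + (- (s * h x) + (1 + s) * t) *\<^sub>R e) * indicator D (x + (- (s * h x) + (1 + s) * t) *\<^sub>R e) \<partial>lborel)"
      by (rule nn_integral_real_affine) (use s in auto)
    also have "(\<integral>\<^sup>+t. F (x + (- (s * h x) + (1 + s) * t) *\<^sub>R e) * indicator D (x + (- (s * h x) + (1 + s) * t) *\<^sub>R e) \<partial>lborel)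
       = (\<integral>\<^sup>+t. F (x + t *\<^sub>R e - (s * h (x + t *\<^sub>R e)) *\<^sub>R e) * indicator D (x + t *\<^sub>R e) \<partial>lborel)"
    proof (rule nn_integral_cong)
      fix t :: real
      have 1: "x + t *\<^sub>R e - (s * h (x + t *\<^sub>R e)) *\<^sub>R e = x + (- (s * h x) + (1 + s) * t) *\<^sub>R e"
        unfolding h_line by (simp add: algebra_simps)
      have "h x - (- (s * h x) + (1 + s) * t) = (1 + s) * (h x - t)" by (simp add: algebra_simps)
      then have "x + (- (s * h x) + (1 + s) * t) *\<^sub>R e \<in> D \<longleftrightarrow> x + t *\<^sub>R e \<in> D"
        unfolding D_def mem_Collect_eq h_line using s by (simp add: zero_less_mult_iff)
      then show "F (x + (- (s * h x) + (1 + s) * t) *\<^sub>R e) * indicator D (x + (- (s * h x) + (1 + s) * t) *\<^sub>R e)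
         = F (x + t *\<^sub>R e - (s * h (x + t *\<^sub>R e)) *\<^sub>R e) * indicator D (x + t *\<^sub>R e)"
        unfolding 1 by (simp add: indicator_def)
    qed
    finally show ?thesis using s by simp
  qed
  note line = this
  have "(\<integral>\<^sup>+x. F x * indicator D x \<partial>lborel) = (\<integral>\<^sup>+x. indicator {0<..<1} (x \<bullet> e) * (\<integral>\<^sup>+t. F (x + t *\<^sub>R e) * indicator D (x + t *\<^sub>R e) \<partial>lborel) \<partial>lborel)"
    by (rule nn_integral_along_lines[OF _ e]) measurable
  also have "... = (\<integral>\<^sup>+x. ennreal (1 + s) * (indicator {0<..<1} (x \<bullet> e) * (\<integral>\<^sup>+t. F (x + t *\<^sub>R e - (s * h (x + t *\<^sub>R e)) *\<^sub>R e) * indicator D (x + t *\<^sub>R e) \<partial>lborel)) \<partial>lborel)"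
    unfolding line by (simp add: mult_ac)
  also have "... = ennreal (1 + s) * (\<integral>\<^sup>+x. indicator {0<..<1} (x \<bullet> e) * (\<integral>\<^sup>+t. F (x + t *\<^sub>R e - (s * h (x + t *\<^sub>R e)) *\<^sub>R e) * indicator D (x + t *\<^sub>R e) \<partial>lborel) \<partial>lborel)"
    by (rule nn_integral_cmult) measurable
  also have "(\<integral>\<^sup>+x. indicator {0<..<1} (x \<bullet> e) * (\<integral>\<^sup>+t. F (x + t *\<^sub>R e - (s * h (x + t *\<^sub>R e)) *\<^sub>R e) * indicator D (x + t *\<^sub>R e) \<partial>lborel) \<partial>lborel)
     = (\<integral>\<^sup>+x. F (x - (s * h x) *\<^sub>R e) * indicator D x \<partial>lborel)"
    by (rule nn_integral_along_lines[OF _ e, symmetric]) measurable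
  finally show ?thesis .
qed

end

section \<open>Averages over balls whose radius is proportional to the depth\<close>

lemma nn_integral_ball_scale:
  fixes g :: "real^'n => ennreal"
  assumes [measurable]: "g \<in> borel_measurable borel" and r: "r > 0"
  shows "(\<integral>\<^sup>+y. g y * indicator (ball x r) y \<partial>lborel) = ennreal (r ^ CARD('n)) * (\<integral>\<^sup>+z. g (x + r *\<^sub>R z) * indicator (ball 0 1) z \<partial>lborel)"
proof -
  have [measurable]: "ball x r \<in> sets borel" by simp
  have "x + r *\<^sub>R z \<in> ball x r \<longleftrightarrow> z \<in> ball 0 1" for z using r by (simp add: dist_norm)
  then show ?thesis using nn_integral_lborel_affine[of "%y. g y * indicator (ball x r) y" r x] r by (simp add: indicator_def)
qed

lemma emeasure_ball_scale:
  fixes x :: "real^'n"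
  assumes "r > 0"
  shows "emeasure lborel (ball x r) = ennreal (r ^ CARD('n)) * emeasure lborel (ball (0::real^'n) 1)"
  using nn_integral_ball_scale[of "%x::real^'n. 1" r x] assms by simp

context special_lipschitz
begin

text \<open>With this factor the radius \<open>\<rho>\<close> has Lipschitz constant
  \<open>1/8\<close>, so that radii at points less than \<open>4 * \<rho> x\<close> away from
  \<open>x\<close> agree with \<open>\<rho> x\<close> up to a factor 2.\<close>

definition c where "c = 1 / (8 * (L + 1))"

lemma c_props: "c > 0" "c <= 1/8" "(L + 1) * c = 1/8" using L_nonneg by (auto simp: c_def field_simps)

definition \<rho> where "\<rho> x = c * h x"

lemma \<rho>_measurable [measurable]: "\<rho> \<in> borel_measurable borel" unfolding \<rho>_def by measurable

lemma \<rho>_pos: "\<rho> x > 0 \<longleftrightarrow> x \<in> D" using c_props(1) by (simp add: \<rho>_def D_def zero_less_mult_iff)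

lemma \<rho>_lip: "\<bar>\<rho> x - \<rho> y\<bar> <= norm (x - y) / 8"
proof -
  have "\<bar>\<rho> x - \<rho> y\<bar> = c * \<bar>h x - h y\<bar>" using c_props(1) by (simp add: \<rho>_def abs_mult flip: right_diff_distrib)
  also have "... <= c * ((L + 1) * norm (x - y))" using c_props(1) by (intro mult_left_mono h_lip) auto
  also have "... = norm (x - y) / 8" 
  proof -
    have "c * ((L + 1) * norm (x - y)) = ((L + 1) * c) * norm (x - y)" by (simp only: mult_ac)
    then show ?thesis unfolding c_props(3) by simp
  qed
  finally show ?thesis .
qed

lemma \<rho>_near:
  assumes "norm (x - y) < 4 * \<rho> x"
  shows "\<rho> x <= 2 * \<rho> y" "\<rho> y <= 2 * \<rho> x" using \<rho>_lip[of x y] assms by linarith+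

text \<open>For points of \<open>D\<close> and positive \<open>k\<close> this is the mean of
  \<open>g\<close> over \<open>ball x (k * \<rho> x)\<close> times the volume of the unit ball.
  Written over the unit ball, averages at different points can be compared pointwise under one
  integral.\<close>

definition avg :: "real => (real^'n => ennreal) => real^'n => ennreal" where
  "avg k g x = (\<integral>\<^sup>+z. g (x + (k * \<rho> x) *\<^sub>R z) * indicator (ball 0 1) z \<partial>lborel)"

lemma avg_measurable [measurable]: "g \<in> borel_measurable borel ==> avg k g \<in> borel_measurable borel"
proof -
  assume [measurable]: "g \<in> borel_measurable borel"
  have [measurable]: "ball (0::real^'n) 1 \<in> sets borel" by simp
  show ?thesis unfolding avg_def by measurable
qed

lemma avg_ball:
  assumes "g \<in> borel_measurable borel" "x \<in> D" "k > 0"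
  shows "(\<integral>\<^sup>+y. g y * indicator (ball x (k * \<rho> x)) y \<partial>lborel) = ennreal ((k * \<rho> x) ^ CARD('n)) * avg k g x"
  unfolding avg_def by (rule nn_integral_ball_scale) (use assms \<rho>_pos in auto)

lemma avg_ball':
  assumes "g \<in> borel_measurable borel" "x \<in> D" "k > 0"
  shows "avg k g x = ennreal ((1 / (k * \<rho> x)) ^ CARD('n)) * (\<integral>\<^sup>+y. g y * indicator (ball x (k * \<rho> x)) y \<partial>lborel)"
proof -
  have p: "k * \<rho> x > 0" using assms \<rho>_pos by simp
  have "ennreal ((1 / (k * \<rho> x)) ^ CARD('n)) * ennreal ((k * \<rho> x) ^ CARD('n)) = 1"
  proof -
    have "(1 / (k * \<rho> x)) ^ CARD('n) * (k * \<rho> x) ^ CARD('n) = 1"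
    proof -
      have "(1 / a) ^ n * a ^ n = 1" if "a > 0" for a :: real and n using that by (simp add: power_divide)
      then show ?thesis using p .
    qed
    then show ?thesis using p by (subst ennreal_mult[symmetric]) auto
  qed
  then show ?thesis unfolding avg_ball[OF assms] by (simp add: mult.assoc[symmetric])
qed

lemma dist_set_measurable:
  "(%(x, y). indicator (ball x (k * \<rho> x)) y :: ennreal) \<in> borel_measurable (borel \<Otimes>\<^sub>M borel)"
  "(%(x, y). indicator (ball y (k * \<rho> y)) x :: ennreal) \<in> borel_measurable (borel \<Otimes>\<^sub>M borel)"
proof -
  have "(%(x, y). if dist x y < k * \<rho> x then 1 else 0 :: ennreal) \<in> borel_measurable (borel \<Otimes>\<^sub>M borel)" by measurable
  moreover have "(%(x, y). indicator (ball x (k * \<rho> x)) y :: ennreal) = (%(x, y). if dist x y < k * \<rho> x then 1 else 0)"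
    by (auto simp: indicator_def fun_eq_iff)
  ultimately show "(%(x, y). indicator (ball x (k * \<rho> x)) y :: ennreal) \<in> borel_measurable (borel \<Otimes>\<^sub>M borel)" by simp
  have "(%(x, y). if dist y x < k * \<rho> y then 1 else 0 :: ennreal) \<in> borel_measurable (borel \<Otimes>\<^sub>M borel)" by measurable
  moreover have "(%(x, y). indicator (ball y (k * \<rho> y)) x :: ennreal) = (%(x, y). if dist y x < k * \<rho> y then 1 else 0)"
    by (auto simp: indicator_def fun_eq_iff)
  ultimately show "(%(x, y). indicator (ball y (k * \<rho> y)) x :: ennreal) \<in> borel_measurable (borel \<Otimes>\<^sub>M borel)" by simp
qed

text \<open>If \<open>y\<close> lies in \<open>ball x (k * \<rho> x)\<close> then \<open>x\<close>
  lies in \<open>ball y (2 * k * \<rho> y)\<close>, as the radii are comparable. After exchanging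
  the integrals, the weight and the volume of the larger ball each lose a factor
  \<open>2 ^ CARD('n)\<close>.\<close>

lemma avg_upper:
  assumes g[measurable]: "g \<in> borel_measurable borel" and k: "0 < k" "k <= 4"
  shows "(\<integral>\<^sup>+x. avg k g x * indicator D x \<partial>lborel) <= ennreal (4 ^ CARD('n)) * emeasure lborel (ball (0::real^'n) 1) * (\<integral>\<^sup>+y. g y * indicator D y \<partial>lborel)"
proof -
  let ?N = "CARD('n)"
  note [measurable] = dist_set_measurable
  define w where "w y = ennreal ((2 / (k * \<rho> y)) ^ ?N) * (g y * indicator D y)" for y
  have wm[measurable]: "w \<in> borel_measurable borel" unfolding w_def by measurable
  have "(\<integral>\<^sup>+x. avg k g x * indicator D x \<partial>lborel) <= (\<integral>\<^sup>+x. \<integral>\<^sup>+y. w y * indicator (ball y ((2 * k) * \<rho> y)) x \<partial>lborel \<partial>lborel)"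
  proof (rule nn_integral_mono)
    fix x
    show "avg k g x * indicator D x <= (\<integral>\<^sup>+y. w y * indicator (ball y ((2 * k) * \<rho> y)) x \<partial>lborel)"
    proof (cases "x \<in> D")
      case True
      have rx: "\<rho> x > 0" using True \<rho>_pos by simp
      have [measurable]: "ball x (k * \<rho> x) \<in> sets borel" by simp
      have "avg k g x = (\<integral>\<^sup>+y. ennreal ((1 / (k * \<rho> x)) ^ ?N) * (g y * indicator (ball x (k * \<rho> x)) y) \<partial>lborel)"
        unfolding avg_ball'[OF g True k(1)] by (rule nn_integral_cmult[symmetric]) measurable
      also have "... <= (\<integral>\<^sup>+y. w y * indicator (ball y ((2 * k) * \<rho> y)) x \<partial>lborel)"
      proof (rule nn_integral_mono)
        fix y
        show "ennreal ((1 / (k * \<rho> x)) ^ ?N) * (g y * indicator (ball x (k * \<rho> x)) y) <= w y * indicator (ball y ((2 * k) * \<rho> y)) x"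
        proof (cases "y \<in> ball x (k * \<rho> x)")
          case y: True
          have d: "norm (x - y) < k * \<rho> x" using y by (simp add: dist_norm)
          also have "k * \<rho> x <= 4 * \<rho> x" using k rx by (intro mult_right_mono) auto
          finally have n: "\<rho> x <= 2 * \<rho> y" "\<rho> y <= 2 * \<rho> x" using \<rho>_near by blast+
          then have ry: "\<rho> y > 0" using rx by linarith
          have "k * \<rho> x <= k * (2 * \<rho> y)" using n k by (intro mult_left_mono) auto
          then have "norm (x - y) < 2 * k * \<rho> y" using d by (simp add: mult_ac)
          then have b: "x \<in> ball y ((2 * k) * \<rho> y)" by (simp add: dist_norm norm_minus_commute)
          have "1 / (k * \<rho> x) <= 2 / (k * \<rho> y)" using n k rx ry by (simp add: divide_simps mult_left_mono)
          then have "(1 / (k * \<rho> x)) ^ ?N <= (2 / (k * \<rho> y)) ^ ?N" using k rx by (intro power_mono) auto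
          then show ?thesis using y b ry \<rho>_pos[of y] by (auto simp: w_def intro!: mult_right_mono ennreal_leI)
        qed simp
      qed
      finally show ?thesis using True by simp
    qed simp
  qed
  also have "... = (\<integral>\<^sup>+y. \<integral>\<^sup>+x. w y * indicator (ball y ((2 * k) * \<rho> y)) x \<partial>lborel \<partial>lborel)"
    by (rule lborel_pair.Fubini') measurable
  also have "... = (\<integral>\<^sup>+y. (ennreal (4 ^ ?N) * emeasure lborel (ball (0::real^'n) 1)) * (g y * indicator D y) \<partial>lborel)"
  proof (rule nn_integral_cong)
    fix y
    show "(\<integral>\<^sup>+x. w y * indicator (ball y ((2 * k) * \<rho> y)) x \<partial>lborel) = (ennreal (4 ^ ?N) * emeasure lborel (ball (0::real^'n) 1)) * (g y * indicator D y)"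
    proof (cases "y \<in> D")
      case True
      then have ry: "\<rho> y > 0" using \<rho>_pos by simp
      have "(2 / (k * \<rho> y)) ^ ?N * (2 * k * \<rho> y) ^ ?N = 4 ^ ?N"
        using k ry by (subst power_mult_distrib[symmetric]) (simp add: field_simps)
      then have "ennreal ((2 / (k * \<rho> y)) ^ ?N) * ennreal ((2 * k * \<rho> y) ^ ?N) = ennreal (4 ^ ?N)"
        using k ry by (subst ennreal_mult[symmetric]) auto
      moreover have "(\<integral>\<^sup>+x. w y * indicator (ball y ((2 * k) * \<rho> y)) x \<partial>lborel) = w y * (ennreal ((2 * k * \<rho> y) ^ ?N) * emeasure lborel (ball (0::real^'n) 1))"
        using emeasure_ball_scale[of "2 * k * \<rho> y" y] k ry by (simp add: nn_integral_cmult)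
      ultimately show ?thesis using True by (simp add: w_def mult.commute mult.left_commute)
    qed (simp add: w_def)
  qed
  also have "... = ennreal (4 ^ ?N) * emeasure lborel (ball (0::real^'n) 1) * (\<integral>\<^sup>+y. g y * indicator D y \<partial>lborel)"
    by (rule nn_integral_cmult) measurable
  finally show ?thesis .
qed

text \<open>Conversely, every \<open>x\<close> in \<open>ball y (\<rho> y / 2)\<close> has
  \<open>y\<close> in \<open>ball x (\<rho> x)\<close>. The weight in \<open>w\<close> is the
  inverse of the scaled volume of that half ball, so the first exchange is an equality.\<close>

lemma avg_lower:
  assumes g[measurable]: "g \<in> borel_measurable borel"
  shows "emeasure lborel (ball (0::real^'n) 1) * (\<integral>\<^sup>+y. g y * indicator D y \<partial>lborel) <= ennreal (4 ^ CARD('n)) * (\<integral>\<^sup>+x. avg 1 g x * indicator D x \<partial>lborel)"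
proof -
  let ?N = "CARD('n)"
  note [measurable] = dist_set_measurable
  define w where "w y = ennreal ((2 / \<rho> y) ^ ?N) * (g y * indicator D y)" for y
  have wm[measurable]: "w \<in> borel_measurable borel" unfolding w_def by measurable
  have "emeasure lborel (ball (0::real^'n) 1) * (\<integral>\<^sup>+y. g y * indicator D y \<partial>lborel) = (\<integral>\<^sup>+y. emeasure lborel (ball (0::real^'n) 1) * (g y * indicator D y) \<partial>lborel)"
    by (rule nn_integral_cmult[symmetric]) measurable
  also have "... = (\<integral>\<^sup>+y. \<integral>\<^sup>+x. w y * indicator (ball y ((1/2) * \<rho> y)) x \<partial>lborel \<partial>lborel)"
  proof (rule nn_integral_cong)
    fix y
    show "emeasure lborel (ball (0::real^'n) 1) * (g y * indicator D y) = (\<integral>\<^sup>+x. w y * indicator (ball y ((1/2) * \<rho> y)) x \<partial>lborel)"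
    proof (cases "y \<in> D")
      case True
      then have ry: "\<rho> y > 0" using \<rho>_pos by simp
      have "(2 / \<rho> y) ^ ?N * ((1/2) * \<rho> y) ^ ?N = 1"
        using ry by (subst power_mult_distrib[symmetric]) (simp add: field_simps)
      then have "ennreal ((2 / \<rho> y) ^ ?N) * ennreal (((1/2) * \<rho> y) ^ ?N) = 1"
        using ry by (subst ennreal_mult[symmetric]) auto
      moreover have "(\<integral>\<^sup>+x. w y * indicator (ball y ((1/2) * \<rho> y)) x \<partial>lborel) = (g y * indicator D y * emeasure lborel (ball (0::real^'n) 1)) * (ennreal ((2 / \<rho> y) ^ ?N) * ennreal (((1/2) * \<rho> y) ^ ?N))"
      proof -
        have "(\<integral>\<^sup>+x. w y * indicator (ball y ((1/2) * \<rho> y)) x \<partial>lborel) = w y * emeasure lborel (ball y ((1/2) * \<rho> y))"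
          by (rule nn_integral_cmult_indicator) simp
        also have "emeasure lborel (ball y ((1/2) * \<rho> y)) = ennreal (((1/2) * \<rho> y) ^ ?N) * emeasure lborel (ball (0::real^'n) 1)"
          by (rule emeasure_ball_scale) (use ry in simp)
        finally show ?thesis by (simp only: w_def mult_ac)
      qed
      ultimately show ?thesis by (simp add: mult.commute)
    qed (simp add: w_def)
  qed
  also have "... = (\<integral>\<^sup>+x. \<integral>\<^sup>+y. w y * indicator (ball y ((1/2) * \<rho> y)) x \<partial>lborel \<partial>lborel)"
    by (rule lborel_pair.Fubini') measurable
  also have "... <= (\<integral>\<^sup>+x. ennreal (4 ^ ?N) * (avg 1 g x * indicator D x) \<partial>lborel)"
  proof (rule nn_integral_mono)
    fix x
    have key: "x \<in> D & y \<in> ball x (1 * \<rho> x) & ennreal ((2 / \<rho> y) ^ ?N) <= ennreal (4 ^ ?N) * ennreal ((1 / (1 * \<rho> x)) ^ ?N)"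
      if y: "y \<in> D" "x \<in> ball y ((1/2) * \<rho> y)" for y
    proof -
      have ry: "\<rho> y > 0" using y \<rho>_pos by simp
      have d: "norm (y - x) < \<rho> y / 2" using y(2) by (simp add: dist_norm)
      then have n: "\<rho> y <= 2 * \<rho> x" "\<rho> x <= 2 * \<rho> y" using \<rho>_near[of y x] ry by auto
      then have rx: "\<rho> x > 0" using ry by linarith
      have "2 / \<rho> y <= 4 * (1 / \<rho> x)" using n rx ry by (simp add: field_simps)
      then have "(2 / \<rho> y) ^ ?N <= (4 * (1 / \<rho> x)) ^ ?N" using ry by (intro power_mono) auto
      also have "... = 4 ^ ?N * (1 / (1 * \<rho> x)) ^ ?N" by (simp only: power_mult_distrib mult_1)
      finally have "ennreal ((2 / \<rho> y) ^ ?N) <= ennreal (4 ^ ?N * (1 / (1 * \<rho> x)) ^ ?N)" by (rule ennreal_leI)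
      also have "... = ennreal (4 ^ ?N) * ennreal ((1 / (1 * \<rho> x)) ^ ?N)" using rx by (intro ennreal_mult) auto
      finally show ?thesis using rx \<rho>_pos d n by (auto simp: dist_norm norm_minus_commute)
    qed
    show "(\<integral>\<^sup>+y. w y * indicator (ball y ((1/2) * \<rho> y)) x \<partial>lborel) <= ennreal (4 ^ ?N) * (avg 1 g x * indicator D x)"
    proof (cases "x \<in> D")
      case True
      have [measurable]: "ball x (1 * \<rho> x) \<in> sets borel" by simp
      have "(\<integral>\<^sup>+y. w y * indicator (ball y ((1/2) * \<rho> y)) x \<partial>lborel) <= (\<integral>\<^sup>+y. (ennreal (4 ^ ?N) * ennreal ((1 / (1 * \<rho> x)) ^ ?N)) * (g y * indicator (ball x (1 * \<rho> x)) y) \<partial>lborel)"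
      proof (rule nn_integral_mono)
        fix y
        show "w y * indicator (ball y ((1/2) * \<rho> y)) x <= (ennreal (4 ^ ?N) * ennreal ((1 / (1 * \<rho> x)) ^ ?N)) * (g y * indicator (ball x (1 * \<rho> x)) y)"
        proof (cases "y \<in> D & x \<in> ball y ((1/2) * \<rho> y)")
          case True
          then have "y \<in> D" "x \<in> ball y ((1/2) * \<rho> y)" by auto
          with key[OF this] show ?thesis by (auto simp: w_def intro!: mult_right_mono)
        qed (auto simp: w_def)
      qed
      also have "... = (ennreal (4 ^ ?N) * ennreal ((1 / (1 * \<rho> x)) ^ ?N)) * (\<integral>\<^sup>+y. g y * indicator (ball x (1 * \<rho> x)) y \<partial>lborel)"
        by (rule nn_integral_cmult) measurable
      also have "... = ennreal (4 ^ ?N) * avg 1 g x"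
        by (subst avg_ball'[OF g True]) (simp_all only: mult.assoc zero_less_one)
      finally show ?thesis using True by simp
    next
      case False
      have "w y * indicator (ball y ((1/2) * \<rho> y)) x = 0" for y
        using key[of y] False by (cases "y \<in> D") (auto simp: w_def indicator_def)
      then have "(\<integral>\<^sup>+y. w y * indicator (ball y ((1/2) * \<rho> y)) x \<partial>lborel) = (\<integral>\<^sup>+y. 0 \<partial>(lborel :: (real^'n) measure))"
        by (intro nn_integral_cong)
      then show ?thesis by simp
    qed
  qed
  also have "... = ennreal (4 ^ ?N) * (\<integral>\<^sup>+x. avg 1 g x * indicator D x \<partial>lborel)" by (rule nn_integral_cmult) measurable
  finally show ?thesis .
qed

end

text \<open>Young's inequality keeps the coefficient of \<open>(norm B)\<^sup>2\<close> as close to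
  1 as desired, which matters because it competes with the Jacobian of a stretching. The difference
  of \<open>A\<close> and \<open>B\<close> is measured through a common reference
  \<open>R\<close>.\<close>

lemma norm_sq_compare:
  fixes A B R :: "'a::real_normed_vector"
  assumes "\<eta> > 0"
  shows "(norm A)\<^sup>2 <= (1 + \<eta>) * (norm B)\<^sup>2 + (1 + 1/\<eta>) * (2 * (norm (A - R))\<^sup>2 + 2 * (norm (B - R))\<^sup>2)"
proof -
  let ?a = "norm B" and ?d = "norm (A - B)"
  have "norm A <= ?a + ?d" using norm_triangle_ineq[of B "A - B"] by simp
  then have "(norm A)\<^sup>2 <= (?a + ?d)\<^sup>2" by (intro power_mono) auto
  also have "(?a + ?d)\<^sup>2 <= (1 + \<eta>) * ?a\<^sup>2 + (1 + 1/\<eta>) * ?d\<^sup>2"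
  proof -
    have "0 <= (\<eta> * ?a - ?d)\<^sup>2 / \<eta>" using assms by simp
    also have "... = \<eta> * ?a\<^sup>2 - 2 * ?a * ?d + ?d\<^sup>2 / \<eta>" using assms by (simp add: power2_eq_square field_simps)
    finally show ?thesis by (simp add: power2_eq_square algebra_simps)
  qed
  also have "?d\<^sup>2 <= 2 * (norm (A - R))\<^sup>2 + 2 * (norm (B - R))\<^sup>2" using norm_sq_diff_le[of "A - R" "B - R"] by simp
  finally show ?thesis using assms by (simp add: mult_left_mono)
qed

context special_lipschitz
begin

text \<open>The average of \<open>|jac v|\<^sup>2\<close> over the ball of radius \<open>\<rho> x\<close> is compared with the one at the stretched
  point \<open>x - s h(x) e\<close>; since the stretching has Jacobian \<open>1 + s\<close>, the latter is absorbed.\<close>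
lemma korn_special:
  "\<exists>C\<ge>0. \<forall>v. smooth_vec v --> nsq D (jac v) < \<infinity> --> nsq D (jac v) <= ennreal C * nsq D (strain v)"
proof -
  let ?N = "CARD('n)"
  obtain C0 where C0: "C0 >= 0" "!!(u :: real^'n => real^'n) a r. smooth_vec u ==> r > 0 ==>
     \<exists>R. nsq (ball a r) (%x. jac u x - R) <= ennreal C0 * nsq (ball a (2 * r)) (strain u)" using korn_ball by blast
  \<comment> \<open>The shift \<open>s * h x\<close> then equals \<open>\<rho> x / 2\<close> and the
    radius at the stretched point is at most \<open>3/2 * \<rho> x\<close>, so the ball around that
    point stays in \<open>ball x (2 * \<rho> x)\<close>.\<close>
  define s where "s = c / 2"
  \<comment> \<open>Smaller than \<open>s\<close>, so that \<open>s - \<eta>\<close> survives as a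
    positive coefficient after absorption.\<close>
  define \<eta> where "\<eta> = s / 2"
  have s: "s > 0" "\<eta> > 0" "\<eta> < s" using c_props by (auto simp: s_def \<eta>_def)
  define K1 where "K1 = C0 * 4 ^ ?N"
  define K where "K = (1 + 1/\<eta>) * (4 * K1)"
  have K: "K1 >= 0" "K >= 0" using C0 s by (auto simp: K1_def K_def)
  define T where "T x = x - (s * h x) *\<^sub>R e" for x
  have hT: "h (T x) = (1 + s) * h x" for x using h_line[of x "- (s * h x)"] by (simp add: T_def algebra_simps)
  have rT: "\<rho> (T x) = (1 + s) * \<rho> x" for x by (simp add: \<rho>_def hT)
  have TD: "T x \<in> D \<longleftrightarrow> x \<in> D" for x using s by (simp add: D_def hT zero_less_mult_iff)
  have Tball: "ball (T x) (1 * \<rho> (T x)) \<subseteq> ball x (2 * \<rho> x)" if "x \<in> D" for x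
  proof
    fix y assume y: "y \<in> ball (T x) (1 * \<rho> (T x))"
    have rx: "\<rho> x > 0" using that \<rho>_pos by simp
    have "norm (x - T x) = s * h x" using that s e by (simp add: T_def D_def)
    also have "... = \<rho> x / 2" by (simp add: s_def \<rho>_def)
    finally have "norm (x - T x) = \<rho> x / 2" .
    moreover have "norm (T x - y) < (1 + s) * \<rho> x" using y by (simp add: rT dist_norm)
    moreover have "s * \<rho> x <= (1/2) * \<rho> x" using rx c_props by (intro mult_right_mono) (auto simp: s_def)
    moreover have "norm (x - y) <= norm (x - T x) + norm (T x - y)" using norm_triangle_ineq[of "x - T x" "T x - y"] by simp
    ultimately have "norm (x - y) < 2 * \<rho> x" by (simp add: algebra_simps)
    then show "y \<in> ball x (2 * \<rho> x)" by (simp add: dist_norm)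
  qed
  obtain w where w: "emeasure lborel (ball (0::real^'n) 1) = ennreal w" "w > 0"
  proof -
    have f: "emeasure lborel (ball (0::real^'n) 1) < \<infinity>" by (rule emeasure_lborel_ball_finite)
    have "measure lborel (ball (0::real^'n) 1) > 0"
      using content_ball_pos[of 1 "0::real^'n"] by (simp add: measure_completion)
    then show ?thesis using f that[of "measure lborel (ball (0::real^'n) 1)"] by (simp add: emeasure_eq_ennreal_measure less_top[symmetric])
  qed
  \<comment> \<open>The product collects the constants of \<open>avg_lower\<close>, of the
    absorption and of \<open>avg_upper\<close>. The added 1 makes \<open>C\<close> positive, so that
    an infinite strain integral settles the claim.\<close>
  define C where "C = (4 ^ ?N / w) * ((1 + s) * K / (s - \<eta>)) * (4 ^ ?N * w) + 1"
  have Cpos: "C > 0" unfolding C_def using s K w by (intro add_nonneg_pos mult_nonneg_nonneg divide_nonneg_nonneg) auto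
  have "nsq D (jac v) <= ennreal C * nsq D (strain v)" if v: "smooth_vec v" and fin: "nsq D (jac v) < \<infinity>" for v
  proof (cases "nsq D (strain v) = \<infinity>")
    case True
    then show ?thesis using Cpos by (simp add: ennreal_mult_top)
  next
    case False
    note vm[measurable] = smooth_vec_measurable[OF v]
    define J where "J y = ennreal ((norm (jac v y))\<^sup>2)" for y
    define E where "E y = ennreal ((norm (strain v y))\<^sup>2)" for y
    have Jm[measurable]: "J \<in> borel_measurable borel" unfolding J_def by measurable
    have Em[measurable]: "E \<in> borel_measurable borel" unfolding E_def by measurable
    \<comment> \<open>The balls around \<open>x\<close> and \<open>T x\<close> both lie in
      \<open>ball x (2 * \<rho> x)\<close>, where Korn's inequality for balls supplies one matrix
      \<open>R\<close> near the Jacobian. The two averages are compared pointwise in their common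
      variable on the unit ball.\<close>
    have pt: "avg 1 J x <= ennreal (1 + \<eta>) * avg 1 J (T x) + ennreal K * avg 4 E x" if x: "x \<in> D" for x
    proof -
      have rx: "\<rho> x > 0" using x \<rho>_pos by simp
      then obtain R where R: "nsq (ball x (2 * \<rho> x)) (%y. jac v y - R) <= ennreal C0 * nsq (ball x (2 * (2 * \<rho> x))) (strain v)"
        using C0(2)[OF v, of "2 * \<rho> x" x] by auto
      define H where "H y = ennreal ((norm (jac v y - R))\<^sup>2)" for y
      have Hm[measurable]: "H \<in> borel_measurable borel" unfolding H_def by measurable
      let ?H = "%B. \<integral>\<^sup>+y. H y * indicator B y \<partial>lborel"
      have HE: "ennreal ((1 / \<rho> x) ^ ?N) * ?H (ball x (2 * \<rho> x)) <= ennreal K1 * avg 4 E x"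
      proof -
        have "?H (ball x (2 * \<rho> x)) <= ennreal C0 * (\<integral>\<^sup>+y. E y * indicator (ball x (4 * \<rho> x)) y \<partial>lborel)"
          using R by (simp add: nsq_def H_def E_def)
        also have "(\<integral>\<^sup>+y. E y * indicator (ball x (4 * \<rho> x)) y \<partial>lborel) = ennreal ((4 * \<rho> x) ^ ?N) * avg 4 E x"
          by (rule avg_ball[OF Em x]) simp
        finally have "ennreal ((1 / \<rho> x) ^ ?N) * ?H (ball x (2 * \<rho> x)) <= ennreal ((1 / \<rho> x) ^ ?N) * (ennreal C0 * (ennreal ((4 * \<rho> x) ^ ?N) * avg 4 E x))"
          by (intro mult_left_mono) auto
        also have "... = ennreal K1 * avg 4 E x"
        proof -
          have "(1 / a) ^ n * (4 * a) ^ n = 4 ^ n" if "a > 0" for a :: real and n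
            using that by (simp add: power_divide power_mult_distrib)
          then have "(1 / \<rho> x) ^ ?N * C0 * (4 * \<rho> x) ^ ?N = K1" using rx by (simp add: K1_def mult.commute mult.left_commute)
          moreover have "ennreal ((1 / \<rho> x) ^ ?N * C0 * (4 * \<rho> x) ^ ?N) = ennreal ((1 / \<rho> x) ^ ?N) * ennreal C0 * ennreal ((4 * \<rho> x) ^ ?N)"
            using rx C0 by (subst ennreal_mult, simp, simp)+ (rule refl)
          ultimately show ?thesis by (simp only: mult.assoc)
        qed
        finally show ?thesis .
      qed
      have mono: "ennreal ((1 / r) ^ ?N) * ?H B <= ennreal ((1 / \<rho> x) ^ ?N) * ?H (ball x (2 * \<rho> x))" if "r >= \<rho> x" "B \<subseteq> ball x (2 * \<rho> x)" for r B
      proof (intro mult_mono ennreal_leI power_mono nn_integral_mono)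
        show "1 / r <= 1 / \<rho> x" using that rx by (intro divide_left_mono) auto
        show "indicator B y <= (indicator (ball x (2 * \<rho> x)) y :: ennreal)" for y using that by (auto simp: indicator_def)
      qed (use that rx in auto)
      have H1: "avg 1 H x <= ennreal K1 * avg 4 E x"
        unfolding avg_ball'[OF Hm x zero_less_one] by (rule order_trans[OF mono HE]) (use rx in auto)
      have Tx: "T x \<in> D" using x TD by simp
      have H2: "avg 1 H (T x) <= ennreal K1 * avg 4 E x" unfolding avg_ball'[OF Hm Tx zero_less_one]
        by (rule order_trans[OF mono HE]) (use Tball[OF x] rx s rT in auto)
      let ?i = "indicator (ball (0::real^'n) 1) :: real^'n => ennreal"
      let ?p = "%z. x + (1 * \<rho> x) *\<^sub>R z" and ?q = "%z. T x + (1 * \<rho> (T x)) *\<^sub>R z"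
      have [measurable]: "ball (0::real^'n) 1 \<in> sets borel" by simp
      have "avg 1 J x <= (\<integral>\<^sup>+z. ennreal (1 + \<eta>) * (J (?q z) * ?i z) + (ennreal (2 * (1 + 1/\<eta>)) * (H (?p z) * ?i z) + ennreal (2 * (1 + 1/\<eta>)) * (H (?q z) * ?i z)) \<partial>lborel)"
        unfolding avg_def
      proof (rule nn_integral_mono)
        fix z
        have "J (?p z) <= ennreal ((1 + \<eta>) * (norm (jac v (?q z)))\<^sup>2 + (2 * (1 + 1/\<eta>) * (norm (jac v (?p z) - R))\<^sup>2 + 2 * (1 + 1/\<eta>) * (norm (jac v (?q z) - R))\<^sup>2))"
          unfolding J_def by (intro ennreal_leI) (use norm_sq_compare[OF s(2), of "jac v (?p z)" "jac v (?q z)" R] in \<open>simp add: algebra_simps\<close>)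
        also have "... = ennreal (1 + \<eta>) * J (?q z) + (ennreal (2 * (1 + 1/\<eta>)) * H (?p z) + ennreal (2 * (1 + 1/\<eta>)) * H (?q z))"
          using s by (simp only: J_def H_def ennreal_mult ennreal_plus add_nonneg_nonneg mult_nonneg_nonneg zero_le_power2 zero_le_numeral zero_le_one divide_nonneg_pos less_imp_le)
        finally show "J (?p z) * ?i z <= ennreal (1 + \<eta>) * (J (?q z) * ?i z) + (ennreal (2 * (1 + 1/\<eta>)) * (H (?p z) * ?i z) + ennreal (2 * (1 + 1/\<eta>)) * (H (?q z) * ?i z))"
          by (auto simp: indicator_def)
      qed
      also have "... = ennreal (1 + \<eta>) * avg 1 J (T x) + (ennreal (2 * (1 + 1/\<eta>)) * avg 1 H x + ennreal (2 * (1 + 1/\<eta>)) * avg 1 H (T x))"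
        unfolding avg_def by (subst nn_integral_add, measurable)+ (simp add: nn_integral_cmult)
      also have "... <= ennreal (1 + \<eta>) * avg 1 J (T x) + (ennreal (2 * (1 + 1/\<eta>)) * (ennreal K1 * avg 4 E x) + ennreal (2 * (1 + 1/\<eta>)) * (ennreal K1 * avg 4 E x))"
        by (intro add_left_mono add_mono mult_left_mono H1 H2) auto
      also have "ennreal (2 * (1 + 1/\<eta>)) * (ennreal K1 * avg 4 E x) + ennreal (2 * (1 + 1/\<eta>)) * (ennreal K1 * avg 4 E x) = ennreal K * avg 4 E x"
      proof -
        have "ennreal K = ennreal (2 * (1 + 1/\<eta>) * K1) + ennreal (2 * (1 + 1/\<eta>) * K1)"
          using s K by (subst ennreal_plus[symmetric]) (auto simp: K_def algebra_simps intro!: arg_cong[of _ _ ennreal])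
        also have "ennreal (2 * (1 + 1/\<eta>) * K1) = ennreal (2 * (1 + 1/\<eta>)) * ennreal K1"
          using s K by (intro ennreal_mult) auto
        finally show ?thesis by (simp only: distrib_right mult.assoc)
      qed
      finally show ?thesis .
    qed
    let ?a = "\<integral>\<^sup>+x. avg 1 J x * indicator D x \<partial>lborel" and ?b = "\<integral>\<^sup>+x. avg 4 E x * indicator D x \<partial>lborel"
    have JD: "(\<integral>\<^sup>+y. J y * indicator D y \<partial>lborel) = nsq D (jac v)" "(\<integral>\<^sup>+y. E y * indicator D y \<partial>lborel) = nsq D (strain v)"
      by (simp_all add: nsq_def J_def E_def)
    have a_up: "?a <= ennreal (4 ^ ?N) * ennreal w * nsq D (jac v)" using avg_upper[OF Jm, of 1] JD w by simp
    have b_up: "?b <= ennreal (4 ^ ?N) * ennreal w * nsq D (strain v)" using avg_upper[OF Em, of 4] JD w by simp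
    have low: "ennreal w * nsq D (jac v) <= ennreal (4 ^ ?N) * ?a" using avg_lower[OF Jm] JD w by simp
    \<comment> \<open>After multiplication by the Jacobian \<open>1 + s\<close>, the integral of the
      averages at stretched points becomes \<open>?a\<close> itself.\<close>
    have ab: "ennreal (1 + s) * ?a <= ennreal (1 + \<eta>) * ?a + ennreal (1 + s) * (ennreal K * ?b)"
    proof -
      have "?a <= (\<integral>\<^sup>+x. ennreal (1 + \<eta>) * (avg 1 J (T x) * indicator D x) + ennreal K * (avg 4 E x * indicator D x) \<partial>lborel)"
        by (rule nn_integral_mono) (use pt in \<open>auto simp: indicator_def\<close>)
      also have "... = ennreal (1 + \<eta>) * (\<integral>\<^sup>+x. avg 1 J (T x) * indicator D x \<partial>lborel) + ennreal K * ?b"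
        unfolding T_def by (subst nn_integral_add, measurable) (simp add: nn_integral_cmult)
      finally have "ennreal (1 + s) * ?a <= ennreal (1 + s) * (ennreal (1 + \<eta>) * (\<integral>\<^sup>+x. avg 1 J (T x) * indicator D x \<partial>lborel) + ennreal K * ?b)"
        by (intro mult_left_mono) auto
      also have "... = ennreal (1 + \<eta>) * (ennreal (1 + s) * (\<integral>\<^sup>+x. avg 1 J (T x) * indicator D x \<partial>lborel)) + ennreal (1 + s) * (ennreal K * ?b)"
        by (simp only: distrib_left mult_ac)
      also have "ennreal (1 + s) * (\<integral>\<^sup>+x. avg 1 J (T x) * indicator D x \<partial>lborel) = ?a"
        unfolding T_def by (rule stretch_integral[symmetric, OF _ s(1)]) measurable
      finally show ?thesis .
    qed
    obtain x where x: "nsq D (jac v) = ennreal x" "x >= 0" using fin by (cases "nsq D (jac v)") auto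
    obtain y where y: "nsq D (strain v) = ennreal y" "y >= 0" using False by (cases "nsq D (strain v)") auto
    have "?a < \<infinity>" by (rule le_less_trans[OF a_up]) (simp add: x(1) ennreal_mult_less_top)
    then obtain a where a: "?a = ennreal a" "a >= 0" by (cases ?a) auto
    have "?b < \<infinity>" by (rule le_less_trans[OF b_up]) (simp add: y(1) ennreal_mult_less_top)
    then obtain b where b: "?b = ennreal b" "b >= 0" by (cases ?b) auto
    have 1: "w * x <= 4 ^ ?N * a" using low unfolding x(1) a(1) using w x a by (simp add: ennreal_mult[symmetric])
    have 2: "b <= 4 ^ ?N * w * y" using b_up unfolding b(1) y(1) using w y b by (simp add: ennreal_mult[symmetric])
    have 3: "(1 + s) * a <= (1 + \<eta>) * a + (1 + s) * (K * b)"
      using ab unfolding a(1) b(1) using s K a b by (simp add: ennreal_mult[symmetric] ennreal_plus[symmetric] del: ennreal_plus)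
    \<comment> \<open>This subtraction requires \<open>?a\<close> to be finite, the reason for
      assuming a finite gradient integral.\<close>
    have "(s - \<eta>) * a <= (1 + s) * K * b" using 3 by (simp add: algebra_simps)
    then have "a <= (1 + s) * K / (s - \<eta>) * b" using s by (simp add: field_simps)
    also have "... <= (1 + s) * K / (s - \<eta>) * (4 ^ ?N * w * y)" using s K by (intro mult_left_mono 2) auto
    finally have "4 ^ ?N * a <= 4 ^ ?N * ((1 + s) * K / (s - \<eta>) * (4 ^ ?N * w * y))" by (intro mult_left_mono) auto
    with 1 have "w * x <= 4 ^ ?N * ((1 + s) * K / (s - \<eta>) * (4 ^ ?N * w * y))" by linarith
    then have "x <= (4 ^ ?N * ((1 + s) * K / (s - \<eta>) * (4 ^ ?N * w * y))) / w" unfolding pos_le_divide_eq[OF w(2)] by (simp only: mult.commute[of x w])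
    also have "... = (C - 1) * y" by (simp add: C_def)
    also have "... <= C * y" using y by (simp add: algebra_simps)
    finally show ?thesis unfolding x(1) y(1) using Cpos y by (simp add: ennreal_mult[symmetric] ennreal_leI)
  qed
  then show ?thesis using Cpos less_imp_le by blast
qed

end

subsection \<open>Korn inequality on a Lipschitz domain\<close>

lemma nsq_continuous_finite:
  assumes "bounded B" "continuous_on UNIV F" "!!x. x \<in> U ==> x \<notin> B ==> F x = 0"
  shows "nsq U F < \<infinity>"
proof -
  have K: "compact (closure B)" using assms(1) by simp
  have i: "integrable lborel (%x. indicator (closure B) x *\<^sub>R (norm (F x))\<^sup>2)"
    by (rule borel_integrable_compact[OF K]) (intro continuous_intros continuous_on_subset[OF assms(2)], simp)
  have "nsq U F <= (\<integral>\<^sup>+x. ennreal (indicator (closure B) x *\<^sub>R (norm (F x))\<^sup>2) \<partial>lborel)" unfolding nsq_def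
  proof (rule nn_integral_mono)
    fix x
    show "ennreal ((norm (F x))\<^sup>2) * indicator U x <= ennreal (indicator (closure B) x *\<^sub>R (norm (F x))\<^sup>2)"
      using assms(3)[of x] closure_subset[of B] by (auto simp: indicator_def)
  qed
  also have "... < \<infinity>" by (subst nn_integral_eq_integral[OF i]) auto
  finally show ?thesis .
qed

lemma nsq_le_sum:
  assumes "finite P" "\<Omega> \<subseteq> (\<Union>p\<in>P. A p)" "!!p. p \<in> P ==> A p \<in> sets borel" "F \<in> borel_measurable borel" "\<Omega> \<in> sets borel"
  shows "nsq \<Omega> F <= (\<Sum>p\<in>P. nsq (\<Omega> \<inter> A p) F)"
proof -
  have "nsq \<Omega> F <= (\<integral>\<^sup>+x. (\<Sum>p\<in>P. ennreal ((norm (F x))\<^sup>2) * indicator (\<Omega> \<inter> A p) x) \<partial>lborel)" unfolding nsq_def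
  proof (rule nn_integral_mono)
    fix x
    show "ennreal ((norm (F x))\<^sup>2) * indicator \<Omega> x <= (\<Sum>p\<in>P. ennreal ((norm (F x))\<^sup>2) * indicator (\<Omega> \<inter> A p) x)"
    proof (cases "x \<in> \<Omega>")
      case True
      then obtain p where p: "p \<in> P" "x \<in> A p" using assms(2) by blast
      have "ennreal ((norm (F x))\<^sup>2) * indicator (\<Omega> \<inter> A p) x <= (\<Sum>p\<in>P. ennreal ((norm (F x))\<^sup>2) * indicator (\<Omega> \<inter> A p) x)"
        by (rule member_le_sum[OF p(1)]) (use assms(1) in auto)
      then show ?thesis using True p by simp
    qed simp
  qed
  also have "... = (\<Sum>p\<in>P. nsq (\<Omega> \<inter> A p) F)" unfolding nsq_def using assms by (subst nn_integral_sum) auto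
  finally show ?thesis .
qed

lemma frontier_chart:
  fixes \<Omega> :: "(real^'n) set"
  assumes "lipschitz_boundary \<Omega>" "p \<in> frontier \<Omega>"
  obtains e \<phi> L r where "special_lipschitz e \<phi> L" "r > 0" "\<Omega> \<inter> ball p r = special_lipschitz.D e \<phi> \<inter> ball p r"
proof -
  obtain e r \<phi> L where c: "norm e = 1" "r > 0" "L-lipschitz_on UNIV \<phi>"
    "!!y t. \<phi> (y + t *\<^sub>R e) = \<phi> y" "\<Omega> \<inter> ball p r = {y \<in> ball p r. y \<bullet> e < \<phi> y}"
    using bspec[OF assms(1)[unfolded lipschitz_boundary_def] assms(2)] by blast
  have s: "special_lipschitz e \<phi> L" using c by unfold_locales auto
  have "special_lipschitz.D e \<phi> = {y. y \<bullet> e < \<phi> y}"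
    unfolding special_lipschitz.D_def[OF s] special_lipschitz.h_def[OF s] by auto
  then have "\<Omega> \<inter> ball p r = special_lipschitz.D e \<phi> \<inter> ball p r" using c(5) by blast
  then show ?thesis by (rule that[OF s c(2)])
qed

text \<open>Near \<open>p\<close> the domain coincides with a set \<open>D\<close>, the whole space
  at interior points and the region below a graph otherwise, on which Korn's inequality holds for
  compactly supported fields. The cutoff costs the lower order term \<open>nsq \<Omega> u\<close>,
  and its compact support supplies the finiteness required by \<open>korn_special\<close>.\<close>

lemma korn_local_gradient:
  fixes \<Omega> :: "(real^'n) set"
  assumes O: "open \<Omega>" "lipschitz_boundary \<Omega>" and p: "p \<in> closure \<Omega>"
  shows "\<exists>r>0. \<exists>C\<ge>0. \<forall>u. smooth_vec u --> nsq (\<Omega> \<inter> ball p r) (jac u) <= ennreal C * (nsq \<Omega> (strain u) + nsq \<Omega> u)"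
proof -
  obtain r D C0 where rD: "r > 0" "D \<in> sets borel" "\<Omega> \<inter> ball p r = D \<inter> ball p r" "C0 >= 0"
    "!!v K. smooth_vec v ==> compact K ==> (\<forall>x. x \<notin> K --> v x = 0) ==> nsq D (jac v) <= ennreal C0 * nsq D (strain v)"
  proof (cases "p \<in> \<Omega>")
    case True
    then obtain r where r: "r > 0" "ball p r \<subseteq> \<Omega>" using O(1) open_contains_ball by blast
    show thesis
    proof (rule that[of r UNIV 2])
      show "nsq UNIV (jac v) <= ennreal 2 * nsq UNIV (strain v)" if "smooth_vec v" "compact K" "\<forall>x. x \<notin> K --> v x = 0" for v :: "real^'n => real^'n" and K
        using korn_compact_support[OF that(1,2)] that(3) by simp
    qed (use r in auto)
  next
    case False
    then have "p \<in> frontier \<Omega>" using p O(1) by (simp add: frontier_def interior_open)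
    then obtain e \<phi> L r where c: "special_lipschitz e \<phi> L" "r > 0" "\<Omega> \<inter> ball p r = special_lipschitz.D e \<phi> \<inter> ball p r"
      using frontier_chart[OF O(2)] by metis
    interpret special_lipschitz e \<phi> L by (rule c)
    obtain C where C: "C >= 0" "!!v. smooth_vec v ==> nsq D (jac v) < \<infinity> ==> nsq D (jac v) <= ennreal C * nsq D (strain v)"
      using korn_special by blast
    show thesis
    proof (rule that[OF c(2) D_measurable c(3) C(1)])
      fix v :: "real^'n => real^'n" and K assume v: "smooth_vec v" "compact K" "\<forall>x. x \<notin> K --> v x = 0"
      have "jac v x = 0" if "x \<notin> K" for x unfolding jac_def vec_eq_iff
        using partial_deriv_eq_0[of "- K" x "%y. v y $ _" 0] that v(3) compact_imp_closed[OF v(2)] by (simp add: open_Compl)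
      then have "nsq D (jac v) < \<infinity>" by (intro nsq_continuous_finite[OF compact_imp_bounded[OF v(2)] jac_continuous[OF v(1)]])
      then show "nsq D (jac v) <= ennreal C * nsq D (strain v)" by (rule C(2)[OF v(1)])
    qed
  qed
  obtain \<eta> :: "real^'n => real" where e: "smooth_fun \<eta>" "!!x. 0 <= \<eta> x & \<eta> x <= 1" "!!x. x \<in> ball p (r/3) ==> \<eta> x = 1" "!!x. x \<notin> ball p (r/2) ==> \<eta> x = 0"
    using plateau_exists[of "r/3" "r/2" p] rD(1) by auto
  have "\<exists>B\<ge>0. \<forall>u D. smooth_vec u --> D \<in> sets borel -->
      nsq D (strain (%x. \<eta> x *\<^sub>R u x)) <= 2 * nsq (D \<inter> ball p r) (strain u) + ennreal B * nsq (D \<inter> ball p r) u &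
      nsq D (jac (%x. \<eta> x *\<^sub>R u x)) <= 2 * nsq (D \<inter> ball p r) (jac u) + ennreal B * nsq (D \<inter> ball p r) u"
    by (rule cutoff_strain_bound[of _ _ "r/2"]) (use e rD(1) in auto)
  then obtain B where B: "B >= 0" "\<forall>u D. smooth_vec u --> D \<in> sets borel -->
      nsq D (strain (%x. \<eta> x *\<^sub>R u x)) <= 2 * nsq (D \<inter> ball p r) (strain u) + ennreal B * nsq (D \<inter> ball p r) u" by blast
  have "nsq (\<Omega> \<inter> ball p (r/3)) (jac u) <= ennreal (C0 * (2 + B)) * (nsq \<Omega> (strain u) + nsq \<Omega> u)" if u: "smooth_vec u" for u
  proof -
    let ?v = "%x. \<eta> x *\<^sub>R u x"
    have sub: "\<Omega> \<inter> ball p (r/3) \<subseteq> D"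
    proof
      fix x assume "x \<in> \<Omega> \<inter> ball p (r/3)"
      then have "x \<in> \<Omega> \<inter> ball p r" using rD(1) by auto
      then show "x \<in> D" using rD(3) by auto
    qed
    have "nsq (\<Omega> \<inter> ball p (r/3)) (jac u) = nsq (\<Omega> \<inter> ball p (r/3)) (jac ?v)"
      by (rule nsq_cong) (use cutoff_jac_on_plateau[OF e(1) u open_ball[of p "r/3"]] e(3) in simp)
    also have "... <= nsq D (jac ?v)" by (rule nsq_mono) (use sub in auto)
    also have "... <= ennreal C0 * nsq D (strain ?v)"
      by (rule rD(5)[OF smooth_vec_cutoff[OF e(1) u] compact_cball[of p "r/2"]]) (use e(4) in auto)
    also have "... <= ennreal C0 * (2 * nsq (D \<inter> ball p r) (strain u) + ennreal B * nsq (D \<inter> ball p r) u)"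
      by (intro mult_left_mono) (use B(2) u rD(2) in auto)
    also have "... <= ennreal C0 * (ennreal (2 + B) * nsq \<Omega> (strain u) + ennreal (2 + B) * nsq \<Omega> u)"
    proof (intro mult_left_mono add_mono mult_mono)
      show "nsq (D \<inter> ball p r) (strain u) <= nsq \<Omega> (strain u)" "nsq (D \<inter> ball p r) u <= nsq \<Omega> u"
        by (rule nsq_mono; use rD(3) in blast)+
      show "2 <= ennreal (2 + B)" using B(1) by (metis ennreal_leI ennreal_numeral le_add_same_cancel1 zero_le_numeral)
      show "ennreal B <= ennreal (2 + B)" by (intro ennreal_leI) simp
    qed auto
    also have "... = ennreal (C0 * (2 + B)) * (nsq \<Omega> (strain u) + nsq \<Omega> u)"
    proof -
      have "ennreal (C0 * (2 + B)) = ennreal C0 * ennreal (2 + B)" using rD(4) B(1) by (intro ennreal_mult) auto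
      then show ?thesis by (simp only: distrib_left mult.assoc)
    qed
    finally show ?thesis .
  qed
  moreover have "r/3 > 0" "C0 * (2 + B) >= 0" using rD(1,4) B(1) by auto
  ultimately show ?thesis by blast
qed

section \<open>Poincare-Korn pieces and their chaining through overlaps\<close>

definition pk_piece :: "(real^'n) set => (real^'n) set => bool" where
  "pk_piece \<Omega> P \<longleftrightarrow> open P & P \<subseteq> \<Omega> & P ~= {} & (\<exists>C\<ge>0. \<forall>u. smooth_vec u -->
     (\<exists>b R. skew R & nsq P (%x. u x - (b + R *v x)) <= ennreal C * nsq \<Omega> (strain u)))"

text \<open>By the cone property all points of the domain near \<open>p\<close> see every point of
  one ball around \<open>p + e0 *\<^sub>R c\<close>. The connecting segments may leave the piece but
  stay in the domain, which is why a piece is measured against the strain on all of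
  \<open>\<Omega>\<close>.\<close>

lemma pk_piece_local:
  fixes \<Omega> :: "(real^'n) set"
  assumes O: "open \<Omega>" "lipschitz_boundary \<Omega>" and p: "p \<in> closure \<Omega>"
  shows "\<exists>r>0. pk_piece \<Omega> (\<Omega> \<inter> ball p r)"
proof -
  obtain r e0 c k where cone: "cone_at \<Omega> p r e0 c k" using cone_at_exists[OF O p] by blast
  then have pos: "r > 0" "e0 > 0" "k > 0" by (auto simp: cone_at_def)
  \<comment> \<open>For \<open>x\<close> within \<open>d\<close> of \<open>p\<close> and
    \<open>y\<close> within \<open>d\<close> of \<open>a\<close>, the direction
    \<open>(1 / e0) *\<^sub>R (y - x)\<close> deviates from \<open>c\<close> by at most
    \<open>2 * d / e0 = k\<close>.\<close>
  define d where "d = k * e0 / 2"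
  define r' where "r' = min r d"
  have d: "d > 0" "r' > 0" "r' <= r" "r' <= d" using pos by (auto simp: d_def r'_def)
  define a where "a = p + e0 *\<^sub>R c"
  have seg: "closed_segment y x \<subseteq> \<Omega>" if x: "x \<in> \<Omega> \<inter> ball p r'" and y: "y \<in> ball a d" for x y
  proof
    fix w assume "w \<in> closed_segment y x"
    then have "w \<in> closed_segment x y" by (simp add: closed_segment_commute)
    then obtain t where t: "0 <= t" "t <= 1" "w = (1 - t) *\<^sub>R x + t *\<^sub>R y" by (auto simp: in_segment)
    define z where "z = (1 / e0) *\<^sub>R (y - x)"
    have yx: "y - x = e0 *\<^sub>R z" using pos by (simp add: z_def)
    have "norm (e0 *\<^sub>R (z - c)) = norm ((y - a) - (x - p))" by (simp add: scaleR_diff_right flip: yx) (simp add: a_def algebra_simps)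
    also have "... <= norm (y - a) + norm (x - p)" by (rule norm_triangle_ineq4)
    also have "... <= 2 * d" using x y d by (simp add: dist_norm norm_minus_commute)
    finally have "e0 * norm (z - c) <= e0 * k" using pos by (simp add: d_def mult.commute)
    then have z: "z \<in> cball c k" using pos by (simp add: dist_norm norm_minus_commute)
    show "w \<in> \<Omega>"
    proof (cases "t = 0")
      case True
      then show ?thesis using t x by simp
    next
      case False
      then have "x + (t * e0) *\<^sub>R z \<in> \<Omega>"
        using cone x z t pos d mult_le_one[of t] unfolding cone_at_def by (auto simp: mult_left_le_one_le)
      moreover have "w = x + (t * e0) *\<^sub>R z" 
      proof -
        have "w = x + t *\<^sub>R (y - x)" using t(3) by (simp add: algebra_simps)
        then show ?thesis unfolding yx by simp
      qed
      ultimately show ?thesis by simp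
    qed
  qed
  obtain x0 where x0: "x0 \<in> \<Omega> \<inter> ball p r'" using p d(2) unfolding closure_approachable by (auto simp: dist_commute)
  have YU: "ball a d \<subseteq> \<Omega>" using seg[OF x0] by (auto simp: subset_iff)
  have Sd: "\<Omega> \<inter> ball p r' \<subseteq> ball a (d + r' + norm (e0 *\<^sub>R c))"
  proof
    fix x assume "x \<in> \<Omega> \<inter> ball p r'"
    then have "norm (p - x) < r'" by (simp add: dist_norm)
    then show "x \<in> ball a (d + r' + norm (e0 *\<^sub>R c))"
      using norm_triangle_ineq[of "p - x" "e0 *\<^sub>R c"] d by (simp add: a_def dist_norm algebra_simps)
  qed
  have "\<exists>C\<ge>0. \<forall>u. smooth_vec u --> (\<exists>b R. skew R & nsq (\<Omega> \<inter> ball p r') (%x. u x - (b + R *v x)) <= ennreal C * nsq \<Omega> (strain u))"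
    by (rule poincare_korn_star[OF _ _ Sd d(1) _ YU seg]) (use O d in \<open>auto simp: add_nonneg_nonneg\<close>)
  then have "pk_piece \<Omega> (\<Omega> \<inter> ball p r')" unfolding pk_piece_def using O(1) x0 by (auto intro: open_Int)
  then show ?thesis using d(2) by blast
qed

text \<open>A quantitative equivalence of norms on affine maps: the value at the barycentre
  \<open>m\<close> of a bump and the entries of the matrix are integrals of the map against the bump
  and its derivatives, hence bounded by the L2 norm on the ball.\<close>

lemma affine_bounded_by_nsq:
  fixes q :: "real^'n"
  assumes d: "d > 0" and M: "M >= 0"
  shows "\<exists>K\<ge>0. \<forall>b (R :: real^'n^'n) x. norm x <= M --> ennreal ((norm (b + R *v x))\<^sup>2) <= ennreal K * nsq (ball q d) (%x. b + R *v x)"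
proof -
  let ?K = "cball q (d/2)"
  obtain \<eta> :: "real^'n => real" where eta: "smooth_fun \<eta>" "!!x. \<eta> x >= 0" "!!x. x \<notin> ball q (d/2) ==> \<eta> x = 0" "integral\<^sup>L lborel \<eta> = 1"
    using bump_exists[of "d/2" q] d by auto
  have eK: "\<eta> x = 0" if "x \<notin> ?K" for x using eta(3)[of x] that by auto
  define D where "D i = partial_deriv \<eta> i" for i
  note Ds = smooth_fun_has_derivative(2)[OF eta(1), folded D_def]
  have DK: "D i x = 0" if "x \<notin> ?K" for i x
    unfolding D_def by (rule partial_deriv_eq_0[of "- ?K"]) (use that eK in \<open>auto simp: open_Compl\<close>)
  note ec = smooth_fun_continuous[OF eta(1), of UNIV] and Dc = smooth_fun_continuous[OF Ds, of UNIV]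
  have int: "integrable lborel (%y. f y * g y)" if "continuous_on UNIV f" "continuous_on UNIV g" "!!x. x \<notin> ?K ==> g x = 0" for f g :: "real^'n => real"
    by (rule test_fun_integrable[of _ ?K]) (use that in \<open>auto intro!: continuous_intros\<close>)
  have ie: "integrable lborel \<eta>" by (rule test_fun_integrable[OF ec compact_cball eK])
  have KB: "?K \<subseteq> ball q d" using d by auto
  define m where "m = (\<chi> j. \<integral>y. y $ j * \<eta> y \<partial>lborel)"
  define \<mu> where "\<mu> = (LINT y|lborel. (\<eta> y)\<^sup>2)"
  define \<kappa> where "\<kappa> = (\<Sum>j\<in>UNIV. \<integral>y. (D j y)\<^sup>2 \<partial>lborel)"
  have nn: "\<mu> >= 0" "\<kappa> >= 0" by (auto simp: \<mu>_def \<kappa>_def intro!: sum_nonneg)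
  let ?N = "real CARD('n)"
  define K where "K = 2 * (?N * \<mu>) + 2 * ((M + norm m)\<^sup>2 * (?N * \<kappa>))"
  have K0: "K >= 0" using nn by (simp add: K_def)
  have "ennreal ((norm (b + R *v x))\<^sup>2) <= ennreal K * nsq (ball q d) (%x. b + R *v x)" if x: "norm x <= M" for b and R :: "real^'n^'n" and x
  proof -
    let ?E = "nsq (ball q d) (%x. b + R *v x)"
    let ?f = "%i y. (b + R *v y) $ i"
    have fs: "smooth_fun (?f i)" for i using smooth_vec_affine[of b R] by (simp add: smooth_vec_def)
    note fc = smooth_fun_continuous[OF fs, of UNIV]
    have fE: "(\<integral>\<^sup>+y. ennreal ((?f i y)\<^sup>2) * indicator (ball q d) y \<partial>lborel) <= ?E" for i unfolding nsq_def
    proof (intro nn_integral_mono mult_right_mono ennreal_leI)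
      fix y
      have "\<bar>?f i y\<bar> <= norm (b + R *v y)" by (rule component_le_norm_cart)
      then show "(?f i y)\<^sup>2 <= (norm (b + R *v y))\<^sup>2" by (simp add: abs_le_square_iff[symmetric])
    qed auto
    define c where "c = b + R *v m"
    have ci: "c $ i = (LINT y|lborel. ?f i y * \<eta> y)" for i
    proof -
      have "?f i y * \<eta> y = b $ i * \<eta> y + (\<Sum>j\<in>UNIV. R $ i $ j * (y $ j * \<eta> y))" for y
        by (simp add: matrix_vector_mult_def distrib_right sum_distrib_right mult.assoc)
      moreover note ie
      moreover have "integrable lborel (%y. y $ j * \<eta> y)" for j by (rule int[OF _ ec eK]) (intro continuous_intros)
      ultimately show ?thesis using eta(4) by (simp add: c_def m_def matrix_vector_mult_def Bochner_Integration.integral_sum)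
    qed
    have Rij: "R $ i $ j = - (LINT y|lborel. ?f i y * D j y)" for i j
    proof -
      have pf: "partial_deriv (?f i) j y = R $ i $ j" for y using jac_affine[of b R y] by (simp add: jac_def vec_eq_iff)
      have "0 = (LINT y|lborel. partial_deriv (%y. ?f i y * \<eta> y) j y)"
        by (rule integral_partial_deriv_eq_0(1)[symmetric, of _ ?K]) (use eK smooth_fun_mult[OF fs eta(1)] in auto)
      also have "... = (LINT y|lborel. ?f i y * D j y + R $ i $ j * \<eta> y)"
        by (simp only: partial_deriv_rules(3)[OF fs eta(1)] pf D_def)
      also have "... = (LINT y|lborel. ?f i y * D j y) + R $ i $ j"
        using int[OF fc Dc DK, of i j] ie eta(4) by (subst Bochner_Integration.integral_add) auto
      finally show ?thesis by simp
    qed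
    have cb: "ennreal ((norm c)\<^sup>2) <= ennreal (?N * \<mu>) * ?E"
    proof -
      have "ennreal ((c $ i)\<^sup>2) <= ennreal \<mu> * ?E" for i
        unfolding ci \<mu>_def by (rule order_trans[OF nn_Cauchy_Schwarz[OF fc ec compact_cball KB eK] mult_left_mono[OF fE]]) auto
      then have "(\<Sum>i\<in>UNIV. ennreal ((c $ i)\<^sup>2)) <= (\<Sum>i\<in>(UNIV::'n set). ennreal \<mu> * ?E)" by (intro sum_mono)
      then show ?thesis using nn by (simp add: norm_vec_sq ennreal_mult ennreal_of_nat_eq_real_of_nat mult.assoc)
    qed
    have Rb: "ennreal ((norm R)\<^sup>2) <= ennreal (?N * \<kappa>) * ?E"
    proof -
      have "ennreal ((R $ i $ j)\<^sup>2) <= ennreal (LINT y|lborel. (D j y)\<^sup>2) * ?E" for i j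
        unfolding Rij power2_minus by (rule order_trans[OF nn_Cauchy_Schwarz[OF fc Dc compact_cball KB DK] mult_left_mono[OF fE]]) auto
      then have "(\<Sum>i\<in>UNIV. \<Sum>j\<in>UNIV. ennreal ((R $ i $ j)\<^sup>2)) <= (\<Sum>i\<in>(UNIV::'n set). \<Sum>j\<in>(UNIV::'n set). ennreal (LINT y|lborel. (D j y)\<^sup>2) * ?E)" by (intro sum_mono)
      also have "... = ennreal (?N * \<kappa>) * ?E"
        using nn by (simp add: \<kappa>_def ennreal_mult ennreal_of_nat_eq_real_of_nat mult.assoc sum_nonneg sum_distrib_right flip: sum_ennreal)
      finally show ?thesis by (simp add: norm_mat_sq sum_nonneg flip: sum_ennreal)
    qed
    have "b + R *v x = c + R *v (x - m)" by (simp add: c_def matrix_vector_mult_diff_distrib)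
    then have "(norm (b + R *v x))\<^sup>2 <= 2 * (norm c)\<^sup>2 + 2 * (norm (R *v (x - m)))\<^sup>2" using norm_sq_add_le[of c "R *v (x - m)"] by simp
    moreover have "(norm (R *v (x - m)))\<^sup>2 <= (M + norm m)\<^sup>2 * (norm R)\<^sup>2"
    proof -
      have "norm (x - m) <= M + norm m" using norm_triangle_ineq4[of x m] x by linarith
      then have "norm R * norm (x - m) <= norm R * (M + norm m)" by (intro mult_left_mono) auto
      then have "norm (R *v (x - m)) <= norm R * (M + norm m)" using norm_matrix_vector_le[of R "x - m"] by linarith
      from power_mono[OF this norm_ge_zero, of 2] show ?thesis by (simp add: power_mult_distrib mult.commute)
    qed
    ultimately have "(norm (b + R *v x))\<^sup>2 <= 2 * (norm c)\<^sup>2 + 2 * ((M + norm m)\<^sup>2 * (norm R)\<^sup>2)" by linarith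
    from ennreal_leI[OF this] have "ennreal ((norm (b + R *v x))\<^sup>2) <= 2 * ennreal ((norm c)\<^sup>2) + 2 * (ennreal ((M + norm m)\<^sup>2) * ennreal ((norm R)\<^sup>2))"
      by (simp add: ennreal_plus ennreal_mult)
    also have "... <= 2 * (ennreal (?N * \<mu>) * ?E) + 2 * (ennreal ((M + norm m)\<^sup>2) * (ennreal (?N * \<kappa>) * ?E))"
      by (intro add_mono mult_left_mono cb Rb) auto
    also have "... = ennreal K * ?E"
      unfolding K_def using nn by (simp add: ennreal_plus ennreal_mult distrib_right mult.assoc)
    finally show ?thesis .
  qed
  then show ?thesis using K0 by blast
qed

lemma affine_measurable: "(%x. b + R *v x) \<in> borel_measurable borel" for R :: "real^'n^'n"
  by (rule smooth_vec_measurable(1)[OF smooth_vec_affine])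

text \<open>The two rigid motions differ by an affine map that is small in L2 on a ball in the
  overlap, as both approximate \<open>u\<close> there. Being affine, it is then small on all of
  \<open>Q\<close>, so the motion found for \<open>P\<close> also serves on
  \<open>Q\<close>.\<close>

lemma pk_piece_Un:
  fixes \<Omega> :: "(real^'n) set"
  assumes O: "bounded \<Omega>" "open \<Omega>" and P: "pk_piece \<Omega> P" "pk_piece \<Omega> Q" and PQ: "P \<inter> Q ~= {}"
  shows "pk_piece \<Omega> (P \<union> Q)"
proof -
  have o: "open P" "open Q" "P \<subseteq> \<Omega>" "Q \<subseteq> \<Omega>" using P by (auto simp: pk_piece_def)
  obtain C1 where C1: "C1 >= 0" "!!u. smooth_vec u ==> \<exists>b R. skew R & nsq P (%x. u x - (b + R *v x)) <= ennreal C1 * nsq \<Omega> (strain u)"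
    using P(1) unfolding pk_piece_def by blast
  obtain C2 where C2: "C2 >= 0" "!!u. smooth_vec u ==> \<exists>b R. skew R & nsq Q (%x. u x - (b + R *v x)) <= ennreal C2 * nsq \<Omega> (strain u)"
    using P(2) unfolding pk_piece_def by blast
  have "open (P \<inter> Q)" using o by auto
  then obtain q d where q: "d > 0" "ball q d \<subseteq> P \<inter> Q" using PQ open_contains_ball by (metis ex_in_conv)
  obtain M where M: "M >= 0" "!!x. x \<in> \<Omega> ==> norm x <= M" using O(1) bounded_pos less_imp_le by metis
  obtain K where K: "K >= 0" "!!b (R :: real^'n^'n) x. norm x <= M ==> ennreal ((norm (b + R *v x))\<^sup>2) <= ennreal K * nsq (ball q d) (%x. b + R *v x)"
    using affine_bounded_by_nsq[OF q(1) M(1), of q] by blast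
  have "emeasure lborel Q < \<infinity>" by (rule emeasure_bounded_finite) (use O o bounded_subset in blast)
  then obtain w where w: "emeasure lborel Q = ennreal w" "w >= 0" by (cases "emeasure lborel Q") auto
  define C where "C = C1 + (2 * C2 + 2 * (K * (2 * C1 + 2 * C2) * w))"
  have C0: "C >= 0" using C1 C2 K w by (simp add: C_def)
  have "\<exists>b R. skew R & nsq (P \<union> Q) (%x. u x - (b + R *v x)) <= ennreal C * nsq \<Omega> (strain u)" if u: "smooth_vec u" for u
  proof -
    let ?E = "nsq \<Omega> (strain u)"
    obtain b R where R: "skew R" "nsq P (%x. u x - (b + R *v x)) <= ennreal C1 * ?E" using C1(2)[OF u] by blast
    obtain b' R' where R': "skew R'" "nsq Q (%x. u x - (b' + R' *v x)) <= ennreal C2 * ?E" using C2(2)[OF u] by blast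
    let ?r = "%x. (b' - b) + (R' - R) *v x"
    have rr: "?r x = (u x - (b + R *v x)) - (u x - (b' + R' *v x))" for x by (simp add: matrix_vector_mult_diff_rdistrib)
    note m = smooth_vec_measurable(1)[OF strain_minus_rigid(1)[OF u R(1)], of b] smooth_vec_measurable(1)[OF strain_minus_rigid(1)[OF u R'(1)], of b']
    have "nsq (ball q d) ?r <= 2 * nsq (ball q d) (%x. u x - (b + R *v x)) + 2 * nsq (ball q d) (%x. u x - (b' + R' *v x))"
      by (rule nsq_add_le[OF _ m]) (simp, unfold rr, rule norm_triangle_ineq4)
    also have "... <= 2 * (ennreal C1 * ?E) + 2 * (ennreal C2 * ?E)"
    proof (intro add_mono mult_left_mono)
      show "nsq (ball q d) (%x. u x - (b + R *v x)) <= ennreal C1 * ?E"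
        by (rule order_trans[OF nsq_mono R(2)]) (use q(2) in auto)
      show "nsq (ball q d) (%x. u x - (b' + R' *v x)) <= ennreal C2 * ?E"
        by (rule order_trans[OF nsq_mono R'(2)]) (use q(2) in auto)
    qed auto
    also have "... = ennreal (2 * C1 + 2 * C2) * ?E" using C1 C2 by (simp add: ennreal_plus ennreal_mult distrib_right mult.assoc)
    finally have rb: "nsq (ball q d) ?r <= ennreal (2 * C1 + 2 * C2) * ?E" .
    have "nsq Q ?r <= (\<integral>\<^sup>+x. (ennreal K * (ennreal (2 * C1 + 2 * C2) * ?E)) * indicator Q x \<partial>lborel)" unfolding nsq_def[of Q]
    proof (rule nn_integral_mono)
      fix x
      show "ennreal ((norm (?r x))\<^sup>2) * indicator Q x <= (ennreal K * (ennreal (2 * C1 + 2 * C2) * ?E)) * indicator Q x"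
      proof (cases "x \<in> Q")
        case True
        then have "norm x <= M" using M o by auto
        from order_trans[OF K(2)[OF this, of "b' - b" "R' - R"] mult_left_mono[OF rb]] show ?thesis using True by simp
      qed simp
    qed
    also have "... = ennreal K * (ennreal (2 * C1 + 2 * C2) * ?E) * ennreal w"
      using o w by (simp add: nn_integral_cmult_indicator)
    also have "... = ennreal (K * (2 * C1 + 2 * C2) * w) * ?E"
    proof -
      have "ennreal (K * (2 * C1 + 2 * C2) * w) = ennreal K * ennreal (2 * C1 + 2 * C2) * ennreal w"
        using K C1 C2 w by (subst ennreal_mult, simp, simp)+ (rule refl)
      then show ?thesis by (simp only: mult_ac)
    qed
    finally have rQ: "nsq Q ?r <= ennreal (K * (2 * C1 + 2 * C2) * w) * ?E" .
    have "nsq Q (%x. u x - (b + R *v x)) <= 2 * nsq Q (%x. u x - (b' + R' *v x)) + 2 * nsq Q ?r"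
    proof (rule nsq_add_le[OF _ m(2) affine_measurable])
      fix x
      have eq: "u x - (b + R *v x) = (u x - (b' + R' *v x)) + ?r x" by (simp add: matrix_vector_mult_diff_rdistrib)
      show "norm (u x - (b + R *v x)) <= norm (u x - (b' + R' *v x)) + norm (?r x)" unfolding eq by (rule norm_triangle_ineq)
    qed (use o in auto)
    also have "... <= 2 * (ennreal C2 * ?E) + 2 * (ennreal (K * (2 * C1 + 2 * C2) * w) * ?E)"
      by (intro add_mono mult_left_mono R'(2) rQ) auto
    finally have Qb: "nsq Q (%x. u x - (b + R *v x)) <= 2 * (ennreal C2 * ?E) + 2 * (ennreal (K * (2 * C1 + 2 * C2) * w) * ?E)" .
    have "nsq (P \<union> Q) (%x. u x - (b + R *v x)) <= (\<integral>\<^sup>+x. ennreal ((norm (u x - (b + R *v x)))\<^sup>2) * indicator P x + ennreal ((norm (u x - (b + R *v x)))\<^sup>2) * indicator Q x \<partial>lborel)"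
      unfolding nsq_def by (rule nn_integral_mono) (auto simp: indicator_def)
    also have "... = nsq P (%x. u x - (b + R *v x)) + nsq Q (%x. u x - (b + R *v x))"
      unfolding nsq_def using m o by (intro nn_integral_add) auto
    also have "... <= ennreal C1 * ?E + (2 * (ennreal C2 * ?E) + 2 * (ennreal (K * (2 * C1 + 2 * C2) * w) * ?E))"
      by (intro add_mono R(2) Qb)
    also have "... = ennreal C * ?E"
    proof -
      have "ennreal C1 * E + (2 * (ennreal C2 * E) + 2 * (ennreal X * E)) = ennreal (C1 + (2 * C2 + 2 * X)) * E" if "X >= 0" for X E
        using that C1 C2 by (simp add: ennreal_plus ennreal_mult distrib_right mult.assoc)
      then show ?thesis unfolding C_def using K C1 C2 w by auto
    qed
    finally show ?thesis using R(1) by blast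
  qed
  then show ?thesis using C0 o P(1) unfolding pk_piece_def by (intro conjI exI[of _ C]) auto
qed

text \<open>A maximal subfamily with a good union cannot meet any remaining piece, for the two could
  be merged. The union and the rest would then separate the domain, contradicting connectedness
  unless nothing remains.\<close>

lemma pk_piece_domain:
  fixes \<Omega> :: "(real^'n) set"
  assumes O: "bounded \<Omega>" "open \<Omega>" "connected \<Omega>" and F: "finite F" "F ~= {}" "!!P. P \<in> F ==> pk_piece \<Omega> P" "\<Union>F = \<Omega>"
  shows "pk_piece \<Omega> \<Omega>"
proof -
  let ?A = "{G. G \<subseteq> F & pk_piece \<Omega> (\<Union>G)}"
  obtain P0 where P0: "P0 \<in> F" using F(2) by blast
  have fin: "finite ?A" using F(1) by auto
  have ne: "?A ~= {}" using P0 F(3) by (auto intro!: exI[of _ "{P0}"])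
  obtain G where G: "G \<in> ?A" "\<forall>H\<in>?A. G \<subseteq> H --> G = H" using finite_has_maximal[OF fin ne] by (metis (lifting))
  have GF: "G \<subseteq> F" "pk_piece \<Omega> (\<Union>G)" using G(1) by auto
  have disj: "P \<inter> \<Union>G = {}" if "P \<in> F - G" for P
  proof (rule ccontr)
    assume "P \<inter> \<Union>G ~= {}"
    then have "pk_piece \<Omega> (P \<union> \<Union>G)" using pk_piece_Un[OF O(1,2) F(3) GF(2)] that by blast
    then have "insert P G \<in> ?A" using that GF by auto
    then have "G = insert P G" using G(2) by blast
    then show False using that by blast
  qed
  have "open (\<Union>G)" "open (\<Union>(F - G))" using F(3) GF(1) by (auto simp: pk_piece_def)
  moreover have "\<Union>G \<inter> \<Union>(F - G) \<inter> \<Omega> = {}" using disj by blast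
  moreover have "\<Omega> \<subseteq> \<Union>G \<union> \<Union>(F - G)" using F(4) by blast
  ultimately have "\<Union>G \<inter> \<Omega> = {} \<or> \<Union>(F - G) \<inter> \<Omega> = {}" using connectedD[OF O(3)] by blast
  moreover have "\<Union>G ~= {}" "\<Union>G \<subseteq> \<Omega>" using GF(2) by (auto simp: pk_piece_def)
  ultimately have "\<Union>(F - G) \<inter> \<Omega> = {}" by blast
  then have "\<Union>G = \<Omega>" using F(4) GF(1) by blast
  then show ?thesis using GF(2) by simp
qed

lemma closure_finite_cover:
  fixes \<Omega> :: "(real^'n) set"
  assumes "bounded \<Omega>" "\<forall>p\<in>closure \<Omega>. r p > 0"
  shows "\<exists>P. finite P & P \<subseteq> closure \<Omega> & closure \<Omega> \<subseteq> (\<Union>p\<in>P. ball p (r p))"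
proof -
  have c: "compact (closure \<Omega>)" using assms(1) by simp
  have s: "closure \<Omega> \<subseteq> (\<Union>p\<in>closure \<Omega>. ball p (r p))" using assms(2) by fastforce
  show ?thesis by (rule compactE_image[OF c _ s]) auto
qed

text \<open>The chained Poincare-Korn inequality controls \<open>u\<close> minus a rigid motion in
  L2. This difference has the same strain as \<open>u\<close>, and the local gradient estimates,
  summed over a finite cover, bound its Jacobian by that strain and the L2 norm just
  controlled.\<close>

lemma korn_domain:
  fixes \<Omega> :: "(real^'n) set"
  assumes O: "bounded \<Omega>" "open \<Omega>" "connected \<Omega>" "lipschitz_boundary \<Omega>"
  shows "\<exists>C\<ge>0. \<forall>u. smooth_vec u --> (\<exists>b R. skew R & nsq \<Omega> (%x. u x - (b + R *v x)) <= ennreal C * nsq \<Omega> (strain u)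
     & nsq \<Omega> (%x. jac u x - R) <= ennreal C * nsq \<Omega> (strain u))"
proof (cases "\<Omega> = {}")
  case True
  have "skew (0 :: real^'n^'n)" by (simp add: skew_def transpose_def vec_eq_iff)
  then show ?thesis using True by (auto simp: nsq_def)
next
  case False
  have "\<forall>p. \<exists>r. p \<in> closure \<Omega> --> r > 0 & pk_piece \<Omega> (\<Omega> \<inter> ball p r)" using pk_piece_local[OF O(2,4)] by blast
  from choice[OF this] obtain r where r: "!!p. p \<in> closure \<Omega> ==> r p > 0" "!!p. p \<in> closure \<Omega> ==> pk_piece \<Omega> (\<Omega> \<inter> ball p (r p))" by blast
  obtain P where P: "finite P" "P \<subseteq> closure \<Omega>" "closure \<Omega> \<subseteq> (\<Union>p\<in>P. ball p (r p))"
    using closure_finite_cover[OF O(1), of r] r(1) by auto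
  have "pk_piece \<Omega> \<Omega>"
  proof (rule pk_piece_domain[OF O(1-3), of "(%p. \<Omega> \<inter> ball p (r p)) ` P"])
    show "\<Union>((%p. \<Omega> \<inter> ball p (r p)) ` P) = \<Omega>" using P(3) closure_subset[of \<Omega>] by blast
    show "(%p. \<Omega> \<inter> ball p (r p)) ` P ~= {}" using P(3) False closure_subset[of \<Omega>] by auto
  qed (use P r in auto)
  then obtain C1 where C1: "C1 >= 0" "!!u. smooth_vec u ==> \<exists>b R. skew R & nsq \<Omega> (%x. u x - (b + R *v x)) <= ennreal C1 * nsq \<Omega> (strain u)"
    unfolding pk_piece_def by blast
  have "\<forall>p. \<exists>r. p \<in> closure \<Omega> --> r > 0 & (\<exists>C\<ge>0. \<forall>u. smooth_vec u --> nsq (\<Omega> \<inter> ball p r) (jac u) <= ennreal C * (nsq \<Omega> (strain u) + nsq \<Omega> u))"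
    using korn_local_gradient[OF O(2,4)] by blast
  from choice[OF this] obtain s where s: "!!p. p \<in> closure \<Omega> ==> s p > 0"
    "!!p. p \<in> closure \<Omega> ==> \<exists>C\<ge>0. \<forall>u. smooth_vec u --> nsq (\<Omega> \<inter> ball p (s p)) (jac u) <= ennreal C * (nsq \<Omega> (strain u) + nsq \<Omega> u)" by blast
  have "\<forall>p. \<exists>C. p \<in> closure \<Omega> --> C >= 0 & (\<forall>u. smooth_vec u --> nsq (\<Omega> \<inter> ball p (s p)) (jac u) <= ennreal C * (nsq \<Omega> (strain u) + nsq \<Omega> u))"
    using s(2) by blast
  from choice[OF this] obtain Cf where Cf: "!!p. p \<in> closure \<Omega> ==> Cf p >= 0"
    "!!p u. p \<in> closure \<Omega> ==> smooth_vec u ==> nsq (\<Omega> \<inter> ball p (s p)) (jac u) <= ennreal (Cf p) * (nsq \<Omega> (strain u) + nsq \<Omega> u)" by blast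
  obtain S where S: "finite S" "S \<subseteq> closure \<Omega>" "closure \<Omega> \<subseteq> (\<Union>p\<in>S. ball p (s p))"
    using closure_finite_cover[OF O(1), of s] s(1) by auto
  define C2 where "C2 = (\<Sum>p\<in>S. Cf p)"
  have C2: "C2 >= 0" unfolding C2_def using S Cf by (intro sum_nonneg) auto
  have grad: "nsq \<Omega> (jac u) <= ennreal C2 * (nsq \<Omega> (strain u) + nsq \<Omega> u)" if u: "smooth_vec u" for u
  proof -
    have "nsq \<Omega> (jac u) <= (\<Sum>p\<in>S. nsq (\<Omega> \<inter> ball p (s p)) (jac u))"
      by (rule nsq_le_sum) (use S closure_subset[of \<Omega>] smooth_vec_measurable[OF u] O in auto)
    also have "... <= (\<Sum>p\<in>S. ennreal (Cf p) * (nsq \<Omega> (strain u) + nsq \<Omega> u))" by (intro sum_mono Cf u) (use S in auto)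
    also have "... = ennreal C2 * (nsq \<Omega> (strain u) + nsq \<Omega> u)"
      unfolding C2_def using S Cf by (subst sum_ennreal[symmetric]) (auto simp: sum_distrib_right)
    finally show ?thesis .
  qed
  define C where "C = C1 + C2 * (1 + C1)"
  have C0: "C >= 0" "C1 <= C" "C2 * (1 + C1) <= C" using C1 C2 by (auto simp: C_def)
  have "\<exists>b R. skew R & nsq \<Omega> (%x. u x - (b + R *v x)) <= ennreal C * nsq \<Omega> (strain u)
     & nsq \<Omega> (%x. jac u x - R) <= ennreal C * nsq \<Omega> (strain u)" if u: "smooth_vec u" for u
  proof -
    let ?E = "nsq \<Omega> (strain u)"
    obtain b R where R: "skew R" "nsq \<Omega> (%x. u x - (b + R *v x)) <= ennreal C1 * ?E" using C1(2)[OF u] by blast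
    note sr = strain_minus_rigid[OF u R(1), of b]
    have "nsq \<Omega> (%x. jac u x - R) = nsq \<Omega> (jac (%x. u x - (b + R *v x)))" by (rule nsq_cong) (simp add: sr)
    also have "... <= ennreal C2 * (nsq \<Omega> (strain (%x. u x - (b + R *v x))) + nsq \<Omega> (%x. u x - (b + R *v x)))"
      by (rule grad[OF sr(1)])
    also have "nsq \<Omega> (strain (%x. u x - (b + R *v x))) = ?E" by (rule nsq_cong) (simp add: sr)
    also have "ennreal C2 * (?E + nsq \<Omega> (%x. u x - (b + R *v x))) <= ennreal C2 * (?E + ennreal C1 * ?E)"
      by (intro mult_left_mono add_left_mono R) auto
    also have "... = ennreal (C2 * (1 + C1)) * ?E" using C1 C2 by (simp add: ennreal_mult ennreal_plus distrib_left distrib_right mult.assoc)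
    also have "... <= ennreal C * ?E" using C0 by (intro mult_right_mono ennreal_leI) auto
    finally have "nsq \<Omega> (%x. jac u x - R) <= ennreal C * ?E" .
    moreover have "nsq \<Omega> (%x. u x - (b + R *v x)) <= ennreal C * ?E"
      by (rule order_trans[OF R(2)]) (use C0 in \<open>intro mult_right_mono ennreal_leI; simp\<close>)
    ultimately show ?thesis using R(1) by blast
  qed
  then show ?thesis using C0(1) by blast
qed

section \<open>Traces\<close>

lemma hausdorff_pre_antimono: "d <= d' ==> hausdorff_pre s d' A <= hausdorff_pre s d A"
  unfolding hausdorff_pre_def by (rule INF_superset_mono) (auto intro: order_trans)

lemma omega_s_nonneg: "s >= 0 ==> omega_s s >= 0" unfolding omega_s_def using Gamma_real_pos[of "s/2 + 1"] by simp

lemma hausdorff_pre_finite_cover: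
  fixes A :: "'a::euclidean_space set"
  assumes "finite Y" "A \<subseteq> (\<Union>y\<in>Y. cball y d)" "d > 0" "s > 0"
  shows "hausdorff_pre s (2 * d) A <= of_nat (card Y) * ennreal (omega_s s * d powr s)"
proof -
  obtain f where f: "bij_betw f {0..<card Y} Y" using ex_bij_betw_nat_finite[OF assms(1)] by blast
  \<comment> \<open>The sequence is padded with empty sets, which contribute nothing: their diameter
    is 0 and \<open>0 powr s\<close> is 0.\<close>
  define C where "C i = (if i < card Y then cball (f i) d else {})" for i
  have "A \<subseteq> (\<Union>i. C i)"
  proof
    fix x assume "x \<in> A"
    then obtain y where y: "y \<in> Y" "x \<in> cball y d" using assms(2) by blast
    then obtain i where "i < card Y" "f i = y" using f unfolding bij_betw_def by (metis atLeastLessThan_iff imageE)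
    then show "x \<in> (\<Union>i. C i)" using y by (auto simp: C_def intro!: exI[of _ i])
  qed
  moreover have "bounded (C i) & diameter (C i) <= 2 * d" for i using assms by (auto simp: C_def diameter_cball)
  ultimately have "hausdorff_pre s (2 * d) A <= (\<Sum>i. ennreal (omega_s s * (diameter (C i) / 2) powr s))"
    unfolding hausdorff_pre_def by (intro INF_lower) auto
  also have "... = (\<Sum>i<card Y. ennreal (omega_s s * (diameter (C i) / 2) powr s))"
    using assms by (intro suminf_finite) (auto simp: C_def)
  also have "... = (\<Sum>i<card Y. ennreal (omega_s s * d powr s))"
    using assms by (intro sum.cong) (auto simp: C_def diameter_cball)
  finally show ?thesis by simp
qed

context special_lipschitz
begin

definition proj where "proj x = x - (x \<bullet> e) *\<^sub>R e"

lemma proj_simps: "proj (x - y) = proj x - proj y" "proj (proj x) = proj x" "proj x \<bullet> e = 0" "proj (t *\<^sub>R x) = t *\<^sub>R proj x"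
  "proj (x + t *\<^sub>R e) = proj x" by (simp_all add: proj_def inner_diff_left inner_add_left algebra_simps ee)

lemma proj_continuous: "continuous_on A proj" unfolding proj_def by (intro continuous_intros)

lemma proj_measurable [measurable]: "proj \<in> borel_measurable borel"
  by (rule borel_measurable_continuous_onI[OF proj_continuous])

text \<open>The measure in the hyperplane orthogonal to \<open>e\<close> is expressed as the volume
  of a cylinder of height 1, so all measuring takes place in \<open>lborel\<close> of the full
  space.\<close>

definition slab :: "(real^'n) set => (real^'n) set" where
  "slab A = {x. proj x \<in> A & 0 < x \<bullet> e & x \<bullet> e < 1}"

text \<open>Projection along \<open>e\<close> is injective on the graph with Lipschitz inverse,
  because height differences are those of \<open>\<phi>\<close>, which depends on the projection
  only.\<close>

lemma graph_dist:
  assumes "h x = 0" "h y = 0"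
  shows "norm (x - y) <= (L + 1) * norm (proj x - proj y)"
proof -
  have p: "\<phi> (proj z) = \<phi> z" for z using inv[of z "- (z \<bullet> e)"] by (simp add: proj_def)
  have xy: "x - y = (proj x - proj y) + (\<phi> x - \<phi> y) *\<^sub>R e" using assms by (simp add: h_def proj_def algebra_simps)
  have "\<bar>\<phi> x - \<phi> y\<bar> <= L * norm (proj x - proj y)"
    using lipschitz_onD[OF lip, of "proj x" "proj y"] by (simp add: p dist_norm)
  moreover have "norm (x - y) <= norm (proj x - proj y) + \<bar>\<phi> x - \<phi> y\<bar>"
    using norm_triangle_ineq[of "proj x - proj y" "(\<phi> x - \<phi> y) *\<^sub>R e"] unfolding xy[symmetric] by (simp add: e)
  ultimately show ?thesis by (simp add: distrib_right)
qed

text \<open>The volume of the unit disc in the hyperplane orthogonal to \<open>e\<close>.\<close>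

definition m1 where "m1 = measure lborel (slab (ball 0 1))"

lemma open_slab: "open B ==> open (slab B)"
proof -
  assume "open B"
  then have o: "open (proj -` B)" by (rule open_vimage[OF _ proj_continuous])
  have "open (proj -` B \<inter> {x. 0 < x \<bullet> e} \<inter> {x. x \<bullet> e < 1})"
    by (rule open_Int[OF open_Int[OF o open_Collect_less] open_Collect_less]) (auto intro!: continuous_intros)
  moreover have "slab B = proj -` B \<inter> {x. 0 < x \<bullet> e} \<inter> {x. x \<bullet> e < 1}" by (auto simp: slab_def)
  ultimately show ?thesis by simp
qed

lemma slab_bounded: "bounded B ==> bounded (slab B)"
proof -
  assume "bounded B"
  then obtain M where M: "!!x. x \<in> B ==> norm x <= M" using bounded_iff by blast
  have "norm x <= M + 1" if "x \<in> slab B" for x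
  proof -
    have "x = proj x + (x \<bullet> e) *\<^sub>R e" by (simp add: proj_def)
    then have "norm x <= norm (proj x) + norm ((x \<bullet> e) *\<^sub>R e)" using norm_triangle_ineq by metis
    then show ?thesis using that M e by (force simp: slab_def)
  qed
  then show ?thesis using bounded_iff by blast
qed

text \<open>The cylinder \<open>Z\<close> of radius and height \<open>t\<close> is a dilation of the
  unit one and so scales with \<open>t ^ CARD('n)\<close>; integrating along \<open>e\<close> shows
  that its height accounts for one factor \<open>t\<close>.\<close>

lemma slab_ball_emeasure:
  assumes t: "t > 0"
  shows "emeasure lborel (slab (ball 0 t)) = ennreal (t ^ (CARD('n) - 1) * m1)" and "m1 > 0"
proof -
  let ?N = "CARD('n)"
  have m: "slab (ball 0 s) \<in> sets borel" for s by (simp add: open_slab)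
  have f1: "emeasure lborel (slab (ball 0 1)) < \<infinity>" by (rule emeasure_bounded_finite[OF slab_bounded]) simp
  then have e1: "emeasure lborel (slab (ball 0 1)) = ennreal m1" unfolding m1_def by (simp add: emeasure_eq_ennreal_measure less_top[symmetric])
  have "(1/2) *\<^sub>R e \<in> slab (ball 0 1)" using ee by (simp add: slab_def proj_def)
  then have "emeasure lborel (slab (ball 0 1)) ~= 0" using open_slab[of "ball 0 1"] open_not_negligible[of "slab (ball 0 1)"]
    by (auto simp: negligible_iff_null_sets null_sets_def emeasure_completion m)
  then show m1: "m1 > 0" using e1 by (auto simp: m1_def less_le)
  define Z where "Z = {x. proj x \<in> ball 0 t & 0 < x \<bullet> e & x \<bullet> e < t}"
  have Zm[measurable]: "Z \<in> sets borel"
  proof -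
    have o: "open (proj -` ball 0 t)" by (rule open_vimage[OF open_ball proj_continuous])
    have "open (proj -` ball 0 t \<inter> {x. 0 < x \<bullet> e} \<inter> {x. x \<bullet> e < t})"
      by (rule open_Int[OF open_Int[OF o open_Collect_less] open_Collect_less]) (auto intro!: continuous_intros)
    moreover have "Z = proj -` ball 0 t \<inter> {x. 0 < x \<bullet> e} \<inter> {x. x \<bullet> e < t}" by (auto simp: Z_def)
    ultimately show ?thesis by simp
  qed
  have "t *\<^sub>R x \<in> Z \<longleftrightarrow> x \<in> slab (ball 0 1)" for x using t by (auto simp: Z_def slab_def proj_simps zero_less_mult_iff)
  then have "emeasure lborel Z = ennreal (t ^ ?N) * emeasure lborel (slab (ball 0 1))"
    using nn_integral_lborel_affine[of "indicator Z" t 0] t m[of 1] by (simp add: indicator_def flip: nn_integral_indicator)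
  moreover have "emeasure lborel Z = ennreal t * emeasure lborel (slab (ball 0 t))"
  proof -
    have "emeasure lborel Z = (\<integral>\<^sup>+x. indicator Z x \<partial>lborel)" by simp
    also have "... = (\<integral>\<^sup>+x. indicator {0<..<1} (x \<bullet> e) * (\<integral>\<^sup>+s. indicator Z (x + s *\<^sub>R e) \<partial>lborel) \<partial>lborel)"
      by (rule nn_integral_along_lines[OF _ e]) measurable
    also have "... = (\<integral>\<^sup>+x. ennreal t * indicator (slab (ball 0 t)) x \<partial>lborel)"
    proof (rule nn_integral_cong)
      fix x
      have "(\<integral>\<^sup>+s. indicator Z (x + s *\<^sub>R e) \<partial>lborel) = (\<integral>\<^sup>+s. indicator (ball 0 t) (proj x) * indicator {- (x \<bullet> e)<..<t - x \<bullet> e} s \<partial>lborel)"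
        by (rule nn_integral_cong) (auto simp: Z_def indicator_def proj_simps inner_add_left ee)
      also have "... = indicator (ball 0 t) (proj x) * ennreal t" using t by (simp add: nn_integral_cmult)
      finally show "indicator {0<..<1} (x \<bullet> e) * (\<integral>\<^sup>+s. indicator Z (x + s *\<^sub>R e) \<partial>lborel) = ennreal t * indicator (slab (ball 0 t)) x"
        by (auto simp: slab_def indicator_def)
    qed
    also have "... = ennreal t * emeasure lborel (slab (ball 0 t))" by (rule nn_integral_cmult_indicator) (simp add: m)
    finally show ?thesis .
  qed
  ultimately have eq: "ennreal t * emeasure lborel (slab (ball 0 t)) = ennreal (t ^ ?N * m1)" using e1 m1 t by (simp add: ennreal_mult)
  have "emeasure lborel (slab (ball 0 t)) < \<infinity>" by (rule emeasure_bounded_finite[OF slab_bounded]) simp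
  then obtain a where a: "emeasure lborel (slab (ball 0 t)) = ennreal a" "a >= 0" by (cases "emeasure lborel (slab (ball 0 t))") auto
  have "t * a = t ^ ?N * m1" using eq unfolding a(1) using t a m1 by (simp add: ennreal_mult[symmetric])
  also have "t ^ ?N = t * t ^ (?N - 1)" using power_Suc[of t "?N - 1"] by simp
  finally have "a = t ^ (?N - 1) * m1" using t by simp
  then show "emeasure lborel (slab (ball 0 t)) = ennreal (t ^ (?N - 1) * m1)" using a by simp
qed

lemma slab_ball_translate:
  "emeasure lborel (slab (ball (proj y) t)) = emeasure lborel (slab (ball 0 t))"
proof -
  have [measurable]: "slab (ball (proj y) t) \<in> sets borel" "slab (ball 0 t) \<in> sets borel" by (auto simp: open_slab)
  have "proj y + x \<in> slab (ball (proj y) t) \<longleftrightarrow> x \<in> slab (ball 0 t)" for x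
  proof -
    have "proj (proj y + x) = proj y + proj x" using proj_simps(1)[of "proj y" "- x"] proj_simps(4)[of "-1" x] by (simp add: proj_simps)
    then show ?thesis by (simp add: slab_def inner_add_left proj_simps dist_norm)
  qed
  then show ?thesis
    using nn_integral_lborel_affine[of "indicator (slab (ball (proj y) t))" 1 "proj y"] by (simp add: indicator_def flip: nn_integral_indicator)
qed

text \<open>A maximal separated subset of \<open>K\<close> gives a covering by balls whose number is controlled by the
  volume of disjoint slabs over its projection.\<close>
lemma hausdorff_graph_le:
  assumes N: "CARD('n) >= 2" and K: "compact K" "K \<subseteq> {x. h x = 0}"
  shows "hausdorff_outer (real CARD('n) - 1) K \<le>
    ennreal (omega_s (real CARD('n) - 1) * (2 * (L + 1)) ^ (CARD('n) - 1) / m1) * emeasure lborel (slab (proj ` K))"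
proof -
  let ?N = "CARD('n)" and ?s = "real CARD('n) - 1"
  define c0 where "c0 = omega_s ?s * (2 * (L + 1)) ^ (?N - 1) / m1"
  have m1: "m1 > 0" using slab_ball_emeasure(2)[of 1] by simp
  have om: "omega_s ?s >= 0" using N by (intro omega_s_nonneg) auto
  have c0: "c0 >= 0" using om m1 L_nonneg by (simp add: c0_def)
  have pK: "compact (proj ` K)" by (intro compact_continuous_image proj_continuous K)
  define B where "B d = (\<Union>z\<in>proj ` K. ball z d)" for d
  have Bo: "open (B d)" for d unfolding B_def by auto
  have Bmono: "d <= d' ==> B d \<subseteq> B d'" for d d' unfolding B_def using subset_ball[of d d'] by blast
  have Bb: "bounded (B d)" for d
  proof -
    obtain M where M: "\<forall>x\<in>proj ` K. norm x <= M" using compact_imp_bounded[OF pK] unfolding bounded_iff by blast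
    have "norm x <= M + d" if xB: "x \<in> B d" for x
    proof -
      obtain z where "z \<in> proj ` K" "dist z x < d" using xB by (auto simp: B_def)
      then show ?thesis using bspec[OF M, of z] norm_triangle_ineq2[of x z] by (simp add: dist_norm norm_minus_commute)
    qed
    then show ?thesis using bounded_iff by blast
  qed
  have main: "hausdorff_pre ?s (2 * d) K <= ennreal c0 * emeasure lborel (slab (B d))" if d: "d > 0" for d
  proof -
    \<comment> \<open>Points of the graph at distance at least \<open>d\<close> have projections at
      distance at least \<open>2 * t\<close>, so the slabs of radius \<open>t\<close> over them are
      disjoint.\<close>
    define t where "t = d / (2 * (L + 1))"
    have t: "t > 0" "t <= d" "d = 2 * (L + 1) * t" using d L_nonneg by (auto simp: t_def field_simps)
    define sep where "sep Y \<longleftrightarrow> finite Y & Y \<subseteq> K & (\<forall>y\<in>Y. \<forall>z\<in>Y. y ~= z --> dist y z >= d)" for Y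
    have cnt: "of_nat (card Y) * ennreal (t ^ (?N - 1) * m1) <= emeasure lborel (slab (B d))" if Y: "sep Y" for Y
    proof -
      have dj: "disjoint_family_on (%y. slab (ball (proj y) t)) Y" unfolding disjoint_family_on_def
      proof (intro ballI impI)
        fix y z assume yz: "y \<in> Y" "z \<in> Y" "y ~= z"
        have "d <= norm (y - z)" using Y yz by (auto simp: sep_def dist_norm)
        also have "... <= (L + 1) * norm (proj y - proj z)" using Y yz K by (intro graph_dist) (auto simp: sep_def)
        finally have "(L + 1) * (2 * t) <= (L + 1) * norm (proj y - proj z)" using t(3) by (simp add: algebra_simps)
        then have far: "2 * t <= norm (proj y - proj z)" using L_nonneg by simp
        show "slab (ball (proj y) t) \<inter> slab (ball (proj z) t) = {}"
        proof (rule ccontr)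
          assume "slab (ball (proj y) t) \<inter> slab (ball (proj z) t) ~= {}"
          then obtain x where "dist (proj y) (proj x) < t" "dist (proj z) (proj x) < t" by (auto simp: slab_def)
          then show False using far dist_triangle[of "proj y" "proj z" "proj x"] by (simp add: dist_norm norm_minus_commute)
        qed
      qed
      have "of_nat (card Y) * ennreal (t ^ (?N - 1) * m1) = (\<Sum>y\<in>Y. emeasure lborel (slab (ball (proj y) t)))"
        by (simp add: slab_ball_translate slab_ball_emeasure(1)[OF t(1)])
      also have "... = emeasure lborel (\<Union>y\<in>Y. slab (ball (proj y) t))"
        using Y dj by (intro sum_emeasure) (auto simp: sep_def open_slab)
      also have "... <= emeasure lborel (slab (B d))"
      proof (rule emeasure_mono)
        show "(\<Union>y\<in>Y. slab (ball (proj y) t)) \<subseteq> slab (B d)" 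
        proof (rule UN_least)
          fix y assume "y \<in> Y"
          then have "y \<in> K" using Y by (auto simp: sep_def)
          then have "ball (proj y) t \<subseteq> B d" unfolding B_def using subset_ball[OF t(2), of "proj y"] by blast
          then show "slab (ball (proj y) t) \<subseteq> slab (B d)" unfolding slab_def by blast
        qed
      qed (simp add: open_slab Bo)
      finally show ?thesis .
    qed
    have fin: "emeasure lborel (slab (B d)) < \<infinity>" by (rule emeasure_bounded_finite[OF slab_bounded[OF Bb]])
    then obtain v where v: "emeasure lborel (slab (B d)) = ennreal v" "v >= 0" by (cases "emeasure lborel (slab (B d))") auto
    have mt: "t ^ (?N - 1) * m1 > 0" using t m1 by simp
    have cnt': "real (card Y) * (t ^ (?N - 1) * m1) <= v" if "sep Y" for Y
      using cnt[OF that] unfolding v(1) using v(2) mt by (simp add: ennreal_of_nat_eq_real_of_nat ennreal_mult[symmetric])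
    \<comment> \<open>The volume bound limits the size of separated sets, so one of maximal
      cardinality exists; its points form a \<open>d\<close>-net of \<open>K\<close>.\<close>
    have "\<forall>Y. sep Y --> card Y < nat \<lceil>v / (t ^ (?N - 1) * m1)\<rceil> + 1"
    proof (intro allI impI)
      fix Y assume "sep Y"
      from cnt'[OF this] have "real (card Y) <= v / (t ^ (?N - 1) * m1)" using mt by (simp add: pos_le_divide_eq)
      then show "card Y < nat \<lceil>v / (t ^ (?N - 1) * m1)\<rceil> + 1" by linarith
    qed
    moreover have "sep {}" by (simp add: sep_def)
    ultimately obtain Y where Y: "sep Y" "\<forall>Z. sep Z --> card Z <= card Y"
      using ex_has_greatest_nat[of sep "{}" card] by blast
    have cover: "K \<subseteq> (\<Union>y\<in>Y. cball y d)"
    proof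
      fix x assume x: "x \<in> K"
      show "x \<in> (\<Union>y\<in>Y. cball y d)"
      proof (rule ccontr)
        assume n: "x \<notin> (\<Union>y\<in>Y. cball y d)"
        then have "x \<notin> Y" using d by auto
        moreover have "finite Y" using Y(1) by (simp add: sep_def)
        ultimately have "card (insert x Y) = Suc (card Y)" by simp
        moreover have "sep (insert x Y)" using Y(1) x n by (auto simp: sep_def dist_commute less_imp_le not_le)
        ultimately show False using Y(2)[rule_format, of "insert x Y"] by linarith
      qed
    qed
    have "hausdorff_pre ?s (2 * d) K <= of_nat (card Y) * ennreal (omega_s ?s * d powr ?s)"
      by (rule hausdorff_pre_finite_cover[OF _ cover d]) (use Y N in \<open>auto simp: sep_def\<close>)
    also have "d powr ?s = (2 * (L + 1)) ^ (?N - 1) * t ^ (?N - 1)"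
    proof -
      have "?s = real (?N - 1)" using N by (simp add: of_nat_diff)
      then have "d powr ?s = d ^ (?N - 1)" using powr_realpow[OF d, of "?N - 1"] by (simp only:)
      then show ?thesis unfolding t(3) by (simp add: power_mult_distrib)
    qed
    also have "omega_s ?s * ((2 * (L + 1)) ^ (?N - 1) * t ^ (?N - 1)) = c0 * (t ^ (?N - 1) * m1)"
      using m1 by (simp add: c0_def)
    also have "of_nat (card Y) * ennreal (c0 * (t ^ (?N - 1) * m1)) = ennreal c0 * (of_nat (card Y) * ennreal (t ^ (?N - 1) * m1))"
      using c0 mt by (subst ennreal_mult) (auto simp: mult_ac)
    also have "... <= ennreal c0 * emeasure lborel (slab (B d))" by (intro mult_left_mono cnt Y) auto
    finally show ?thesis .
  qed
  \<comment> \<open>Shrinking neighbourhoods of the compact projection decrease to the projection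
    itself, so their volumes converge and the neighbourhood disappears from the bound.\<close>
  define A where "A n = slab (B (1 / real (Suc n)))" for n
  have Ainf: "(%n. emeasure lborel (A n)) ----> emeasure lborel (\<Inter>n. A n)"
  proof (rule Lim_emeasure_decseq)
    show "range A \<subseteq> sets lborel" by (auto simp: A_def open_slab Bo)
    have "B (1 / real (Suc n)) \<subseteq> B (1 / real (Suc m))" if "m <= n" for m n
    proof -
      have "1 / real (Suc n) <= 1 / real (Suc m)" using that by (intro divide_left_mono) auto
      then show ?thesis by (rule Bmono)
    qed
    then show "decseq A" unfolding decseq_def A_def slab_def by blast
    show "emeasure lborel (A n) ~= \<infinity>" for n
      unfolding A_def using emeasure_bounded_finite[OF slab_bounded[OF Bb]] by (auto simp: less_top[symmetric])
  qed
  have AK: "(\<Inter>n. A n) = slab (proj ` K)"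
  proof
    show "slab (proj ` K) \<subseteq> (\<Inter>n. A n)"
    proof
      fix x assume x: "x \<in> slab (proj ` K)"
      have "proj x \<in> B d" if "d > 0" for d
      proof -
        have "proj x \<in> proj ` K" using x by (simp add: slab_def)
        then show ?thesis unfolding B_def using that by (intro UN_I[of "proj x"]) auto
      qed
      then show "x \<in> (\<Inter>n. A n)" using x by (auto simp: A_def slab_def)
    qed
    show "(\<Inter>n. A n) \<subseteq> slab (proj ` K)"
    proof
      fix x assume x: "x \<in> (\<Inter>n. A n)"
      then have xn: "proj x \<in> B (1 / real (Suc n))" "0 < x \<bullet> e" "x \<bullet> e < 1" for n unfolding A_def slab_def by blast+
      have "proj x \<in> closure (proj ` K)" unfolding closure_approachable
      proof (intro allI impI)
        fix d :: real assume "d > 0"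
        then obtain n where n: "1 / real (Suc n) < d" using nat_approx_posE by metis
        obtain z where "z \<in> proj ` K" "dist z (proj x) < 1 / real (Suc n)" using xn(1)[of n] by (auto simp: B_def simp del: of_nat_Suc)
        then show "\<exists>y\<in>proj ` K. dist y (proj x) < d" using n by (meson order.strict_trans)
      qed
      then have "proj x \<in> proj ` K" using compact_imp_closed[OF pK] by simp
      then show "x \<in> slab (proj ` K)" using xn by (auto simp: slab_def)
    qed
  qed
  have "hausdorff_pre ?s d K <= ennreal c0 * emeasure lborel (slab (proj ` K))" if "d > 0" for d
  proof -
    from that have "d / 2 > 0" by simp
    from nat_approx_posE[OF this] obtain n0 where n0: "1 / real (Suc n0) < d / 2" .
    have le: "hausdorff_pre ?s d K <= ennreal c0 * emeasure lborel (A n)" for n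
    proof -
      \<comment> \<open>The covering at scale \<open>2 / Suc n\<close> bounds
        \<open>hausdorff_pre\<close> at \<open>d\<close> only once that scale is below
        \<open>d\<close>; smaller indices follow by monotonicity.\<close>
      let ?n = "max n n0"
      have "1 / real (Suc ?n) <= 1 / real (Suc n0)" by (intro divide_left_mono) auto
      then have "2 * (1 / real (Suc ?n)) <= d" using n0 by linarith
      then have "hausdorff_pre ?s d K <= hausdorff_pre ?s (2 * (1 / real (Suc ?n))) K" by (rule hausdorff_pre_antimono)
      also have "... <= ennreal c0 * emeasure lborel (A ?n)" unfolding A_def by (rule main) simp
      also have "emeasure lborel (A ?n) <= emeasure lborel (A n)"
      proof (rule emeasure_mono)
        have "1 / real (Suc ?n) <= 1 / real (Suc n)" by (intro divide_left_mono) auto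
        then have "B (1 / real (Suc ?n)) \<subseteq> B (1 / real (Suc n))" by (rule Bmono)
        then show "A ?n \<subseteq> A n" unfolding A_def slab_def by blast
      qed (simp add: A_def open_slab Bo)
      finally show ?thesis by (simp add: mult_left_mono)
    qed
    have "(%n. ennreal c0 * emeasure lborel (A n)) ----> ennreal c0 * emeasure lborel (slab (proj ` K))"
      using ennreal_tendsto_cmult[OF _ Ainf, of "ennreal c0"] by (simp add: AK)
    then show ?thesis by (rule LIMSEQ_le_const) (use le in blast)
  qed
  then show ?thesis unfolding hausdorff_outer_def c0_def by (intro SUP_least) auto
qed

end

section \<open>Boundary integrals through the layer cake formula\<close>

lemma layer_cake_le: "(\<integral>\<^sup>+t. indicator {t. 0 < t & ennreal t <= a} t \<partial>lborel) <= a"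
proof (cases a)
  case (real r)
  have "{t. 0 < t & ennreal t <= a} = {0<..r}" using real by (auto simp: ennreal_le_iff)
  then show ?thesis using real by simp
qed simp

lemma layer_cake_eq: "r >= 0 ==> (\<integral>\<^sup>+t. indicator {t. 0 < t & t <= r} t \<partial>lborel) = ennreal r"
proof -
  assume "r >= 0"
  moreover have "{t. 0 < t & t <= r} = {0<..r}" by auto
  ultimately show ?thesis by simp
qed

text \<open>The fundamental theorem is applied to the squared norm along the ray from
  \<open>y\<close> in the direction \<open>- e\<close>, up to a point where \<open>w\<close>
  vanishes, and the derivative is split by \<open>2ab <= a^2 + b^2\<close>.\<close>

lemma decay_square_le:
  fixes w :: "real^'n => real^'n"
  assumes w: "smooth_vec w" "bounded B" "\<forall>x. x \<notin> B --> w x = 0" and e: "norm e = 1"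
  shows "ennreal ((norm (w y))\<^sup>2) <= (\<integral>\<^sup>+t. ennreal ((norm (w (y - t *\<^sub>R e)))\<^sup>2 + (norm (jac w (y - t *\<^sub>R e)))\<^sup>2) * indicator {0<..} t \<partial>lborel)"
proof -
  obtain M where M: "!!x. x \<in> B ==> norm x <= M" using w(2) bounded_iff by blast
  \<comment> \<open>Long enough for \<open>y - T *\<^sub>R e\<close> to have left the bounded set
    \<open>B\<close>.\<close>
  define T where "T = \<bar>M\<bar> + norm y + 1"
  have T: "T > 0" unfolding T_def by (simp add: add_nonneg_pos)
  have wT: "w (y - T *\<^sub>R e) = 0"
  proof -
    have "norm (y - T *\<^sub>R e) >= T - norm y" using norm_triangle_ineq3[of "T *\<^sub>R e" y] e T by (simp add: norm_minus_commute)
    then have "\<not> norm (y - T *\<^sub>R e) <= M" unfolding T_def by linarith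
    then show ?thesis using M w(3) by blast
  qed
  define f where "f t = (norm (w (y - t *\<^sub>R e)))\<^sup>2" for t
  define f' where "f' t = - 2 * (w (y - t *\<^sub>R e) \<bullet> (jac w (y - t *\<^sub>R e) *v e))" for t
  define G where "G t = (norm (w (y - t *\<^sub>R e)))\<^sup>2 + (norm (jac w (y - t *\<^sub>R e)))\<^sup>2" for t
  have d: "(f has_field_derivative f' t) (at t)" for t
  proof -
    have 1: "((%t. y - t *\<^sub>R e) has_derivative (%h. - (h *\<^sub>R e))) (at t)" by (auto intro!: derivative_eq_intros)
    have 2: "((%t. w (y - t *\<^sub>R e)) has_derivative (%h. jac w (y - t *\<^sub>R e) *v (- (h *\<^sub>R e)))) (at t)"
      using diff_chain_at[OF 1 smooth_vec_has_derivative[OF w(1)]] by (simp add: o_def)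
    have "(%h. w (y - t *\<^sub>R e) \<bullet> (jac w (y - t *\<^sub>R e) *v (- (h *\<^sub>R e))) + (jac w (y - t *\<^sub>R e) *v (- (h *\<^sub>R e))) \<bullet> w (y - t *\<^sub>R e)) = (%h. f' t * h)"
      by (rule ext) (simp add: f'_def inner_commute matrix_vector_mult_scaleR linear_neg[OF matrix_vector_mul_linear])
    then show ?thesis
      using has_derivative_inner[OF 2 2] unfolding f_def power2_norm_eq_inner has_field_derivative_def by simp
  qed
  have lc: "continuous_on A (%t. y - t *\<^sub>R e)" for A by (intro continuous_intros)
  have wc: "continuous_on A (%t. w (y - t *\<^sub>R e))" "continuous_on A (%t. jac w (y - t *\<^sub>R e))" for A
    by (rule continuous_on_compose2[OF smooth_vec_continuous[OF w(1), of UNIV] lc]; simp)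
      (rule continuous_on_compose2[OF jac_continuous[OF w(1), of UNIV] lc]; simp)
  have je: "bounded_linear (%A :: real^'n^'n. A *v e)" by (rule linear_conv_bounded_linear[THEN iffD1], rule linearI)
      (simp_all add: matrix_vector_mult_add_rdistrib scaleR_matrix_vector_assoc)
  have fc: "continuous_on A f'" for A unfolding f'_def by (intro continuous_intros wc bounded_linear.continuous_on[OF je])
  have Gc: "continuous_on A G" for A unfolding G_def by (intro continuous_intros wc)
  have iG: "integrable lborel (%t. indicator {0..T} t *\<^sub>R G t)" by (rule borel_integrable_compact) (auto intro: Gc)
  have fb: "- f' t <= G t" for t
  proof -
    let ?a = "w (y - t *\<^sub>R e)" and ?J = "jac w (y - t *\<^sub>R e)"
    have "?a \<bullet> (?J *v e) <= norm ?a * norm (?J *v e)" by (rule norm_cauchy_schwarz)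
    also have "... <= norm ?a * norm ?J" using norm_matrix_vector_le[of ?J e] e by (intro mult_left_mono) auto
    finally have "- f' t <= 2 * norm ?a * norm ?J" by (simp add: f'_def)
    also have "... <= G t" unfolding G_def by (rule sum_squares_bound)
    finally show ?thesis .
  qed
  have "(LINT t|lborel. f' t * indicator {0..T} t) = f T - f 0"
  proof (rule integral_FTC_Icc_real)
    show "isCont f' t" for t using fc[of UNIV] by (simp add: continuous_on_eq_continuous_at)
  qed (use T d in auto)
  moreover have "f T = 0" by (simp add: f_def wT)
  ultimately have "f 0 = (LINT t|lborel. - (f' t * indicator {0..T} t))" by simp
  also have "... <= (LINT t|lborel. indicator {0..T} t *\<^sub>R G t)"
  proof (rule integral_mono)
    have "integrable lborel (%t. indicator {0..T} t *\<^sub>R f' t)" by (rule borel_integrable_compact) (auto intro: fc)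
    then show "integrable lborel (%t. - (f' t * indicator {0..T} t))" by (simp add: mult.commute)
    show "integrable lborel (%t. indicator {0..T} t *\<^sub>R G t)" by (rule iG)
    show "- (f' t * indicator {0..T} t) <= indicator {0..T} t *\<^sub>R G t" for t using fb[of t] by (auto simp: indicator_def)
  qed
  finally have "ennreal (f 0) <= ennreal (LINT t|lborel. indicator {0..T} t *\<^sub>R G t)" by (rule ennreal_leI)
  also have "... = (\<integral>\<^sup>+t. ennreal (indicator {0..T} t *\<^sub>R G t) \<partial>lborel)"
    by (rule nn_integral_eq_integral[symmetric, OF iG]) (simp add: G_def)
  also have "... <= (\<integral>\<^sup>+t. ennreal (G t) * indicator {0<..} t \<partial>lborel)"
  proof (rule nn_integral_mono_AE)
    have "AE t in lborel. t ~= (0::real)" by (rule AE_lborel_singleton)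
    then show "AE t in lborel. ennreal (indicator {0..T} t *\<^sub>R G t) <= ennreal (G t) * indicator {0<..} t"
      by eventually_elim (auto simp: indicator_def G_def)
  qed
  finally show ?thesis by (simp add: f_def G_def)
qed

context special_lipschitz
begin

text \<open>The function \<open>g\<close>, an integral over whole lines parallel to
  \<open>e\<close>, dominates the squared norm of \<open>w\<close> on the graph and is constant on
  these lines. Hence the slab over the projection of a superlevel set of \<open>w\<close> on
  \<open>K\<close> lies in the superlevel set of \<open>g\<close>. The layer cake formula for
  \<open>\<sigma>\<close> reduces the claim to such compact sets, where
  \<open>hausdorff_graph_le\<close> applies, and its converse for \<open>g\<close> reassembles the
  integral over \<open>D\<close>.\<close>

lemma trace_chart:
  assumes N: "CARD('n) >= 2"
  shows "\<exists>C\<ge>0. \<forall>w B K \<sigma>. smooth_vec w --> bounded B --> (\<forall>x. x \<notin> B --> w x = 0) -->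
    compact K --> K \<subseteq> {x. h x = 0} --> K \<subseteq> space \<sigma> --> sigma_finite_measure \<sigma> -->
    (%x. (norm (w x))\<^sup>2 * indicator K x) \<in> borel_measurable \<sigma> -->
    (\<forall>A. A \<subseteq> K --> compact A --> emeasure \<sigma> A <= hausdorff_outer (real CARD('n) - 1) A) -->
    (\<integral>\<^sup>+x. ennreal ((norm (w x))\<^sup>2 * indicator K x) \<partial>\<sigma>) <= ennreal C * (nsq D w + nsq D (jac w))"
proof -
  define C where "C = omega_s (real CARD('n) - 1) * (2 * (L + 1)) ^ (CARD('n) - 1) / m1"
  have C0: "C >= 0"
    unfolding C_def using slab_ball_emeasure(2)[of 1] omega_s_nonneg[of "real CARD('n) - 1"] N L_nonneg by simp
  have "(\<integral>\<^sup>+x. ennreal ((norm (w x))\<^sup>2 * indicator K x) \<partial>\<sigma>) <= ennreal C * (nsq D w + nsq D (jac w))"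
    if w: "smooth_vec w" and B: "bounded B" "\<forall>x. x \<notin> B --> w x = 0" and K: "compact K" "K \<subseteq> {x. h x = 0}" "K \<subseteq> space \<sigma>"
      and s: "sigma_finite_measure \<sigma>" and m: "(%x. (norm (w x))\<^sup>2 * indicator K x) \<in> borel_measurable \<sigma>"
      and H: "\<forall>A. A \<subseteq> K --> compact A --> emeasure \<sigma> A <= hausdorff_outer (real CARD('n) - 1) A" for w B K \<sigma>
  proof -
    note wm[measurable] = smooth_vec_measurable[OF w]
    define G where "G x = ennreal ((norm (w x))\<^sup>2 + (norm (jac w x))\<^sup>2) * indicator D x" for x
    have Gm[measurable]: "G \<in> borel_measurable borel" unfolding G_def by measurable
    have GI: "(\<integral>\<^sup>+x. G x \<partial>lborel) = nsq D w + nsq D (jac w)"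
    proof -
      have "(\<integral>\<^sup>+x. G x \<partial>lborel) = (\<integral>\<^sup>+x. ennreal ((norm (w x))\<^sup>2) * indicator D x + ennreal ((norm (jac w x))\<^sup>2) * indicator D x \<partial>lborel)"
        unfolding G_def by (intro nn_integral_cong) (auto simp: indicator_def)
      also have "... = nsq D w + nsq D (jac w)" unfolding nsq_def by (rule nn_integral_add) measurable
      finally show ?thesis .
    qed
    define g where "g x = (\<integral>\<^sup>+t. G (x + t *\<^sub>R e) \<partial>lborel)" for x
    have gm[measurable]: "g \<in> borel_measurable borel" unfolding g_def by measurable
    have gshift: "g (x + s *\<^sub>R e) = g x" for x s
    proof -
      have "g x = (\<integral>\<^sup>+t. G (x + (s + 1 * t) *\<^sub>R e) \<partial>lborel)"
        unfolding g_def using nn_integral_real_affine[of "%t. G (x + t *\<^sub>R e)" 1 s] by simp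
      then show ?thesis by (simp add: g_def algebra_simps)
    qed
    have wg: "ennreal ((norm (w y))\<^sup>2) <= g y" if y: "h y = 0" for y
    proof -
      have "ennreal ((norm (w y))\<^sup>2) <= (\<integral>\<^sup>+t. ennreal ((norm (w (y - t *\<^sub>R e)))\<^sup>2 + (norm (jac w (y - t *\<^sub>R e)))\<^sup>2) * indicator {0<..} t \<partial>lborel)"
        by (rule decay_square_le[OF w B e])
      also have "... = (\<integral>\<^sup>+t. G (y + (- t) *\<^sub>R e) \<partial>lborel)"
      proof (rule nn_integral_cong)
        fix t
        have "y + (- t) *\<^sub>R e \<in> D \<longleftrightarrow> t > 0" unfolding D_def mem_Collect_eq h_line using y by simp
        then show "ennreal ((norm (w (y - t *\<^sub>R e)))\<^sup>2 + (norm (jac w (y - t *\<^sub>R e)))\<^sup>2) * indicator {0<..} t = G (y + (- t) *\<^sub>R e)"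
          by (simp add: G_def indicator_def)
      qed
      also have "... = g y" unfolding g_def using nn_integral_real_affine[of "%t. G (y + t *\<^sub>R e)" "-1" 0] by simp
      finally show ?thesis .
    qed
    interpret sf: sigma_finite_measure \<sigma> by (rule s)
    interpret pr: pair_sigma_finite \<sigma> "lborel :: real measure" ..
    define f where "f x = (norm (w x))\<^sup>2 * indicator K x" for x
    have fm[measurable]: "f \<in> borel_measurable \<sigma>" using m by (simp add: f_def[abs_def])
    have f0: "f x >= 0" for x by (simp add: f_def)
    let ?S = "%x t. if 0 < t & t <= f x then 1 else 0 :: ennreal"
    have "(\<integral>\<^sup>+x. ennreal (f x) \<partial>\<sigma>) = (\<integral>\<^sup>+x. \<integral>\<^sup>+t. ?S x t \<partial>lborel \<partial>\<sigma>)"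
    proof (rule nn_integral_cong)
      fix x
      show "ennreal (f x) = (\<integral>\<^sup>+t. ?S x t \<partial>lborel)" using layer_cake_eq[OF f0[of x]] by (simp add: indicator_def of_bool_def)
    qed
    also have "... = (\<integral>\<^sup>+t. \<integral>\<^sup>+x. ?S x t \<partial>\<sigma> \<partial>lborel)" by (rule pr.Fubini'[symmetric]) measurable
    also have "... <= (\<integral>\<^sup>+t. ennreal C * (\<integral>\<^sup>+x. indicator {0<..<1} (x \<bullet> e) * indicator {t. 0 < t & ennreal t <= g x} t \<partial>lborel) \<partial>lborel)"
    proof (rule nn_integral_mono)
      fix t :: real
      show "(\<integral>\<^sup>+x. ?S x t \<partial>\<sigma>) <= ennreal C * (\<integral>\<^sup>+x. indicator {0<..<1} (x \<bullet> e) * indicator {t. 0 < t & ennreal t <= g x} t \<partial>lborel)"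
      proof (cases "t > 0")
        case t: True
        define A where "A = {x \<in> K. t <= (norm (w x))\<^sup>2}"
        have Ac: "compact A"
        proof -
          have "closed {x. t <= (norm (w x))\<^sup>2}" by (intro closed_Collect_le continuous_intros smooth_vec_continuous[OF w])
          then have "compact (K \<inter> {x. t <= (norm (w x))\<^sup>2})" by (rule compact_Int_closed[OF K(1)])
          moreover have "A = K \<inter> {x. t <= (norm (w x))\<^sup>2}" by (auto simp: A_def)
          ultimately show ?thesis by simp
        qed
        have AK: "A \<subseteq> K" by (auto simp: A_def)
        have Aeq: "A = {x \<in> space \<sigma>. t <= f x}" using t K(3) by (auto simp: A_def f_def indicator_def)
        then have As: "A \<in> sets \<sigma>" by simp
        have pA: "compact (proj ` A)" by (intro compact_continuous_image proj_continuous Ac)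
        have sm[measurable]: "slab (proj ` A) \<in> sets borel"
        proof -
          have [measurable]: "proj ` A \<in> sets borel" by (rule borel_closed[OF compact_imp_closed[OF pA]])
          show ?thesis unfolding slab_def by measurable
        qed
        have "(\<integral>\<^sup>+x. ?S x t \<partial>\<sigma>) = (\<integral>\<^sup>+x. indicator A x \<partial>\<sigma>)"
          by (rule nn_integral_cong) (use t in \<open>auto simp: Aeq indicator_def\<close>)
        also have "... = emeasure \<sigma> A" using As by simp
        also have "... <= hausdorff_outer (real CARD('n) - 1) A" using H AK Ac by blast
        also have "... <= ennreal C * emeasure lborel (slab (proj ` A))"
          unfolding C_def by (rule hausdorff_graph_le[OF N Ac]) (use AK K(2) in blast)
        also have "emeasure lborel (slab (proj ` A)) = (\<integral>\<^sup>+x. indicator (slab (proj ` A)) x \<partial>lborel)" by simp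
        also have "... <= (\<integral>\<^sup>+x. indicator {0<..<1} (x \<bullet> e) * indicator {t. 0 < t & ennreal t <= g x} t \<partial>lborel)"
        proof (rule nn_integral_mono)
          fix x
          have "ennreal t <= g x" if x: "x \<in> slab (proj ` A)"
          proof -
            obtain y where y: "y \<in> A" "proj x = proj y" using x by (auto simp: slab_def)
            have gp: "g (proj z) = g z" for z using gshift[of z "- (z \<bullet> e)"] by (simp add: proj_def)
            have "ennreal t <= ennreal ((norm (w y))\<^sup>2)" using y by (auto simp: A_def intro: ennreal_leI)
            also have "... <= g y" by (rule wg) (use y AK K(2) in blast)
            also have "g y = g x" using gp[of x] gp[of y] y(2) by simp
            finally show ?thesis .
          qed
          then show "indicator (slab (proj ` A)) x <= (indicator {0<..<1} (x \<bullet> e) * indicator {t. 0 < t & ennreal t <= g x} t :: ennreal)"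
            using t by (auto simp: indicator_def slab_def)
        qed
        finally show ?thesis by (simp add: mult_left_mono)
      next
        case False
        then have "(\<integral>\<^sup>+x. ?S x t \<partial>\<sigma>) = (\<integral>\<^sup>+x. 0 \<partial>\<sigma>)" by (intro nn_integral_cong) auto
        then show ?thesis by simp
      qed
    qed
    also have "... = ennreal C * (\<integral>\<^sup>+t. \<integral>\<^sup>+x. indicator {0<..<1} (x \<bullet> e) * indicator {t. 0 < t & ennreal t <= g x} t \<partial>lborel \<partial>lborel)"
      by (rule nn_integral_cmult) (unfold indicator_def mem_Collect_eq, measurable)
    also have "(\<integral>\<^sup>+t. \<integral>\<^sup>+x. indicator {0<..<1} (x \<bullet> e) * indicator {t. 0 < t & ennreal t <= g x} t \<partial>lborel \<partial>lborel)
       = (\<integral>\<^sup>+x. \<integral>\<^sup>+t. indicator {0<..<1} (x \<bullet> e) * indicator {t. 0 < t & ennreal t <= g x} t \<partial>lborel \<partial>lborel)"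
      by (rule lborel_pair.Fubini') (unfold indicator_def mem_Collect_eq, measurable)
    also have "... <= (\<integral>\<^sup>+x. indicator {0<..<1} (x \<bullet> e) * g x \<partial>lborel)"
    proof (rule nn_integral_mono)
      fix x
      have "(\<integral>\<^sup>+t. indicator {0<..<1} (x \<bullet> e) * indicator {t. 0 < t & ennreal t <= g x} t \<partial>lborel) = indicator {0<..<1} (x \<bullet> e) * (\<integral>\<^sup>+t. indicator {t. 0 < t & ennreal t <= g x} t \<partial>lborel)"
        by (rule nn_integral_cmult) (unfold indicator_def mem_Collect_eq, measurable)
      also have "... <= indicator {0<..<1} (x \<bullet> e) * g x" by (intro mult_left_mono layer_cake_le) auto
      finally show "(\<integral>\<^sup>+t. indicator {0<..<1} (x \<bullet> e) * indicator {t. 0 < t & ennreal t <= g x} t \<partial>lborel) <= indicator {0<..<1} (x \<bullet> e) * g x" .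
    qed
    also have "... = (\<integral>\<^sup>+x. G x \<partial>lborel)" unfolding g_def by (rule nn_integral_along_lines[OF Gm e, symmetric])
    also have "... = nsq D w + nsq D (jac w)" by (rule GI)
    finally show ?thesis by (simp add: f_def mult_left_mono)
  qed
  then show ?thesis using C0 by blast
qed

end

text \<open>\<open>measure_of\<close> returns the prescribed set function if it is a measure and 0
  otherwise. In either case it lies below the Hausdorff outer measure, and the trace estimate rests
  on this upper bound.\<close>

lemma surf_facts:
  fixes \<Omega> :: "(real^'n) set"
  shows "space (surf \<Omega>) = frontier \<Omega>" "sets (surf \<Omega>) = sets (restrict_space borel (frontier \<Omega>))"
    "emeasure (surf \<Omega>) A <= hausdorff_outer (real CARD('n) - 1) A"
proof -
  let ?A = "sets (restrict_space borel (frontier \<Omega>))"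
  have sp: "?A \<subseteq> Pow (frontier \<Omega>)" using sets.space_closed[of "restrict_space borel (frontier \<Omega>)"] by (simp add: space_restrict_space)
  show "space (surf \<Omega>) = frontier \<Omega>" unfolding surf_def hausdorff_measure_def by (rule space_measure_of[OF sp])
  have "sigma_sets (frontier \<Omega>) ?A = ?A" using sets.sigma_sets_eq[of "restrict_space borel (frontier \<Omega>)"] by (simp add: space_restrict_space)
  then show "sets (surf \<Omega>) = ?A" unfolding surf_def hausdorff_measure_def using sets_measure_of[OF sp] by simp
  show "emeasure (surf \<Omega>) A <= hausdorff_outer (real CARD('n) - 1) A"
    unfolding surf_def hausdorff_measure_def by (simp add: emeasure_measure_of_conv)
qed

text \<open>Frontier points lie outside the open domain, so their depth is at most 0; a negative
  depth would persist in a neighbourhood and cut the point off from the closure.\<close>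

lemma frontier_in_graph:
  assumes "open \<Omega>" "special_lipschitz e \<phi> L" "\<Omega> \<inter> ball p r = special_lipschitz.D e \<phi> \<inter> ball p r"
  shows "frontier \<Omega> \<inter> ball p r \<subseteq> {x. special_lipschitz.h e \<phi> x = 0}"
proof
  interpret special_lipschitz e \<phi> L by fact
  fix x assume x: "x \<in> frontier \<Omega> \<inter> ball p r"
  then have "x \<notin> \<Omega>" using assms(1) by (simp add: frontier_def interior_open)
  then have "x \<notin> D" using x assms(3) by blast
  then have "h x <= 0" by (simp add: D_def)
  moreover have "\<not> h x < 0"
  proof
    assume n: "h x < 0"
    have "open ({y. h y < 0} \<inter> ball p r)" by (intro open_Int open_Collect_less h_continuous continuous_intros) auto
    moreover have "x \<in> {y. h y < 0} \<inter> ball p r" using n x by auto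
    moreover have "x \<in> closure \<Omega>" using x by (simp add: frontier_def)
    ultimately have "\<Omega> \<inter> ({y. h y < 0} \<inter> ball p r) ~= {}" using open_Int_closure_eq_empty by blast
    then obtain y where "y \<in> \<Omega> \<inter> ball p r" "h y < 0" by blast
    then have "y \<in> D" using assms(3) by blast
    then show False using \<open>h y < 0\<close> by (simp add: D_def)
  qed
  ultimately show "x \<in> {x. h x = 0}" by simp
qed

lemma trace_domain:
  fixes \<Omega> :: "(real^'n) set"
  assumes N: "CARD('n) >= 2" and O: "bounded \<Omega>" "open \<Omega>" "lipschitz_boundary \<Omega>"
  shows "finite_measure (surf \<Omega>)"
    "\<exists>C\<ge>0. \<forall>u. smooth_vec u --> (\<integral>\<^sup>+x. ennreal ((norm (u x))\<^sup>2) \<partial>surf \<Omega>) <= ennreal C * (nsq \<Omega> u + nsq \<Omega> (jac u))"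
proof -
  let ?s = "real CARD('n) - 1"
  have fc: "compact (frontier \<Omega>)" using O(1) by (simp add: compact_frontier_bounded)
  have csets: "A \<in> sets (surf \<Omega>)" if "compact A" "A \<subseteq> frontier \<Omega>" for A
  proof -
    have "A \<in> sets borel" by (rule borel_closed[OF compact_imp_closed[OF that(1)]])
    moreover have "A = frontier \<Omega> \<inter> A" using that by blast
    ultimately show ?thesis unfolding surf_facts(2) sets_restrict_space by blast
  qed
  \<comment> \<open>The integral estimate is conditional because Fubini in
    \<open>trace_chart\<close> demands a sigma-finite boundary measure. The first half, summed over
    a finite cover, shows that the measure is finite; then the second half is released.\<close>
  have local: "\<exists>r>0. emeasure (surf \<Omega>) (frontier \<Omega> \<inter> cball p r) < \<infinity> & (sigma_finite_measure (surf \<Omega>) --> (\<exists>C\<ge>0. \<forall>u. smooth_vec u -->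
      (\<integral>\<^sup>+x. ennreal ((norm (u x))\<^sup>2 * indicator (frontier \<Omega> \<inter> cball p r) x) \<partial>surf \<Omega>) <= ennreal C * (nsq \<Omega> u + nsq \<Omega> (jac u))))"
    if p: "p \<in> frontier \<Omega>" for p
  proof -
    obtain e \<phi> L r where c: "special_lipschitz e \<phi> L" "r > 0" "\<Omega> \<inter> ball p r = special_lipschitz.D e \<phi> \<inter> ball p r"
      using frontier_chart[OF O(3) p] .
    interpret special_lipschitz e \<phi> L by (rule c)
    let ?K = "frontier \<Omega> \<inter> cball p (r/4)"
    have Kc: "compact ?K" by (rule compact_Int_closed[OF fc]) simp
    have "?K \<subseteq> frontier \<Omega> \<inter> ball p r" using c(2) by auto
    then have Kh: "?K \<subseteq> {x. h x = 0}" using frontier_in_graph[OF O(2) c(1) c(3)] by blast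
    have "emeasure (surf \<Omega>) ?K < \<infinity>"
    proof -
      have "bounded (proj ` ?K)" by (intro compact_imp_bounded compact_continuous_image proj_continuous Kc)
      then have "emeasure lborel (slab (proj ` ?K)) < \<infinity>" by (intro emeasure_bounded_finite slab_bounded)
      then have "ennreal (omega_s ?s * (2 * (L + 1)) ^ (CARD('n) - 1) / m1) * emeasure lborel (slab (proj ` ?K)) < \<infinity>"
        by (simp add: ennreal_mult_less_top)
      then show ?thesis using surf_facts(3)[of \<Omega> ?K] hausdorff_graph_le[OF N Kc Kh] by (meson le_less_trans)
    qed
    moreover have "\<exists>C\<ge>0. \<forall>u. smooth_vec u -->
      (\<integral>\<^sup>+x. ennreal ((norm (u x))\<^sup>2 * indicator ?K x) \<partial>surf \<Omega>) <= ennreal C * (nsq \<Omega> u + nsq \<Omega> (jac u))"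
      if sf: "sigma_finite_measure (surf \<Omega>)"
    proof -
      obtain C where C: "C >= 0" "!!w B K \<sigma>. smooth_vec w ==> bounded B ==> (\<forall>x. x \<notin> B --> w x = 0) ==>
        compact K ==> K \<subseteq> {x. h x = 0} ==> K \<subseteq> space \<sigma> ==> sigma_finite_measure \<sigma> ==>
        (%x. (norm (w x))\<^sup>2 * indicator K x) \<in> borel_measurable \<sigma> ==>
        (\<forall>A. A \<subseteq> K --> compact A --> emeasure \<sigma> A <= hausdorff_outer ?s A) ==>
        (\<integral>\<^sup>+x. ennreal ((norm (w x))\<^sup>2 * indicator K x) \<partial>\<sigma>) <= ennreal C * (nsq D w + nsq D (jac w))"
        using trace_chart[OF N] by blast
      obtain \<eta> :: "real^'n => real" where et: "smooth_fun \<eta>" "!!x. 0 <= \<eta> x & \<eta> x <= 1" "!!x. x \<in> ball p (r/3) ==> \<eta> x = 1" "!!x. x \<notin> ball p (r/2) ==> \<eta> x = 0"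
        using plateau_exists[of "r/3" "r/2" p] c(2) by auto
      have "\<exists>B\<ge>0. \<forall>u D. smooth_vec u --> D \<in> sets borel -->
        nsq D (strain (%x. \<eta> x *\<^sub>R u x)) <= 2 * nsq (D \<inter> ball p r) (strain u) + ennreal B * nsq (D \<inter> ball p r) u &
        nsq D (jac (%x. \<eta> x *\<^sub>R u x)) <= 2 * nsq (D \<inter> ball p r) (jac u) + ennreal B * nsq (D \<inter> ball p r) u"
        by (rule cutoff_strain_bound[of _ _ "r/2"]) (use et c(2) in auto)
      then obtain B where B: "B >= 0" "\<forall>u D. smooth_vec u --> D \<in> sets borel -->
        nsq D (jac (%x. \<eta> x *\<^sub>R u x)) <= 2 * nsq (D \<inter> ball p r) (jac u) + ennreal B * nsq (D \<inter> ball p r) u" by blast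
      have "(\<integral>\<^sup>+x. ennreal ((norm (u x))\<^sup>2 * indicator ?K x) \<partial>surf \<Omega>) <= ennreal (C * (3 + B)) * (nsq \<Omega> u + nsq \<Omega> (jac u))"
        if u: "smooth_vec u" for u
      proof -
        let ?w = "%x. \<eta> x *\<^sub>R u x"
        have ws: "smooth_vec ?w" by (rule smooth_vec_cutoff[OF et(1) u])
        have wz: "\<forall>x. x \<notin> ball p (r/2) --> ?w x = 0" using et(4) by simp
        have "(\<integral>\<^sup>+x. ennreal ((norm (u x))\<^sup>2 * indicator ?K x) \<partial>surf \<Omega>) = (\<integral>\<^sup>+x. ennreal ((norm (?w x))\<^sup>2 * indicator ?K x) \<partial>surf \<Omega>)"
        proof (rule nn_integral_cong)
          fix x
          show "ennreal ((norm (u x))\<^sup>2 * indicator ?K x) = ennreal ((norm (?w x))\<^sup>2 * indicator ?K x)"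
            using et(3)[of x] c(2) by (cases "x \<in> ?K") auto
        qed
        also have "... <= ennreal C * (nsq D ?w + nsq D (jac ?w))"
        proof (rule C(2)[OF ws bounded_ball wz Kc Kh _ sf])
          show "?K \<subseteq> space (surf \<Omega>)" by (simp add: surf_facts)
          have "?K \<in> sets borel" by (rule borel_closed[OF compact_imp_closed[OF Kc]])
          then have "(%x. (norm (?w x))\<^sup>2 * indicator ?K x) \<in> borel_measurable borel"
            using smooth_vec_measurable(1)[OF ws] by measurable
          then have "(%x. (norm (?w x))\<^sup>2 * indicator ?K x) \<in> borel_measurable (restrict_space borel (frontier \<Omega>))"
            by (rule measurable_restrict_space1)
          then show "(%x. (norm (?w x))\<^sup>2 * indicator ?K x) \<in> borel_measurable (surf \<Omega>)"
            using measurable_cong_sets[OF surf_facts(2) refl] by blast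
          show "\<forall>A. A \<subseteq> ?K --> compact A --> emeasure (surf \<Omega>) A <= hausdorff_outer ?s A" using surf_facts(3) by blast
        qed
        also have "... <= ennreal C * (nsq \<Omega> u + (2 * nsq \<Omega> (jac u) + ennreal B * nsq \<Omega> u))"
        proof (intro mult_left_mono add_mono)
          have DO: "D \<inter> ball p r \<subseteq> \<Omega>" using c(3) by blast
          have "nsq D ?w <= nsq (D \<inter> ball p r) u" unfolding nsq_def
          proof (rule nn_integral_mono)
            fix x
            show "ennreal ((norm (?w x))\<^sup>2) * indicator D x <= ennreal ((norm (u x))\<^sup>2) * indicator (D \<inter> ball p r) x"
            proof (cases "x \<in> ball p r")
              case True
              have "norm (?w x) <= norm (u x)" using et(2)[of x] mult_left_le_one_le[of "norm (u x)" "\<eta> x"] by simp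
              then show ?thesis using True by (auto simp: indicator_def intro!: ennreal_leI power_mono simp del: norm_scaleR)
            next
              case False
              then have "x \<notin> ball p (r/2)" using c(2) by auto
              then show ?thesis using et(4) by simp
            qed
          qed
          also have "... <= nsq \<Omega> u" by (rule nsq_mono) (use DO in auto)
          finally show "nsq D ?w <= nsq \<Omega> u" .
          have "nsq D (jac ?w) <= 2 * nsq (D \<inter> ball p r) (jac u) + ennreal B * nsq (D \<inter> ball p r) u" using B(2) u D_measurable by blast
          also have "... <= 2 * nsq \<Omega> (jac u) + ennreal B * nsq \<Omega> u"
            by (intro add_mono mult_left_mono nsq_mono) (use DO in auto)
          finally show "nsq D (jac ?w) <= 2 * nsq \<Omega> (jac u) + ennreal B * nsq \<Omega> u" .
        qed auto
        also have "... <= ennreal C * (ennreal (3 + B) * (nsq \<Omega> u + nsq \<Omega> (jac u)))"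
        proof (intro mult_left_mono)
          have "nsq \<Omega> u + (2 * nsq \<Omega> (jac u) + ennreal B * nsq \<Omega> u) = (1 + ennreal B) * nsq \<Omega> u + 2 * nsq \<Omega> (jac u)"
            by (simp add: distrib_right add_ac)
          also have "... <= ennreal (3 + B) * nsq \<Omega> u + ennreal (3 + B) * nsq \<Omega> (jac u)"
          proof (intro add_mono mult_right_mono)
            show "1 + ennreal B <= ennreal (3 + B)" using ennreal_leI[of "1 + B" "3 + B"] B(1) by (simp add: ennreal_plus)
            show "2 <= ennreal (3 + B)" using ennreal_leI[of 2 "3 + B"] B(1) by simp
          qed auto
          finally show "nsq \<Omega> u + (2 * nsq \<Omega> (jac u) + ennreal B * nsq \<Omega> u) <= ennreal (3 + B) * (nsq \<Omega> u + nsq \<Omega> (jac u))"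
            by (simp only: distrib_left)
        qed auto
        also have "... = ennreal (C * (3 + B)) * (nsq \<Omega> u + nsq \<Omega> (jac u))"
          using C(1) B(1) by (subst ennreal_mult) (auto simp: mult.assoc)
        finally show ?thesis .
      qed
      moreover have "C * (3 + B) >= 0" using C B by simp
      ultimately show ?thesis by blast
    qed
    ultimately show ?thesis using c(2) by (intro exI[of _ "r/4"]) auto
  qed
  have "\<forall>p. \<exists>r. p \<in> frontier \<Omega> --> r > 0 & emeasure (surf \<Omega>) (frontier \<Omega> \<inter> cball p r) < \<infinity> & (sigma_finite_measure (surf \<Omega>) --> (\<exists>C\<ge>0. \<forall>u. smooth_vec u -->
      (\<integral>\<^sup>+x. ennreal ((norm (u x))\<^sup>2 * indicator (frontier \<Omega> \<inter> cball p r) x) \<partial>surf \<Omega>) <= ennreal C * (nsq \<Omega> u + nsq \<Omega> (jac u))))"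
    using local by blast
  from choice[OF this] obtain r where r: "!!p. p \<in> frontier \<Omega> ==> r p > 0"
    "!!p. p \<in> frontier \<Omega> ==> emeasure (surf \<Omega>) (frontier \<Omega> \<inter> cball p (r p)) < \<infinity>"
    "!!p. p \<in> frontier \<Omega> ==> sigma_finite_measure (surf \<Omega>) ==> (\<exists>C\<ge>0. \<forall>u. smooth_vec u -->
      (\<integral>\<^sup>+x. ennreal ((norm (u x))\<^sup>2 * indicator (frontier \<Omega> \<inter> cball p (r p)) x) \<partial>surf \<Omega>) <= ennreal C * (nsq \<Omega> u + nsq \<Omega> (jac u)))" by blast
  have "frontier \<Omega> \<subseteq> (\<Union>p\<in>frontier \<Omega>. ball p (r p))" using r(1) by fastforce
  then obtain P where P: "P \<subseteq> frontier \<Omega>" "finite P" "frontier \<Omega> \<subseteq> (\<Union>p\<in>P. ball p (r p))"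
    by (rule compactE_image[OF fc, rotated]) auto
  let ?F = "%p. frontier \<Omega> \<inter> cball p (r p)"
  have Fs: "?F p \<in> sets (surf \<Omega>)" for p by (rule csets) (auto intro: compact_Int_closed[OF fc])
  have cov: "frontier \<Omega> \<subseteq> (\<Union>p\<in>P. ?F p)" using P(3) ball_subset_cball by blast
  show fin: "finite_measure (surf \<Omega>)"
  proof
    have "emeasure (surf \<Omega>) (space (surf \<Omega>)) <= emeasure (surf \<Omega>) (\<Union>p\<in>P. ?F p)"
      unfolding surf_facts(1) by (rule emeasure_mono[OF cov]) (intro sets.finite_UN P Fs)
    also have "... <= (\<Sum>p\<in>P. emeasure (surf \<Omega>) (?F p))" by (rule emeasure_subadditive_finite) (use Fs P in auto)
    also have "... < \<infinity>" using P r(2) by (auto simp: less_top[symmetric] subset_iff)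
    finally show "emeasure (surf \<Omega>) (space (surf \<Omega>)) ~= \<infinity>" by auto
  qed
  interpret finite_measure "surf \<Omega>" by (rule fin)
  have "\<forall>p. \<exists>C. p \<in> frontier \<Omega> --> C >= 0 & (\<forall>u. smooth_vec u -->
      (\<integral>\<^sup>+x. ennreal ((norm (u x))\<^sup>2 * indicator (?F p) x) \<partial>surf \<Omega>) <= ennreal C * (nsq \<Omega> u + nsq \<Omega> (jac u)))"
    using r(3) sigma_finite_measure_axioms by blast
  from choice[OF this] obtain Cf where Cf: "!!p. p \<in> frontier \<Omega> ==> Cf p >= 0"
    "!!p u. p \<in> frontier \<Omega> ==> smooth_vec u ==> (\<integral>\<^sup>+x. ennreal ((norm (u x))\<^sup>2 * indicator (?F p) x) \<partial>surf \<Omega>) <= ennreal (Cf p) * (nsq \<Omega> u + nsq \<Omega> (jac u))" by blast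
  have "(\<integral>\<^sup>+x. ennreal ((norm (u x))\<^sup>2) \<partial>surf \<Omega>) <= ennreal (\<Sum>p\<in>P. Cf p) * (nsq \<Omega> u + nsq \<Omega> (jac u))" if u: "smooth_vec u" for u
  proof -
    have [measurable]: "u \<in> borel_measurable (surf \<Omega>)"
      using measurable_restrict_space1[OF smooth_vec_measurable(1)[OF u], of "frontier \<Omega>"] measurable_cong_sets[OF surf_facts(2) refl] by blast
    have "(\<integral>\<^sup>+x. ennreal ((norm (u x))\<^sup>2) \<partial>surf \<Omega>) <= (\<integral>\<^sup>+x. (\<Sum>p\<in>P. ennreal ((norm (u x))\<^sup>2 * indicator (?F p) x)) \<partial>surf \<Omega>)"
    proof (rule nn_integral_mono)
      fix x assume "x \<in> space (surf \<Omega>)"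
      then obtain p where p: "p \<in> P" "x \<in> ?F p" using cov surf_facts(1) by blast
      have "ennreal ((norm (u x))\<^sup>2 * indicator (?F p) x) <= (\<Sum>p\<in>P. ennreal ((norm (u x))\<^sup>2 * indicator (?F p) x))"
        by (rule member_le_sum[OF p(1)]) (use P in auto)
      then show "ennreal ((norm (u x))\<^sup>2) <= (\<Sum>p\<in>P. ennreal ((norm (u x))\<^sup>2 * indicator (?F p) x))" using p(2) by simp
    qed
    also have "... = (\<Sum>p\<in>P. \<integral>\<^sup>+x. ennreal ((norm (u x))\<^sup>2 * indicator (?F p) x) \<partial>surf \<Omega>)"
      by (rule nn_integral_sum) (use Fs in measurable)
    also have "... <= (\<Sum>p\<in>P. ennreal (Cf p) * (nsq \<Omega> u + nsq \<Omega> (jac u)))" by (intro sum_mono Cf u) (use P in auto)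
    also have "... = ennreal (\<Sum>p\<in>P. Cf p) * (nsq \<Omega> u + nsq \<Omega> (jac u))"
      using P Cf by (subst sum_ennreal[symmetric]) (auto simp: sum_distrib_right)
    finally show ?thesis .
  qed
  moreover have "(\<Sum>p\<in>P. Cf p) >= 0" using P Cf by (intro sum_nonneg) auto
  ultimately show "\<exists>C\<ge>0. \<forall>u. smooth_vec u --> (\<integral>\<^sup>+x. ennreal ((norm (u x))\<^sup>2) \<partial>surf \<Omega>) <= ennreal C * (nsq \<Omega> u + nsq \<Omega> (jac u))" by blast
qed

section \<open>The quadratic energy density\<close>

lemma borel_measurable_AE_lebesgue_on:
  fixes f g :: "real^'n => real"
  assumes "open \<Omega>" "f \<in> borel_measurable (lebesgue_on \<Omega>)" "AE x in lebesgue_on \<Omega>. f x = g x"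
  shows "g \<in> borel_measurable (lebesgue_on \<Omega>)"
proof -
  have O: "\<Omega> \<in> sets lebesgue" using assms(1) by auto
  have "(%x. if x \<in> \<Omega> then f x else 0) \<in> borel_measurable lebesgue" using assms(2) O by (subst borel_measurable_if) auto
  moreover have "AE x in lebesgue. x \<in> \<Omega> --> f x = g x" using assms(3) O by (subst (asm) AE_restrict_space_iff) auto
  then have "AE x in lebesgue. (if x \<in> \<Omega> then f x else 0) = (if x \<in> \<Omega> then g x else 0)" by eventually_elim auto
  ultimately have "(%x. if x \<in> \<Omega> then g x else 0) \<in> borel_measurable lebesgue" by (rule borel_measurable_AE)
  then show ?thesis using O by (subst (asm) borel_measurable_if) auto
qed

text \<open>The mean value theorem for \<open>f (s *\<^sub>R y)\<close> minus its quadratic model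
  reduces the error to that of linearizing \<open>Df\<close> at 0, so differentiability of
  \<open>Df\<close> at the single point 0 suffices.\<close>

lemma second_order_expansion:
  fixes f :: "'a::euclidean_space => real" and Df :: "'a => ('a \<Rightarrow>\<^sub>L real)" and D2 :: "'a \<Rightarrow>\<^sub>L ('a \<Rightarrow>\<^sub>L real)"
  assumes U: "open U" "0 \<in> U" and f: "!!y. y \<in> U ==> (f has_derivative blinfun_apply (Df y)) (at y)"
    and D: "(Df has_derivative blinfun_apply D2) (at 0)" and z: "f 0 = 0" "Df 0 = 0" and e: "e > 0"
  shows "\<exists>d>0. \<forall>y. norm y < d --> \<bar>f y - (1/2) * blinfun_apply (blinfun_apply D2 y) y\<bar> <= e * (norm y)\<^sup>2"
proof -
  obtain r where r: "r > 0" "ball 0 r \<subseteq> U" using U open_contains_ball by blast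
  obtain d0 where d0: "d0 > 0" "!!y. norm y < d0 ==> norm (Df y - D2 y) <= e * norm y"
    using D e unfolding has_derivative_at_alt by (auto simp: z)
  have "\<bar>f y - (1/2) * D2 y y\<bar> <= e * (norm y)\<^sup>2" if y: "norm y < min r d0" for y
  proof -
    define g where "g s = f (s *\<^sub>R y) - (1/2) * s\<^sup>2 * D2 y y" for s
    define g' where "g' s h = h * ((Df (s *\<^sub>R y) - D2 (s *\<^sub>R y)) y)" for s h :: real
    have sy: "norm (s *\<^sub>R y) <= norm y" if "0 <= s" "s <= 1" for s using that by (simp add: mult_left_le_one_le)
    have der: "(g has_derivative g' s) (at s within {0..1})" if s: "0 <= s" "s <= 1" for s
    proof -
      have "norm (s *\<^sub>R y) < r" using sy[OF s] y by simp
      then have "s *\<^sub>R y \<in> U" using r(2) by auto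
      from f[OF this] have fd: "(f has_derivative Df (s *\<^sub>R y)) (at (s *\<^sub>R y))" .
      have 1: "((%s. s *\<^sub>R y) has_derivative (%h. h *\<^sub>R y)) (at s)" by (auto intro!: derivative_eq_intros)
      have 2: "((%s. f (s *\<^sub>R y)) has_derivative (%h. Df (s *\<^sub>R y) (h *\<^sub>R y))) (at s)"
        using diff_chain_at[OF 1 fd] by (simp add: o_def)
      have 3: "((%s. (1/2) * s\<^sup>2 * D2 y y) has_derivative (%h. h * s * D2 y y)) (at s)"
        by (auto intro!: derivative_eq_intros simp: algebra_simps)
      have "(g has_derivative (%h. Df (s *\<^sub>R y) (h *\<^sub>R y) - h * s * D2 y y)) (at s)"
        unfolding g_def by (rule has_derivative_diff[OF 2 3])
      moreover have "(%h. Df (s *\<^sub>R y) (h *\<^sub>R y) - h * s * D2 y y) = g' s"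
        by (rule ext) (simp add: g'_def blinfun.scaleR_right blinfun.diff_left blinfun.scaleR_left algebra_simps)
      ultimately show ?thesis by (simp add: has_derivative_at_withinI)
    qed
    obtain s where s: "s \<in> {0..1}" "g 1 - g 0 = g' s (1 - 0)" using mvt_very_simple[OF zero_le_one der] by blast
    have "g 1 - g 0 = f y - (1/2) * D2 y y" by (simp add: g_def z)
    then have "\<bar>f y - (1/2) * D2 y y\<bar> = \<bar>(Df (s *\<^sub>R y) - D2 (s *\<^sub>R y)) y\<bar>" using s(2) by (simp add: g'_def)
    also have "... <= norm (Df (s *\<^sub>R y) - D2 (s *\<^sub>R y)) * norm y" using norm_blinfun[of "Df (s *\<^sub>R y) - D2 (s *\<^sub>R y)" y] by simp
    also have "... <= (e * norm (s *\<^sub>R y)) * norm y" using sy[of s] s(1) y by (intro mult_right_mono d0(2)) auto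
    also have "... <= (e * norm y) * norm y" using sy[of s] s(1) e by (intro mult_right_mono mult_left_mono) auto
    finally show ?thesis by (simp add: power2_eq_square mult.assoc)
  qed
  then show ?thesis using r(1) d0(1) by (intro exI[of _ "min r d0"]) auto
qed

section \<open>Expansion of the stored energy at the identity\<close>

lemma transpose_add_mat: "transpose (A + B) = transpose A + transpose (B :: real^'n^'n)"
  by (simp add: vec_eq_iff transpose_def)

lemma transpose_scaleR_mat: "transpose (c *\<^sub>R A) = c *\<^sub>R transpose (A :: real^'n^'n)" by (simp add: vec_eq_iff transpose_def)

lemma matrix_scaleR_mult: "(c *\<^sub>R A) ** B = c *\<^sub>R (A ** (B :: real^'n^'n))" "A ** (c *\<^sub>R B) = c *\<^sub>R (A ** B)"
  by (simp_all add: vec_eq_iff matrix_matrix_mult_def sum_distrib_left mult.left_commute mult.assoc)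

lemma matrix_add_rdist: "(A + B) ** C = A ** C + B ** (C :: real^'n^'n)"
  by (simp add: vec_eq_iff matrix_matrix_mult_def sum.distrib distrib_right)

lemma green_strain_sym:
  fixes B :: "real^'n^'n"
  assumes "transpose B = B"
  shows "transpose (mat 1 + t *\<^sub>R B) ** (mat 1 + t *\<^sub>R B) - mat 1 = (2 * t) *\<^sub>R (B + (t/2) *\<^sub>R (B ** B))"
proof -
  have "transpose (mat 1 + t *\<^sub>R B) = mat 1 + t *\<^sub>R B" using assms by (simp add: transpose_add_mat transpose_scaleR_mat transpose_mat)
  then have "transpose (mat 1 + t *\<^sub>R B) ** (mat 1 + t *\<^sub>R B) = mat 1 + t *\<^sub>R B + (t *\<^sub>R B + (t * t) *\<^sub>R (B ** B))"
    by (simp add: matrix_add_ldistrib matrix_add_rdist matrix_scaleR_mult scaleR_add_right)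
  moreover have "(2 * t) *\<^sub>R (B + (t/2) *\<^sub>R (B ** B)) = t *\<^sub>R B + (t *\<^sub>R B + (t * t) *\<^sub>R (B ** B))"
    by (simp add: vec_eq_iff algebra_simps)
  ultimately show ?thesis by simp
qed

lemma det_near_identity:
  fixes B :: "real^'n^'n"
  shows "eventually (%n. det (mat 1 + (1 / real (Suc n)) *\<^sub>R B) > 0) sequentially"
proof -
  have "(%n. 1 / real (Suc n)) ----> 0" using LIMSEQ_inverse_real_of_nat by (simp add: inverse_eq_divide)
  then have "(%n. mat 1 + (1 / real (Suc n)) *\<^sub>R B) ----> mat 1 + 0 *\<^sub>R B" by (intro tendsto_intros)
  then have l: "(%n. mat 1 + (1 / real (Suc n)) *\<^sub>R B) ----> mat 1" by simp
  have "(%n. det (mat 1 + (1 / real (Suc n)) *\<^sub>R B)) ----> det (mat 1 :: real^'n^'n)"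
    unfolding det_def by (intro tendsto_intros tendsto_vec_nth l)
  then show ?thesis by (intro order_tendstoD(1)) auto
qed

text \<open>For symmetric \<open>B\<close> the Green strain of \<open>mat 1 + t *\<^sub>R B\<close>
  is \<open>t\<close> times a matrix tending to \<open>B\<close>, so the energy divided by
  \<open>t\<^sup>2\<close> tends to the quadratic form at \<open>B\<close>. The coercivity of
  \<open>W\<close> survives the limit; the missing factor 1/2 in front of the strain there becomes 4
  after squaring. Using a sequence for \<open>t\<close> keeps the limit measurable later.\<close>

lemma V0_pointwise:
  fixes W V :: "real^'n^'n => ennreal" and DV :: "real^'n^'n => ((real^'n^'n) \<Rightarrow>\<^sub>L real)"
    and D2 :: "(real^'n^'n) \<Rightarrow>\<^sub>L ((real^'n^'n) \<Rightarrow>\<^sub>L real)"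
  assumes Ob: "open Ob" "0 \<in> Ob" and Vf: "!!D. D \<in> Ob ==> V D < \<infinity>"
    and d1: "!!D. D \<in> Ob ==> ((%D. enn2real (V D)) has_derivative blinfun_apply (DV D)) (at D)"
    and d2: "(DV has_derivative blinfun_apply D2) (at 0)"
    and WV: "!!F. det F > 0 ==> W F = V ((1/2) *\<^sub>R (transpose F ** F - mat 1))"
    and W1: "W (mat 1) = 0" and C: "C > 0" "!!F. ennreal (C * (norm (transpose F ** F - mat 1))\<^sup>2) <= W F"
    and B: "transpose B = B"
  shows "(%n. enn2real (W (mat 1 + (1 / real (Suc n)) *\<^sub>R B)) * (real (Suc n))\<^sup>2) ----> (1/2) * D2 B B"
    and "4 * C * (norm B)\<^sup>2 <= (1/2) * D2 B B"
proof -
  define f where "f D = enn2real (V D)" for D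
  have V0: "V 0 = 0" using WV[of "mat 1"] W1 by (simp add: transpose_mat)
  then have f0: "f 0 = 0" by (simp add: f_def)
  \<comment> \<open>The nonnegative function \<open>V\<close> vanishes at 0, so this is a minimum
    and the first derivative is 0.\<close>
  have "blinfun_apply (DV 0) = (%v. 0)" by (rule differential_zero_maxmin[OF Ob(2,1) d1[OF Ob(2)]]) (simp add: V0)
  then have DV0: "DV 0 = 0" by (intro blinfun_eqI) simp
  define t where "t n = 1 / real (Suc n)" for n
  have t: "t n > 0" "t n <= 1" for n by (auto simp: t_def)
  have tl: "t ----> 0" using LIMSEQ_inverse_real_of_nat by (simp add: inverse_eq_divide t_def[abs_def])
  define E where "E n = B + (t n / 2) *\<^sub>R (B ** B)" for n
  have El: "E ----> B"
  proof -
    have "(%n. B + (t n / 2) *\<^sub>R (B ** B)) ----> B + (0 / 2) *\<^sub>R (B ** B)" by (intro tendsto_intros tl) auto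
    then show ?thesis by (simp add: E_def[abs_def])
  qed
  have gs: "(1/2) *\<^sub>R (transpose (mat 1 + t n *\<^sub>R B) ** (mat 1 + t n *\<^sub>R B) - mat 1) = t n *\<^sub>R E n" for n
    unfolding green_strain_sym[OF B] E_def by simp
  define q where "q D = (1/2) * D2 D D" for D
  have ql: "(%n. q (E n)) ----> q B" unfolding q_def by (intro tendsto_intros El)
  have tE: "(%n. t n *\<^sub>R E n) ----> 0" using tendsto_scaleR[OF tl El] by simp
  have Wf: "eventually (%n. W (mat 1 + t n *\<^sub>R B) = V (t n *\<^sub>R E n) & t n *\<^sub>R E n \<in> Ob) sequentially"
    using det_near_identity[of B, folded t_def] topological_tendstoD[OF tE Ob]
  proof eventually_elim
    case (elim n)
    show ?case using WV[OF elim(1)] elim(2) unfolding gs by blast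
  qed
  define w where "w n = enn2real (W (mat 1 + t n *\<^sub>R B)) * (real (Suc n))\<^sup>2" for n
  have sc: "q (t n *\<^sub>R E n) * (real (Suc n))\<^sup>2 = q (E n)" for n
    by (simp add: q_def blinfun.scaleR_left blinfun.scaleR_right t_def power2_eq_square)
  have wq: "(%n. w n - q (E n)) ----> 0"
  proof (rule LIMSEQ_I)
    fix e :: real assume e: "e > 0"
    define M where "M = (norm B + norm (B ** B))\<^sup>2 + 1"
    have M: "M > 0" unfolding M_def by (simp add: add_nonneg_pos)
    have EM: "(norm (E n))\<^sup>2 <= M" for n
    proof -
      have "norm (E n) <= norm B + norm ((t n / 2) *\<^sub>R (B ** B))" unfolding E_def by (rule norm_triangle_ineq)
      also have "norm ((t n / 2) *\<^sub>R (B ** B)) <= 1 * norm (B ** B)"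
        using t[of n] by (simp only: norm_scaleR) (intro mult_right_mono, auto)
      finally have "(norm (E n))\<^sup>2 <= (norm B + norm (B ** B))\<^sup>2" by (intro power_mono) auto
      then show ?thesis unfolding M_def by linarith
    qed
    have "e / (2 * M) > 0" using e M by simp
    from second_order_expansion[OF Ob d1 d2 _ DV0 this] V0 obtain d where d: "d > 0"
      "!!y. norm y < d ==> \<bar>enn2real (V y) - (1/2) * D2 y y\<bar> <= e / (2 * M) * (norm y)\<^sup>2" by auto
    have "eventually (%n. norm (t n *\<^sub>R E n) < d) sequentially" using tendstoD[OF tE d(1)] by simp
    with Wf have "eventually (%n. norm (w n - q (E n) - 0) < e) sequentially"
    proof eventually_elim
      case (elim n)
      have "\<bar>enn2real (V (t n *\<^sub>R E n)) - q (t n *\<^sub>R E n)\<bar> <= e / (2 * M) * (norm (t n *\<^sub>R E n))\<^sup>2"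
        unfolding q_def by (rule d(2)) (use elim in simp)
      then have "\<bar>enn2real (V (t n *\<^sub>R E n)) - q (t n *\<^sub>R E n)\<bar> * (real (Suc n))\<^sup>2 <= e / (2 * M) * (norm (t n *\<^sub>R E n))\<^sup>2 * (real (Suc n))\<^sup>2"
        by (intro mult_right_mono) auto
      also have "... = e / (2 * M) * (norm (E n))\<^sup>2" by (simp add: t_def power_divide)
      also have "... <= e / (2 * M) * M" using e M EM[of n] by (intro mult_left_mono) auto
      also have "... = e / 2" using M by simp
      finally have "\<bar>enn2real (V (t n *\<^sub>R E n)) - q (t n *\<^sub>R E n)\<bar> * (real (Suc n))\<^sup>2 <= e / 2" .
      moreover have "\<bar>enn2real (V (t n *\<^sub>R E n)) - q (t n *\<^sub>R E n)\<bar> * (real (Suc n))\<^sup>2 = \<bar>w n - q (E n)\<bar>"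
        using elim sc[of n] by (simp add: w_def abs_mult left_diff_distrib flip: abs_mult_self_eq) (metis abs_mult abs_power2 left_diff_distrib)
      ultimately show ?case using e by simp
    qed
    then show "\<exists>N. \<forall>n\<ge>N. norm (w n - q (E n) - 0) < e" by (simp add: eventually_sequentially)
  qed
  have wl: "w ----> q B" using tendsto_add[OF wq ql] by simp
  then show "(%n. enn2real (W (mat 1 + (1 / real (Suc n)) *\<^sub>R B)) * (real (Suc n))\<^sup>2) ----> (1/2) * D2 B B"
    by (simp add: w_def[abs_def] t_def q_def)
  have "(%n. 4 * C * (norm (E n))\<^sup>2) ----> 4 * C * (norm B)\<^sup>2" by (intro tendsto_intros El)
  moreover have "eventually (%n. 4 * C * (norm (E n))\<^sup>2 <= w n) sequentially" using Wf
  proof eventually_elim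
    case (elim n)
    let ?F = "mat 1 + t n *\<^sub>R B"
    have nF: "norm (transpose ?F ** ?F - mat 1) = 2 * t n * norm (E n)"
      unfolding green_strain_sym[OF B] E_def[symmetric] using t[of n] by simp
    have "W ?F < \<infinity>" using elim Vf by simp
    then have "C * (norm (transpose ?F ** ?F - mat 1))\<^sup>2 <= enn2real (W ?F)"
      using enn2real_mono[OF C(2)[of ?F]] C(1) by (simp add: less_top)
    then have "C * (2 * t n * norm (E n))\<^sup>2 * (real (Suc n))\<^sup>2 <= w n" unfolding nF w_def by (intro mult_right_mono) auto
    moreover have "C * (2 * t n * norm (E n))\<^sup>2 * (real (Suc n))\<^sup>2 = 4 * C * (norm (E n))\<^sup>2"
      by (simp add: t_def power_mult_distrib power_divide)
    ultimately show ?case by (simp only:)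
  qed
  ultimately show "4 * C * (norm B)\<^sup>2 <= (1/2) * D2 B B"
    unfolding q_def[symmetric] by (rule tendsto_le[OF sequentially_bot wl])
qed

text \<open>The expansion identifies \<open>V0\<close> at a measurable symmetric field, almost
  everywhere, with a pointwise limit of measurable functions built from \<open>W\<close>;
  completeness of Lebesgue measure then transfers measurability.\<close>

lemma V0_facts:
  fixes \<Omega> :: "(real^'n) set"
    and W :: "real^'n => real^'n^'n => ennreal"
    and V :: "real^'n => real^'n^'n => ennreal"
    and DV :: "real^'n => real^'n^'n => ((real^'n^'n) \<Rightarrow>\<^sub>L real)"
    and D2V :: "real^'n => real^'n^'n => ((real^'n^'n) \<Rightarrow>\<^sub>L ((real^'n^'n) \<Rightarrow>\<^sub>L real))"
  assumes O: "open \<Omega>"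
    and W_meas: "(%p. W (fst p) (snd p)) \<in> borel_measurable (lebesgue_on \<Omega> \<Otimes>\<^sub>M borel)"
    and W_coerc: "\<exists>C>0. AE x in lebesgue_on \<Omega>. \<forall>F. ennreal (C * (norm (transpose F ** F - mat 1))\<^sup>2) <= W x F"
    and W_id: "AE x in lebesgue_on \<Omega>. W x (mat 1) = 0"
    and WV: "AE x in lebesgue_on \<Omega>. \<forall>F. det F > 0 --> W x F = V x ((1/2) *\<^sub>R (transpose F ** F - mat 1))"
    and V_C2: "\<exists>Ob \<gamma>. open Ob & 0 \<in> Ob & (AE x in lebesgue_on \<Omega>.
                 (\<forall>D\<in>Ob. V x D < \<infinity>
                   & ((%D. enn2real (V x D)) has_derivative blinfun_apply (DV x D)) (at D)
                   & (DV x has_derivative blinfun_apply (D2V x D)) (at D)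
                   & (\<forall>B. \<bar>blinfun_apply (blinfun_apply (D2V x D) B) B\<bar> <= 2 * \<gamma> * (norm B)\<^sup>2))
                 & continuous_on Ob (D2V x))"
  obtains \<alpha> \<gamma> where "\<alpha> > 0" "\<gamma> >= 0"
    "AE x in lebesgue_on \<Omega>. \<forall>B. transpose B = B --> \<alpha> * (norm B)\<^sup>2 <= V0 D2V x B & V0 D2V x B <= \<gamma> * (norm B)\<^sup>2"
    "!!A. A \<in> borel_measurable (lebesgue_on \<Omega>) ==> (!!x. transpose (A x) = A x) ==> (%x. V0 D2V x (A x)) \<in> borel_measurable (lebesgue_on \<Omega>)"
proof -
  let ?M = "lebesgue_on \<Omega>"
  obtain C where C: "C > 0" "AE x in ?M. \<forall>F. ennreal (C * (norm (transpose F ** F - mat 1))\<^sup>2) <= W x F" using W_coerc by blast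
  obtain Ob \<gamma> where Ob: "open Ob" "0 \<in> Ob" "AE x in ?M.
                 (\<forall>D\<in>Ob. V x D < \<infinity>
                   & ((%D. enn2real (V x D)) has_derivative blinfun_apply (DV x D)) (at D)
                   & (DV x has_derivative blinfun_apply (D2V x D)) (at D)
                   & (\<forall>B. \<bar>blinfun_apply (blinfun_apply (D2V x D) B) B\<bar> <= 2 * \<gamma> * (norm B)\<^sup>2))
                 & continuous_on Ob (D2V x)" using V_C2 by blast
  have ae: "AE x in ?M. \<forall>B. transpose B = B -->
      (%n. enn2real (W x (mat 1 + (1 / real (Suc n)) *\<^sub>R B)) * (real (Suc n))\<^sup>2) ----> V0 D2V x B
      & 4 * C * (norm B)\<^sup>2 <= V0 D2V x B & V0 D2V x B <= max \<gamma> 0 * (norm B)\<^sup>2" using C(2) Ob(3) WV W_id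
  proof eventually_elim
    case (elim x)
    show ?case
    proof (intro allI impI)
      fix B :: "real^'n^'n" assume B: "transpose B = B"
      have vf: "!!D. D \<in> Ob ==> V x D < \<infinity>" and d1: "!!D. D \<in> Ob ==> ((%D. enn2real (V x D)) has_derivative blinfun_apply (DV x D)) (at D)"
        and d2: "(DV x has_derivative blinfun_apply (D2V x 0)) (at 0)" and bd: "\<bar>blinfun_apply (blinfun_apply (D2V x 0) B) B\<bar> <= 2 * \<gamma> * (norm B)\<^sup>2"
        using elim(2) Ob(2) by auto
      have wv: "!!F. det F > 0 ==> W x F = V x ((1/2) *\<^sub>R (transpose F ** F - mat 1))"
        and co: "!!F. ennreal (C * (norm (transpose F ** F - mat 1))\<^sup>2) <= W x F" using elim(1,3) by auto
      note p = V0_pointwise[of Ob "V x" "DV x" "D2V x 0" "W x" C B, OF Ob(1,2) vf d1 d2 wv elim(4) C(1) co B]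
      have "\<gamma> * (norm B)\<^sup>2 <= max \<gamma> 0 * (norm B)\<^sup>2" by (intro mult_right_mono) auto
      then show "(%n. enn2real (W x (mat 1 + (1 / real (Suc n)) *\<^sub>R B)) * (real (Suc n))\<^sup>2) ----> V0 D2V x B
        & 4 * C * (norm B)\<^sup>2 <= V0 D2V x B & V0 D2V x B <= max \<gamma> 0 * (norm B)\<^sup>2" using p bd unfolding V0_def by auto
    qed
  qed
  show ?thesis
  proof
    \<comment> \<open>The bound \<open>\<gamma>\<close> comes without a sign and is replaced by its
      positive part.\<close>
    show "4 * C > 0" "max \<gamma> 0 >= 0" using C by auto
    show "AE x in ?M. \<forall>B. transpose B = B --> 4 * C * (norm B)\<^sup>2 <= V0 D2V x B & V0 D2V x B <= max \<gamma> 0 * (norm B)\<^sup>2"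
      using ae by eventually_elim blast
    fix A :: "real^'n => real^'n^'n" assume A[measurable]: "A \<in> borel_measurable ?M" and sym: "!!x. transpose (A x) = A x"
    let ?u = "%n x. enn2real (W x (mat 1 + (1 / real (Suc n)) *\<^sub>R A x)) * (real (Suc n))\<^sup>2"
    have um: "?u n \<in> borel_measurable ?M" for n
    proof -
      have "(%x. (x, mat 1 + (1 / real (Suc n)) *\<^sub>R A x)) \<in> ?M \<rightarrow>\<^sub>M ?M \<Otimes>\<^sub>M borel" by measurable
      from measurable_compose[OF this W_meas] have "(%x. W x (mat 1 + (1 / real (Suc n)) *\<^sub>R A x)) \<in> borel_measurable ?M" by simp
      then show ?thesis by measurable
    qed
    have "(%x. lim (%n. ?u n x)) \<in> borel_measurable ?M" by (rule borel_measurable_lim_metric) (rule um)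
    moreover have "AE x in ?M. lim (%n. ?u n x) = V0 D2V x (A x)" using ae by eventually_elim (intro limI, use sym in blast)
    ultimately show "(%x. V0 D2V x (A x)) \<in> borel_measurable ?M" by (rule borel_measurable_AE_lebesgue_on[OF O])
  qed
qed

section \<open>The load functional\<close>

lemma nsq_eq_sq_int: "open \<Omega> ==> L2_on (lebesgue_on \<Omega>) F ==> nsq \<Omega> F = ennreal (sq_int (lebesgue_on \<Omega>) F)"
  by (simp add: sq_int_eq_nn nn_integral_lebesgue_on nsq_def)

locale lipschitz_domain =
  fixes \<Omega> :: "(real^'n) set"
  assumes N: "CARD('n) >= 2" and O: "bounded \<Omega>" "open \<Omega>" "connected \<Omega>" "lipschitz_boundary \<Omega>"
begin

abbreviation M where "M \<equiv> lebesgue_on \<Omega>"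

text \<open>The squared H1 norm; its subadditivity up to the factor 2 replaces the triangle
  inequality.\<close>

definition hn :: "(real^'n => real^'n) => real" where
  "hn v = sq_int M v + sq_int M (grad \<Omega> v)"

lemma hn_nonneg: "hn v >= 0" by (simp add: hn_def sq_int_nonneg)

lemma H1_lincomb: "H1 \<Omega> v ==> H1 \<Omega> w ==> H1 \<Omega> (%x. v x + c *\<^sub>R w x)" by (rule grad_add(1)[OF O(1,2)])

lemma H1_diff: "H1 \<Omega> v ==> H1 \<Omega> w ==> H1 \<Omega> (%x. v x - w x)" using H1_lincomb[of v w "-1"] by simp

lemma H1_rigid: "H1 \<Omega> (%x. b + A *v x)" by (rule grad_smooth(1)[OF O(1,2) smooth_vec_affine])

lemma grad_diff: "H1 \<Omega> v ==> H1 \<Omega> w ==> AE x in M. grad \<Omega> (%x. v x - w x) x = grad \<Omega> v x - grad \<Omega> w x"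
  using grad_add(2)[OF O(1,2), of v w "-1"] by simp

lemma hn_lincomb:
  assumes v: "H1 \<Omega> v" and w: "H1 \<Omega> w"
  shows "hn (%x. v x + c *\<^sub>R w x) <= 2 * hn v + 2 * c\<^sup>2 * hn w"
proof -
  note vp = grad_props[OF v] and wp = grad_props[OF w]
  have "sq_int M (grad \<Omega> (%x. v x + c *\<^sub>R w x)) = sq_int M (%x. grad \<Omega> v x + c *\<^sub>R grad \<Omega> w x)"
    by (rule sq_int_cong_AE[OF grad_add(2)[OF O(1,2) v w] grad_props(2)[OF H1_lincomb[OF v w]]])
      (intro L2_on_add L2_on_scaleR vp wp)
  moreover have "sq_int M (%x. grad \<Omega> v x + c *\<^sub>R grad \<Omega> w x) <= 2 * sq_int M (grad \<Omega> v) + 2 * (c\<^sup>2 * sq_int M (grad \<Omega> w))"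
    using sq_int_add_le[OF vp(2) L2_on_scaleR[OF wp(2), of c]] by (simp add: sq_int_scaleR)
  moreover have "sq_int M (%x. v x + c *\<^sub>R w x) <= 2 * sq_int M v + 2 * (c\<^sup>2 * sq_int M w)"
    using sq_int_add_le[OF vp(1) L2_on_scaleR[OF wp(1), of c]] by (simp add: sq_int_scaleR)
  ultimately show ?thesis by (simp add: hn_def algebra_simps)
qed

lemma hn_diff: "H1 \<Omega> v ==> H1 \<Omega> w ==> hn (%x. v x - w x) <= 2 * hn v + 2 * hn w" using hn_lincomb[of v w "-1"] by simp

lemma H1_dist_hn:
  assumes "H1 \<Omega> v" "H1 \<Omega> w"
  shows "H1_dist \<Omega> v w = sqrt (hn (%x. v x - w x))"
proof -
  have "sq_int M (grad \<Omega> (%x. v x - w x)) = sq_int M (%x. grad \<Omega> v x - grad \<Omega> w x)"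
    by (rule sq_int_cong_AE[OF grad_diff[OF assms] grad_props(2)[OF H1_diff[OF assms]]])
      (intro L2_on_diff grad_props assms)
  then show ?thesis by (simp add: H1_dist_eq hn_def)
qed

lemma hn_smooth: "smooth_vec u ==> hn u = sq_int M u + sq_int M (jac u)"
  using grad_smooth[OF O(1,2)] by (simp add: hn_def sq_int_cong_AE grad_props(2))

lemma H1_smooth: "smooth_vec u ==> H1 \<Omega> u" by (rule grad_smooth(1)[OF O(1,2)])

lemma smooth_dense_hn:
  assumes v: "H1 \<Omega> v"
  obtains u where "!!k. smooth_vec (u k)" "(%k. hn (%x. u k x - v x)) ----> 0"
proof -
  obtain u where u: "!!k. smooth_vec (u k)" "(%k. H1_dist \<Omega> (u k) v) ----> 0" using smooth_dense[OF O(1,2,4) v] by blast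
  have "(%k. (H1_dist \<Omega> (u k) v)\<^sup>2) ----> 0\<^sup>2" by (intro tendsto_intros u)
  then have "(%k. hn (%x. u k x - v x)) ----> 0" by (simp add: H1_dist_hn[OF H1_smooth[OF u(1)] v] hn_nonneg)
  then show ?thesis using that u(1) by blast
qed

lemma surf_smooth_L2:
  obtains C where "C >= 0" "!!u. smooth_vec u ==> L2_on (surf \<Omega>) u" "!!u. smooth_vec u ==> sq_int (surf \<Omega>) u <= C * hn u"
proof -
  obtain C where C: "C >= 0" "!!u. smooth_vec u ==> (\<integral>\<^sup>+x. ennreal ((norm (u x))\<^sup>2) \<partial>surf \<Omega>) <= ennreal C * (nsq \<Omega> u + nsq \<Omega> (jac u))"
    using trace_domain(2)[OF N O(1,2,4)] by blast
  have b: "L2_on (surf \<Omega>) u & sq_int (surf \<Omega>) u <= C * hn u" if u: "smooth_vec u" for u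
  proof -
    note g = grad_smooth[OF O(1,2) u]
    have "u \<in> borel_measurable (restrict_space borel (frontier \<Omega>))"
      by (rule measurable_restrict_space1[OF smooth_vec_measurable(1)[OF u]])
    then have m: "u \<in> borel_measurable (surf \<Omega>)" using measurable_cong_sets[OF surf_facts(2)[of \<Omega>] refl] by blast
    have "ennreal C * (nsq \<Omega> u + nsq \<Omega> (jac u)) = ennreal (C * hn u)"
      using C(1) by (simp add: nsq_eq_sq_int[OF O(2)] g hn_smooth[OF u] sq_int_nonneg ennreal_mult flip: ennreal_plus)
    then have le: "(\<integral>\<^sup>+x. ennreal ((norm (u x))\<^sup>2) \<partial>surf \<Omega>) <= ennreal (C * hn u)" using C(2)[OF u] by simp
    then have "(\<integral>\<^sup>+x. ennreal ((norm (u x))\<^sup>2) \<partial>surf \<Omega>) < \<infinity>" using le_less_trans ennreal_less_top by fastforce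
    then have L: "L2_on (surf \<Omega>) u" unfolding L2_on_def using m by (intro conjI integrableI_bounded) auto
    then show ?thesis using le C(1) hn_nonneg[of u] by (simp add: sq_int_eq_nn[symmetric])
  qed
  show ?thesis by (rule that[of C]) (use C(1) b in auto)
qed

end

locale loaded_domain = lipschitz_domain \<Omega> for \<Omega> :: "(real^'n) set" +
  fixes f g :: "real^'n => real^'n"
  assumes fL: "L2_on (surf \<Omega>) f" and gL: "L2_on M g"
begin

abbreviation bint where "bint u \<equiv> (LINT x|surf \<Omega>. f x \<bullet> u x)"

lemma bint_bound: "\<exists>K\<ge>0. \<forall>u. smooth_vec u --> (bint u)\<^sup>2 <= K * hn u"
proof -
  obtain C where C: "C >= 0" "!!u. smooth_vec u ==> L2_on (surf \<Omega>) u" "!!u. smooth_vec u ==> sq_int (surf \<Omega>) u <= C * hn u"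
    using surf_smooth_L2 by blast
  have "(bint u)\<^sup>2 <= (sq_int (surf \<Omega>) f * C) * hn u" if u: "smooth_vec u" for u
  proof -
    have "(bint u)\<^sup>2 <= sq_int (surf \<Omega>) f * sq_int (surf \<Omega>) u"
      using L2_Cauchy_Schwarz[OF fL C(2)[OF u]] by (simp add: sq_int_def)
    also have "... <= sq_int (surf \<Omega>) f * (C * hn u)" by (intro mult_left_mono C(3)[OF u] sq_int_nonneg)
    finally show ?thesis by (simp add: mult.assoc)
  qed
  then show ?thesis using C(1) sq_int_nonneg[of "surf \<Omega>" f] by (intro exI[of _ "sq_int (surf \<Omega>) f * C"]) auto
qed

lemma bint_lincomb:
  assumes "smooth_vec u" "smooth_vec w"
  shows "bint (%x. u x + c *\<^sub>R w x) = bint u + c * bint w"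
proof -
  obtain C where C: "!!u. smooth_vec u ==> L2_on (surf \<Omega>) u" using surf_smooth_L2 by blast
  have i: "integrable (surf \<Omega>) (%x. f x \<bullet> u x)" "integrable (surf \<Omega>) (%x. f x \<bullet> w x)" by (intro L2_on_inner fL C assms)+
  then show ?thesis by (simp add: inner_add_right)
qed

lemma smooth_lincomb: "smooth_vec u ==> smooth_vec w ==> smooth_vec (%x. u x + c *\<^sub>R w x)"
  by (intro smooth_vec_add smooth_vec_scaleR)

text \<open>The trace bound makes boundary integrals along any approximating sequence Cauchy and any
  two sequences asymptotically equal. So a common limit exists; it is unique because at least one
  such sequence is at hand, and the definite description denotes it.\<close>

lemma bdry_work_lim:
  assumes v: "H1 \<Omega> v" and u: "!!k. smooth_vec (u k)" "(%k. hn (%x. u k x - v x)) ----> 0"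
  shows "(%k. bint (u k)) ----> bdry_work \<Omega> f v"
proof -
  obtain K where K: "K >= 0" "!!u. smooth_vec u ==> (bint u)\<^sup>2 <= K * hn u" using bint_bound by blast
  let ?d = "%u. sqrt (2 * K * hn (%x. u x - v x))"
  have q: "\<bar>bint a - bint b\<bar> <= ?d a + ?d b" if a: "smooth_vec a" and b: "smooth_vec b" for a b
  proof -
    have ab: "(bint a - bint b)\<^sup>2 <= K * hn (%x. a x - b x)"
      using K(2)[OF smooth_lincomb[OF a b, of "-1"]] bint_lincomb[OF a b, of "-1"] by simp
    have "hn (%x. a x - b x) <= 2 * hn (%x. a x - v x) + 2 * hn (%x. b x - v x)"
      using hn_diff[OF H1_diff[OF H1_smooth[OF a] v] H1_diff[OF H1_smooth[OF b] v]] by simp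
    from mult_left_mono[OF this K(1)] ab
    have "(bint a - bint b)\<^sup>2 <= 2 * K * hn (%x. a x - v x) + 2 * K * hn (%x. b x - v x)"
      by (simp add: distrib_left mult.assoc mult.left_commute)
    then have "sqrt ((bint a - bint b)\<^sup>2) <= sqrt (2 * K * hn (%x. a x - v x) + 2 * K * hn (%x. b x - v x))"
      by (rule real_sqrt_le_mono)
    also have "... <= ?d a + ?d b" using K(1) hn_nonneg by (intro sqrt_add_le_add_sqrt) auto
    finally show ?thesis by simp
  qed
  have d0: "(%k. ?d (w k)) ----> 0" if "(%k. hn (%x. w k x - v x)) ----> 0" for w :: "nat => _"
  proof -
    have "(%k. ?d (w k)) ----> sqrt (2 * K * 0)" by (intro tendsto_intros that)
    then show ?thesis by simp
  qed
  have "Cauchy (%k. bint (u k))"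
  proof (rule metric_CauchyI)
    fix e :: real assume "e > 0"
    then have "eventually (%k. ?d (u k) < e / 2) sequentially" by (intro order_tendstoD(2)[OF d0[OF u(2)]]) simp
    then obtain k0 where k0: "!!k. k >= k0 ==> ?d (u k) < e / 2" by (auto simp: eventually_sequentially)
    show "\<exists>k0. \<forall>m\<ge>k0. \<forall>n\<ge>k0. dist (bint (u m)) (bint (u n)) < e"
    proof (intro exI allI impI)
      fix m n assume "m >= k0" "n >= k0"
      from k0[OF this(1)] k0[OF this(2)] show "dist (bint (u m)) (bint (u n)) < e"
        using q[OF u(1) u(1), of m n] by (simp add: dist_real_def)
    qed
  qed
  then obtain l where l: "(%k. bint (u k)) ----> l" using Cauchy_convergent_iff convergent_def by blast
  have all: "(%k. bint (w k)) ----> l" if w: "!!k. smooth_vec (w k)" "(%k. hn (%x. w k x - v x)) ----> 0" for w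
  proof -
    have "(%k. ?d (w k) + ?d (u k)) ----> 0" using tendsto_add[OF d0[OF w(2)] d0[OF u(2)]] by simp
    then have "(%k. bint (w k) - bint (u k)) ----> 0" by (rule Lim_null_comparison[rotated]) (simp add: q[OF w(1) u(1)])
    from tendsto_add[OF this l] show ?thesis by simp
  qed
  have iff: "(\<forall>k i. smooth_fun (%x. w k x $ i)) & (%k. H1_dist \<Omega> (w k) v) ----> 0 \<longleftrightarrow>
      (\<forall>k. smooth_vec (w k)) & (%k. hn (%x. w k x - v x)) ----> 0" for w :: "nat => _"
  proof (cases "\<forall>k. smooth_vec (w k)")
    case True
    then have "H1_dist \<Omega> (w k) v = sqrt (hn (%x. w k x - v x))" for k using H1_dist_hn[OF H1_smooth v] by blast
    then have "(%k. H1_dist \<Omega> (w k) v) ----> 0 \<longleftrightarrow> (%k. sqrt (hn (%x. w k x - v x))) ----> 0" by simp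
    also have "... \<longleftrightarrow> (%k. hn (%x. w k x - v x)) ----> 0"
    proof
      assume "(%k. sqrt (hn (%x. w k x - v x))) ----> 0"
      from tendsto_power[OF this, of 2] show "(%k. hn (%x. w k x - v x)) ----> 0" by (simp add: hn_nonneg)
    next
      assume "(%k. hn (%x. w k x - v x)) ----> 0"
      from tendsto_real_sqrt[OF this] show "(%k. sqrt (hn (%x. w k x - v x))) ----> 0" by simp
    qed
    finally show ?thesis using True unfolding smooth_vec_def by blast
  qed (auto simp: smooth_vec_def)
  have "bdry_work \<Omega> f v = l" unfolding bdry_work_def iff
  proof (rule the_equality)
    show "\<forall>w. (\<forall>k. smooth_vec (w k)) & (%k. hn (%x. w k x - v x)) ----> 0 --> (%k. bint (w k)) ----> l" using all by blast
    fix l' assume "\<forall>w. (\<forall>k. smooth_vec (w k)) & (%k. hn (%x. w k x - v x)) ----> 0 --> (%k. bint (w k)) ----> l'"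
    then have "(%k. bint (u k)) ----> l'" using u by blast
    then show "l' = l" using l LIMSEQ_unique by blast
  qed
  then show ?thesis using l by simp
qed

text \<open>Linear combinations of approximating sequences approximate the linear combination, and
  boundary integrals of smooth fields are linear.\<close>

lemma load_lincomb:
  assumes v: "H1 \<Omega> v" and w: "H1 \<Omega> w"
  shows "load \<Omega> f g (%x. v x + c *\<^sub>R w x) = load \<Omega> f g v + c * load \<Omega> f g w"
proof -
  obtain a where a: "!!k. smooth_vec (a k)" "(%k. hn (%x. a k x - v x)) ----> 0" using smooth_dense_hn[OF v] by blast
  obtain b where b: "!!k. smooth_vec (b k)" "(%k. hn (%x. b k x - w x)) ----> 0" using smooth_dense_hn[OF w] by blast
  let ?s = "%k x. a k x + c *\<^sub>R b k x"
  have eq: "(%x. ?s k x - (v x + c *\<^sub>R w x)) = (%x. (a k x - v x) + c *\<^sub>R (b k x - w x))" for k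
    by (rule ext) (simp add: scaleR_diff_right)
  have "(%k. 2 * hn (%x. a k x - v x) + 2 * c\<^sup>2 * hn (%x. b k x - w x)) ----> 2 * 0 + 2 * c\<^sup>2 * 0"
    by (intro tendsto_intros a b)
  then have z: "(%k. 2 * hn (%x. a k x - v x) + 2 * c\<^sup>2 * hn (%x. b k x - w x)) ----> 0" by simp
  have "(%k. hn (%x. ?s k x - (v x + c *\<^sub>R w x))) ----> 0" by (rule Lim_null_comparison[OF _ z])
      (unfold eq, intro always_eventually allI, simp add: hn_nonneg hn_lincomb H1_diff H1_smooth a b v w)
  from bdry_work_lim[OF H1_lincomb[OF v w] smooth_lincomb[OF a(1) b(1)] this]
  have "(%k. bint (a k) + c * bint (b k)) ----> bdry_work \<Omega> f (%x. v x + c *\<^sub>R w x)"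
    by (simp only: bint_lincomb[OF a(1) b(1)])
  moreover have "(%k. bint (a k) + c * bint (b k)) ----> bdry_work \<Omega> f v + c * bdry_work \<Omega> f w"
    by (intro tendsto_intros bdry_work_lim v w a b)
  ultimately have "bdry_work \<Omega> f (%x. v x + c *\<^sub>R w x) = bdry_work \<Omega> f v + c * bdry_work \<Omega> f w" by (rule LIMSEQ_unique)
  moreover have "integrable M (%x. g x \<bullet> v x)" "integrable M (%x. g x \<bullet> w x)" by (intro L2_on_inner gL grad_props v w)+
  then have "(LINT x|M. g x \<bullet> (v x + c *\<^sub>R w x)) = (LINT x|M. g x \<bullet> v x) + c * (LINT x|M. g x \<bullet> w x)"
    by (simp add: inner_add_right)
  ultimately show ?thesis by (simp add: load_def algebra_simps)
qed

lemma load_diff: "H1 \<Omega> v ==> H1 \<Omega> w ==> load \<Omega> f g (%x. v x - w x) = load \<Omega> f g v - load \<Omega> f g w"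
  using load_lincomb[of v w "-1"] by simp

lemma load_bound: "\<exists>K\<ge>0. \<forall>v. H1 \<Omega> v --> (load \<Omega> f g v)\<^sup>2 <= K * hn v"
proof -
  obtain K where K: "K >= 0" "!!u. smooth_vec u ==> (bint u)\<^sup>2 <= K * hn u" using bint_bound by blast
  \<comment> \<open>Each half of the load is doubled when squaring the sum; the boundary half is
    doubled once more when passing from an approximant to \<open>v\<close>.\<close>
  have "(load \<Omega> f g v)\<^sup>2 <= (4 * K + 2 * sq_int M g) * hn v" if v: "H1 \<Omega> v" for v
  proof -
    obtain a where a: "!!k. smooth_vec (a k)" "(%k. hn (%x. a k x - v x)) ----> 0" using smooth_dense_hn[OF v] by blast
    have le: "(bint (a k))\<^sup>2 <= K * (2 * hn (%x. a k x - v x) + 2 * hn v)" for k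
    proof -
      have "hn (a k) <= 2 * hn (%x. a k x - v x) + 2 * hn v"
        using hn_lincomb[OF H1_diff[OF H1_smooth[OF a(1)] v] v, of k 1] by simp
      then show ?thesis using K(2)[OF a(1), of k] K(1) by (meson mult_left_mono order_trans)
    qed
    have "(%k. (bint (a k))\<^sup>2) ----> (bdry_work \<Omega> f v)\<^sup>2" by (intro tendsto_intros bdry_work_lim v a)
    moreover have "(%k. K * (2 * hn (%x. a k x - v x) + 2 * hn v)) ----> K * (2 * 0 + 2 * hn v)" by (intro tendsto_intros a)
    ultimately have "(bdry_work \<Omega> f v)\<^sup>2 <= K * (2 * 0 + 2 * hn v)" by (rule LIMSEQ_le) (use le in auto)
    moreover have "(LINT x|M. g x \<bullet> v x)\<^sup>2 <= sq_int M g * sq_int M v"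
      using L2_Cauchy_Schwarz[OF gL grad_props(1)[OF v]] by (simp add: sq_int_def)
    moreover have "sq_int M g * sq_int M v <= sq_int M g * hn v"
      by (intro mult_left_mono sq_int_nonneg) (simp add: hn_def sq_int_nonneg)
    moreover have "(load \<Omega> f g v)\<^sup>2 <= 2 * (bdry_work \<Omega> f v)\<^sup>2 + 2 * (LINT x|M. g x \<bullet> v x)\<^sup>2"
      unfolding load_def using norm_sq_add_le[of "bdry_work \<Omega> f v" "\<integral>x. g x \<bullet> v x \<partial>M"] by simp
    ultimately show ?thesis by (simp add: algebra_simps)
  qed
  then show ?thesis using K(1) sq_int_nonneg[of M g] by (intro exI[of _ "4 * K + 2 * sq_int M g"]) auto
qed

end

section \<open>Completeness of \<open>H\<^sup>1\<close>\<close>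

lemma geometric_increments_limit:
  fixes u :: "nat => 'a::banach"
  assumes "!!k. norm (u (Suc k) - u k) <= c / 2 ^ k"
  shows "convergent u" "norm (u k - lim u) <= 2 * c / 2 ^ k"
proof -
  have "norm (u 1 - u 0) <= c" using assms[of 0] by simp
  then have c: "c >= 0" using norm_ge_zero order_trans by blast
  \<comment> \<open>Subtracting the remaining geometric tail makes the induction close.\<close>
  have d: "norm (u (k + n) - u k) <= 2 * c / 2 ^ k - 2 * c / 2 ^ (k + n)" for k n
  proof (induction n)
    case (Suc n)
    have "norm (u (k + Suc n) - u k) <= norm (u (Suc (k + n)) - u (k + n)) + norm (u (k + n) - u k)"
      using norm_triangle_ineq[of "u (Suc (k + n)) - u (k + n)" "u (k + n) - u k"] by simp
    also have "... <= c / 2 ^ (k + n) + (2 * c / 2 ^ k - 2 * c / 2 ^ (k + n))" by (intro add_mono assms Suc)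
    finally show ?case by simp
  qed simp
  then have d': "norm (u (k + n) - u k) <= 2 * c / 2 ^ k" for k n
  proof -
    have "2 * c / 2 ^ (k + n) >= 0" using c by simp
    then show ?thesis using d[where k=k and n=n] by linarith
  qed
  have z: "(%k. 2 * c / 2 ^ k) ----> 0"
  proof -
    have "(%k. 2 * c * (1/2) ^ k) ----> 2 * c * 0" by (intro tendsto_intros LIMSEQ_power_zero) simp
    then show ?thesis by (simp add: power_divide)
  qed
  have "Cauchy u"
  proof (rule metric_CauchyI)
    fix e :: real assume "e > 0"
    then have "eventually (%k. 2 * c / 2 ^ k < e / 2) sequentially" by (intro order_tendstoD(2)[OF z]) simp
    then obtain k where k: "2 * c / 2 ^ k < e / 2" by (auto simp: eventually_sequentially)
    have "dist (u n) (u k) < e / 2" if "n >= k" for n using d'[of k "n - k"] k that by (simp add: dist_norm)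
    then show "\<exists>k. \<forall>m\<ge>k. \<forall>n\<ge>k. dist (u m) (u n) < e"
      by (intro exI[of _ k] allI impI) (rule dist_triangle_half_l[of _ "u k"], auto simp: dist_commute)
  qed
  then show cv: "convergent u" by (simp add: Cauchy_convergent)
  have "(%n. norm (u (n + k) - u k)) ----> norm (lim u - u k)"
    by (intro tendsto_intros LIMSEQ_ignore_initial_segment) (use cv convergent_LIMSEQ_iff in blast)
  then have "norm (lim u - u k) <= 2 * c / 2 ^ k" by (rule LIMSEQ_le_const2) (use d'[of k] in \<open>auto simp: add.commute\<close>)
  then show "norm (u k - lim u) <= 2 * c / 2 ^ k" by (simp add: norm_minus_commute)
qed

text \<open>The weighted sum \<open>\<Sum>k. 4 ^ k * \<bar>u (k + 1) - u k\<bar>\<^sup>2\<close> has finite integral and dominates all tails pointwise.\<close>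
lemma L2_complete:
  fixes u :: "nat => 'a => 'b::euclidean_space"
  assumes L: "!!k. L2_on M (u k)" and d: "!!k. sq_int M (%x. u (Suc k) x - u k x) <= B / 8 ^ k"
  obtains w where "L2_on M w" "(%k. sq_int M (%x. u k x - w x)) ----> 0"
proof -
  have m[measurable]: "u k \<in> borel_measurable M" for k using L by (simp add: L2_on_def)
  define w where "w x = lim (%k. u k x)" for x
  have [measurable]: "w \<in> borel_measurable M" unfolding w_def[abs_def] by (rule borel_measurable_lim_metric) simp
  have B: "B >= 0" using d[of 0] sq_int_nonneg[of M "%x. u (Suc 0) x - u 0 x"] by simp
  \<comment> \<open>Against increments of size \<open>8 ^ k\<close> in the denominator the weight
    \<open>4 ^ k\<close> leaves the summable factor \<open>(1/2) ^ k\<close>, and pointwise it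
    yields increments that decay like \<open>1 / 2 ^ k\<close>.\<close>
  define p where "p k x = ennreal (4 ^ k * (norm (u (Suc k) x - u k x))\<^sup>2)" for k x
  have [measurable]: "p k \<in> borel_measurable M" for k unfolding p_def[abs_def] by measurable
  define G where "G x = (\<Sum>k. p k x)" for x
  have [measurable]: "G \<in> borel_measurable M" unfolding G_def[abs_def] by measurable
  have ip: "(\<integral>\<^sup>+x. p k x \<partial>M) <= ennreal (B * (1/2) ^ k)" for k
  proof -
    have "(\<integral>\<^sup>+x. p k x \<partial>M) = ennreal (4 ^ k) * (\<integral>\<^sup>+x. ennreal ((norm (u (Suc k) x - u k x))\<^sup>2) \<partial>M)"
      unfolding p_def by (simp add: ennreal_mult nn_integral_cmult)
    also have "... = ennreal (4 ^ k) * ennreal (sq_int M (%x. u (Suc k) x - u k x))"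
      by (simp only: sq_int_eq_nn[OF L2_on_diff[OF L L]])
    also have "... <= ennreal (4 ^ k) * ennreal (B / 8 ^ k)" by (intro mult_left_mono ennreal_leI d) simp
    also have "... = ennreal (4 ^ k * (B / 8 ^ k))" using B by (subst ennreal_mult) auto
    also have "4 ^ k * (B / 8 ^ k) = B * (4 / 8) ^ k" by (simp only: power_divide times_divide_eq_right mult.commute)
    finally show ?thesis by simp
  qed
  have "(\<integral>\<^sup>+x. G x \<partial>M) = (\<Sum>k. \<integral>\<^sup>+x. p k x \<partial>M)" unfolding G_def by (rule nn_integral_suminf) simp
  also have "... <= (\<Sum>k. ennreal (B * (1/2) ^ k))" by (intro suminf_le ip) auto
  also have "... = ennreal (\<Sum>k. B * (1/2) ^ k)"
    by (rule suminf_ennreal_eq) (use B in \<open>auto intro!: summable_sums summable_mult summable_geometric\<close>)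
  finally have IG: "(\<integral>\<^sup>+x. G x \<partial>M) < \<infinity>" using ennreal_less_top le_less_trans infinity_ennreal_def by metis
  have p4: "(2 ^ k)\<^sup>2 = (4::real) ^ k" for k by (simp add: power2_eq_square flip: power_mult_distrib)
  define H where "H x = enn2real (G x)" for x
  have H0: "\<bar>H x\<bar> = H x" for x by (simp add: H_def)
  have iH: "integrable M H" unfolding H_def[abs_def]
    by (rule integrableI_nn_integral_finite[where x="enn2real (\<integral>\<^sup>+x. G x \<partial>M)"])
      (use IG nn_integral_PInf_AE[of G M] in \<open>auto simp: less_top[symmetric] intro!: nn_integral_cong_AE elim!: eventually_mono\<close>)
  have fin: "AE x in M. G x ~= \<infinity>" using IG by (intro nn_integral_PInf_AE) auto
  have bd: "AE x in M. \<forall>k. (norm (u k x - w x))\<^sup>2 <= 4 / 4 ^ k * H x" using fin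
  proof eventually_elim
    case (elim x)
    have H: "ennreal (H x) = G x" using elim by (simp add: H_def less_top)
    have "norm (u (Suc k) x - u k x) <= sqrt (H x) / 2 ^ k" for k
    proof -
      have "p k x <= G x" unfolding G_def using sum_le_suminf[of "%k. p k x" "{k}"] by simp
      then have "4 ^ k * (norm (u (Suc k) x - u k x))\<^sup>2 <= H x"
        unfolding p_def H[symmetric] by (subst (asm) ennreal_le_iff) (auto simp: H_def)
      then have "(2 ^ k * norm (u (Suc k) x - u k x))\<^sup>2 <= H x" by (simp add: power_mult_distrib p4)
      then have "2 ^ k * norm (u (Suc k) x - u k x) <= sqrt (H x)" by (rule real_le_rsqrt)
      then show ?thesis by (simp add: field_simps)
    qed
    from geometric_increments_limit(2)[OF this] have "norm (u k x - w x) <= 2 * sqrt (H x) / 2 ^ k" for k by (simp add: w_def)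
    from power_mono[OF this norm_ge_zero, of _ 2] have "(norm (u k x - w x))\<^sup>2 <= (2 * sqrt (H x) / 2 ^ k)\<^sup>2" for k .
    moreover have "(2 * sqrt (H x) / 2 ^ k)\<^sup>2 = 4 / 4 ^ k * H x" for k
      by (simp add: power_divide power_mult_distrib p4 H_def)
    ultimately show ?case by simp
  qed
  have Ld: "L2_on M (%x. u k x - w x)" for k unfolding L2_on_def
  proof
    show "integrable M (%x. (norm (u k x - w x))\<^sup>2)"
      by (rule Bochner_Integration.integrable_bound[of _ "%x. 4 / 4 ^ k * H x"]) (use bd iH in \<open>auto elim!: eventually_mono simp: abs_mult H0\<close>)
  qed measurable
  have "L2_on M (%x. u 0 x - (u 0 x - w x))" by (rule L2_on_diff[OF L Ld])
  then have "L2_on M w" by simp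
  moreover have "(%k. sq_int M (%x. u k x - w x)) ----> 0"
  proof (rule Lim_null_comparison)
    have "sq_int M (%x. u k x - w x) <= (LINT x|M. 4 / 4 ^ k * H x)" for k
      unfolding sq_int_def by (rule integral_mono_AE) (use Ld iH bd in \<open>auto simp: L2_on_def elim!: eventually_mono\<close>)
    then have "sq_int M (%x. u k x - w x) <= 4 * (LINT x|M. H x) * (1/4) ^ k" for k by (simp add: power_divide)
    then show "eventually (%k. norm (sq_int M (%x. u k x - w x)) <= 4 * (LINT x|M. H x) * (1/4) ^ k) sequentially"
      by (simp add: sq_int_nonneg)
    have "(%k. 4 * (LINT x|M. H x) * (1/4) ^ k) ----> 4 * (LINT x|M. H x) * 0" by (intro tendsto_intros LIMSEQ_power_zero) simp
    then show "(%k. 4 * (LINT x|M. H x) * (1/4) ^ k) ----> 0" by simp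
  qed
  ultimately show ?thesis using that by blast
qed

lemma L2_inner_tendsto:
  assumes u: "!!k. L2_on M (u k)" "L2_on M w" "(%k. sq_int M (%x. u k x - w x)) ----> 0" and p: "L2_on M \<psi>"
  shows "(%k. \<integral>x. u k x \<bullet> \<psi> x \<partial>M) ----> (LINT x|M. w x \<bullet> \<psi> x)"
proof -
  have "(%k. sqrt (sq_int M (%x. u k x - w x) * sq_int M \<psi>)) ----> sqrt (0 * sq_int M \<psi>)" by (intro tendsto_intros u)
  then have z: "(%k. sqrt (sq_int M (%x. u k x - w x) * sq_int M \<psi>)) ----> 0" by simp
  have "(%k. (LINT x|M. u k x \<bullet> \<psi> x) - (LINT x|M. w x \<bullet> \<psi> x)) ----> 0"
  proof (rule Lim_null_comparison[OF always_eventually z], rule allI)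
    fix k
    have "(LINT x|M. u k x \<bullet> \<psi> x) - (LINT x|M. w x \<bullet> \<psi> x) = (LINT x|M. (u k x - w x) \<bullet> \<psi> x)"
      by (simp add: inner_diff_left L2_on_inner u p)
    then show "norm ((LINT x|M. u k x \<bullet> \<psi> x) - (LINT x|M. w x \<bullet> \<psi> x)) <= sqrt (sq_int M (%x. u k x - w x) * sq_int M \<psi>)"
      using L2_Cauchy_Schwarz[OF L2_on_diff[OF u(1,2)] p] by (simp add: sq_int_def real_le_rsqrt)
  qed
  from tendsto_add[OF this tendsto_const[of "\<integral>x. w x \<bullet> \<psi> x \<partial>M"]] show ?thesis by simp
qed

lemma continuous_on_axis:
  fixes h :: "'a::topological_space => 'b::{zero,topological_space}"
  assumes "continuous_on A h"
  shows "continuous_on A (%x. axis i (h x))" unfolding axis_def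
proof (rule continuous_on_vec_lambda)
  fix j show "continuous_on A (%x. if j = i then h x else 0)" using assms by (cases "j = i") auto
qed

context lipschitz_domain
begin

text \<open>Fields and gradients converge separately in L2, and the integration by parts identity
  passes to the limit against each fixed test function.\<close>

lemma H1_complete:
  assumes u: "!!k. H1 \<Omega> (u k)" and d: "!!k. hn (%x. u (Suc k) x - u k x) <= B / 8 ^ k"
  obtains w where "H1 \<Omega> w" "(%k. hn (%x. u k x - w x)) ----> 0"
proof -
  note up = grad_props[OF u]
  have gd: "sq_int M (%x. grad \<Omega> v x - G x) = sq_int M (grad \<Omega> (%x. v x - v' x))"
    if "H1 \<Omega> v" "H1 \<Omega> v'" "AE x in M. grad \<Omega> v' x = G x" "L2_on M G" for v v' G
  proof (rule sq_int_cong_AE)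
    show "AE x in M. grad \<Omega> v x - G x = grad \<Omega> (%x. v x - v' x) x"
      using grad_diff[OF that(1,2)] that(3) by eventually_elim simp
  qed (intro L2_on_diff grad_props H1_diff that)+
  have "sq_int M (%x. u (Suc k) x - u k x) <= B / 8 ^ k" for k
    using d[of k] sq_int_nonneg[of M "grad \<Omega> (%x. u (Suc k) x - u k x)"] by (simp add: hn_def)
  from L2_complete[OF up(1) this] obtain w where w: "L2_on M w" "(%k. sq_int M (%x. u k x - w x)) ----> 0" by blast
  have "sq_int M (%x. grad \<Omega> (u (Suc k)) x - grad \<Omega> (u k) x) <= B / 8 ^ k" for k
    using d[of k] sq_int_nonneg[of M "%x. u (Suc k) x - u k x"] gd[OF u u _ up(2), of k k "Suc k"] by (simp add: hn_def)
  from L2_complete[OF up(2) this] obtain G where G: "L2_on M G" "(%k. sq_int M (%x. grad \<Omega> (u k) x - G x)) ----> 0" by blast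
  have "weak_grad \<Omega> w G" unfolding weak_grad_def
  proof (intro allI impI)
    fix \<phi> and i j :: 'n assume t: "test_fun \<Omega> \<phi>"
    then have s: "smooth_fun \<phi>" by (simp add: test_fun_def)
    have c: "continuous_on UNIV \<phi>" "continuous_on UNIV (partial_deriv \<phi> j)"
      using smooth_fun_continuous s smooth_fun_has_derivative(2) by blast+
    have L1: "L2_on M (%x. axis i (partial_deriv \<phi> j x))" "L2_on M (%x. axis i (axis j (\<phi> x)))"
      by (intro L2_on_continuous[OF O(1,2)] continuous_on_axis c)+
    have "(%k. \<integral>x. u k x $ i * partial_deriv \<phi> j x \<partial>M) ----> (LINT x|M. w x $ i * partial_deriv \<phi> j x)"
      using L2_inner_tendsto[OF up(1) w L1(1)] by (simp add: inner_axis)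
    moreover have "(%k. - (LINT x|M. grad \<Omega> (u k) x $ i $ j * \<phi> x)) ----> - (LINT x|M. G x $ i $ j * \<phi> x)"
      using tendsto_minus[OF L2_inner_tendsto[OF up(2) G L1(2)]] by (simp add: inner_axis)
    moreover have "(LINT x|M. u k x $ i * partial_deriv \<phi> j x) = - (LINT x|M. grad \<Omega> (u k) x $ i $ j * \<phi> x)" for k
      using up(3) t unfolding weak_grad_def by blast
    ultimately show "(LINT x|M. w x $ i * partial_deriv \<phi> j x) = - (LINT x|M. G x $ i $ j * \<phi> x)" using LIMSEQ_unique by simp
  qed
  note gu = grad_unique[OF O(1,2) w(1) G(1) this]
  have "(%k. hn (%x. u k x - w x)) ----> 0" using tendsto_add[OF w(2) G(2)] by (simp add: hn_def gd[OF u gu G(1)])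
  then show ?thesis using that gu(1) by blast
qed

end

section \<open>Coercivity of the linear energy\<close>

context lipschitz_domain
begin

abbreviation sym_field :: "(real^'n => real^'n^'n) => bool" where
  "sym_field A \<equiv> L2_on M A & (\<forall>x. transpose (A x) = A x)"

lemma symgrad_eq_sympart: "symgrad \<Omega> v x = sympart (grad \<Omega> v x)" by (simp add: symgrad_def sympart_def)

lemma sym_field_symgrad: "H1 \<Omega> v ==> sym_field (symgrad \<Omega> v)" unfolding symgrad_eq_sympart[abs_def]
  by (auto simp: L2_on_linear[OF bounded_linear_sympart] grad_props(2) vec_eq_iff transpose_def sympart_nth)

lemma symgrad_lincomb:
  assumes "H1 \<Omega> v" "H1 \<Omega> w"
  shows "AE x in M. symgrad \<Omega> (%x. v x + c *\<^sub>R w x) x = symgrad \<Omega> v x + c *\<^sub>R symgrad \<Omega> w x"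
  using grad_add(2)[OF O(1,2) assms, of c] by eventually_elim (simp add: symgrad_eq_sympart sympart_simps)

lemma symgrad_diff: "H1 \<Omega> v ==> H1 \<Omega> w ==> AE x in M. symgrad \<Omega> (%x. v x - w x) x = symgrad \<Omega> v x - symgrad \<Omega> w x"
  using symgrad_lincomb[of v w "-1"] by simp

lemma symgrad_affine: "AE x in M. symgrad \<Omega> (%x. b + A *v x) x = sympart A"
  using grad_smooth(2)[OF O(1,2) smooth_vec_affine[of b A]] by eventually_elim (simp add: symgrad_eq_sympart jac_affine)

lemma sym_field_ops:
  assumes "sym_field A" "sym_field B"
  shows "sym_field (%x. A x + B x)" "sym_field (%x. A x - B x)" "sym_field (%x. c *\<^sub>R A x)"
  using assms by (auto intro!: L2_on_add L2_on_diff L2_on_scaleR simp: vec_eq_iff transpose_def)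

lemma sq_int_symgrad_diff:
  assumes "H1 \<Omega> v" "H1 \<Omega> w"
  shows "sq_int M (%x. symgrad \<Omega> v x - symgrad \<Omega> w x) = sq_int M (symgrad \<Omega> (%x. v x - w x))"
proof (rule sq_int_cong_AE)
  show "AE x in M. symgrad \<Omega> v x - symgrad \<Omega> w x = symgrad \<Omega> (%x. v x - w x) x"
    using symgrad_diff[OF assms] by eventually_elim simp
qed (use sym_field_symgrad assms H1_diff[OF assms] in \<open>blast intro: L2_on_diff\<close>)+

lemma sq_int_symgrad_le:
  assumes "H1 \<Omega> v"
  shows "sq_int M (symgrad \<Omega> v) <= hn v"
proof -
  have "sq_int M (symgrad \<Omega> v) <= sq_int M (grad \<Omega> v)"
    unfolding sq_int_def using sym_field_symgrad[OF assms] grad_props(2)[OF assms]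
    by (intro integral_mono) (auto simp: L2_on_def symgrad_eq_sympart norm_sympart_le)
  then show ?thesis using sq_int_nonneg[of M v] by (simp add: hn_def)
qed

text \<open>The rigid motion is taken from a smooth approximant close enough to \<open>v\<close>,
  and the margin \<open>e\<close> pays for the distance. It spares a limit of rigid motions.\<close>

lemma korn_H1:
  "\<exists>C\<ge>0. \<forall>v e. H1 \<Omega> v --> e > 0 --> (\<exists>b R. skew R & hn (%x. v x - (b + R *v x)) <= C * sq_int M (symgrad \<Omega> v) + e)"
proof -
  obtain C where C: "C >= 0" "!!u. smooth_vec u ==> \<exists>b R. skew R & nsq \<Omega> (%x. u x - (b + R *v x)) <= ennreal C * nsq \<Omega> (strain u)
     & nsq \<Omega> (%x. jac u x - R) <= ennreal C * nsq \<Omega> (strain u)" using korn_domain[OF O] by blast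
  \<comment> \<open>Korn for the approximant counts field and Jacobian, a factor 2. Passing from
    \<open>u\<close> to \<open>v\<close> doubles once for the field and once for the strain, which
    gives \<open>8 * C\<close> and the error coefficient \<open>8 * C + 2\<close>.\<close>
  have "\<exists>b R. skew R & hn (%x. v x - (b + R *v x)) <= (8 * C) * sq_int M (symgrad \<Omega> v) + e"
    if v: "H1 \<Omega> v" and e: "e > 0" for v and e :: real
  proof -
    obtain a where a: "!!k. smooth_vec (a k)" "(%k. hn (%x. a k x - v x)) ----> 0" using smooth_dense_hn[OF v] by blast
    have "eventually (%k. hn (%x. a k x - v x) < e / (8 * C + 2)) sequentially"
      using e C(1) by (intro order_tendstoD(2)[OF a(2)]) simp
    then obtain u where u: "smooth_vec u" "hn (%x. u x - v x) < e / (8 * C + 2)"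
      using a(1) by (auto simp: eventually_sequentially)
    then have ue: "(8 * C + 2) * hn (%x. u x - v x) <= e" using C(1) by (simp add: field_simps)
    from C(2)[OF u(1)] obtain b R where R: "skew R" "nsq \<Omega> (%x. u x - (b + R *v x)) <= ennreal C * nsq \<Omega> (strain u)"
      "nsq \<Omega> (%x. jac u x - R) <= ennreal C * nsq \<Omega> (strain u)" by blast
    let ?r = "%x. u x - (b + R *v x)"
    have r: "smooth_vec ?r" "jac ?r = (%x. jac u x - R)" using strain_minus_rigid[OF u(1) R(1)] by auto
    have Ls: "L2_on M (strain u)" by (intro L2_on_continuous O strain_continuous u)
    have se: "sq_int M (strain u) = sq_int M (symgrad \<Omega> u)"
      by (rule sq_int_cong_AE[OF _ Ls]) (use grad_smooth(2)[OF O(1,2) u(1)] sym_field_symgrad[OF H1_smooth[OF u(1)]]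
        in \<open>auto elim!: eventually_mono simp: symgrad_eq_sympart strain_def\<close>)
    have "hn ?r <= 2 * (C * sq_int M (strain u))"
    proof -
      have "sq_int M F <= C * sq_int M (strain u)" if "L2_on M F" "nsq \<Omega> F <= ennreal C * nsq \<Omega> (strain u)" for F :: "real^'n => 'z::euclidean_space"
        using that C(1) by (simp add: nsq_eq_sq_int[OF O(2)] Ls sq_int_nonneg flip: ennreal_mult)
      from this[OF _ R(2)] this[OF _ R(3)] show ?thesis
        using grad_smooth(3,4)[OF O(1,2) r(1)] unfolding hn_smooth[OF r(1)] r(2) by force
    qed
    moreover have "sq_int M (strain u) <= 2 * sq_int M (symgrad \<Omega> v) + 2 * hn (%x. u x - v x)"
    proof -
      have "sq_int M (%x. (symgrad \<Omega> u x - symgrad \<Omega> v x) + symgrad \<Omega> v x)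
          <= 2 * sq_int M (%x. symgrad \<Omega> u x - symgrad \<Omega> v x) + 2 * sq_int M (symgrad \<Omega> v)"
        by (rule sq_int_add_le) (use sym_field_symgrad[OF v] sym_field_symgrad[OF H1_smooth[OF u(1)]] L2_on_diff in blast)+
      then show ?thesis unfolding se
        using sq_int_symgrad_le[OF H1_diff[OF H1_smooth[OF u(1)] v]] sq_int_symgrad_diff[OF H1_smooth[OF u(1)] v] by simp
    qed
    from mult_left_mono[OF this C(1)] have "C * sq_int M (strain u) <= 2 * (C * sq_int M (symgrad \<Omega> v)) + 2 * (C * hn (%x. u x - v x))"
      by (simp add: algebra_simps)
    moreover have "hn (%x. v x - (b + R *v x)) <= 2 * hn ?r + 2 * hn (%x. u x - v x)"
      using hn_diff[OF H1_smooth[OF r(1)] H1_diff[OF H1_smooth[OF u(1)] v]] by (simp add: algebra_simps)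
    ultimately have "hn (%x. v x - (b + R *v x)) <= (8 * C) * sq_int M (symgrad \<Omega> v) + e"
      using ue by (simp add: algebra_simps)
    then show ?thesis using R(1) by blast
  qed
  then show ?thesis using C(1) by (intro exI[of _ "8 * C"]) auto
qed

end

locale elastic_domain = loaded_domain \<Omega> f g for \<Omega> :: "(real^'n) set" and f g +
  fixes D2V :: "real^'n => real^'n^'n => ((real^'n^'n) \<Rightarrow>\<^sub>L ((real^'n^'n) \<Rightarrow>\<^sub>L real))" and \<alpha> \<gamma> :: real
  assumes equil: "equilibrated \<Omega> f g" and compat: "compatible \<Omega> f g" and pos: "\<alpha> > 0" "\<gamma> >= 0"
    and V0_bounds: "AE x in M. \<forall>B. transpose B = B --> \<alpha> * (norm B)\<^sup>2 <= V0 D2V x B & V0 D2V x B <= \<gamma> * (norm B)\<^sup>2"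
    and V0_measurable: "!!A. A \<in> borel_measurable M ==> (!!x. transpose (A x) = A x) ==> (%x. V0 D2V x (A x)) \<in> borel_measurable M"
begin

abbreviation "L \<equiv> load \<Omega> f g"
abbreviation "E \<equiv> Elin \<Omega> D2V f g"
abbreviation "S \<equiv> symgrad \<Omega>"

definition Q :: "(real^'n => real^'n^'n) => real" where
  "Q A = (LINT x|M. V0 D2V x (A x))"

lemma E_eq: "E v = Q (S v) - L v" by (simp add: Elin_def Q_def)

lemma V0_field:
  assumes A: "sym_field A"
  shows "integrable M (%x. V0 D2V x (A x))" "\<alpha> * sq_int M A <= Q A" "Q A <= \<gamma> * sq_int M A" "0 <= Q A"
proof -
  have b: "AE x in M. \<alpha> * (norm (A x))\<^sup>2 <= V0 D2V x (A x) & V0 D2V x (A x) <= \<gamma> * (norm (A x))\<^sup>2"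
    using V0_bounds by eventually_elim (use A in blast)
  have m: "(%x. V0 D2V x (A x)) \<in> borel_measurable M" using A by (intro V0_measurable) (auto simp: L2_on_def)
  have i: "integrable M (%x. (norm (A x))\<^sup>2)" using A by (simp add: L2_on_def)
  show iV: "integrable M (%x. V0 D2V x (A x))"
  proof (rule Bochner_Integration.integrable_bound[of _ "%x. \<gamma> * (norm (A x))\<^sup>2"])
    show "AE x in M. norm (V0 D2V x (A x)) <= norm (\<gamma> * (norm (A x))\<^sup>2)" using b
    proof eventually_elim
      case (elim x)
      moreover have "0 <= \<alpha> * (norm (A x))\<^sup>2" using pos by simp
      ultimately show ?case by simp
    qed
  qed (use i m in auto)
  have "(LINT x|M. \<alpha> * (norm (A x))\<^sup>2) <= Q A" "Q A <= (LINT x|M. \<gamma> * (norm (A x))\<^sup>2)"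
    unfolding Q_def by (rule integral_mono_AE; use iV i b in \<open>auto elim: eventually_mono\<close>)+
  then show le: "\<alpha> * sq_int M A <= Q A" "Q A <= \<gamma> * sq_int M A" by (simp_all add: sq_int_def)
  show "0 <= Q A" using le(1) pos(1) sq_int_nonneg[of M A] by (meson mult_nonneg_nonneg less_imp_le order_trans)
qed

lemma Q_cong_AE:
  assumes "AE x in M. A x = B x" "sym_field A" "sym_field B"
  shows "Q A = Q B" unfolding Q_def using V0_field(1)[OF assms(2)] V0_field(1)[OF assms(3)]
  by (intro integral_cong_AE) (use assms(1) in \<open>auto elim: eventually_mono\<close>)

lemma V0_parallelogram: "V0 D2V x A + V0 D2V x B = 2 * V0 D2V x ((1/2) *\<^sub>R (A + B)) + (1/2) * V0 D2V x (A - B)"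
  by (simp add: V0_def blinfun.add_left blinfun.add_right blinfun.diff_left blinfun.diff_right
      blinfun.scaleR_left blinfun.scaleR_right field_simps)

text \<open>Young's inequality in the form of an identity: the defect is itself a value of the form,
  nonnegative at symmetric matrices. It compares energies with a factor \<open>1 + t\<close>
  arbitrarily close to 1.\<close>

lemma V0_Young:
  assumes "t ~= 0"
  shows "(1 + t) * V0 D2V x A + (1 + 1/t) * V0 D2V x (B - A) - V0 D2V x B = t * V0 D2V x (A - (1/t) *\<^sub>R (B - A))"
  using assms by (simp add: V0_def blinfun.add_left blinfun.add_right blinfun.diff_left blinfun.diff_right
      blinfun.scaleR_left blinfun.scaleR_right field_simps)

lemma Q_parallelogram:
  assumes A: "sym_field A" and B: "sym_field B"
  shows "Q A + Q B = 2 * Q (%x. (1/2) *\<^sub>R (A x + B x)) + (1/2) * Q (%x. A x - B x)"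
proof -
  note s = sym_field_ops(1,2)[OF A B]
  note i = V0_field(1)[OF A] V0_field(1)[OF B] V0_field(1)[OF s(2)] V0_field(1)[OF sym_field_ops(3)[OF s(1) s(1), of "1/2"]]
  have "Q A + Q B = (LINT x|M. V0 D2V x (A x) + V0 D2V x (B x))" unfolding Q_def using i by simp
  also have "... = (LINT x|M. 2 * V0 D2V x ((1/2) *\<^sub>R (A x + B x)) + (1/2) * V0 D2V x (A x - B x))"
    by (simp only: V0_parallelogram)
  also have "... = 2 * Q (%x. (1/2) *\<^sub>R (A x + B x)) + (1/2) * Q (%x. A x - B x)" unfolding Q_def using i by simp
  finally show ?thesis .
qed

lemma Q_Young:
  assumes A: "sym_field A" and B: "sym_field B" and t: "t > 0"
  shows "Q B <= (1 + t) * Q A + (1 + 1/t) * Q (%x. B x - A x)"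
proof -
  note s = sym_field_ops(2)[OF B A]
  note r = sym_field_ops(2)[OF A sym_field_ops(3)[OF s s, of "1/t"]]
  note i = V0_field(1)[OF A] V0_field(1)[OF B] V0_field(1)[OF s]
  have "0 <= t * Q (%x. A x - (1/t) *\<^sub>R (B x - A x))" using V0_field(4)[OF r] t by simp
  also have "... = (LINT x|M. (1 + t) * V0 D2V x (A x) + (1 + 1/t) * V0 D2V x (B x - A x) - V0 D2V x (B x))"
    using t by (simp add: V0_Young Q_def)
  also have "... = (1 + t) * Q A + (1 + 1/t) * Q (%x. B x - A x) - Q B" unfolding Q_def using i by simp
  finally show ?thesis by simp
qed

lemma load_rigid: "skew R ==> L (%x. b + R *v x) = 0"
  using equil H1_rigid[of b R] symgrad_affine[of b R] unfolding equilibrated_def by (simp add: sympart_skew)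

lemma E_rigid:
  assumes v: "H1 \<Omega> v" and R: "skew R"
  shows "E (%x. v x - (b + R *v x)) = E v"
proof -
  have "Q (S (%x. v x - (b + R *v x))) = Q (S v)" by (rule Q_cong_AE; (intro sym_field_symgrad H1_diff v H1_rigid)?)
      (use symgrad_diff[OF v H1_rigid, of b R] symgrad_affine[of b R] R
        in \<open>auto elim!: eventually_elim2 simp: sympart_skew\<close>)
  then show ?thesis by (simp add: E_eq load_diff[OF v H1_rigid] load_rigid[OF R])
qed

text \<open>Equilibrated loads do not see rigid motions, so \<open>v\<close> may be replaced by its
  remainder in Korn's inequality. The margin left by \<open>korn_H1\<close> is arbitrary and
  disappears.\<close>

lemma load_strain_bound: "\<exists>K\<ge>0. \<forall>v. H1 \<Omega> v --> (L v)\<^sup>2 <= K * sq_int M (S v)"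
proof -
  obtain K where K: "K >= 0" "!!v. H1 \<Omega> v ==> (L v)\<^sup>2 <= K * hn v" using load_bound by blast
  obtain C where C: "C >= 0" "!!v e. H1 \<Omega> v ==> e > 0 ==> \<exists>b R. skew R & hn (%x. v x - (b + R *v x)) <= C * sq_int M (S v) + e"
    using korn_H1 by blast
  have "(L v)\<^sup>2 <= K * C * sq_int M (S v)" if v: "H1 \<Omega> v" for v
  proof (rule field_le_epsilon)
    fix e :: real assume e: "e > 0"
    then have "e / (K + 1) > 0" using K(1) by simp
    from C(2)[OF v this] obtain b R where R: "skew R" "hn (%x. v x - (b + R *v x)) <= C * sq_int M (S v) + e / (K + 1)" by blast
    have "(L v)\<^sup>2 = (L (%x. v x - (b + R *v x)))\<^sup>2" by (simp add: load_diff[OF v H1_rigid] load_rigid[OF R(1)])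
    also have "... <= K * hn (%x. v x - (b + R *v x))" by (rule K(2)[OF H1_diff[OF v H1_rigid]])
    also have "... <= K * (C * sq_int M (S v) + e / (K + 1))" by (rule mult_left_mono[OF R(2) K(1)])
    also have "... <= K * C * sq_int M (S v) + e"
    proof -
      have "K * (e / (K + 1)) <= e" using K(1) e by (simp add: field_simps)
      then show ?thesis by (simp add: distrib_left)
    qed
    finally show "(L v)\<^sup>2 <= K * C * sq_int M (S v) + e" .
  qed
  then show ?thesis using K(1) C(1) by (intro exI[of _ "K * C"]) auto
qed

lemma E_bounded_below: "\<exists>c. \<forall>v. H1 \<Omega> v --> c <= E v"
proof -
  obtain K where K: "K >= 0" "!!v. H1 \<Omega> v ==> (L v)\<^sup>2 <= K * sq_int M (S v)" using load_strain_bound by blast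
  \<comment> \<open>This is the minimum over \<open>r\<close> of
    \<open>\<alpha> * r\<^sup>2 - sqrt K * r\<close>, with \<open>r\<close> the L2 norm of the
    strain.\<close>
  have "- (K / (4 * \<alpha>)) <= E v" if v: "H1 \<Omega> v" for v
  proof (rule ccontr)
    let ?s = "sq_int M (S v)"
    assume "\<not> ?thesis"
    then have l: "\<alpha> * ?s + K / (4 * \<alpha>) < L v" using V0_field(2)[OF sym_field_symgrad[OF v]] by (simp add: E_eq)
    have "0 <= \<alpha> * ?s + K / (4 * \<alpha>)" using pos K(1) sq_int_nonneg[of M "S v"] by simp
    from power_strict_mono[OF l this, of 2] have "(\<alpha> * ?s + K / (4 * \<alpha>))\<^sup>2 < (L v)\<^sup>2" by simp
    moreover have "(\<alpha> * ?s + K / (4 * \<alpha>))\<^sup>2 = (\<alpha> * ?s - K / (4 * \<alpha>))\<^sup>2 + K * ?s"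
      using pos by (simp add: power2_eq_square field_simps)
    moreover have "(\<alpha> * ?s - K / (4 * \<alpha>))\<^sup>2 >= 0" by simp
    ultimately show False using K(2)[OF v] by linarith
  qed
  then show ?thesis by blast
qed

end

section \<open>Minimizers\<close>

context elastic_domain
begin

text \<open>Convergence is strong, so the load converges by its bound. The quadratic part at
  \<open>w\<close> is at most \<open>1 + t\<close> times the part along the sequence plus an error
  that vanishes for each fixed \<open>t\<close>.\<close>

lemma E_lsc:
  assumes u: "!!k. H1 \<Omega> (u k)" "H1 \<Omega> w" "(%k. hn (%x. u k x - w x)) ----> 0" "(%k. E (u k)) ----> m"
  shows "E w <= m"
proof -
  obtain K where K: "K >= 0" "!!v. H1 \<Omega> v ==> (L v)\<^sup>2 <= K * hn v" using load_bound by blast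
  have Ll: "(%k. L (u k)) ----> L w"
  proof -
    have "(%k. sqrt (K * hn (%x. u k x - w x))) ----> sqrt (K * 0)" by (intro tendsto_intros u)
    then have z: "(%k. sqrt (K * hn (%x. u k x - w x))) ----> 0" by simp
    have "(%k. L (u k) - L w) ----> 0" by (rule Lim_null_comparison[OF always_eventually z])
        (use K(2)[OF H1_diff[OF u(1,2)]] in \<open>auto simp: load_diff[OF u(1,2)] intro!: real_le_rsqrt\<close>)
    from tendsto_add[OF this tendsto_const[of "L w"]] show ?thesis by simp
  qed
  have Ql: "(%k. Q (S (u k))) ----> m + L w" using tendsto_add[OF u(4) Ll] by (simp add: E_eq)
  have X: "0 <= m + L w" by (rule LIMSEQ_le_const[OF Ql]) (use V0_field(4)[OF sym_field_symgrad[OF u(1)]] in auto)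
  have Qd: "Q (%x. S w x - S (u k) x) <= \<gamma> * hn (%x. u k x - w x)" for k
  proof -
    have "Q (%x. S w x - S (u k) x) <= \<gamma> * sq_int M (%x. S w x - S (u k) x)"
      by (rule V0_field(3)[OF sym_field_ops(2)[OF sym_field_symgrad[OF u(2)] sym_field_symgrad[OF u(1)]]])
    also have "sq_int M (%x. S w x - S (u k) x) = sq_int M (%x. S (u k) x - S w x)"
      by (simp add: sq_int_def norm_minus_commute)
    also have "... <= hn (%x. u k x - w x)"
      using sq_int_symgrad_le[OF H1_diff[OF u(1,2)]] by (simp add: sq_int_symgrad_diff[OF u(1,2)])
    finally show ?thesis using pos(2) by (simp add: mult_left_mono)
  qed
  have "Q (S w) <= m + L w"
  proof (rule field_le_epsilon)
    fix e :: real assume e: "e > 0"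
    \<comment> \<open>Makes \<open>t * (m + L w)\<close> at most \<open>e\<close>; the added 1
      avoids division by 0.\<close>
    define t where "t = e / (m + L w + 1)"
    have t: "t > 0" using X e by (simp add: t_def)
    have "(%k. (1 + t) * Q (S (u k)) + (1 + 1/t) * (\<gamma> * hn (%x. u k x - w x))) ----> (1 + t) * (m + L w) + (1 + 1/t) * (\<gamma> * 0)"
      by (intro tendsto_intros Ql u)
    moreover have "Q (S w) <= (1 + t) * Q (S (u k)) + (1 + 1/t) * (\<gamma> * hn (%x. u k x - w x))" for k
    proof -
      have "(1 + 1/t) * Q (%x. S w x - S (u k) x) <= (1 + 1/t) * (\<gamma> * hn (%x. u k x - w x))"
        using t by (intro mult_left_mono Qd) auto
      then show ?thesis using Q_Young[OF sym_field_symgrad[OF u(1)] sym_field_symgrad[OF u(2)] t, of k] by linarith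
    qed
    ultimately have "Q (S w) <= (1 + t) * (m + L w) + (1 + 1/t) * (\<gamma> * 0)" by (intro LIMSEQ_le_const) auto
    moreover have "t * (m + L w) <= e" using X e by (simp add: t_def field_simps)
    ultimately show "Q (S w) <= m + L w + e" by (simp add: algebra_simps)
  qed
  then show ?thesis by (simp add: E_eq)
qed

text \<open>Convexity with a quadratic gain: two nearly minimal fields have a midpoint of no less
  than the infimal energy, so the energy of their strain difference is small.\<close>

lemma E_midpoint:
  assumes v: "H1 \<Omega> v" and w: "H1 \<Omega> w"
  shows "H1 \<Omega> (%x. v x + (1/2) *\<^sub>R (w x - v x))"
    "E v + E w = 2 * E (%x. v x + (1/2) *\<^sub>R (w x - v x)) + (1/2) * Q (%x. S v x - S w x)"
proof -
  let ?z = "%x. v x + (1/2) *\<^sub>R (w x - v x)"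
  note d = H1_diff[OF w v]
  show z: "H1 \<Omega> ?z" by (rule H1_lincomb[OF v d])
  note s = sym_field_symgrad[OF v] sym_field_symgrad[OF w]
  have "AE x in M. S ?z x = (1/2) *\<^sub>R (S v x + S w x)" using symgrad_lincomb[OF v d, of "1/2"] symgrad_diff[OF w v]
  proof eventually_elim
    case (elim x)
    have "S v x + (1/2) *\<^sub>R (S w x - S v x) = (1/2) *\<^sub>R (S v x + S w x)" by (simp add: vec_eq_iff field_simps)
    then show ?case using elim by simp
  qed
  then have "Q (S ?z) = Q (%x. (1/2) *\<^sub>R (S v x + S w x))"
    by (rule Q_cong_AE[OF _ sym_field_symgrad[OF z] sym_field_ops(3)[OF sym_field_ops(1)[OF s] s(1)]])
  moreover have "L ?z = L v + (1/2) * (L w - L v)" by (simp only: load_lincomb[OF v d] load_diff[OF w v])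
  ultimately show "E v + E w = 2 * E ?z + (1/2) * Q (%x. S v x - S w x)"
    using Q_parallelogram[OF s] by (simp add: E_eq field_simps)
qed

lemma skew_closed:
  fixes A B :: "real^'n^'n"
  shows "skew (0 :: real^'n^'n)" "skew A ==> skew B ==> skew (A + B)" "skew A ==> skew (c *\<^sub>R A)"
  by (simp add: skew_def transpose_def vec_eq_iff) (simp_all add: skew_def transpose_add_mat transpose_scaleR_mat)

lemma skew_sum: "(!!j. skew (R j)) ==> skew (\<Sum>j<k. R (j::nat) :: real^'n^'n)" by (induction k) (simp_all add: skew_closed)

text \<open>By the parallelogram identity the strains of a fast minimizing sequence are Cauchy; Korn's inequality makes
  the displacements Cauchy too after subtracting accumulated rigid motions, which do not change the energy.\<close>
lemma E_minimizer: "\<exists>w. H1 \<Omega> w & (\<forall>v. H1 \<Omega> v --> E w <= E v)"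
proof -
  obtain c where c: "!!v. H1 \<Omega> v ==> c <= E v" using E_bounded_below by blast
  define m where "m = (INF v\<in>{v. H1 \<Omega> v}. E v)"
  have bb: "bdd_below (E ` {v. H1 \<Omega> v})" using c by (intro bdd_belowI2[of _ c]) auto
  have ne: "{v. H1 \<Omega> v} ~= {}" using H1_rigid by blast
  have mle: "m <= E v" if "H1 \<Omega> v" for v unfolding m_def by (rule cINF_lower[OF bb]) (use that in simp)
  \<comment> \<open>The rate \<open>1 / 8 ^ k\<close> is the one that \<open>H1_complete\<close>
    expects of successive squared distances.\<close>
  have "\<forall>k. \<exists>v. H1 \<Omega> v & E v < m + 1 / 8 ^ k"
  proof
    fix k :: nat
    have "m < m + 1 / 8 ^ k" by simp
    then show "\<exists>v. H1 \<Omega> v & E v < m + 1 / 8 ^ k" using cINF_less_iff[OF ne bb] unfolding m_def by blast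
  qed
  from choice[OF this] obtain v where v: "!!k. H1 \<Omega> (v k)" "!!k. E (v k) < m + 1 / 8 ^ k" by blast
  obtain C where C: "C >= 0" "!!v e. H1 \<Omega> v ==> e > 0 ==> \<exists>b R. skew R & hn (%x. v x - (b + R *v x)) <= C * sq_int M (S v) + e"
    using korn_H1 by blast
  \<comment> \<open>The midpoint identity bounds the squared strain difference by
    \<open>4 / \<alpha> / 8 ^ k\<close>; the added 1 is Korn's margin, chosen as
    \<open>1 / 8 ^ k\<close>.\<close>
  define B where "B = C * (4 / \<alpha>) + 1"
  have "\<forall>k. \<exists>p. skew (snd p) & hn (%x. (v (Suc k) x - v k x) - (fst p + snd p *v x)) <= B / 8 ^ k"
  proof
    fix k
    have "m + m + (1/2) * (\<alpha> * sq_int M (S (%x. v (Suc k) x - v k x))) <= E (v (Suc k)) + E (v k)"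
      using E_midpoint[OF v(1) v(1), of "Suc k" k] mle[OF E_midpoint(1)[OF v(1) v(1), of "Suc k" k]]
        V0_field(2)[OF sym_field_ops(2)[OF sym_field_symgrad[OF v(1)] sym_field_symgrad[OF v(1)]], of "Suc k" k]
        sq_int_symgrad_diff[OF v(1) v(1), of "Suc k" k] by simp
    moreover have "E (v (Suc k)) + E (v k) <= m + m + 2 / 8 ^ k"
    proof -
      have "1 / 8 ^ Suc k <= 1 / (8::real) ^ k" by (simp add: field_simps)
      then show ?thesis using v(2)[of k] v(2)[of "Suc k"] by simp
    qed
    ultimately have "\<alpha> * sq_int M (S (%x. v (Suc k) x - v k x)) <= 4 / 8 ^ k" by simp
    then have "sq_int M (S (%x. v (Suc k) x - v k x)) <= 4 / \<alpha> / 8 ^ k" using pos(1) by (simp add: field_simps)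
    from mult_left_mono[OF this C(1)] have s: "C * sq_int M (S (%x. v (Suc k) x - v k x)) + 1 / 8 ^ k <= B / 8 ^ k"
      by (simp add: B_def add_divide_distrib)
    obtain b R where "skew R" "hn (%x. (v (Suc k) x - v k x) - (b + R *v x)) <= C * sq_int M (S (%x. v (Suc k) x - v k x)) + 1 / 8 ^ k"
      using C(2)[OF H1_diff[OF v(1) v(1)], of "1 / 8 ^ k" "Suc k" k] by auto
    then show "\<exists>p. skew (snd p) & hn (%x. (v (Suc k) x - v k x) - (fst p + snd p *v x)) <= B / 8 ^ k"
      using s by (intro exI[of _ "(b, R)"]) auto
  qed
  from choice[OF this] obtain p where p: "!!k. skew (snd (p k))"
    "!!k. hn (%x. (v (Suc k) x - v k x) - (fst (p k) + snd (p k) *v x)) <= B / 8 ^ k" by blast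
  \<comment> \<open>Removing the partial sums of the motions makes each increment of
    \<open>w\<close> equal to an increment of \<open>v\<close> minus its own rigid motion, while the
    energies stay unchanged.\<close>
  define bb RR where "bb k = (\<Sum>j<k. fst (p j))" and "RR k = (\<Sum>j<k. snd (p j))" for k
  have RR: "skew (RR k)" for k unfolding RR_def by (rule skew_sum) (rule p)
  define w where "w k x = v k x - (bb k + RR k *v x)" for k x
  have w: "H1 \<Omega> (w k)" for k unfolding w_def[abs_def] by (intro H1_diff v H1_rigid)
  have "(%x. w (Suc k) x - w k x) = (%x. (v (Suc k) x - v k x) - (fst (p k) + snd (p k) *v x))" for k
    by (rule ext) (simp add: w_def bb_def RR_def matrix_vector_mult_add_rdistrib algebra_simps)
  then have "hn (%x. w (Suc k) x - w k x) <= B / 8 ^ k" for k using p(2)[of k] by simp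
  from H1_complete[OF w this] obtain z where z: "H1 \<Omega> z" "(%k. hn (%x. w k x - z x)) ----> 0" by blast
  have Ew: "E (w k) = E (v k)" for k unfolding w_def[abs_def] by (rule E_rigid[OF v(1) RR])
  have "(%k. m + (1/8) ^ k) ----> m + 0" by (intro tendsto_intros LIMSEQ_power_zero) simp
  then have u: "(%k. m + (1/8) ^ k) ----> m" by simp
  have "(%k. E (w k)) ----> m" by (rule tendsto_sandwich[OF always_eventually always_eventually tendsto_const u])
      (use mle[OF w] v(2) in \<open>auto simp: Ew power_divide less_imp_le\<close>)
  from E_lsc[OF w z this] have "E z <= m" .
  then show ?thesis using z(1) mle by (meson order_trans)
qed

section \<open>Comparison of the two functionals\<close>

definition ell :: "real^'n^'n => real" where
  "ell A = L (%x. A *v x)"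

lemma H1_linear: "H1 \<Omega> (%x. A *v x)" using H1_rigid[of 0 A] by simp

lemma linear_ell: "linear ell"
proof -
  have "(%x. (A + c *\<^sub>R B) *v x) = (%x. A *v x + c *\<^sub>R (B *v x))" for A B :: "real^'n^'n" and c
    by (rule ext) (simp add: matrix_vector_mult_add_rdistrib scaleR_matrix_vector_assoc)
  then have l: "ell (A + c *\<^sub>R B) = ell A + c * ell B" for A B c
    unfolding ell_def using load_lincomb[OF H1_linear H1_linear, of A c B] by simp
  have z: "ell 0 = 0" using l[of 0 1 0] by simp
  show ?thesis by (rule linearI) (use l[of _ 1] l[of 0] z in simp_all)
qed

lemma skew_square_sym: "skew W ==> transpose (W ** W) = W ** (W :: real^'n^'n)"
  by (simp add: matrix_transpose_mul skew_def) (simp add: vec_eq_iff matrix_matrix_mult_def)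

lemma zero_matrix_square: "0 ** 0 = (0 :: real^'n^'n)" by (simp add: matrix_matrix_mult_def vec_eq_iff)

text \<open>Compatibility says that a continuous function is negative on the compact unit sphere of
  skew matrices, so it has a negative maximum there; homogeneity of degree 2 extends the bound to
  all skew matrices.\<close>

lemma ell_coercive:
  obtains l where "l > 0" "!!W. skew W ==> ell (W ** W) <= - l * (norm W)\<^sup>2"
proof -
  let ?K = "{W :: real^'n^'n. skew W} \<inter> sphere 0 1"
  have neg: "ell (W ** W) < 0" if "skew W" "W ~= 0" for W using compat that unfolding compatible_def ell_def by blast
  have sc: "ell (W ** W) = (norm W)\<^sup>2 * ell ((1 / norm W) *\<^sub>R W ** ((1 / norm W) *\<^sub>R W))" if "W ~= 0" for W :: "real^'n^'n"
    using that by (simp add: matrix_scaleR_mult linear_scale[OF linear_ell] power2_eq_square)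
  have cl: "closed {W :: real^'n^'n. skew W}"
  proof -
    have "{W :: real^'n^'n. skew W} = (\<Inter>i. \<Inter>j. {W. W $ j $ i = - W $ i $ j})"
      by (auto simp: skew_def vec_eq_iff transpose_def)
    then show ?thesis by (auto intro!: closed_INT closed_Collect_eq continuous_intros)
  qed
  have K: "compact ?K" using closed_Int_compact[OF cl compact_sphere] .
  have c: "continuous_on ?K (%W. ell (W ** W))"
  proof -
    have "continuous_on ?K (%W. W ** W)" unfolding matrix_matrix_mult_def by (intro continuous_intros)
    from continuous_on_compose2[OF linear_continuous_on[OF linear_conv_bounded_linear[THEN iffD1, OF linear_ell], of UNIV] this]
    show ?thesis by simp
  qed
  show ?thesis
  proof (cases "?K = {}")
    \<comment> \<open>With no skew matrix of norm 1, every skew matrix is 0 and any \<open>l\<close>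
      serves.\<close>
    case True
    have z: "W = 0" if "skew W" for W :: "real^'n^'n"
    proof (rule ccontr)
      assume "W ~= 0"
      then have "(1 / norm W) *\<^sub>R W \<in> ?K" using that by (simp add: skew_closed(3))
      then show False using True by blast
    qed
    have "ell (W ** W) <= - 1 * (norm W)\<^sup>2" if "skew W" for W
      unfolding z[OF that] by (simp add: linear_0[OF linear_ell] zero_matrix_square)
    then show ?thesis by (rule that[OF zero_less_one])
  next
    case False
    from continuous_attains_sup[OF K this c] obtain W0 where W0: "W0 \<in> ?K" "!!W. W \<in> ?K ==> ell (W ** W) <= ell (W0 ** W0)" by blast
    have "W0 ~= 0" using W0(1) by auto
    then have p: "- ell (W0 ** W0) > 0" using neg[of W0] W0(1) by simp
    have "ell (W ** W) <= - (- ell (W0 ** W0)) * (norm W)\<^sup>2" if "skew W" for W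
    proof (cases "W = 0")
      case False
      then have "(1 / norm W) *\<^sub>R W \<in> ?K" using that by (simp add: skew_closed(3))
      from W0(2)[OF this] have "(norm W)\<^sup>2 * ell ((1 / norm W) *\<^sub>R W ** ((1 / norm W) *\<^sub>R W)) <= (norm W)\<^sup>2 * ell (W0 ** W0)"
        by (intro mult_left_mono) auto
      then show ?thesis using sc[OF False] by (simp add: mult.commute)
    qed (simp add: linear_0[OF linear_ell] zero_matrix_square)
    then show ?thesis using that[OF p] by blast
  qed
qed

abbreviation "F \<equiv> Flim \<Omega> D2V f g"

definition shift :: "(real^'n => real^'n) => real^'n^'n => real^'n => real^'n" where
  "shift v W x = v x + (- 1/2) *\<^sub>R ((W ** W) *v x)"

lemma H1_shift: "H1 \<Omega> v ==> H1 \<Omega> (shift v W)" unfolding shift_def[abs_def] by (intro H1_lincomb H1_linear)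

lemma F_term:
  assumes v: "H1 \<Omega> v" and W: "skew W"
  shows "Q (%x. S v x - (1/2) *\<^sub>R (W ** W)) - L v = E (shift v W) - (1/2) * ell (W ** W)"
    "0 <= Q (%x. S v x - (1/2) *\<^sub>R (W ** W))"
proof -
  have sp: "sympart (W ** W) = W ** W" by (simp add: sympart_def skew_square_sym[OF W] flip: scaleR_2)
  have c: "sym_field (%x. (1/2) *\<^sub>R (W ** W))"
    using L2_on_continuous[OF O(1,2), of "%x. (1/2) *\<^sub>R (W ** W)"] by (simp add: skew_square_sym[OF W] transpose_scaleR_mat)
  note sf = sym_field_ops(2)[OF sym_field_symgrad[OF v] c]
  show "0 <= Q (%x. S v x - (1/2) *\<^sub>R (W ** W))" by (rule V0_field(4)[OF sf])
  have a: "AE x in M. S (shift v W) x = S v x - (1/2) *\<^sub>R (W ** W)"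
    using symgrad_lincomb[OF v H1_linear[of "W ** W"], of "-1/2"] symgrad_affine[of 0 "W ** W"]
    unfolding shift_def[abs_def] by eventually_elim (simp add: sp)
  have "Q (S (shift v W)) = Q (%x. S v x - (1/2) *\<^sub>R (W ** W))"
    by (rule Q_cong_AE[OF a sym_field_symgrad[OF H1_shift[OF v]] sf])
  moreover have "L (shift v W) = L v - (1/2) * ell (W ** W)"
    unfolding shift_def[abs_def] ell_def using load_lincomb[OF v H1_linear, of "-1/2" "W ** W"] by simp
  ultimately show "Q (%x. S v x - (1/2) *\<^sub>R (W ** W)) - L v = E (shift v W) - (1/2) * ell (W ** W)" by (simp add: E_eq)
qed

text \<open>The shift is a linear field whose matrix is quadratic in \<open>W k\<close>, and on a
  bounded domain the H1 norm of a linear field is bounded by the norm of its matrix.\<close>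

lemma hn_shift_tendsto:
  assumes v: "H1 \<Omega> v" and W: "W ----> 0"
  shows "(%k. hn (%x. shift v (W k) x - v x)) ----> 0"
proof -
  let ?A = "%k. (- 1/2) *\<^sub>R (W k ** W k)"
  have Wc: "(%k. W k $ i $ j) ----> 0" for i j using tendsto_vec_nth[OF tendsto_vec_nth[OF W]] by simp
  have "(%k. ?A k $ i $ j) ----> 0" for i j
  proof -
    have "(%k. \<Sum>l\<in>UNIV. W k $ i $ l * W k $ l $ j) ----> (\<Sum>l\<in>(UNIV::'n set). 0 * 0)"
      by (rule tendsto_sum) (rule tendsto_mult[OF Wc Wc])
    from tendsto_mult[OF tendsto_const this, of "-1/2"] show ?thesis by (simp add: matrix_matrix_mult_def)
  qed
  then have A: "?A ----> 0" by (intro vec_tendstoI) simp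
  let ?i = "%x::real^'n. x"
  have iL: "L2_on M ?i" by (rule L2_on_continuous[OF O(1,2)]) simp
  have le: "hn (%x. B *v x) <= (norm B)\<^sup>2 * (sq_int M ?i + measure M (space M))" for B :: "real^'n^'n"
  proof -
    have s: "smooth_vec (%x. B *v x)" using smooth_vec_affine[of 0 B] by simp
    have j: "jac (%x. B *v x) = (%x. B)" using jac_affine[of 0 B] by auto
    have "sq_int M (%x. B *v x) <= (LINT x|M. (norm B)\<^sup>2 * (norm x)\<^sup>2)" unfolding sq_int_def
    proof (rule integral_mono)
      show "integrable M (%x. (norm (B *v x))\<^sup>2)" using grad_props(1)[OF H1_linear] by (simp add: L2_on_def)
      show "integrable M (%x. (norm B)\<^sup>2 * (norm x)\<^sup>2)" using iL by (simp add: L2_on_def)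
      show "(norm (B *v x))\<^sup>2 <= (norm B)\<^sup>2 * (norm x)\<^sup>2" for x
        using power_mono[OF norm_matrix_vector_le[of B x], of 2] by (simp add: power_mult_distrib)
    qed
    moreover have "sq_int M (%x. B) = (norm B)\<^sup>2 * measure M (space M)" by (simp add: sq_int_def)
    ultimately show ?thesis by (simp add: hn_smooth[OF s] j sq_int_def distrib_left)
  qed
  have eq: "(%x. shift v (W k) x - v x) = (%x. ?A k *v x)" for k
    by (rule ext) (simp add: shift_def scaleR_matrix_vector_assoc)
  have "(%k. (norm (?A k))\<^sup>2 * (sq_int M ?i + measure M (space M))) ----> (norm (0::real^'n^'n))\<^sup>2 * (sq_int M ?i + measure M (space M))"
    by (intro tendsto_intros A)
  then have z: "(%k. (norm (?A k))\<^sup>2 * (sq_int M ?i + measure M (space M))) ----> 0" by simp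
  show ?thesis
    by (rule Lim_null_comparison[OF always_eventually z]) (use le in \<open>auto simp only: eq real_norm_def abs_of_nonneg[OF hn_nonneg]\<close>)
qed

lemma F_eq: "F v = (INF W\<in>{W. skew W}. Q (%x. S v x - (1/2) *\<^sub>R (W ** W))) - L v" by (simp add: Flim_def Q_def)

lemma F_le_E:
  assumes v: "H1 \<Omega> v"
  shows "F v <= E v"
proof -
  \<comment> \<open>An infimum of reals is below its members only when the family is bounded below;
    here 0 is a bound, and the member \<open>W = 0\<close> is the linear energy.\<close>
  have "bdd_below ((%W. Q (%x. S v x - (1/2) *\<^sub>R (W ** W))) ` {W. skew W})"
    by (intro bdd_belowI2[of _ 0]) (use F_term(2)[OF v] in simp)
  then have "(INF W\<in>{W. skew W}. Q (%x. S v x - (1/2) *\<^sub>R (W ** W))) <= Q (%x. S v x - (1/2) *\<^sub>R (0 ** 0))"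
    using cINF_lower[of "%W. Q (%x. S v x - (1/2) *\<^sub>R (W ** W))" "{W. skew W}" 0] skew_closed(1) by simp
  then show ?thesis by (simp add: F_eq E_eq zero_matrix_square)
qed

lemma F_ge:
  assumes v: "H1 \<Omega> v" and m: "!!v. H1 \<Omega> v ==> m <= E v"
  shows "m <= F v"
proof -
  obtain l where l: "l > 0" "!!W. skew W ==> ell (W ** W) <= - l * (norm W)\<^sup>2" using ell_coercive by blast
  have "m + L v <= (INF W\<in>{W. skew W}. Q (%x. S v x - (1/2) *\<^sub>R (W ** W)))"
  proof (rule cINF_greatest)
    show "{W :: real^'n^'n. skew W} ~= {}" using skew_closed(1) by blast
    fix W :: "real^'n^'n" assume "W \<in> {W. skew W}"
    then have W: "skew W" by simp
    have "ell (W ** W) <= 0" using l(2)[OF W] mult_nonneg_nonneg[OF less_imp_le[OF l(1)] zero_le_power2[of "norm W"]] by simp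
    then show "m + L v <= Q (%x. S v x - (1/2) *\<^sub>R (W ** W))" using F_term(1)[OF v W] m[OF H1_shift[OF v, of W]] by linarith
  qed
  then show ?thesis by (simp add: F_eq)
qed

lemma F_min_imp_E_min:
  assumes v: "H1 \<Omega> v" and m: "!!v. H1 \<Omega> v ==> m <= E v" and F: "F v <= m"
  shows "E v <= m"
proof -
  obtain l where l: "l > 0" "!!W. skew W ==> ell (W ** W) <= - l * (norm W)\<^sup>2" using ell_coercive by blast
  have "\<forall>k. \<exists>W. skew W & Q (%x. S v x - (1/2) *\<^sub>R (W ** W)) - L v < m + 1 / real (Suc k)"
  proof
    fix k
    have i: "(INF W\<in>{W. skew W}. Q (%x. S v x - (1/2) *\<^sub>R (W ** W))) < m + L v + 1 / real (Suc k)"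
    proof -
      have "0 < 1 / real (Suc k)" by simp
      then show ?thesis using F unfolding F_eq by linarith
    qed
    have "(%W. Q (%x. S v x - (1/2) *\<^sub>R (W ** W))) ` {W. skew W} ~= {}" using skew_closed(1) by blast
    from cInf_lessD[OF this i] obtain y where "y \<in> (%W. Q (%x. S v x - (1/2) *\<^sub>R (W ** W))) ` {W. skew W}" "y < m + L v + 1 / real (Suc k)"
      by blast
    then obtain W where "skew W" "Q (%x. S v x - (1/2) *\<^sub>R (W ** W)) < m + L v + 1 / real (Suc k)" by blast
    then show "\<exists>W. skew W & Q (%x. S v x - (1/2) *\<^sub>R (W ** W)) - L v < m + 1 / real (Suc k)" by (intro exI[of _ W]) linarith
  qed
  from choice[OF this] obtain W where W: "!!k. skew (W k)"
    "!!k. Q (%x. S v x - (1/2) *\<^sub>R (W k ** W k)) - L v < m + 1 / real (Suc k)" by blast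
  \<comment> \<open>Half the coercivity of the load remains as a penalty on \<open>W k\<close>. As
    shifted fields cannot have energy below \<open>m\<close>, the penalty is at most
    \<open>1 / Suc k\<close>.\<close>
  have le: "E (shift v (W k)) + (l / 2) * (norm (W k))\<^sup>2 < m + 1 / real (Suc k)" for k
    using W(2)[of k] F_term(1)[OF v W(1), of k] l(2)[OF W(1), of k] by linarith
  have z: "(%k. 1 / real (Suc k)) ----> 0" using LIMSEQ_inverse_real_of_nat by (simp add: inverse_eq_divide)
  have n: "(norm (W k))\<^sup>2 <= (2 / l) * (1 / real (Suc k))" for k
  proof -
    have "(l / 2) * (norm (W k))\<^sup>2 <= 1 / real (Suc k)" using le[of k] m[OF H1_shift[OF v, of "W k"]] by linarith
    then have "(2 / l) * ((l / 2) * (norm (W k))\<^sup>2) <= (2 / l) * (1 / real (Suc k))" using l(1) by (intro mult_left_mono) auto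
    then show ?thesis using l(1) by simp
  qed
  have "(%k. (norm (W k))\<^sup>2) ----> 0"
    by (rule Lim_null_comparison[OF always_eventually tendsto_mult_right_zero[OF z, of "2 / l"]])
      (use n in \<open>auto simp only: real_norm_def abs_power2\<close>)
  from tendsto_real_sqrt[OF this] have "W ----> 0" by (simp add: tendsto_norm_zero_iff)
  note sh = hn_shift_tendsto[OF v this]
  have "(%k. E (shift v (W k))) ----> m"
  proof (rule tendsto_sandwich[OF always_eventually always_eventually tendsto_const])
    show "(%k. m + 1 / real (Suc k)) ----> m" using tendsto_add[OF tendsto_const z, of m] by simp
    show "\<forall>k. m <= E (shift v (W k))" using m H1_shift[OF v] by blast
    show "\<forall>k. E (shift v (W k)) <= m + 1 / real (Suc k)"
    proof
      fix k
      have "0 <= (l / 2) * (norm (W k))\<^sup>2" using l(1) by simp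
      then show "E (shift v (W k)) <= m + 1 / real (Suc k)" using le[of k] by linarith
    qed
  qed
  from E_lsc[OF H1_shift[OF v] v sh this] show ?thesis .
qed

theorem F_E_minima:
  "(\<exists>u. H1 \<Omega> u & (\<forall>v. H1 \<Omega> v --> F u <= F v))
   & (\<exists>u. H1 \<Omega> u & (\<forall>v. H1 \<Omega> v --> E u <= E v))
   & (INF v\<in>{v. H1 \<Omega> v}. F v) = (INF v\<in>{v. H1 \<Omega> v}. E v)
   & {u. H1 \<Omega> u & (\<forall>v. H1 \<Omega> v --> F u <= F v)} = {u. H1 \<Omega> u & (\<forall>v. H1 \<Omega> v --> E u <= E v)}"
proof -
  obtain w where w: "H1 \<Omega> w" "!!v. H1 \<Omega> v ==> E w <= E v" using E_minimizer by blast
  have ge: "E w <= F v" if "H1 \<Omega> v" for v by (rule F_ge[OF that w(2)])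
  have Fw: "F w = E w" using F_le_E[OF w(1)] ge[OF w(1)] by simp
  \<comment> \<open>Both infima are evaluated as minima attained at \<open>w\<close>, which settles
    boundedness below and equality at once.\<close>
  have "(INF v\<in>{v. H1 \<Omega> v}. F v) = E w" by (rule cInf_eq_minimum) (use Fw w(1) ge in \<open>auto simp: image_iff intro: exI[of _ w]\<close>)
  moreover have "(INF v\<in>{v. H1 \<Omega> v}. E v) = E w" by (rule cInf_eq_minimum) (use w in auto)
  moreover have "(\<forall>v. H1 \<Omega> v --> F u <= F v) \<longleftrightarrow> (\<forall>v. H1 \<Omega> v --> E u <= E v)" if u: "H1 \<Omega> u" for u
  proof
    assume "\<forall>v. H1 \<Omega> v --> F u <= F v"
    then have "F u <= E w" using w(1) Fw by auto
    from F_min_imp_E_min[OF u w(2) this] show "\<forall>v. H1 \<Omega> v --> E u <= E v" using w(2) order_trans by blast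
  next
    assume "\<forall>v. H1 \<Omega> v --> E u <= E v"
    then have "F u <= E w" using F_le_E[OF u] w(1) order_trans by blast
    then show "\<forall>v. H1 \<Omega> v --> F u <= F v" using ge order_trans by blast
  qed
  then have "{u. H1 \<Omega> u & (\<forall>v. H1 \<Omega> v --> F u <= F v)} = {u. H1 \<Omega> u & (\<forall>v. H1 \<Omega> v --> E u <= E v)}" by blast
  ultimately show ?thesis using w Fw ge by (intro conjI exI[of _ w]) auto
qed

end

theorem mainTheorem6:
  fixes \<Omega> :: "(real^'n) set"
    and W :: "real^'n \<Rightarrow> real^'n^'n \<Rightarrow> ennreal"
    and V :: "real^'n \<Rightarrow> real^'n^'n \<Rightarrow> ennreal"
    and DV :: "real^'n \<Rightarrow> real^'n^'n \<Rightarrow> ((real^'n^'n) \<Rightarrow>\<^sub>L real)"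
    and D2V :: "real^'n \<Rightarrow> real^'n^'n \<Rightarrow> ((real^'n^'n) \<Rightarrow>\<^sub>L ((real^'n^'n) \<Rightarrow>\<^sub>L real))"
    and f g :: "real^'n \<Rightarrow> real^'n"
  assumes dim: "CARD('n) = 2 \<or> CARD('n) = 3"
    and dom: "bounded \<Omega>" "connected \<Omega>" "open \<Omega>" "lipschitz_boundary \<Omega>"
    and W_meas: "(\<lambda>p. W (fst p) (snd p)) \<in> borel_measurable (lebesgue_on \<Omega> \<Otimes>\<^sub>M borel)"
    and W_det: "AE x in lebesgue_on \<Omega>. \<forall>F. det F \<le> 0 \<longrightarrow> W x F = \<infinity>"
    and W_frame: "AE x in lebesgue_on \<Omega>. \<forall>R\<in>SOmat. \<forall>F. W x (R ** F) = W x F"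
    and W_C2: "AE x in lebesgue_on \<Omega>. \<exists>U. open U \<and> SOmat \<subseteq> U \<and>
                 (\<forall>F\<in>U. W x F < \<infinity>) \<and> C2_on U (\<lambda>F. enn2real (W x F))"
    and W_coerc: "\<exists>C>0. AE x in lebesgue_on \<Omega>. \<forall>F.
                 ennreal (C * (norm (transpose F ** F - mat 1))\<^sup>2) \<le> W x F"
    and W_id: "AE x in lebesgue_on \<Omega>. W x (mat 1) = 0 \<and>
                 ((\<lambda>F. enn2real (W x F)) has_derivative (\<lambda>_. 0)) (at (mat 1))"
    and WV: "AE x in lebesgue_on \<Omega>. \<forall>F. det F > 0 \<longrightarrow>
                 W x F = V x ((1/2) *\<^sub>R (transpose F ** F - mat 1))"
    and V_C2: "\<exists>Ob \<gamma>. open Ob \<and> 0 \<in> Ob \<and> (AE x in lebesgue_on \<Omega>.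
                 (\<forall>D\<in>Ob. V x D < \<infinity>
                   \<and> ((\<lambda>D. enn2real (V x D)) has_derivative blinfun_apply (DV x D)) (at D)
                   \<and> (DV x has_derivative blinfun_apply (D2V x D)) (at D)
                   \<and> (\<forall>B. \<bar>blinfun_apply (blinfun_apply (D2V x D) B) B\<bar> \<le> 2 * \<gamma> * (norm B)\<^sup>2))
                 \<and> continuous_on Ob (D2V x))"
    and f_L2: "L2_on (surf \<Omega>) f"
    and g_L2: "L2_on (lebesgue_on \<Omega>) g"
    and equil: "equilibrated \<Omega> f g"
    and compat: "compatible \<Omega> f g"
  shows "(\<exists>u. H1 \<Omega> u \<and> (\<forall>v. H1 \<Omega> v \<longrightarrow> Flim \<Omega> D2V f g u \<le> Flim \<Omega> D2V f g v))
       \<and> (\<exists>u. H1 \<Omega> u \<and> (\<forall>v. H1 \<Omega> v \<longrightarrow> Elin \<Omega> D2V f g u \<le> Elin \<Omega> D2V f g v))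
       \<and> (INF v \<in> {v. H1 \<Omega> v}. Flim \<Omega> D2V f g v) = (INF v \<in> {v. H1 \<Omega> v}. Elin \<Omega> D2V f g v)
       \<and> {u. H1 \<Omega> u \<and> (\<forall>v. H1 \<Omega> v \<longrightarrow> Flim \<Omega> D2V f g u \<le> Flim \<Omega> D2V f g v)}
         = {u. H1 \<Omega> u \<and> (\<forall>v. H1 \<Omega> v \<longrightarrow> Elin \<Omega> D2V f g u \<le> Elin \<Omega> D2V f g v)}"
proof -
  have "CARD('n) \<ge> 2" using dim by auto
  then interpret loaded_domain \<Omega> f g using dom f_L2 g_L2 by unfold_locales
  have "AE x in lebesgue_on \<Omega>. W x (mat 1) = 0" using W_id by eventually_elim blast
  from V0_facts[OF dom(3) W_meas W_coerc this WV V_C2] obtain \<alpha> \<gamma> where V0: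
    "\<alpha> > 0" "\<gamma> \<ge> 0" "AE x in M. \<forall>B. transpose B = B \<longrightarrow> \<alpha> * (norm B)\<^sup>2 \<le> V0 D2V x B \<and> V0 D2V x B \<le> \<gamma> * (norm B)\<^sup>2"
    "\<And>A. A \<in> borel_measurable M \<Longrightarrow> (\<And>x. transpose (A x) = A x) \<Longrightarrow> (\<lambda>x. V0 D2V x (A x)) \<in> borel_measurable M"
    by blast
  interpret elastic_domain \<Omega> f g D2V \<alpha> \<gamma> using equil compat V0(1-3) by unfold_locales (assumption+, rule V0(4), auto)
  show ?thesis by (rule F_E_minima)
qed

end
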